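(* Let $N\ge2$ and $\Omega=B_1(0)\subset\mathbb{R}^N$. There exists $g\in L^\infty(\mathbb{R}^N\setminus\Omega)$ such that the solutions $u_s$ of the Poisson problem with exterior datum $g$ satisfy $$\limsup_{s\to0^+}u_s(x)=1\quad\text{and}\quad\liminf_{s\to0^+}u_s(x)=0\qquad\text{for some }x\in\Omega.$$
   Context: For $s\in(0,1)$, $(-\Delta)^s u(x)=c_{N,s}\lim_{\epsilon\to0}\int_{\{|x-y|>\epsilon\}}\frac{u(x)-u(y)}{|x-y|^{N+2s}}dy$ with $c_{N,s}=\frac{4^s\Gamma(\frac N2+s)}{\Gamma(2-s)\pi^{N/2}}s(1-s)$. For $g\in L^\infty(\mathbb{R}^N\setminus\Omega)$, the solution of the Poisson problem with exterior datum $g$ is the unique $u_s\in L^\infty(\mathbb{R}^N)$ with $\int u_s(-\Delta)^s\phi\,dx=0$ for all $\phi\in C_c^\infty(\Omega)$ and $u_s=g$ a.e. in $\mathbb{R}^N\setminus\Omega$ (it is continuous, indeed smooth, in $\Omega$). *)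

theory Defs
  imports "HOL-Analysis.Analysis"
begin

coinductive smooth_fun :: "('a::euclidean_space \<Rightarrow> real) \<Rightarrow> bool" where
  "f differentiable_on UNIV \<Longrightarrow>
   (\<forall>b\<in>Basis. smooth_fun (\<lambda>x. frechet_derivative f (at x) b)) \<Longrightarrow> smooth_fun f"

definition test_fun :: "'a::euclidean_space set \<Rightarrow> ('a \<Rightarrow> real) \<Rightarrow> bool" where
  "test_fun \<Omega> \<phi> \<longleftrightarrow> smooth_fun \<phi> \<and> compact (closure {x. \<phi> x \<noteq> 0})
      \<and> closure {x. \<phi> x \<noteq> 0} \<subseteq> \<Omega>"

definition frac_const :: "nat \<Rightarrow> real \<Rightarrow> real" where
  "frac_const N s = 4 powr s * Gamma (real N / 2 + s) / (Gamma (2 - s) * pi powr (real N / 2))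
      * s * (1 - s)"

definition frac_lap :: "real \<Rightarrow> ('a::euclidean_space \<Rightarrow> real) \<Rightarrow> 'a \<Rightarrow> real" where
  "frac_lap s u x = frac_const DIM('a) s *
     Lim (at_right 0) (\<lambda>\<epsilon>. LINT y : {y. dist x y > \<epsilon>} | lebesgue.
            (u x - u y) / dist x y powr (real DIM('a) + 2 * s))"

text \<open>u is the (distributional) solution of the Poisson problem for (-Delta)^s in Omega with
  exterior datum g; u is taken to be the continuous representative inside Omega.\<close>
definition frac_poisson_sol ::
    "real \<Rightarrow> 'a::euclidean_space set \<Rightarrow> ('a \<Rightarrow> real) \<Rightarrow> ('a \<Rightarrow> real) \<Rightarrow> bool" where
  "frac_poisson_sol s \<Omega> g u \<longleftrightarrow>
     u \<in> borel_measurable lebesgue \<and> (\<exists>C. AE x in lebesgue. \<bar>u x\<bar> \<le> C)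
     \<and> (\<forall>\<phi>. test_fun \<Omega> \<phi> \<longrightarrow> (\<integral>x. u x * frac_lap s \<phi> x \<partial>lebesgue) = 0)
     \<and> (AE x in lebesgue. x \<notin> \<Omega> \<longrightarrow> u x = g x)
     \<and> continuous_on \<Omega> u"

end

theory Submission
  imports Defs
begin

text \<open>The solution with exterior datum \<open>g\<close> is \<open>u\<^sub>s(x) = \<integral> P\<^sub>s(x, y) g(y) dy\<close>, where
  \<open>P\<^sub>s(x, y) = C ((1 - |x|\<^sup>2) / (|y|\<^sup>2 - 1))\<^sup>s / |y - x|\<^sup>N\<close> for \<open>|x| < 1 < |y|\<close>. As \<open>s \<rightarrow> 0\<close> the probability density
  \<open>P\<^sub>s(0, \<cdot>)\<close> escapes to infinity, whereas for each fixed \<open>s\<close> it is concentrated on a large ball. So there are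
  \<open>\<sigma>\<^sub>k \<rightarrow> 0\<close> and disjoint consecutive spherical shells such that \<open>P\<^sub>s(0, \<cdot>)\<close> with \<open>s = \<sigma>\<^sub>k\<close> lives almost
  entirely on the \<open>k\<close>-th shell; if \<open>g\<close> is the indicator of the union of the even shells, then
  \<open>u\<^sub>s(0)\<close> oscillates between \<open>0\<close> and \<open>1\<close>.

  The link between \<open>P\<^sub>s\<close> and \<open>(-\<Delta>)\<^sup>s\<close> is the Riesz kernel \<open>W = |\<cdot>|\<^sup>2\<^sup>s\<^sup>-\<^sup>N\<close>: \<open>P\<^sub>s(x, \<cdot>)\<close> is the balayage of the unit mass at
  \<open>x\<close>, i.e. its Riesz potential is \<open>W(\<cdot> - x)\<close> outside the ball; \<open>W * (-\<Delta>)\<^sup>s \<phi>\<close> is a multiple of \<open>\<phi>\<close>; and a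
  function is determined by its Riesz potential on its support, because the energy is a superposition of
  squared norms of heat extensions. Existence follows by sweeping \<open>(-\<Delta>)\<^sup>s \<phi>\<close> out of the ball,
  and the formula for \<open>u\<^sub>s(0)\<close> by testing with mollified Green functions.\<close>

section \<open>Integration in polar coordinates\<close>

text \<open>All normalising constants remain unevaluated integrals. About \<open>riesz_norm\<close>
  the argument uses that it is finite, positive and at least a multiple of \<open>1 / s\<close>;
  about the constant in \<open>W * (-Delta)^s\<close> it uses positivity. Fourier analysis is
  replaced by subordination: \<open>|x|^(2s-N)\<close> and \<open>|h|^(-N-2s)\<close> are both
  mixtures of Gaussians, so that their composition becomes a computation with two time variables of
  the heat semigroup. The obstacle there is that the integral of \<open>t^(-s-1) (G 0 - G t)\<close>
  near \<open>t = 0\<close> exists only through the cancellation in \<open>G 0 - G t\<close>; hence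
  the cut-off at a small time and the approximate identity that it produces. The second obstacle is
  that a solution is an arbitrary bounded function known through a distributional identity, without
  any control at the unit sphere. Its value at the centre is therefore computed on balls of radius
  \<open>r < 1\<close>, where mollified Green functions have compact support inside the open ball.
  The passage \<open>r -> 1\<close> then only involves points \<open>w\<close> with
  \<open>|w| > 1\<close>, and at almost every such point the datum is locally constant. This is why
  \<open>g\<close> is built from shells with sharp boundaries.\<close>

lemma nn_integral_substitution_open:
  fixes f :: "real \<Rightarrow> real" and g g' :: "real \<Rightarrow> real"
  assumes f [measurable]: "f \<in> borel_measurable borel" and f0: "\<And>x. f x \<ge> 0"
    and g [measurable]: "g \<in> borel_measurable borel" and g' [measurable]: "g' \<in> borel_measurable borel"
    and S [measurable]: "S \<in> sets borel" and T [measurable]: "T \<in> sets borel"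
    and der: "\<And>x. x \<in> S \<Longrightarrow> (g has_field_derivative g' x) (at x)"
    and bij: "bij_betw g S T"
  shows "(\<integral>\<^sup>+x. ennreal (f x) * indicator T x \<partial>lborel) =
         (\<integral>\<^sup>+x. ennreal (\<bar>g' x\<bar> * f (g x)) * indicator S x \<partial>lborel)"
proof -
  have img: "g ` S = T" and inj: "inj_on g S" using bij by (auto simp: bij_betw_def)
  note cv = has_absolute_integral_change_of_variables_1'[OF _ _ inj, of g' f, unfolded img]
  have cv: "((\<lambda>x. \<bar>g' x\<bar> * f (g x)) absolutely_integrable_on S \<and>
     integral S (\<lambda>x. \<bar>g' x\<bar> * f (g x)) = b) \<longleftrightarrow> (f absolutely_integrable_on T \<and> integral T f = b)" for b
    by (rule cv) (use S der in \<open>auto intro: has_field_derivative_at_within\<close>)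
  \<comment> \<open>For a nonnegative function, failure of absolute integrability means the value
    \<infinity>. The change of variables for absolutely integrable functions is an equivalence, so
    both sides are infinite together and the extended-valued identity follows.\<close>
  have nn: "(\<integral>\<^sup>+x. ennreal (h x) * indicator A x \<partial>lborel) =
     (if h absolutely_integrable_on A then ennreal (integral A h) else \<infinity>)"
    if h [measurable]: "h \<in> borel_measurable borel" and h0: "\<And>x. h x \<ge> 0" and A [measurable]: "A \<in> sets borel"
    for h :: "real \<Rightarrow> real" and A
  proof -
    have eq: "ennreal (h x) * indicator A x = ennreal (indicator A x * h x)" for x
      by (auto simp: indicator_def)
    have m: "(\<lambda>x. indicator A x * h x) \<in> borel_measurable lborel" by measurable
    have ai: "h absolutely_integrable_on A \<longleftrightarrow> integrable lborel (\<lambda>x. indicator A x * h x)"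
      unfolding set_integrable_def real_scaleR_def by (rule integrable_completion[OF m])
    show ?thesis
    proof (cases "h absolutely_integrable_on A")
      case True
      then have "integrable lborel (\<lambda>x. indicator A x * h x)" using ai by simp
      then have "(\<integral>\<^sup>+x. ennreal (indicator A x * h x) \<partial>lborel) = ennreal (\<integral>x. indicator A x * h x \<partial>lborel)"
        using h0 by (intro nn_integral_eq_integral) (auto simp: indicator_def)
      also have "(\<integral>x. indicator A x * h x \<partial>lborel) = (LINT x:A|lebesgue. h x)"
        unfolding set_lebesgue_integral_def using integral_completion[OF m] by simp
      also have "\<dots> = integral A h" by (rule set_lebesgue_integral_eq_integral(2)[OF True])
      finally show ?thesis using True by (simp add: eq)
    next
      case False
      then have "\<not> integrable lborel (\<lambda>x. indicator A x * h x)" using ai by simp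
      then have "\<not> (\<integral>\<^sup>+x. ennreal (indicator A x * h x) \<partial>lborel) < \<infinity>"
        using h0 m by (auto simp: integrable_iff_bounded abs_mult)
      then have "(\<integral>\<^sup>+x. ennreal (indicator A x * h x) \<partial>lborel) = \<infinity>"
        by (simp add: not_less top_unique)
      then show ?thesis using False by (simp add: eq)
    qed
  qed
  show ?thesis
    using cv[of "integral T f"] cv[of "integral S (\<lambda>x. \<bar>g' x\<bar> * f (g x))"] f0
    by (subst (1 2) nn) (simp_all, metis)
qed

lemma nn_integral_lborel_affine:
  fixes t :: "'a::euclidean_space"
  assumes c: "c \<noteq> 0" and f [measurable]: "f \<in> borel_measurable borel"
  shows "(\<integral>\<^sup>+x. f x \<partial>lborel) = ennreal (\<bar>c\<bar> ^ DIM('a)) * (\<integral>\<^sup>+x. f (t + c *\<^sub>R x) \<partial>lborel)"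
  by (subst lborel_affine[OF c, of t])
     (simp add: nn_integral_density nn_integral_distr nn_integral_cmult)

lemma nn_integral_lborel_translate:
  fixes a :: "'a::euclidean_space"
  assumes [measurable]: "f \<in> borel_measurable borel"
  shows "(\<integral>\<^sup>+x. f (a + x) \<partial>lborel) = (\<integral>\<^sup>+x. f x \<partial>lborel)"
  using nn_integral_lborel_affine[of 1 f a] by simp

lemma nn_integral_lborel_reflect:
  fixes a :: "'a::euclidean_space"
  assumes [measurable]: "f \<in> borel_measurable borel"
  shows "(\<integral>\<^sup>+x. f (a - x) \<partial>lborel) = (\<integral>\<^sup>+x. f x \<partial>lborel)"
  using nn_integral_lborel_affine[of "-1" f a] by simp

declare borel_open [OF open_ball, measurable] borel_closed [OF closed_cball, measurable]

definition shell :: "'a::euclidean_space set" where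
  "shell = {x. 1 < norm x \<and> norm x < exp 1}"

lemma shell_measurable [measurable]: "shell \<in> sets borel"
  unfolding shell_def by measurable

lemma nn_integral_powr_inverse_interval:
  assumes "0 < a" "a < b"
  shows "(\<integral>\<^sup>+t. ennreal (1/t) * indicator {a<..<b} t \<partial>lborel) = ennreal (ln b - ln a)"
proof -
  have "(\<integral>\<^sup>+t. ennreal (1/t) * indicator {a<..<b} t \<partial>lborel) = (\<integral>\<^sup>+t. ennreal (1/t) * indicator {a..b} t \<partial>lborel)"
  proof (rule nn_integral_cong_AE)
    have "AE t in lborel. t \<noteq> a" "AE t in lborel. t \<noteq> b" by (auto intro: AE_lborel_singleton)
    then show "AE t in lborel. ennreal (1/t) * indicator {a<..<b} t = ennreal (1/t) * indicator {a..b} t"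
      by eventually_elim (auto simp: indicator_def)
  qed
  also have "\<dots> = ennreal (ln b - ln a)"
    using assms by (intro nn_integral_FTC_Icc) (auto intro!: derivative_eq_intros simp: divide_inverse has_real_derivative_iff_has_vector_derivative[symmetric])
  finally show ?thesis .
qed

text \<open>Polar coordinates without surface measure: the shell plays the role of the sphere, because
  every ray meets it in a segment of length one for the measure \<open>d\<tau>/\<tau>\<close>.\<close>

lemma nn_integral_polar:
  fixes f :: "'a::euclidean_space \<Rightarrow> ennreal"
  assumes f [measurable]: "f \<in> borel_measurable borel"
  shows "(\<integral>\<^sup>+x. f x \<partial>lborel) =
    (\<integral>\<^sup>+z. indicator shell z * (\<integral>\<^sup>+t. f (t *\<^sub>R z) * ennreal (t ^ (DIM('a) - 1)) * indicator {0<..} t \<partial>lborel) \<partial>lborel)"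
proof -
  have "(\<integral>\<^sup>+z. indicator shell z * (\<integral>\<^sup>+t. f (t *\<^sub>R z) * ennreal (t ^ (DIM('a) - 1)) * indicator {0<..} t \<partial>lborel) \<partial>lborel)
     = (\<integral>\<^sup>+z. (\<integral>\<^sup>+t. indicator shell z * (f (t *\<^sub>R z) * ennreal (t ^ (DIM('a) - 1)) * indicator {0<..} t) \<partial>lborel) \<partial>lborel)"
    by (intro nn_integral_cong nn_integral_cmult[symmetric]) measurable
  also have "\<dots> = (\<integral>\<^sup>+t. (\<integral>\<^sup>+z. indicator shell z * (f (t *\<^sub>R z) * ennreal (t ^ (DIM('a) - 1)) * indicator {0<..} t) \<partial>lborel) \<partial>lborel)"
    by (rule lborel_pair.Fubini') measurable
  \<comment> \<open>For fixed \<open>t\<close> substitute \<open>x = t z\<close>. The weight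
    \<open>t ^ (N - 1)\<close> against the Jacobian \<open>t ^ N\<close> leaves the measure
    \<open>dt / t\<close>, and the point \<open>x / t\<close> lies in the shell exactly when
    \<open>|x| / e < t < |x|\<close>.\<close>
  also have "\<dots> = (\<integral>\<^sup>+t. (\<integral>\<^sup>+x. f x * (ennreal (1/t) * (indicator shell (x /\<^sub>R t)) * indicator {0<..} t) \<partial>lborel) \<partial>lborel)"
  proof (rule nn_integral_cong)
    fix t :: real
    show "(\<integral>\<^sup>+z. indicator shell z * (f (t *\<^sub>R z) * ennreal (t ^ (DIM('a) - 1)) * indicator {0<..} t) \<partial>lborel)
      = (\<integral>\<^sup>+x. f x * (ennreal (1/t) * (indicator shell (x /\<^sub>R t)) * indicator {0<..} t) \<partial>lborel)"
    proof (cases "t > 0")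
      case True
      have p: "ennreal (t ^ (DIM('a) - Suc 0)) = ennreal (t ^ DIM('a)) * ennreal (1/t)"
        using True DIM_positive[where 'a='a]
        by (cases "DIM('a)") (auto simp: ennreal_mult[symmetric])
      have "(\<integral>\<^sup>+x. f x * (ennreal (1/t) * (indicator shell (x /\<^sub>R t)) * indicator {0<..} t) \<partial>lborel)
        = ennreal (\<bar>t\<bar> ^ DIM('a)) * (\<integral>\<^sup>+x. f (0 + t *\<^sub>R x) * (ennreal (1/t) * (indicator shell ((0 + t *\<^sub>R x) /\<^sub>R t)) * indicator {0<..} t) \<partial>lborel)"
        using True by (intro nn_integral_lborel_affine) auto
      also have "\<dots> = (\<integral>\<^sup>+z. indicator shell z * (f (t *\<^sub>R z) * ennreal (t ^ (DIM('a) - 1)) * indicator {0<..} t) \<partial>lborel)"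
      proof (subst nn_integral_cmult[symmetric], measurable, rule nn_integral_cong)
        fix x :: 'a
        have ac: "A * (F * (B * I)) = I * (F * (A * B))" for A B F I :: ennreal
          by (simp only: mult_ac)
        have x: "(0 + t *\<^sub>R x) /\<^sub>R t = x" using True by simp
        show "ennreal (\<bar>t\<bar> ^ DIM('a)) * (f (0 + t *\<^sub>R x) * (ennreal (1/t) * indicator shell ((0 + t *\<^sub>R x) /\<^sub>R t) * indicator {0<..} t))
          = indicator shell x * (f (t *\<^sub>R x) * ennreal (t ^ (DIM('a) - 1)) * indicator {0<..} t)"
          unfolding x One_nat_def p using ac by (simp add: True less_imp_le)
      qed
      finally show ?thesis by simp
    qed auto
  qed
  also have "\<dots> = (\<integral>\<^sup>+x. (\<integral>\<^sup>+t. f x * (ennreal (1/t) * (indicator shell (x /\<^sub>R t)) * indicator {0<..} t) \<partial>lborel) \<partial>lborel)"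
    by (rule lborel_pair.Fubini'[symmetric]) measurable
  also have "\<dots> = (\<integral>\<^sup>+x. f x * (\<integral>\<^sup>+t. (ennreal (1/t) * (indicator shell (x /\<^sub>R t)) * indicator {0<..} t) \<partial>lborel) \<partial>lborel)"
    by (intro nn_integral_cong nn_integral_cmult) measurable
  also have "\<dots> = (\<integral>\<^sup>+x. f x \<partial>lborel)"
  proof (rule nn_integral_cong_AE)
    have "AE x::'a in lborel. x \<noteq> 0" by (rule AE_lborel_singleton)
    then show "AE x in lborel. f x * (\<integral>\<^sup>+t. (ennreal (1/t) * (indicator shell (x /\<^sub>R t)) * indicator {0<..} t) \<partial>lborel) = f x"
    proof eventually_elim
      case (elim x)
      have "(\<integral>\<^sup>+t. (ennreal (1/t) * (indicator shell (x /\<^sub>R t)) * indicator {0<..} t) \<partial>lborel)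
        = (\<integral>\<^sup>+t. ennreal (1/t) * indicator {norm x / exp 1<..<norm x} t \<partial>lborel)"
      proof (rule nn_integral_cong)
        fix t :: real
        have pos: "norm x / exp 1 > 0" using elim by simp
        have "x /\<^sub>R t \<in> shell \<longleftrightarrow> t \<in> {norm x / exp 1<..<norm x}" if "t > 0"
          using that by (auto simp: shell_def field_simps)
        moreover have "t > 0" if "t \<in> {norm x / exp 1<..<norm x}"
          using that pos by auto
        ultimately show "ennreal (1/t) * indicator shell (x /\<^sub>R t) * indicator {0<..} t
            = ennreal (1/t) * indicator {norm x / exp 1<..<norm x} t"
          by (cases "t > 0") (auto simp: indicator_def)
      qed
      also have "\<dots> = ennreal (ln (norm x) - ln (norm x / exp 1))"
        using elim by (intro nn_integral_powr_inverse_interval) (auto simp: field_simps)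
      also have "\<dots> = 1" using elim by (simp add: ln_div)
      finally show ?case by simp
    qed
  qed
  finally show ?thesis by simp
qed

text \<open>The surface area of the unit sphere: in ordinary polar coordinates the radial factor
  would be the integral of \<open>1 / r\<close> over \<open>(1, e)\<close>, which equals
  one.\<close>

definition sphere_weight :: "'a::euclidean_space itself \<Rightarrow> ennreal" where
  "sphere_weight _ = (\<integral>\<^sup>+(z::'a). indicator shell z * ennreal (1 / norm z ^ DIM('a)) \<partial>lborel)"

text \<open>On the ray through \<open>z\<close> the substitution \<open>r = |z| t\<close> turns the
  integral into one independent of \<open>z\<close> times \<open>|z|^(-N)\<close>; what remains of
  the shell is \<open>sphere_weight\<close>.\<close>

lemma nn_integral_radial:
  fixes f :: "real \<Rightarrow> ennreal"
  assumes f [measurable]: "f \<in> borel_measurable borel"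
  shows "(\<integral>\<^sup>+(x::'a::euclidean_space). f (norm x) \<partial>lborel) =
    sphere_weight TYPE('a) * (\<integral>\<^sup>+r. f r * ennreal (r ^ (DIM('a) - 1)) * indicator {0<..} r \<partial>lborel)"
proof -
  define n where "n = DIM('a) - 1"
  have N: "DIM('a) = Suc n" using DIM_positive[where 'a='a] by (simp add: n_def)
  define I where "I = (\<integral>\<^sup>+r. f r * ennreal (r ^ n) * indicator {0<..} r \<partial>lborel)"
  have inner: "(\<integral>\<^sup>+t. f (norm (t *\<^sub>R z)) * ennreal (t ^ n) * indicator {0<..} t \<partial>lborel)
     = ennreal (1 / norm z ^ DIM('a)) * I" if z: "z \<noteq> 0" for z :: 'a
  proof -
    have c: "norm z > 0" using z by simp
    have "I = ennreal \<bar>norm z\<bar> * (\<integral>\<^sup>+t. f (0 + norm z * t) * ennreal ((0 + norm z * t) ^ n) * indicator {0<..} (0 + norm z * t) \<partial>lborel)"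
      unfolding I_def using c by (intro nn_integral_real_affine) auto
    also have "(\<integral>\<^sup>+t. f (0 + norm z * t) * ennreal ((0 + norm z * t) ^ n) * indicator {0<..} (0 + norm z * t) \<partial>lborel)
      = (\<integral>\<^sup>+t. ennreal (norm z ^ n) * (f (norm (t *\<^sub>R z)) * ennreal (t ^ n) * indicator {0<..} t) \<partial>lborel)"
    proof (rule nn_integral_cong)
      fix t :: real
      have ac: "F * (A * B) = A * (F * B)" for F A B :: ennreal by (simp only: mult_ac)
      show "f (0 + norm z * t) * ennreal ((0 + norm z * t) ^ n) * indicator {0<..} (0 + norm z * t)
        = ennreal (norm z ^ n) * (f (norm (t *\<^sub>R z)) * ennreal (t ^ n) * indicator {0<..} t)"
        using c by (cases "t > 0") (auto simp: power_mult_distrib ennreal_mult ac mult.commute[of t] zero_less_mult_iff)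
    qed
    also have "\<dots> = ennreal (norm z ^ n) * (\<integral>\<^sup>+t. f (norm (t *\<^sub>R z)) * ennreal (t ^ n) * indicator {0<..} t \<partial>lborel)"
      by (rule nn_integral_cmult) measurable
    finally have I: "I = ennreal \<bar>norm z\<bar> * (ennreal (norm z ^ n) * (\<integral>\<^sup>+t. f (norm (t *\<^sub>R z)) * ennreal (t ^ n) * indicator {0<..} t \<partial>lborel))" .
    have one: "ennreal (1 / norm z ^ DIM('a)) * (ennreal \<bar>norm z\<bar> * ennreal (norm z ^ n)) = 1"
      using c by (simp add: N ennreal_mult[symmetric])
    show ?thesis unfolding I using one by (simp add: mult.assoc[symmetric])
  qed
  have "(\<integral>\<^sup>+(x::'a). f (norm x) \<partial>lborel) =
    (\<integral>\<^sup>+(z::'a). indicator shell z * (\<integral>\<^sup>+t. f (norm (t *\<^sub>R z)) * ennreal (t ^ n) * indicator {0<..} t \<partial>lborel) \<partial>lborel)"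
    unfolding n_def by (rule nn_integral_polar) measurable
  also have "\<dots> = (\<integral>\<^sup>+(z::'a). (indicator shell z * ennreal (1 / norm z ^ DIM('a))) * I \<partial>lborel)"
  proof (rule nn_integral_cong)
    fix z :: 'a
    show "indicator shell z * (\<integral>\<^sup>+t. f (norm (t *\<^sub>R z)) * ennreal (t ^ n) * indicator {0<..} t \<partial>lborel)
      = (indicator shell z * ennreal (1 / norm z ^ DIM('a))) * I"
    proof (cases "z = 0")
      case True then show ?thesis by (simp add: shell_def)
    next
      case False then show ?thesis unfolding inner[OF False] by (simp only: mult.assoc)
    qed
  qed
  also have "\<dots> = sphere_weight TYPE('a) * I"
    unfolding sphere_weight_def by (rule nn_integral_multc) measurable
  finally show ?thesis unfolding I_def n_def .
qed

lemma sphere_weight_finite: "sphere_weight TYPE('a::euclidean_space) < \<infinity>"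
proof -
  have "sphere_weight TYPE('a) \<le> (\<integral>\<^sup>+(z::'a). indicator (ball 0 (exp 1)) z \<partial>lborel)"
    unfolding sphere_weight_def
    by (intro nn_integral_mono) (auto simp: shell_def indicator_def divide_le_eq_1 intro!: ennreal_le_1[THEN iffD2] one_le_power)
  also have "\<dots> = emeasure lborel (ball (0::'a) (exp 1))" by simp
  also have "\<dots> < \<infinity>" using emeasure_lborel_ball_finite[of "0::'a" "exp 1"] by (simp add: less_top)
  finally show ?thesis .
qed

text \<open>The radial formula for the constant function one has an infinite left-hand side, which
  rules out the value zero.\<close>

lemma sphere_weight_pos: "sphere_weight TYPE('a::euclidean_space) > 0"
proof -
  have "emeasure lborel (UNIV::'a set) = (\<integral>\<^sup>+(x::'a). 1 \<partial>lborel)" by simp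
  also have "\<dots> = sphere_weight TYPE('a) * (\<integral>\<^sup>+r. 1 * ennreal (r ^ (DIM('a) - 1)) * indicator {0<..} r \<partial>lborel)"
    by (rule nn_integral_radial) simp
  finally have "sphere_weight TYPE('a) \<noteq> 0" by (auto simp: emeasure_lborel_UNIV)
  then show ?thesis by (simp add: zero_less_iff_neq_zero)
qed

lemma nn_integral_powr_near_0_finite:
  assumes "a > -1" "R \<ge> 0"
  shows "(\<integral>\<^sup>+r. ennreal (r powr a) * indicator {0<..R} r \<partial>lborel) < \<infinity>"
proof -
  have "((\<lambda>x. x powr a) has_integral (R powr (a+1) / (a+1))) {0..R}"
    by (rule has_integral_powr_from_0) fact+
  from nn_integral_has_integral_lebesgue[OF _ this]
  have 1: "(\<integral>\<^sup>+r. ennreal (indicator {0..R} r * r powr a) \<partial>lborel) = ennreal (R powr (a+1) / (a+1))"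
    by (simp add: nn_integral_completion)
  have "(\<integral>\<^sup>+r. ennreal (r powr a) * indicator {0<..R} r \<partial>lborel)
    \<le> (\<integral>\<^sup>+r. ennreal (indicator {0..R} r * r powr a) \<partial>lborel)"
    by (intro nn_integral_mono) (auto simp: indicator_def)
  then show ?thesis unfolding 1 by (simp add: order.strict_trans1)
qed

lemma nn_integral_powr_at_top_finite:
  assumes "a < -1" "R > 0"
  shows "(\<integral>\<^sup>+r. ennreal (r powr a) * indicator {R..} r \<partial>lborel) < \<infinity>"
proof -
  have "((\<lambda>x. x powr a) has_integral (- (R powr (a+1)) / (a+1))) {R..}"
    by (rule has_integral_powr_to_inf) fact+
  from nn_integral_has_integral_lebesgue[OF _ this]
  have "(\<integral>\<^sup>+r. ennreal (indicator {R..} r * r powr a) \<partial>lborel) = ennreal (- (R powr (a+1)) / (a+1))"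
    by (simp add: nn_integral_completion)
  moreover have "(\<integral>\<^sup>+r. ennreal (r powr a) * indicator {R..} r \<partial>lborel)
    = (\<integral>\<^sup>+r. ennreal (indicator {R..} r * r powr a) \<partial>lborel)"
    by (intro nn_integral_cong) (auto simp: indicator_def)
  ultimately show ?thesis by simp
qed

lemma nn_integral_norm_powr_ball_finite:
  assumes "a > - real DIM('a::euclidean_space)" "R \<ge> 0"
  shows "(\<integral>\<^sup>+(x::'a). ennreal (norm x powr a) * indicator {0<..R} (norm x) \<partial>lborel) < \<infinity>"
proof -
  have "(\<integral>\<^sup>+r. ennreal (r powr a) * indicator {0<..R} r * ennreal (r ^ (DIM('a) - 1)) * indicator {0<..} r \<partial>lborel)
    = (\<integral>\<^sup>+r. ennreal (r powr (a + real DIM('a) - 1)) * indicator {0<..R} r \<partial>lborel)"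
    using DIM_positive[where 'a='a]
    by (intro nn_integral_cong)
       (auto simp: indicator_def ennreal_mult[symmetric] powr_realpow[symmetric] powr_add[symmetric] of_nat_diff algebra_simps)
  also have "\<dots> < \<infinity>" using assms by (intro nn_integral_powr_near_0_finite) auto
  finally show ?thesis using sphere_weight_finite[where 'a='a]
    by (subst nn_integral_radial) (auto simp: ennreal_mult_less_top)
qed

lemma nn_integral_norm_powr_at_top_finite:
  assumes "a < - real DIM('a::euclidean_space)" "R > 0"
  shows "(\<integral>\<^sup>+(x::'a). ennreal (norm x powr a) * indicator {R..} (norm x) \<partial>lborel) < \<infinity>"
proof -
  have "(\<integral>\<^sup>+r. ennreal (r powr a) * indicator {R..} r * ennreal (r ^ (DIM('a) - 1)) * indicator {0<..} r \<partial>lborel)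
    = (\<integral>\<^sup>+r. ennreal (r powr (a + real DIM('a) - 1)) * indicator {R..} r \<partial>lborel)"
    using DIM_positive[where 'a='a] \<open>R > 0\<close>
    by (intro nn_integral_cong)
       (auto simp: indicator_def ennreal_mult[symmetric] powr_realpow[symmetric] powr_add[symmetric] of_nat_diff algebra_simps)
  also have "\<dots> < \<infinity>" using assms by (intro nn_integral_powr_at_top_finite) auto
  finally show ?thesis using sphere_weight_finite[where 'a='a]
    by (subst nn_integral_radial) (auto simp: ennreal_mult_less_top)
qed

section \<open>Inversion in the unit sphere\<close>

definition inversion :: "'a::euclidean_space \<Rightarrow> 'a" where
  "inversion x = x /\<^sub>R (norm x)\<^sup>2"

lemma inversion_measurable [measurable]: "inversion \<in> borel_measurable borel"
  unfolding inversion_def by measurable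

lemma norm_inversion: "norm (inversion x) = 1 / norm x"
  by (cases "x = 0") (auto simp: inversion_def power2_eq_square divide_inverse)

text \<open>Inversion maps each ray to itself, so in polar coordinates the Jacobian
  \<open>|x|^(-2N)\<close> comes from the one-dimensional substitution
  \<open>t = 1 / (u |z|^2)\<close>, and no determinant has to be computed.\<close>

lemma nn_integral_inversion:
  fixes f :: "'a::euclidean_space \<Rightarrow> real"
  assumes f [measurable]: "f \<in> borel_measurable borel" and f0: "\<And>x. f x \<ge> 0"
  shows "(\<integral>\<^sup>+x. ennreal (f x) \<partial>lborel) = (\<integral>\<^sup>+x. ennreal (f (inversion x) / norm x ^ (2 * DIM('a))) \<partial>lborel)"
proof -
  define n where "n = DIM('a) - 1"
  have N: "DIM('a) = Suc n" using DIM_positive[where 'a='a] by (simp add: n_def)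
  have inner: "(\<integral>\<^sup>+t. ennreal (f (t *\<^sub>R z)) * ennreal (t ^ n) * indicator {0<..} t \<partial>lborel)
    = (\<integral>\<^sup>+t. ennreal (f (inversion (t *\<^sub>R z)) / norm (t *\<^sub>R z) ^ (2 * DIM('a))) * ennreal (t ^ n) * indicator {0<..} t \<partial>lborel)"
    if z: "z \<noteq> 0" for z :: 'a
  proof -
    define a where "a = (norm z)\<^sup>2"
    have a: "a > 0" using z by (simp add: a_def)
    have bij: "bij_betw (\<lambda>u. 1 / (u * a)) {0<..} {0<..}"
      by (rule bij_betw_byWitness[where f'="\<lambda>u. 1 / (u * a)"]) (use a in auto)
    have "(\<integral>\<^sup>+t. ennreal (f (t *\<^sub>R z)) * ennreal (t ^ n) * indicator {0<..} t \<partial>lborel)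
      = (\<integral>\<^sup>+t. ennreal (f (t *\<^sub>R z) * \<bar>t\<bar> ^ n) * indicator {0<..} t \<partial>lborel)"
      by (intro nn_integral_cong) (auto simp: indicator_def ennreal_mult f0)
    also have "\<dots> = (\<integral>\<^sup>+u. ennreal (\<bar>- 1 / (u\<^sup>2 * a)\<bar> * (f ((1 / (u * a)) *\<^sub>R z) * \<bar>1 / (u * a)\<bar> ^ n)) * indicator {0<..} u \<partial>lborel)"
      by (rule nn_integral_substitution_open[OF _ _ _ _ _ _ _ bij])
         (use a f0 in \<open>auto intro!: derivative_eq_intros simp: power2_eq_square field_simps\<close>)
    also have "\<dots> = (\<integral>\<^sup>+t. ennreal (f (inversion (t *\<^sub>R z)) / norm (t *\<^sub>R z) ^ (2 * DIM('a))) * ennreal (t ^ n) * indicator {0<..} t \<partial>lborel)"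
    proof (rule nn_integral_cong)
      fix u :: real
      show "ennreal (\<bar>- 1 / (u\<^sup>2 * a)\<bar> * (f ((1 / (u * a)) *\<^sub>R z) * \<bar>1 / (u * a)\<bar> ^ n)) * indicator {0<..} u
        = ennreal (f (inversion (u *\<^sub>R z)) / norm (u *\<^sub>R z) ^ (2 * DIM('a))) * ennreal (u ^ n) * indicator {0<..} u"
      proof (cases "u > 0")
        case True
        have i: "inversion (u *\<^sub>R z) = (1 / (u * a)) *\<^sub>R z"
          using True by (simp add: inversion_def a_def power2_eq_square field_simps)
        have p: "norm (u *\<^sub>R z) ^ (2 * DIM('a)) = (u\<^sup>2 * a) * (u\<^sup>2 * a) ^ n"
          unfolding power_mult using True by (simp add: N a_def power_mult_distrib)
        have "\<bar>- 1 / (u\<^sup>2 * a)\<bar> * (F * \<bar>1 / (u * a)\<bar> ^ n) = F / ((u\<^sup>2 * a) * (u\<^sup>2 * a) ^ n) * u ^ n" for F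
          using True a by (simp add: power_mult_distrib power_divide power2_eq_square field_simps)
        then show ?thesis using True f0 unfolding i p by (simp add: ennreal_mult[symmetric] a less_imp_le)
      qed auto
    qed
    finally show ?thesis .
  qed
  have "(\<integral>\<^sup>+x. ennreal (f x) \<partial>lborel) =
    (\<integral>\<^sup>+z. indicator shell z * (\<integral>\<^sup>+t. ennreal (f (t *\<^sub>R z)) * ennreal (t ^ n) * indicator {0<..} t \<partial>lborel) \<partial>lborel)"
    unfolding n_def by (rule nn_integral_polar) measurable
  also have "\<dots> = (\<integral>\<^sup>+z. indicator shell z * (\<integral>\<^sup>+t. ennreal (f (inversion (t *\<^sub>R z)) / norm (t *\<^sub>R z) ^ (2 * DIM('a))) * ennreal (t ^ n) * indicator {0<..} t \<partial>lborel) \<partial>lborel)"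
    by (intro nn_integral_cong) (metis (no_types, lifting) indicator_simps(2) inner mem_Collect_eq mult_zero_left norm_zero not_one_less_zero shell_def)
  also have "\<dots> = (\<integral>\<^sup>+x. ennreal (f (inversion x) / norm x ^ (2 * DIM('a))) \<partial>lborel)"
    unfolding n_def by (rule nn_integral_polar[symmetric]) measurable
  finally show ?thesis .
qed

text \<open>The Beta integral \<open>B(1 - s, s) = pi / sin(pi s)\<close>.\<close>

definition beta_const :: "real \<Rightarrow> ennreal" where
  "beta_const s = (\<integral>\<^sup>+v. ennreal (v powr (-s) / (1 + v)) * indicator {0<..} v \<partial>lborel)"

lemma beta_const_finite:
  assumes "0 < s" "s < 1" shows "beta_const s < \<infinity>"
proof -
  have "beta_const s \<le> (\<integral>\<^sup>+v. ennreal (v powr (-s)) * indicator {0<..1} v + ennreal (v powr (-s-1)) * indicator {1..} v \<partial>lborel)"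
    unfolding beta_const_def
  proof (rule nn_integral_mono)
    fix v :: real
    have "v powr (-s) / (1 + v) \<le> v powr (-s)" if "v > 0" using that by (simp add: field_simps)
    moreover have "v powr (-s) / (1 + v) \<le> v powr (-s-1)" if "v > 0"
      using that by (simp add: powr_diff field_simps)
    ultimately show "ennreal (v powr (-s) / (1 + v)) * indicator {0<..} v \<le> ennreal (v powr (-s)) * indicator {0<..1} v + ennreal (v powr (-s-1)) * indicator {1..} v"
      by (auto simp: indicator_def ennreal_leI add_increasing)
  qed
  also have "\<dots> < \<infinity>"
    using nn_integral_powr_near_0_finite[of "-s" 1] nn_integral_powr_at_top_finite[of "-s-1" 1] assms
    by (subst nn_integral_add) auto
  finally show ?thesis .
qed

text \<open>On \<open>v \<ge> 1\<close> the integrand is at least \<open>v^(-s-1) / 2\<close>. The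
  blow-up as \<open>s -> 0\<close> is what later drives the exit distribution to infinity.\<close>

lemma beta_const_lower:
  assumes "0 < s" shows "beta_const s \<ge> ennreal (1 / (2 * s))"
proof -
  have "((\<lambda>x. x powr (-s-1)) has_integral (- (1 powr ((-s-1)+1)) / ((-s-1)+1))) {1..}"
    by (rule has_integral_powr_to_inf) (use assms in auto)
  from nn_integral_has_integral_lebesgue[OF _ this]
  have 1: "(\<integral>\<^sup>+r. ennreal (indicator {1..} r * r powr (-s-1)) \<partial>lborel) = ennreal (1 / s)"
    by (simp add: nn_integral_completion)
  have "ennreal (1 / (2 * s)) = ennreal (1/2) * ennreal (1/s)"
    using assms by (subst ennreal_mult[symmetric]) auto
  also have "\<dots> = (\<integral>\<^sup>+r. ennreal (1/2) * ennreal (indicator {1..} r * r powr (-s-1)) \<partial>lborel)"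
    unfolding 1[symmetric] by (rule nn_integral_cmult[symmetric]) measurable
  also have "\<dots> \<le> beta_const s"
    unfolding beta_const_def
  proof (rule nn_integral_mono)
    fix v :: real
    have "1 / 2 * v powr (-s-1) \<le> v powr (-s) / (1 + v)" if "v \<ge> 1"
      using that by (simp add: powr_diff field_simps)
    moreover have "ennreal (1/2) * ennreal (v powr (-s-1)) = ennreal (1/2 * v powr (-s-1))"
      by (subst ennreal_mult[symmetric]) auto
    ultimately show "ennreal (1/2) * ennreal (indicator {1..} v * v powr (-s-1)) \<le> ennreal (v powr (-s) / (1 + v)) * indicator {0<..} v"
      using ennreal_leI by (cases "v \<ge> 1") (fastforce simp: indicator_def)+
  qed
  finally show ?thesis .
qed

section \<open>Riesz kernel and Poisson kernel of the ball\<close>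

text \<open>Along a ray through an interior point of a ball, \<open>R\<^sup>2 - |\<cdot>|\<^sup>2\<close> is a quadratic \<open>\<gamma> - 2 b t - \<alpha> t\<^sup>2\<close>.
  The substitution \<open>v = (\<gamma> - 2 b t - \<alpha> t\<^sup>2) / (\<alpha> t\<^sup>2)\<close> makes the contributions of two opposite rays
  (\<open>b\<close> and \<open>- b\<close>) add up to something independent of \<open>b\<close> and \<open>\<gamma>\<close>.\<close>

lemma chord_ray:
  fixes \<alpha> \<gamma> b s :: real
  assumes \<alpha>: "\<alpha> > 0" and \<gamma>: "\<gamma> > 0"
  defines "q \<equiv> \<lambda>t. \<gamma> - 2 * b * t - \<alpha> * t\<^sup>2"
  defines "D \<equiv> \<lambda>v. sqrt (b\<^sup>2 + \<gamma> * \<alpha> * (1 + v))"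
  shows "(\<integral>\<^sup>+t. ennreal (t powr (2 * s-1) * q t powr (-s)) * indicator {t. 0 < t \<and> 0 < q t} t \<partial>lborel)
    = (\<integral>\<^sup>+v. ennreal (\<alpha> powr (-s) * (v powr (-s) * (\<gamma> * \<alpha> / (2 * D v * (D v + b))))) * indicator {0<..} v \<partial>lborel)"
proof -
  \<comment> \<open>The positive root \<open>t\<close> of
    \<open>\<alpha> (1 + v) t^2 + 2 b t - \<gamma> = 0\<close>, which is the equation
    \<open>q t = \<alpha> t^2 v\<close>, written with the square root in the denominator so that a
    vanishing or negative \<open>b\<close> causes no case distinction.\<close>
  define g where "g v = \<gamma> / (b + D v)" for v
  define g' where "g' v = - \<gamma> * (\<gamma> * \<alpha> / (2 * D v)) / (b + D v)\<^sup>2" for v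
  define T where "T = {t. 0 < t \<and> 0 < q t}"
  have qm [measurable]: "q \<in> borel_measurable borel" unfolding q_def by measurable
  have Dm [measurable]: "D \<in> borel_measurable borel" unfolding D_def by measurable
  have D: "D v > \<bar>b\<bar>" "(D v)\<^sup>2 = b\<^sup>2 + \<gamma> * \<alpha> * (1 + v)" if "v > 0" for v
  proof -
    have "\<gamma> * \<alpha> * (1 + v) > 0" using that \<alpha> \<gamma> by simp
    then show "D v > \<bar>b\<bar>" "(D v)\<^sup>2 = b\<^sup>2 + \<gamma> * \<alpha> * (1 + v)"
      unfolding D_def by (auto intro!: real_less_rsqrt simp: add_nonneg_nonneg)
  qed
  have bD: "b + D v > 0" if "v > 0" for v using D(1)[OF that] by linarith
  have gpos: "g v > 0" if "v > 0" for v using bD[OF that] \<gamma> by (simp add: g_def)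
  have qg: "q (g v) = \<alpha> * (g v)\<^sup>2 * v" if v: "v > 0" for v
  proof -
    have e: "\<gamma> = g v * (b + D v)" using bD[OF v] by (simp add: g_def)
    have "\<gamma> * \<gamma> - 2 * b * g v * \<gamma> - \<alpha> * (g v)\<^sup>2 * \<gamma> = (g v)\<^sup>2 * ((b + D v)\<^sup>2 - 2 * b * (b + D v) - \<alpha> * \<gamma>)"
      by (subst (1 2 3) e) (simp add: power2_eq_square algebra_simps)
    also have "(b + D v)\<^sup>2 - 2 * b * (b + D v) - \<alpha> * \<gamma> = (D v)\<^sup>2 - b\<^sup>2 - \<alpha> * \<gamma>"
      by (simp add: power2_eq_square algebra_simps)
    also have "\<dots> = \<gamma> * (\<alpha> * v)" using D(2)[OF v] by (simp add: algebra_simps)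
    finally have "\<gamma> * q (g v) = \<gamma> * (\<alpha> * (g v)\<^sup>2 * v)" by (simp add: q_def algebra_simps)
    then show ?thesis using \<gamma> by simp
  qed
  have bij: "bij_betw g {0<..} T"
  proof (rule bij_betw_byWitness[where f'="\<lambda>t. q t / (\<alpha> * t\<^sup>2)"])
    show "\<forall>v\<in>{0<..}. q (g v) / (\<alpha> * (g v)\<^sup>2) = v"
      using qg gpos \<alpha> by (auto simp: less_imp_neq[symmetric])
    show "g ` {0<..} \<subseteq> T" using \<alpha> by (auto simp: T_def gpos qg intro!: mult_pos_pos zero_less_power gpos)
    show "(\<lambda>t. q t / (\<alpha> * t\<^sup>2)) ` T \<subseteq> {0<..}" using \<alpha> by (auto simp: T_def)
    show "\<forall>t\<in>T. g (q t / (\<alpha> * t\<^sup>2)) = t"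
    proof
      fix t assume "t \<in> T"
      then have t: "t > 0" "q t > 0" by (auto simp: T_def)
      have "\<gamma> * \<alpha> * (1 + q t / (\<alpha> * t\<^sup>2)) = \<gamma> * (\<alpha> * t\<^sup>2 + q t) / t\<^sup>2" using t \<alpha> by (simp add: field_simps)
      also have "\<alpha> * t\<^sup>2 + q t = \<gamma> - 2 * b * t" by (simp add: q_def)
      finally have "b\<^sup>2 + \<gamma> * \<alpha> * (1 + q t / (\<alpha> * t\<^sup>2)) = (\<gamma> / t - b)\<^sup>2"
        using t by (simp add: power2_eq_square field_simps)
      then have Dt: "D (q t / (\<alpha> * t\<^sup>2)) = \<bar>\<gamma> / t - b\<bar>" by (simp add: D_def)
      \<comment> \<open>This selects the sign of the square root: \<open>D\<close> returns an
        absolute value, and \<open>t\<close> is the positive root only if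
        \<open>\<gamma> / t - b\<close> is positive.\<close>
      have "\<gamma> - b * t > 0"
      proof (cases "b \<le> 0")
        case True
        then have "b * t \<le> 0" using t by (simp add: mult_nonpos_nonneg)
        then show ?thesis using \<gamma> by simp
      next
        case False
        then have "b * t > 0" "\<alpha> * t\<^sup>2 > 0" using t \<alpha> by auto
        then show ?thesis using t(2) by (simp add: q_def)
      qed
      then have "\<gamma> / t - b > 0" using t by (simp add: field_simps)
      then have "b + D (q t / (\<alpha> * t\<^sup>2)) = \<gamma> / t" using Dt by simp
      then show "g (q t / (\<alpha> * t\<^sup>2)) = t" using t \<gamma> by (simp add: g_def)
    qed
  qed
  have der: "(g has_field_derivative g' v) (at v)" if "v \<in> {0<..}" for v
  proof -
    have v: "v > 0" using that by simp
    have p: "b\<^sup>2 + \<gamma> * \<alpha> * (1 + v) > 0" using v \<alpha> \<gamma> by (simp add: add_nonneg_pos)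
    have d: "((\<lambda>v. b\<^sup>2 + \<gamma> * \<alpha> * (1 + v)) has_field_derivative \<gamma> * \<alpha>) (at v)"
      by (auto intro!: derivative_eq_intros)
    have "(D has_field_derivative inverse (D v) / 2 * (\<gamma> * \<alpha>)) (at v)"
      unfolding D_def by (rule DERIV_chain2[OF DERIV_real_sqrt[OF p] d])
    then have bd: "((\<lambda>v. b + D v) has_field_derivative 0 + inverse (D v) / 2 * (\<gamma> * \<alpha>)) (at v)"
      by (rule DERIV_add[OF DERIV_const])
    have eq: "(0 * X - \<gamma> * (0 + inverse Y / 2 * (\<gamma> * \<alpha>))) / (X * X) = - \<gamma> * (\<gamma> * \<alpha> / (2 * Y)) / X\<^sup>2" for X Y
      by (simp add: power2_eq_square inverse_eq_divide)
    from DERIV_divide[OF DERIV_const[of \<gamma>] bd bD[OF v, THEN less_imp_neq, symmetric]] show ?thesis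
      unfolding g_def g'_def by (rule DERIV_cong) (rule eq)
  qed
  have gm [measurable]: "g \<in> borel_measurable borel" unfolding g_def by measurable
  have gm' [measurable]: "g' \<in> borel_measurable borel" unfolding g'_def by measurable
  have Tm [measurable]: "T \<in> sets borel" unfolding T_def by measurable
  have "(\<integral>\<^sup>+t. ennreal (t powr (2 * s-1) * q t powr (-s)) * indicator T t \<partial>lborel)
    = (\<integral>\<^sup>+v. ennreal (\<bar>g' v\<bar> * (g v powr (2 * s-1) * q (g v) powr (-s))) * indicator {0<..} v \<partial>lborel)"
    by (rule nn_integral_substitution_open[OF _ _ _ _ _ _ der bij]) auto
  also have "\<dots> = (\<integral>\<^sup>+v. ennreal (\<alpha> powr (-s) * (v powr (-s) * (\<gamma> * \<alpha> / (2 * D v * (D v + b))))) * indicator {0<..} v \<partial>lborel)"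
  proof (rule nn_integral_cong)
    fix v :: real
    have "\<bar>g' v\<bar> * (g v powr (2 * s-1) * q (g v) powr (-s)) = \<alpha> powr (-s) * (v powr (-s) * (\<gamma> * \<alpha> / (2 * D v * (D v + b))))"
      if v: "v > 0"
    proof -
      have "q (g v) powr (-s) = \<alpha> powr (-s) * (g v powr (2 * (-s))) * v powr (-s)"
        using qg[OF v] gpos[OF v] v \<alpha> powr_powr[of "g v" 2 "-s"] by (simp add: powr_mult)
      then have "g v powr (2 * s-1) * q (g v) powr (-s) = \<alpha> powr (-s) * v powr (-s) * (g v powr (2 * s-1) * g v powr (2 * (-s)))"
        by simp
      also have "g v powr (2 * s-1) * g v powr (2 * (-s)) = 1 / g v"
      proof -
        have "g v powr (2 * s-1) * g v powr (2 * (-s)) = g v powr ((2 * s-1) + 2 * (-s))"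
          by (rule powr_add[symmetric])
        also have "(2 * s-1) + 2 * (-s) = -1" by simp
        also have "g v powr -1 = 1 / g v" using gpos[OF v] by (simp add: powr_minus divide_inverse)
        finally show ?thesis .
      qed
      finally have 1: "g v powr (2 * s-1) * q (g v) powr (-s) = \<alpha> powr (-s) * v powr (-s) * (1 / g v)" .
      have Dp: "D v > 0" using D(1)[OF v] by linarith
      have "\<bar>g' v\<bar> = \<gamma> * (\<gamma> * \<alpha> / (2 * D v)) / (b + D v)\<^sup>2"
        using bD[OF v] Dp \<alpha> \<gamma> by (simp add: g'_def abs_mult)
      then have "\<bar>g' v\<bar> * (1 / g v) = \<gamma> * \<alpha> / (2 * D v * (D v + b))"
      proof -
        have "\<gamma> * (\<gamma> * \<alpha> / (2 * Y)) / X\<^sup>2 * (1 / (\<gamma> / X)) = \<gamma> * \<alpha> / (2 * Y * X)" if "X > 0" for X Y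
          using that \<gamma> by (simp add: power2_eq_square)
        from this[OF bD[OF v], of "D v"] show ?thesis
          using \<open>\<bar>g' v\<bar> = _\<close> by (simp add: g_def add.commute)
      qed
      then show ?thesis unfolding 1 by (metis mult.assoc mult.left_commute)
    qed
    then show "ennreal (\<bar>g' v\<bar> * (g v powr (2 * s-1) * q (g v) powr (-s))) * indicator {0<..} v
      = ennreal (\<alpha> powr (-s) * (v powr (-s) * (\<gamma> * \<alpha> / (2 * D v * (D v + b))))) * indicator {0<..} v"
      by (auto simp: indicator_def)
  qed
  finally show ?thesis unfolding T_def .
qed

text \<open>Partial fractions remove \<open>b\<close>:
  \<open>1 / (2 D (D + b)) + 1 / (2 D (D - b)) = 1 / (D^2 - b^2)\<close>, and
  \<open>D^2 - b^2 = \<gamma> \<alpha> (1 + v)\<close>, so that the factor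
  \<open>\<gamma> \<alpha>\<close> cancels and the integrand of \<open>beta_const\<close> is
  left.\<close>

lemma chord_opposite_rays:
  fixes \<alpha> \<gamma> b s :: real
  assumes \<alpha>: "\<alpha> > 0" and \<gamma>: "\<gamma> > 0"
  defines "q \<equiv> \<lambda>b t. \<gamma> - 2 * b * t - \<alpha> * t\<^sup>2"
  shows "(\<integral>\<^sup>+t. ennreal (t powr (2 * s-1) * q b t powr (-s)) * indicator {t. 0 < t \<and> 0 < q b t} t \<partial>lborel)
    + (\<integral>\<^sup>+t. ennreal (t powr (2 * s-1) * q (-b) t powr (-s)) * indicator {t. 0 < t \<and> 0 < q (-b) t} t \<partial>lborel)
    = ennreal (\<alpha> powr (-s)) * beta_const s"
proof -
  define D where "D v = sqrt (b\<^sup>2 + \<gamma> * \<alpha> * (1 + v))" for v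
  have Dm [measurable]: "D \<in> borel_measurable borel" unfolding D_def by measurable
  have eq: "ennreal (\<alpha> powr (-s) * (v powr (-s) * (\<gamma> * \<alpha> / (2 * D v * (D v + b))))) * indicator {0<..} v
      + ennreal (\<alpha> powr (-s) * (v powr (-s) * (\<gamma> * \<alpha> / (2 * D v * (D v + - b))))) * indicator {0<..} v
      = ennreal (\<alpha> powr (-s)) * (ennreal (v powr (-s) / (1 + v)) * indicator {0<..} v)" for v
  proof (cases "v > 0")
    case v: True
    have p: "\<gamma> * \<alpha> * (1 + v) > 0" using v \<alpha> \<gamma> by simp
    then have D: "D v > \<bar>b\<bar>" "(D v)\<^sup>2 = b\<^sup>2 + \<gamma> * \<alpha> * (1 + v)"
      unfolding D_def by (auto intro!: real_less_rsqrt simp: add_nonneg_nonneg)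
    have d: "D v > 0" "D v + b > 0" "D v + - b > 0" using D(1) by linarith+
    have "\<gamma> * \<alpha> / (2 * D v * (D v + b)) + \<gamma> * \<alpha> / (2 * D v * (D v + - b)) = \<gamma> * \<alpha> / ((D v)\<^sup>2 - b\<^sup>2)"
    proof -
      have "(D v)\<^sup>2 - b\<^sup>2 = (D v + b) * (D v + - b)" by (simp add: power2_eq_square algebra_simps)
      then show ?thesis using d by (simp only:) (simp add: divide_simps, simp add: algebra_simps)
    qed
    also have "\<dots> = 1 / (1 + v)" using D(2) \<alpha> \<gamma> by simp
    finally have sum: "\<gamma> * \<alpha> / (2 * D v * (D v + b)) + \<gamma> * \<alpha> / (2 * D v * (D v + - b)) = 1 / (1 + v)" .
    have nn: "0 \<le> \<gamma> * \<alpha> / (2 * D v * (D v + b))" "0 \<le> \<gamma> * \<alpha> / (2 * D v * (D v + - b))"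
      using d \<alpha> \<gamma> by (auto intro!: divide_nonneg_nonneg mult_nonneg_nonneg)
    have "ennreal (A * (B * X)) + ennreal (A * (B * Y)) = ennreal A * ennreal (B / (1 + v))"
      if XY: "X + Y = 1 / (1 + v)" and "A \<ge> 0" "B \<ge> 0" "X \<ge> 0" "Y \<ge> 0" for A B X Y :: real
    proof -
      have "ennreal (A * (B * X)) + ennreal (A * (B * Y)) = ennreal (A * (B * X) + A * (B * Y))"
        using that by simp
      also have "A * (B * X) + A * (B * Y) = A * (B * (X + Y))" by (simp add: distrib_left)
      also have "\<dots> = A * (B / (1 + v))" by (simp add: XY)
      finally show ?thesis using that v by (subst ennreal_mult[symmetric]) auto
    qed
    from this[OF sum powr_ge_zero powr_ge_zero nn, of \<alpha> "-s" v "-s"]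
    show ?thesis using v by simp
  qed auto
  show ?thesis
    unfolding q_def using chord_ray[OF \<alpha> \<gamma>, of s b] chord_ray[OF \<alpha> \<gamma>, of s "-b"]
    by (simp only: D_def[symmetric] power2_minus beta_const_def)
       (subst nn_integral_add[symmetric], measurable, subst eq, rule nn_integral_cmult, measurable)
qed

text \<open>Unnormalised. At the origin \<open>powr\<close> gives the value 0 in place of infinity,
  which affects the integrals only on a null set.\<close>

definition riesz :: "real \<Rightarrow> 'a::euclidean_space \<Rightarrow> real" where
  "riesz s x = norm x powr (2 * s - real DIM('a))"

lemma riesz_measurable [measurable]: "riesz s \<in> borel_measurable borel"
  unfolding riesz_def by measurable

lemma riesz_nonneg [simp]: "riesz s x \<ge> 0"
  by (simp add: riesz_def)

lemma riesz_minus: "riesz s (x - y) = riesz s (y - x)"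
  by (simp add: riesz_def norm_minus_commute)

definition riesz_ball_const :: "'a::euclidean_space itself \<Rightarrow> real \<Rightarrow> ennreal" where
  "riesz_ball_const _ s = sphere_weight TYPE('a) * beta_const s / 2"

text \<open>The density \<open>(R^2 - |w - c|^2)^(-s)\<close> is a multiple of the equilibrium
  distribution of the ball for the Riesz kernel, so its potential is constant inside. In polar
  coordinates about \<open>z\<close> the density along direction \<open>y\<close> is a power of the
  quadratic with \<open>\<gamma> = R^2 - |z - c|^2\<close>, \<open>b = (z - c) . y\<close> and
  \<open>\<alpha> = |y|^2\<close>, and the kernel together with the radial weight gives
  \<open>t^(2s-1)\<close>. Averaging over \<open>y\<close> and \<open>- y\<close> removes the
  dependence on \<open>z\<close>; this averaging is the origin of the factor one half in
  \<open>riesz_ball_const\<close>.\<close>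

lemma riesz_potential_ball_weight:
  fixes c z :: "'a::euclidean_space"
  assumes z: "z \<in> ball c R"
  shows "(\<integral>\<^sup>+w. ennreal ((R\<^sup>2 - (dist w c)\<^sup>2) powr (-s) * riesz s (w - z)) * indicator (ball c R) w \<partial>lborel)
    = riesz_ball_const TYPE('a) s"
proof -
  define n where "n = DIM('a) - 1"
  have N: "DIM('a) = Suc n" using DIM_positive[where 'a='a] by (simp add: n_def)
  define \<gamma> where "\<gamma> = R\<^sup>2 - (dist z c)\<^sup>2"
  have R: "R > 0" using z by (auto simp: dist_commute intro: le_less_trans[OF zero_le_dist])
  have \<gamma>: "\<gamma> > 0" unfolding \<gamma>_def using z R by (simp add: dist_commute power2_strict_mono)
  define q where "q b \<alpha> t = \<gamma> - 2 * b * t - \<alpha> * t\<^sup>2" for b \<alpha> t :: real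
  define J where "J b \<alpha> = (\<integral>\<^sup>+t. ennreal (t powr (2 * s-1) * q b \<alpha> t powr (-s)) * indicator {0<..} t * indicator {0<..} (q b \<alpha> t) \<partial>lborel)" for b \<alpha>
  have qm [measurable]: "(\<lambda>x. q b \<alpha> x) \<in> borel_measurable borel" for b \<alpha>
    unfolding q_def by measurable
  have Jm [measurable (raw)]: "(\<lambda>x. J (b x) (a x)) \<in> borel_measurable M"
    if [measurable]: "b \<in> borel_measurable M" "a \<in> borel_measurable M" for M :: "'a measure" and b a
    unfolding J_def q_def by measurable
  have Jsum: "J b \<alpha> + J (-b) \<alpha> = ennreal (\<alpha> powr (-s)) * beta_const s" if "\<alpha> > 0" for b \<alpha>
  proof -
    have i: "F * indicator {0<..} t * indicator {0<..} (q b \<alpha> t) = F * indicator {t. 0 < t \<and> 0 < q b \<alpha> t} t" for F :: ennreal and t b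
      by (auto simp: indicator_def)
    show ?thesis unfolding J_def i using chord_opposite_rays[OF that \<gamma>, of s b] by (simp only: q_def)
  qed
  define F where "F w = ennreal ((R\<^sup>2 - (dist w c)\<^sup>2) powr (-s) * riesz s (w - z)) * indicator (ball c R) w" for w
  have [measurable]: "ball c R \<in> sets borel" by simp
  have Fm [measurable]: "F \<in> borel_measurable borel"
    unfolding F_def dist_norm by measurable
  have qR: "R\<^sup>2 - (dist (z + t *\<^sub>R y) c)\<^sup>2 = q ((z - c) \<bullet> y) ((norm y)\<^sup>2) t" for t and y :: 'a
  proof -
    have "(dist (z + t *\<^sub>R y) c)\<^sup>2 = (norm ((z - c) + t *\<^sub>R y))\<^sup>2" by (simp add: dist_norm algebra_simps)
    also have "\<dots> = (norm (z - c))\<^sup>2 + 2 * t * ((z - c) \<bullet> y) + t\<^sup>2 * (norm y)\<^sup>2"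
      by (simp only: power2_norm_eq_inner) (simp add: inner_add_left inner_add_right inner_commute power2_eq_square algebra_simps)
    finally show ?thesis by (simp add: q_def \<gamma>_def dist_norm algebra_simps)
  qed
  have inner: "(\<integral>\<^sup>+t. F (z + t *\<^sub>R y) * ennreal (t ^ n) * indicator {0<..} t \<partial>lborel)
     = ennreal (norm y powr (2 * s - real DIM('a))) * J ((z - c) \<bullet> y) ((norm y)\<^sup>2)" if y: "y \<noteq> 0" for y
    unfolding J_def
  proof (subst nn_integral_cmult[symmetric], measurable, rule nn_integral_cong)
    fix t :: real
    let ?q = "q ((z - c) \<bullet> y) ((norm y)\<^sup>2) t"
    have mem: "z + t *\<^sub>R y \<in> ball c R \<longleftrightarrow> ?q > 0"
      unfolding qR[symmetric] using R by (simp add: dist_commute power_mono_iff not_le[symmetric])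
    show "F (z + t *\<^sub>R y) * ennreal (t ^ n) * indicator {0<..} t = ennreal (norm y powr (2 * s - real DIM('a))) *
       (ennreal (t powr (2 * s-1) * ?q powr (-s)) * indicator {0<..} t * indicator {0<..} ?q)"
    proof (cases "t > 0 \<and> ?q > 0")
      case True
      have "t powr (2 * s-1) = t powr (2 * s - real DIM('a)) * t ^ n"
        using True by (simp add: powr_realpow[symmetric] powr_add[symmetric] N)
      then have "?q powr (-s) * riesz s (t *\<^sub>R y) * t ^ n = norm y powr (2 * s - real DIM('a)) * (t powr (2 * s-1) * ?q powr (-s))"
        using True by (simp add: riesz_def powr_mult)
      then show ?thesis using True mem
        by (simp add: F_def qR ennreal_mult[symmetric])
    qed (use mem in \<open>auto simp: F_def indicator_def\<close>)
  qed
  define G where "G b y = indicator shell y * (ennreal (norm y powr (2 * s - real DIM('a))) * J b ((norm y)\<^sup>2))" for b and y :: 'a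
  have Gm [measurable]: "(\<lambda>y. G (b y) y) \<in> borel_measurable borel" if [measurable]: "b \<in> borel_measurable borel" for b
    unfolding G_def by measurable
  define I where "I = (\<integral>\<^sup>+w. F w \<partial>lborel)"
  have "I = (\<integral>\<^sup>+x. F (z + x) \<partial>lborel)"
    unfolding I_def by (rule nn_integral_lborel_translate[symmetric]) measurable
  also have "\<dots> = (\<integral>\<^sup>+y. indicator shell y * (\<integral>\<^sup>+t. F (z + t *\<^sub>R y) * ennreal (t ^ n) * indicator {0<..} t \<partial>lborel) \<partial>lborel)"
    unfolding n_def by (rule nn_integral_polar) measurable
  also have "\<dots> = (\<integral>\<^sup>+y. G ((z - c) \<bullet> y) y \<partial>lborel)"
  proof (rule nn_integral_cong)
    fix y :: 'a
    show "indicator shell y * (\<integral>\<^sup>+t. F (z + t *\<^sub>R y) * ennreal (t ^ n) * indicator {0<..} t \<partial>lborel) = G ((z - c) \<bullet> y) y"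
    proof (cases "y = 0")
      case True then show ?thesis by (simp add: shell_def G_def)
    next
      case False then show ?thesis by (simp add: inner G_def)
    qed
  qed
  finally have I1: "I = (\<integral>\<^sup>+y. G ((z - c) \<bullet> y) y \<partial>lborel)" .
  \<comment> \<open>The shell is symmetric, so the same integral may be computed with the direction
    reversed, which changes only the sign of \<open>b\<close>.\<close>
  also have "\<dots> = (\<integral>\<^sup>+y. G ((z - c) \<bullet> (0 - y)) (0 - y) \<partial>lborel)"
    by (rule nn_integral_lborel_reflect[symmetric]) measurable
  also have "\<dots> = (\<integral>\<^sup>+y. G (- ((z - c) \<bullet> y)) y \<partial>lborel)"
    by (simp add: G_def shell_def indicator_def)
  finally have I2: "I = (\<integral>\<^sup>+y. G (- ((z - c) \<bullet> y)) y \<partial>lborel)" .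
  have "2 * I = (\<integral>\<^sup>+y. G ((z - c) \<bullet> y) y \<partial>lborel) + (\<integral>\<^sup>+y. G (- ((z - c) \<bullet> y)) y \<partial>lborel)"
    using I1 I2 by (simp add: mult_2)
  also have "\<dots> = (\<integral>\<^sup>+y. G ((z - c) \<bullet> y) y + G (- ((z - c) \<bullet> y)) y \<partial>lborel)"
    by (rule nn_integral_add[symmetric]) measurable
  also have "\<dots> = (\<integral>\<^sup>+(y::'a). (indicator shell y * ennreal (1 / norm y ^ DIM('a))) * beta_const s \<partial>lborel)"
  proof (rule nn_integral_cong)
    fix y :: 'a
    show "G ((z - c) \<bullet> y) y + G (- ((z - c) \<bullet> y)) y = (indicator shell y * ennreal (1 / norm y ^ DIM('a))) * beta_const s"
    proof (cases "y \<in> shell")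
      case True
      then have y: "norm y > 0" by (auto simp: shell_def)
      have "norm y powr (2 * s - real DIM('a)) * ((norm y)\<^sup>2) powr (-s) = 1 / norm y ^ DIM('a)"
      proof -
        have "((norm y)\<^sup>2) powr (-s) = norm y powr (2 * (-s))"
          using y powr_powr[of "norm y" 2 "-s"] by simp
        moreover have "norm y powr (2 * s - real DIM('a)) * norm y powr (2 * (-s)) = norm y powr (- real DIM('a))"
          by (simp add: powr_add[symmetric])
        ultimately show ?thesis using y by (simp add: powr_minus powr_realpow divide_inverse)
      qed
      then have "ennreal (norm y powr (2 * s - real DIM('a))) * (ennreal (((norm y)\<^sup>2) powr (-s)) * beta_const s) = ennreal (1 / norm y ^ DIM('a)) * beta_const s"
        by (simp add: mult.assoc[symmetric] ennreal_mult[symmetric])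
      then show ?thesis using True y Jsum[of "(norm y)\<^sup>2" "(z - c) \<bullet> y"]
        by (simp add: G_def distrib_left[symmetric])
    qed (simp add: G_def)
  qed
  also have "\<dots> = sphere_weight TYPE('a) * beta_const s"
    unfolding sphere_weight_def by (rule nn_integral_multc) measurable
  finally have "2 * I = sphere_weight TYPE('a) * beta_const s" .
  then have "2 * I / 2 = sphere_weight TYPE('a) * beta_const s / 2" by simp
  also have "2 * I / 2 = I" by (simp add: mult.commute[of 2] ennreal_mult_divide_eq)
  finally show ?thesis unfolding I_def F_def riesz_ball_const_def .
qed

section \<open>The Poisson kernel of the unit ball and its total mass\<close>

lemma powr_divide_minus: "(x / y) powr s = x powr s * y powr (-s)" if "x \<ge> 0" "y > 0" for x y s :: real
  using that by (cases "x = 0") (simp_all add: powr_def ln_div exp_add[symmetric] algebra_simps)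

definition riesz_norm :: "'a::euclidean_space itself \<Rightarrow> real \<Rightarrow> real" where
  "riesz_norm T s = enn2real (riesz_ball_const T s)"

lemma beta_const_pos: "0 < s \<Longrightarrow> beta_const s > 0"
  using beta_const_lower[of s] by (auto intro: less_le_trans[of _ "ennreal (1 / (2 * s))"])

lemma riesz_ball_const_eq:
  assumes "0 < s" "s < 1"
  shows "riesz_ball_const TYPE('a::euclidean_space) s = ennreal (riesz_norm TYPE('a) s)"
    and "riesz_norm TYPE('a) s > 0"
proof -
  have "riesz_ball_const TYPE('a) s < \<infinity>"
    unfolding riesz_ball_const_def
    using sphere_weight_finite[where 'a='a] beta_const_finite[OF assms]
    by (simp add: less_top[symmetric] ennreal_divide_eq_top_iff ennreal_mult_eq_top_iff)
  moreover have "riesz_ball_const TYPE('a) s > 0"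
    unfolding riesz_ball_const_def
    using sphere_weight_pos[where 'a='a] beta_const_pos[OF assms(1)]
    by (auto simp: ennreal_zero_less_divide ennreal_zero_less_mult_iff)
  ultimately show "riesz_ball_const TYPE('a) s = ennreal (riesz_norm TYPE('a) s)" "riesz_norm TYPE('a) s > 0"
    by (auto simp: riesz_norm_def enn2real_positive_iff)
qed

text \<open>The factor \<open>1 / riesz_norm\<close> is the classical constant
  \<open>Gamma(N/2) sin(pi s) / pi^(N/2+1)\<close>; here it enters as the reciprocal of the constant
  potential of the ball weight. Setting the kernel to zero unless \<open>|x| < 1 < |y|\<close>
  allows all integrals to run over the whole space.\<close>

definition poisson :: "real \<Rightarrow> 'a::euclidean_space \<Rightarrow> 'a \<Rightarrow> real" where
  "poisson s x y = (if norm x < 1 \<and> 1 < norm y then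
     ((1 - (norm x)\<^sup>2) / ((norm y)\<^sup>2 - 1)) powr s / norm (y - x) ^ DIM('a) / riesz_norm TYPE('a) s else 0)"

lemma poisson_measurable [measurable]:
  "(\<lambda>x. poisson s (f x) (g x)) \<in> borel_measurable M" if [measurable]: "f \<in> borel_measurable M" "g \<in> borel_measurable M"
  unfolding poisson_def by measurable

lemma poisson_nonneg: "poisson s x y \<ge> 0"
  unfolding poisson_def riesz_norm_def by auto

lemma inversion_inversion: "inversion (inversion x) = x"
  by (cases "x = 0") (auto simp: inversion_def norm_inversion power2_eq_square field_simps)

lemma norm_inversion_diff:
  assumes "w \<noteq> 0" "z \<noteq> 0"
  shows "norm (inversion w - z) = norm (w - inversion z) * norm z / norm w"
proof -
  have n: "norm w \<noteq> 0" "norm z \<noteq> 0" using assms by auto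
  have l: "(norm (inversion w - z))\<^sup>2 = 1 / (norm w)\<^sup>2 - 2 * (w \<bullet> z) / (norm w)\<^sup>2 + (norm z)\<^sup>2"
  proof -
    have "(norm (inversion w - z))\<^sup>2 = (norm (inversion w))\<^sup>2 - 2 * (inversion w \<bullet> z) + (norm z)\<^sup>2"
      by (simp add: power2_norm_eq_inner inner_diff_left inner_diff_right inner_commute)
    then show ?thesis by (simp add: norm_inversion power_divide) (simp add: inversion_def divide_inverse)
  qed
  have r: "(norm (w - inversion z))\<^sup>2 = (norm w)\<^sup>2 - 2 * (w \<bullet> z) / (norm z)\<^sup>2 + 1 / (norm z)\<^sup>2"
  proof -
    have "(norm (w - inversion z))\<^sup>2 = (norm w)\<^sup>2 - 2 * (w \<bullet> inversion z) + (norm (inversion z))\<^sup>2"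
      by (simp add: power2_norm_eq_inner inner_diff_left inner_diff_right inner_commute)
    then show ?thesis by (simp add: norm_inversion power_divide) (simp add: inversion_def divide_inverse)
  qed
  have "(norm (inversion w - z))\<^sup>2 = (norm (w - inversion z) * norm z / norm w)\<^sup>2"
    unfolding power_mult_distrib power_divide l r using n by (simp add: field_simps)
  then show ?thesis by (simp add: power2_eq_iff_nonneg)
qed

text \<open>Inversion about \<open>x\<close>, that is \<open>y = x + w / |w|^2\<close>, carries the
  exterior of the unit ball to the ball with centre \<open>c = R x\<close> and radius
  \<open>R = 1 / (1 - |x|^2)\<close>. The Jacobian, the factor \<open>|y - x|^(-N)\<close> and the
  distortion of the Riesz kernel contribute powers of \<open>|w|\<close> that cancel exactly, and
  the integral becomes the potential of the ball weight at the image of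
  \<open>z - x\<close>.\<close>

lemma poisson_riesz:
  fixes x z :: "'a::euclidean_space"
  assumes s: "0 < s" "s < 1" and x: "norm x < 1" and z: "norm z > 1"
  shows "(\<integral>\<^sup>+y. ennreal (poisson s x y * riesz s (y - z)) \<partial>lborel) = ennreal (riesz s (x - z))"
proof -
  define R where "R = 1 / (1 - (norm x)\<^sup>2)"
  define c where "c = R *\<^sub>R x"
  define K where "K = riesz_norm TYPE('a) s"
  define \<zeta> where "\<zeta> = z - x"
  have K: "K > 0" "riesz_ball_const TYPE('a) s = ennreal K" using riesz_ball_const_eq[OF s] by (auto simp: K_def)
  have x1: "1 - (norm x)\<^sup>2 > 0" using x by (simp add: power_less_one_iff)
  have R: "R > 0" using x1 by (simp add: R_def)
  have \<zeta>: "\<zeta> \<noteq> 0" using x z by (auto simp: \<zeta>_def)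
  \<comment> \<open>The algebraic core: up to a positive factor, inversion exchanges the defining
    function of the exterior of the unit ball with that of \<open>ball c R\<close>.\<close>
  have inv: "(norm (x + inversion w))\<^sup>2 - 1 = (1 - (norm x)\<^sup>2) * (R\<^sup>2 - (dist w c)\<^sup>2) / (norm w)\<^sup>2"
    if w: "w \<noteq> 0" for w
  proof -
    have 1: "(norm (x + inversion w))\<^sup>2 = (norm x)\<^sup>2 + 2 * (x \<bullet> w) / (norm w)\<^sup>2 + 1 / (norm w)\<^sup>2"
    proof -
      have "(norm (x + inversion w))\<^sup>2 = (norm x)\<^sup>2 + 2 * (x \<bullet> inversion w) + (norm (inversion w))\<^sup>2"
        by (simp add: power2_norm_eq_inner inner_add_left inner_add_right inner_commute)
      then show ?thesis by (simp add: norm_inversion power_divide) (simp add: inversion_def divide_inverse)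
    qed
    have 2: "(dist w c)\<^sup>2 = (norm w)\<^sup>2 - 2 * R * (x \<bullet> w) + R\<^sup>2 * (norm x)\<^sup>2"
      unfolding dist_norm c_def power2_norm_eq_inner
      by (simp add: inner_diff_left inner_diff_right inner_commute power2_eq_square algebra_simps)
    have 3: "R * (1 - (norm x)\<^sup>2) = 1" using x1 by (simp add: R_def)
    have "(1 - (norm x)\<^sup>2) * (R\<^sup>2 - (dist w c)\<^sup>2) = (R * (1 - (norm x)\<^sup>2))\<^sup>2 - (1 - (norm x)\<^sup>2) * (norm w)\<^sup>2 + 2 * (R * (1 - (norm x)\<^sup>2)) * (x \<bullet> w)"
      unfolding 2 by (simp add: power2_eq_square algebra_simps)
    then have 4: "(1 - (norm x)\<^sup>2) * (R\<^sup>2 - (dist w c)\<^sup>2) = 1 - (1 - (norm x)\<^sup>2) * (norm w)\<^sup>2 + 2 * (x \<bullet> w)"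
      unfolding 3 by simp
    show ?thesis unfolding 1 4 using w by (simp add: field_simps)
  qed
  have mem: "norm (x + inversion w) > 1 \<longleftrightarrow> w \<in> ball c R" if w: "w \<noteq> 0" for w
  proof -
    have "norm (x + inversion w) > 1 \<longleftrightarrow> (norm (x + inversion w))\<^sup>2 - 1 > 0"
      using power2_le_iff_abs_le[of 1 "norm (x + inversion w)"] by (auto simp: abs_square_le_1[symmetric] not_le[symmetric])
    also have "\<dots> \<longleftrightarrow> R\<^sup>2 - (dist w c)\<^sup>2 > 0"
      unfolding inv[OF w] using x1 w by (simp add: zero_less_mult_iff zero_less_divide_iff)
    also have "\<dots> \<longleftrightarrow> w \<in> ball c R"
      using R by (simp add: dist_commute power_mono_iff not_le[symmetric])
    finally show ?thesis .
  qed
  have i\<zeta>: "inversion \<zeta> \<noteq> 0" using \<zeta> by (auto simp: inversion_def)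
  \<comment> \<open>Since \<open>z\<close> lies outside the unit ball, the image of
    \<open>z - x\<close> lies in \<open>ball c R\<close>, where the potential of the weight is
    known.\<close>
  then have mz: "inversion \<zeta> \<in> ball c R"
    using mem[OF i\<zeta>] z by (simp add: inversion_inversion \<zeta>_def)
  define f where "f y = poisson s x y * riesz s (y - z)" for y
  have fm [measurable]: "f \<in> borel_measurable borel" unfolding f_def by measurable
  have f0: "f y \<ge> 0" for y by (simp add: f_def poisson_nonneg)
  have [measurable]: "ball c R \<in> sets borel" by simp
  have "(\<integral>\<^sup>+y. ennreal (f y) \<partial>lborel) = (\<integral>\<^sup>+w. ennreal (f (x + w)) \<partial>lborel)"
    by (rule nn_integral_lborel_translate[symmetric]) measurable
  also have "\<dots> = (\<integral>\<^sup>+w. ennreal (f (x + inversion w) / norm w ^ (2 * DIM('a))) \<partial>lborel)"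
    by (rule nn_integral_inversion) (auto simp: f0)
  also have "\<dots> = (\<integral>\<^sup>+w. ennreal (riesz s \<zeta> / K) * (ennreal ((R\<^sup>2 - (dist w c)\<^sup>2) powr (-s) * riesz s (w - inversion \<zeta>)) * indicator (ball c R) w) \<partial>lborel)"
  proof (rule nn_integral_cong_AE)
    have "AE w::'a in lborel. w \<noteq> 0" by (rule AE_lborel_singleton)
    then show "AE w in lborel. ennreal (f (x + inversion w) / norm w ^ (2 * DIM('a)))
      = ennreal (riesz s \<zeta> / K) * (ennreal ((R\<^sup>2 - (dist w c)\<^sup>2) powr (-s) * riesz s (w - inversion \<zeta>)) * indicator (ball c R) w)"
    proof eventually_elim
      case (elim w)
      show ?case
      proof (cases "w \<in> ball c R")
        case False
        then have "f (x + inversion w) = 0" using mem[OF elim] by (simp add: f_def poisson_def)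
        then show ?thesis using False by simp
      next
        case True
        have n: "norm w > 0" using elim by simp
        define Q where "Q = R\<^sup>2 - (dist w c)\<^sup>2"
        have Q: "Q > 0" using True R by (simp add: Q_def dist_commute power_strict_mono)
        have "(1 - (norm x)\<^sup>2) / ((norm (x + inversion w))\<^sup>2 - 1) = (norm w)\<^sup>2 / Q"
          unfolding inv[OF elim] Q_def[symmetric] using x1 Q n by (simp add: field_simps)
        then have P: "poisson s x (x + inversion w) = ((norm w)\<^sup>2 / Q) powr s * norm w ^ DIM('a) / K"
          using True mem[OF elim] x by (simp add: poisson_def K_def norm_inversion power_divide)
        have "((norm w)\<^sup>2 / Q) powr s = norm w powr (2 * s) * Q powr (-s)"
          using n Q powr_powr[of "norm w" 2 s] by (simp add: powr_divide_minus)
        moreover have "riesz s (x + inversion w - z) = riesz s (w - inversion \<zeta>) * riesz s \<zeta> * norm w powr (real DIM('a) - 2 * s)"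
        proof -
          have e: "x + inversion w - z = inversion w - \<zeta>" by (simp add: \<zeta>_def)
          show ?thesis unfolding e riesz_def norm_inversion_diff[OF elim \<zeta>]
            using n by (simp add: powr_divide_minus powr_mult)
        qed
        ultimately have "f (x + inversion w) = Q powr (-s) * riesz s (w - inversion \<zeta>) * riesz s \<zeta> / K * (norm w powr (2 * s) * norm w ^ DIM('a) * norm w powr (real DIM('a) - 2 * s))"
          unfolding f_def P by simp
        also have "norm w powr (2 * s) * norm w ^ DIM('a) * norm w powr (real DIM('a) - 2 * s) = norm w powr (2 * s + real DIM('a) + (real DIM('a) - 2 * s))"
          using n by (simp only: powr_add powr_realpow)
        also have "2 * s + real DIM('a) + (real DIM('a) - 2 * s) = real (2 * DIM('a))" by simp
        also have "norm w powr real (2 * DIM('a)) = norm w ^ (2 * DIM('a))" by (rule powr_realpow[OF n])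
        finally have "f (x + inversion w) / norm w ^ (2 * DIM('a)) = riesz s \<zeta> / K * (Q powr (-s) * riesz s (w - inversion \<zeta>))"
          using n by simp
        moreover have "ennreal (riesz s \<zeta> / K * (Q powr (-s) * riesz s (w - inversion \<zeta>))) = ennreal (riesz s \<zeta> / K) * ennreal (Q powr (-s) * riesz s (w - inversion \<zeta>))"
          using K by (intro ennreal_mult) auto
        ultimately show ?thesis using True by (simp add: Q_def)
      qed
    qed
  qed
  also have "\<dots> = ennreal (riesz s \<zeta> / K) * (\<integral>\<^sup>+w. ennreal ((R\<^sup>2 - (dist w c)\<^sup>2) powr (-s) * riesz s (w - inversion \<zeta>)) * indicator (ball c R) w \<partial>lborel)"
    unfolding dist_norm by (rule nn_integral_cmult) measurable
  also have "\<dots> = ennreal (riesz s \<zeta> / K) * ennreal K"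
    unfolding riesz_potential_ball_weight[OF mz] K(2) ..
  also have "\<dots> = ennreal (riesz s \<zeta>)" using K(1) by (subst ennreal_mult[symmetric]) auto
  finally show ?thesis unfolding f_def \<zeta>_def riesz_minus[of s x] .
qed

text \<open>Let the point \<open>z\<close> of the balayage identity tend to infinity along a fixed
  direction. The quotients \<open>W(y - z) / W(x - z)\<close> tend to one for every
  \<open>y\<close>, and Fatou's lemma gives the inequality.\<close>

lemma poisson_mass_le_1:
  fixes x :: "'a::euclidean_space"
  assumes s: "0 < s" "s < 1" and x: "norm x < 1"
  shows "(\<integral>\<^sup>+y. ennreal (poisson s x y) \<partial>lborel) \<le> 1"
proof -
  obtain e :: 'a where e: "norm e = 1" using nonempty_Basis norm_Basis by blast
  define z where "z n = (real n + 2) *\<^sub>R e" for n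
  have nz: "norm (z n) = real n + 2" for n using e by (simp add: z_def)
  define h where "h n y = poisson s x y * riesz s (y - z n) / riesz s (x - z n)" for n y
  have pos: "riesz s (x - z n) > 0" for n
  proof -
    have "x \<noteq> z n" using nz[of n] x by auto
    then show ?thesis by (simp add: riesz_def)
  qed
  have int: "(\<integral>\<^sup>+y. ennreal (h n y) \<partial>lborel) = 1" for n
  proof -
    have "(\<integral>\<^sup>+y. ennreal (h n y) \<partial>lborel) = (\<integral>\<^sup>+y. ennreal (1 / riesz s (x - z n)) * ennreal (poisson s x y * riesz s (y - z n)) \<partial>lborel)"
      using pos[of n] by (intro nn_integral_cong) (simp add: h_def ennreal_mult[symmetric] poisson_nonneg)
    also have "\<dots> = ennreal (1 / riesz s (x - z n)) * ennreal (riesz s (x - z n))"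
      using nz[of n] by (subst nn_integral_cmult) (auto simp: poisson_riesz[OF s x])
    also have "\<dots> = 1" using pos[of n] by (simp add: ennreal_mult[symmetric])
    finally show ?thesis .
  qed
  have lim: "(\<lambda>n. h n y) \<longlonglongrightarrow> poisson s x y" for y
  proof -
    have inv0: "(\<lambda>n. 1 / (real n + 2)) \<longlonglongrightarrow> 0" by real_asymp
    have "(\<lambda>n. norm ((1 / (real n + 2)) *\<^sub>R y - e) / norm ((1 / (real n + 2)) *\<^sub>R x - e)) \<longlonglongrightarrow> norm (0 *\<^sub>R y - e) / norm (0 *\<^sub>R x - e)"
      by (intro tendsto_intros inv0) (use e in auto)
    moreover have "norm ((1 / (real n + 2)) *\<^sub>R y - e) / norm ((1 / (real n + 2)) *\<^sub>R x - e) = norm (y - z n) / norm (x - z n)" for n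
    proof -
      have "(1 / (real n + 2)) *\<^sub>R y - e = (1 / (real n + 2)) *\<^sub>R (y - z n)" for y
        by (simp add: z_def scaleR_diff_right add_eq_0_iff)
      then show ?thesis by simp
    qed
    ultimately have "(\<lambda>n. norm (y - z n) / norm (x - z n)) \<longlonglongrightarrow> 1" using e by simp
    then have "(\<lambda>n. poisson s x y * (norm (y - z n) / norm (x - z n)) powr (2 * s - real DIM('a))) \<longlonglongrightarrow> poisson s x y * 1 powr (2 * s - real DIM('a))"
      by (intro tendsto_intros) auto
    then show ?thesis by (simp add: h_def riesz_def powr_divide)
  qed
  have "(\<integral>\<^sup>+y. ennreal (poisson s x y) \<partial>lborel) = (\<integral>\<^sup>+y. liminf (\<lambda>n. ennreal (h n y)) \<partial>lborel)"
    by (intro nn_integral_cong lim_imp_Liminf[symmetric] tendsto_ennrealI lim) auto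
  also have "\<dots> \<le> liminf (\<lambda>n. \<integral>\<^sup>+y. ennreal (h n y) \<partial>lborel)"
    by (rule nn_integral_liminf) (auto simp: h_def)
  also have "\<dots> = 1" unfolding int by (simp add: Liminf_const)
  finally show ?thesis .
qed

text \<open>Fatou's lemma gives an inequality only, while the oscillation argument needs a
  probability density at the centre. There the kernel is radial, and \<open>r = sqrt (1 + v)\<close>
  reduces its mass to one half of \<open>beta_const\<close> times \<open>sphere_weight\<close>,
  which is the normalising constant.\<close>

lemma poisson_center_mass:
  assumes s: "0 < s" "s < 1"
  shows "(\<integral>\<^sup>+y. ennreal (poisson s (0::'a::euclidean_space) y) \<partial>lborel) = 1"
proof -
  define K where "K = riesz_norm TYPE('a) s"
  have K: "K > 0" "riesz_ball_const TYPE('a) s = ennreal K" using riesz_ball_const_eq[OF s] by (auto simp: K_def)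
  have bij: "bij_betw (\<lambda>v. sqrt (1 + v)) {0<..} {1<..}"
    by (rule bij_betw_byWitness[where f'="\<lambda>r. r\<^sup>2 - 1"]) (auto simp: one_less_power)
  define f where "f r = (r\<^sup>2 - 1) powr (-s) / \<bar>r\<bar>" for r :: real
  define h where "h r = ennreal ((1 / (r\<^sup>2 - 1)) powr s / r ^ DIM('a) / K) * indicator {1<..} r" for r :: real
  have "(\<integral>\<^sup>+y. ennreal (poisson s (0::'a) y) \<partial>lborel) = (\<integral>\<^sup>+y. h (norm (y::'a)) \<partial>lborel)"
    by (intro nn_integral_cong) (auto simp: h_def poisson_def K_def indicator_def)
  also have "\<dots> = sphere_weight TYPE('a) * (\<integral>\<^sup>+r. h r * ennreal (r ^ (DIM('a) - 1)) * indicator {0<..} r \<partial>lborel)"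
    by (rule nn_integral_radial) (simp add: h_def)
  also have "(\<integral>\<^sup>+r. h r * ennreal (r ^ (DIM('a) - 1)) * indicator {0<..} r \<partial>lborel) = (\<integral>\<^sup>+r. ennreal (1 / K) * (ennreal (f r) * indicator {1<..} r) \<partial>lborel)"
  proof (rule nn_integral_cong)
    fix r :: real
    show "h r * ennreal (r ^ (DIM('a) - 1)) * indicator {0<..} r = ennreal (1 / K) * (ennreal (f r) * indicator {1<..} r)"
    proof (cases "r > 1")
      case True
      have p: "r ^ DIM('a) = r * r ^ (DIM('a) - 1)" using DIM_positive[where 'a='a] by (cases "DIM('a)") auto
      have "(1 / (r\<^sup>2 - 1)) powr s / r ^ DIM('a) / K * r ^ (DIM('a) - 1) = 1 / K * f r"
        using True K(1) powr_divide_minus[of 1 "r\<^sup>2 - 1" s] by (simp add: p f_def one_less_power)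
      then show ?thesis using True K(1)
        by (simp add: h_def ennreal_mult[symmetric] f_def)
    qed (simp add: h_def)
  qed
  also have "\<dots> = ennreal (1 / K) * (\<integral>\<^sup>+r. ennreal (f r) * indicator {1<..} r \<partial>lborel)"
    unfolding f_def by (rule nn_integral_cmult) measurable
  also have "(\<integral>\<^sup>+r. ennreal (f r) * indicator {1<..} r \<partial>lborel) = (\<integral>\<^sup>+v. ennreal (\<bar>1 / (2 * sqrt (1 + v))\<bar> * f (sqrt (1 + v))) * indicator {0<..} v \<partial>lborel)"
  proof (rule nn_integral_substitution_open[OF _ _ _ _ _ _ _ bij])
    fix v :: real assume "v \<in> {0<..}"
    then have p: "0 < 1 + v" by simp
    have d: "((\<lambda>v. 1 + v) has_field_derivative 1) (at v)" by (auto intro!: derivative_eq_intros)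
    show "((\<lambda>v. sqrt (1 + v)) has_field_derivative 1 / (2 * sqrt (1 + v))) (at v)"
      by (rule DERIV_cong[OF DERIV_chain2[OF DERIV_real_sqrt[OF p] d]]) (simp add: inverse_eq_divide)
  qed (auto simp: f_def)
  also have "\<dots> = (\<integral>\<^sup>+v. ennreal (1 / 2) * (ennreal (v powr (-s) / (1 + v)) * indicator {0<..} v) \<partial>lborel)"
  proof (rule nn_integral_cong)
    fix v :: real
    show "ennreal (\<bar>1 / (2 * sqrt (1 + v))\<bar> * f (sqrt (1 + v))) * indicator {0<..} v = ennreal (1 / 2) * (ennreal (v powr (-s) / (1 + v)) * indicator {0<..} v)"
    proof (cases "v > 0")
      case True
      have "\<bar>1 / (2 * sqrt (1 + v))\<bar> * f (sqrt (1 + v)) = 1 / 2 * (v powr (-s) / (1 + v))"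
        using True by (simp add: f_def abs_of_pos mult.assoc)
      moreover have "ennreal (1 / 2 * (v powr (-s) / (1 + v))) = ennreal (1 / 2) * ennreal (v powr (-s) / (1 + v))"
        using True by (intro ennreal_mult) auto
      ultimately show ?thesis using True by simp
    qed simp
  qed
  also have "\<dots> = ennreal (1 / 2) * beta_const s"
    unfolding beta_const_def by (rule nn_integral_cmult) measurable
  also have "sphere_weight TYPE('a) * (ennreal (1 / K) * (ennreal (1 / 2) * beta_const s)) = ennreal (1 / K) * riesz_ball_const TYPE('a) s"
    by (simp add: riesz_ball_const_def divide_ennreal_def mult_ac)
  also have "\<dots> = 1" unfolding K(2) using K(1) by (subst ennreal_mult[symmetric]) auto
  finally show ?thesis .
qed

section \<open>Gaussians and injectivity of Riesz potentials\<close>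

lemma exp_minus_le_power:
  fixes x :: real
  assumes "x > 0" shows "exp (- x) \<le> fact k / x ^ k"
proof -
  have "x ^ k / fact k \<le> exp x"
  proof -
    have "(\<Sum>i\<in>{k}. x ^ i / fact i) \<le> (\<Sum>i. x ^ i / fact i)"
      using summable_exp[of x] assms
      by (intro sum_le_suminf) (auto simp: divide_inverse mult.commute)
    also have "\<dots> = exp x" by (simp add: exp_def divide_inverse mult.commute)
    finally show ?thesis by simp
  qed
  then show ?thesis using assms by (simp add: exp_minus field_simps)
qed

lemma nn_integral_gaussian_finite:
  "(\<integral>\<^sup>+(x::'a::euclidean_space). ennreal (exp (- (norm x)\<^sup>2)) \<partial>lborel) < \<infinity>"
proof -
  let ?N = "DIM('a)"
  have "(\<integral>\<^sup>+(x::'a). ennreal (exp (- (norm x)\<^sup>2)) \<partial>lborel)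
    \<le> (\<integral>\<^sup>+(x::'a). indicator (ball 0 1) x + ennreal (fact ?N) * (ennreal (norm x powr (- 2 * real ?N)) * indicator {1..} (norm x)) \<partial>lborel)"
  proof (rule nn_integral_mono)
    fix x :: 'a
    have "exp (- (norm x)\<^sup>2) \<le> fact ?N * norm x powr (- 2 * real ?N)" if "norm x \<ge> 1"
    proof -
      have p: "norm x > 0" using that by linarith
      then have "exp (- (norm x)\<^sup>2) \<le> fact ?N / ((norm x)\<^sup>2) ^ ?N" by (intro exp_minus_le_power) simp
      also have "((norm x)\<^sup>2) ^ ?N = norm x powr (2 * real ?N)"
        using powr_realpow[OF p, of "2 * ?N"] by (simp add: power_mult[symmetric])
      finally show ?thesis using powr_minus_divide[of "norm x" "2 * real ?N"] by simp
    qed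
    then have "ennreal (exp (- (norm x)\<^sup>2)) \<le> ennreal (fact ?N) * ennreal (norm x powr (- 2 * real ?N))" if "norm x \<ge> 1"
      using that by (subst ennreal_mult[symmetric]) (auto intro: ennreal_leI)
    then show "ennreal (exp (- (norm x)\<^sup>2)) \<le> indicator (ball 0 1) x + ennreal (fact ?N) * (ennreal (norm x powr (- 2 * real ?N)) * indicator {1..} (norm x))"
      by (cases "norm x \<ge> 1") (auto simp: indicator_def)
  qed
  also have "\<dots> = emeasure lborel (ball (0::'a) 1) + ennreal (fact ?N) * (\<integral>\<^sup>+(x::'a). ennreal (norm x powr (- 2 * real ?N)) * indicator {1..} (norm x) \<partial>lborel)"
    by (subst nn_integral_add) (auto simp: nn_integral_cmult)
  also have "\<dots> < \<infinity>"
    using nn_integral_norm_powr_at_top_finite[where 'a='a, of "- 2 * real ?N" 1] emeasure_lborel_ball_finite[of "0::'a" 1] DIM_positive[where 'a='a]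
    by (auto simp: ennreal_mult_less_top less_top)
  finally show ?thesis .
qed

definition gauss_norm :: "'a::euclidean_space itself \<Rightarrow> real" where
  "gauss_norm _ = enn2real (\<integral>\<^sup>+(x::'a). ennreal (exp (- (norm x)\<^sup>2)) \<partial>lborel)"

lemma gauss_norm:
  "(\<integral>\<^sup>+(x::'a::euclidean_space). ennreal (exp (- (norm x)\<^sup>2)) \<partial>lborel) = ennreal (gauss_norm TYPE('a))"
  "gauss_norm TYPE('a) > 0"
proof -
  have "(\<integral>\<^sup>+(x::'a). ennreal (exp (- (norm x)\<^sup>2)) \<partial>lborel) \<noteq> 0"
  proof
    assume "(\<integral>\<^sup>+(x::'a). ennreal (exp (- (norm x)\<^sup>2)) \<partial>lborel) = 0"
    then have "AE (x::'a) in lborel. ennreal (exp (- (norm x)\<^sup>2)) = 0"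
      by (subst (asm) nn_integral_0_iff_AE) auto
    then have "AE (x::'a) in lborel. False" by simp
    then show False using emeasure_lborel_UNIV[where 'a='a] by (simp add: AE_iff_measurable[OF _ refl])
  qed
  then show "(\<integral>\<^sup>+(x::'a). ennreal (exp (- (norm x)\<^sup>2)) \<partial>lborel) = ennreal (gauss_norm TYPE('a))"
    "gauss_norm TYPE('a) > 0"
    using nn_integral_gaussian_finite[where 'a='a]
    by (auto simp: gauss_norm_def enn2real_positive_iff zero_less_iff_neq_zero)
qed

text \<open>The heat kernel at time \<open>t / 4\<close>, since \<open>gauss_norm\<close> is
  \<open>pi^(N/2)\<close>. The rescaled time removes the factors of four from all formulas and
  preserves the semigroup law.\<close>

definition gauss :: "real \<Rightarrow> 'a::euclidean_space \<Rightarrow> real" where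
  "gauss t x = t powr (- real DIM('a) / 2) * exp (- (norm x)\<^sup>2 / t) / gauss_norm TYPE('a)"

lemma gauss_measurable [measurable]:
  "(\<lambda>x. gauss (t x) (f x)) \<in> borel_measurable M"
  if [measurable]: "t \<in> borel_measurable M" "f \<in> borel_measurable M"
  unfolding gauss_def by measurable

lemma gauss_nonneg [simp]: "gauss t x \<ge> 0"
  using gauss_norm(2)[where 'a='a] by (simp add: gauss_def)

lemma gauss_minus: "gauss t (x - y) = gauss t (y - x)"
  by (simp add: gauss_def norm_minus_commute)

lemma gauss_le: "t > 0 \<Longrightarrow> gauss t (x::'a::euclidean_space) \<le> t powr (- real DIM('a) / 2) / gauss_norm TYPE('a)"
  using gauss_norm(2)[where 'a='a] by (simp add: gauss_def divide_right_mono)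

lemma gauss_scale:
  fixes x :: "'a::euclidean_space"
  assumes "t > 0"
  shows "gauss t (sqrt t *\<^sub>R x) * sqrt t ^ DIM('a) = gauss 1 x"
proof -
  have "t powr (- real DIM('a) / 2) * sqrt t ^ DIM('a) = 1"
    using assms by (simp add: powr_half_sqrt[symmetric] powr_realpow[symmetric] powr_powr powr_add[symmetric] real_sqrt_gt_0_iff)
  then show ?thesis using assms by (simp add: gauss_def power_mult_distrib)
qed

lemma nn_integral_gauss_scale:
  fixes f :: "'a::euclidean_space \<Rightarrow> ennreal"
  assumes [measurable]: "f \<in> borel_measurable borel" and t: "t > 0"
  shows "(\<integral>\<^sup>+y. ennreal (gauss t y) * f y \<partial>lborel) = (\<integral>\<^sup>+y. ennreal (gauss 1 y) * f (sqrt t *\<^sub>R y) \<partial>lborel)"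
proof -
  have "(\<integral>\<^sup>+y. ennreal (gauss t y) * f y \<partial>lborel) = ennreal (\<bar>sqrt t\<bar> ^ DIM('a)) * (\<integral>\<^sup>+y. ennreal (gauss t (0 + sqrt t *\<^sub>R y)) * f (0 + sqrt t *\<^sub>R y) \<partial>lborel)"
    using t by (intro nn_integral_lborel_affine) auto
  also have "\<dots> = (\<integral>\<^sup>+y. ennreal (\<bar>sqrt t\<bar> ^ DIM('a)) * (ennreal (gauss t (0 + sqrt t *\<^sub>R y)) * f (0 + sqrt t *\<^sub>R y)) \<partial>lborel)"
    by (rule nn_integral_cmult[symmetric]) measurable
  also have "\<dots> = (\<integral>\<^sup>+y. ennreal (gauss 1 y) * f (sqrt t *\<^sub>R y) \<partial>lborel)"
  proof (rule nn_integral_cong)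
    fix y :: 'a
    have g: "gauss 1 y = sqrt t ^ DIM('a) * gauss t (sqrt t *\<^sub>R y)"
      using gauss_scale[OF t, of y] by (simp only: mult.commute)
    show "ennreal (\<bar>sqrt t\<bar> ^ DIM('a)) * (ennreal (gauss t (0 + sqrt t *\<^sub>R y)) * f (0 + sqrt t *\<^sub>R y)) = ennreal (gauss 1 y) * f (sqrt t *\<^sub>R y)"
      unfolding g using t by (simp add: ennreal_mult mult.assoc)
  qed
  finally show ?thesis .
qed

lemma gauss_mass:
  assumes "t > 0" shows "(\<integral>\<^sup>+(y::'a::euclidean_space). ennreal (gauss t y) \<partial>lborel) = 1"
proof -
  have "(\<integral>\<^sup>+(y::'a). ennreal (gauss t y) \<partial>lborel) = (\<integral>\<^sup>+(y::'a). ennreal (gauss 1 y) \<partial>lborel)"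
    using nn_integral_gauss_scale[of "\<lambda>_::'a. 1", OF _ assms] by simp
  also have "\<dots> = (\<integral>\<^sup>+(y::'a). ennreal (1 / gauss_norm TYPE('a)) * ennreal (exp (- (norm y)\<^sup>2)) \<partial>lborel)"
    using gauss_norm(2)[where 'a='a] by (intro nn_integral_cong) (simp add: gauss_def ennreal_mult[symmetric])
  also have "\<dots> = ennreal (1 / gauss_norm TYPE('a)) * ennreal (gauss_norm TYPE('a))"
    by (subst nn_integral_cmult) (auto simp: gauss_norm(1))
  also have "\<dots> = 1" using gauss_norm(2)[where 'a='a] by (subst ennreal_mult[symmetric]) auto
  finally show ?thesis .
qed

lemma integrable_gauss: "t > 0 \<Longrightarrow> integrable lborel (gauss t :: 'a::euclidean_space \<Rightarrow> real)"
  using gauss_mass[where 'a='a, of t] by (intro integrableI_nonneg) auto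

lemma integral_gauss: "t > 0 \<Longrightarrow> (\<integral>(y::'a::euclidean_space). gauss t y \<partial>lborel) = 1"
  using gauss_mass[where 'a='a, of t] by (subst integral_eq_nn_integral) auto

text \<open>Completing the square in \<open>y\<close>: the product of two Gaussians in
  \<open>y\<close> is a Gaussian centred at \<open>(b / (a + b)) x\<close> with time
  \<open>a b / (a + b)\<close>, and the remaining factor is the kernel at time \<open>a + b\<close>.
  Integration over \<open>y\<close> then yields the semigroup property.\<close>

lemma gauss_product:
  fixes x y :: "'a::euclidean_space"
  assumes a: "a > 0" and b: "b > 0"
  shows "gauss a (x - y) * gauss b y = gauss (a + b) x * gauss (a * b / (a + b)) (y - (b / (a + b)) *\<^sub>R x)"
proof -
  let ?c = "a * b / (a + b)"
  have ab: "a + b > 0" using a b by simp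
  have "(norm (y - (b / (a + b)) *\<^sub>R x))\<^sup>2 = (norm y)\<^sup>2 - 2 * (b / (a + b)) * (x \<bullet> y) + (b / (a + b))\<^sup>2 * (norm x)\<^sup>2"
    unfolding power2_norm_eq_inner by (simp add: inner_diff_left inner_diff_right inner_commute power2_eq_square algebra_simps)
  then have 1: "(norm (y - (b / (a + b)) *\<^sub>R x))\<^sup>2 / ?c = (a + b) / (a * b) * (norm y)\<^sup>2 - 2 / a * (x \<bullet> y) + b / (a * (a + b)) * (norm x)\<^sup>2"
  proof -
    have "(A - 2 * (b / S) * B + (b / S)\<^sup>2 * C) / (a * b / S) = S / (a * b) * A - 2 / a * B + b / (a * S) * C"
      if "S > 0" for A B C S :: real
    proof -
      have "A / (a * b / S) = S / (a * b) * A" "2 * (b / S) * B / (a * b / S) = 2 / a * B" "(b / S)\<^sup>2 * C / (a * b / S) = b / (a * S) * C"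
        using a b that by (simp_all add: power2_eq_square)
      then show ?thesis by (simp only: diff_divide_distrib add_divide_distrib)
    qed
    with ab \<open>(norm (y - (b / (a + b)) *\<^sub>R x))\<^sup>2 = _\<close> show ?thesis by simp
  qed
  have 2: "(norm (x - y))\<^sup>2 = (norm x)\<^sup>2 - 2 * (x \<bullet> y) + (norm y)\<^sup>2"
    unfolding power2_norm_eq_inner by (simp add: inner_diff_left inner_diff_right inner_commute)
  have 3: "(a + b) / (a * b) = 1 / a + 1 / b" "b / (a * (a + b)) = 1 / a - 1 / (a + b)"
    using a b ab by (auto simp: field_simps)
  have "- (norm (x - y))\<^sup>2 / a + - (norm y)\<^sup>2 / b = - (norm x)\<^sup>2 / (a + b) + - (norm (y - (b / (a + b)) *\<^sub>R x))\<^sup>2 / ?c"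
  proof -
    have "- (X - 2 * B + Y) / a + - Y / b = - X / (a + b) - ((1 / a + 1 / b) * Y - 2 / a * B + (1 / a - 1 / (a + b)) * X)" for X B Y
    proof -
      have "- (X - 2 * B + Y) * u + - Y * v = - X * w - ((u + v) * Y - 2 * u * B + (u - w) * X)" for u v w :: real
        by (simp add: algebra_simps)
      from this[of "1 / a" "1 / b" "1 / (a + b)"] show ?thesis by simp
    qed
    then show ?thesis using 1 2 3 by simp
  qed
  then have e: "exp (- (norm (x - y))\<^sup>2 / a) * exp (- (norm y)\<^sup>2 / b) = exp (- (norm x)\<^sup>2 / (a + b)) * exp (- (norm (y - (b / (a + b)) *\<^sub>R x))\<^sup>2 / ?c)"
    by (simp only: exp_add[symmetric])
  have p: "a powr d * b powr d = (a + b) powr d * ?c powr d" for d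
    using a b ab by (simp add: powr_mult[symmetric])
  have "gauss a (x - y) * gauss b y = (a powr (- real DIM('a) / 2) * b powr (- real DIM('a) / 2)) * (exp (- (norm (x - y))\<^sup>2 / a) * exp (- (norm y)\<^sup>2 / b)) / (gauss_norm TYPE('a) * gauss_norm TYPE('a))"
    by (simp add: gauss_def)
  also have "\<dots> = gauss (a + b) x * gauss ?c (y - (b / (a + b)) *\<^sub>R x)"
    unfolding p e by (simp add: gauss_def)
  finally show ?thesis .
qed

lemma gauss_semigroup:
  fixes x :: "'a::euclidean_space"
  assumes a: "a > 0" and b: "b > 0"
  shows "(\<integral>\<^sup>+y. ennreal (gauss a (x - y) * gauss b y) \<partial>lborel) = ennreal (gauss (a + b) x)"
proof -
  let ?c = "a * b / (a + b)" and ?m = "(b / (a + b)) *\<^sub>R x"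
  have c: "?c > 0" using a b by simp
  have "(\<integral>\<^sup>+y. ennreal (gauss a (x - y) * gauss b y) \<partial>lborel) = (\<integral>\<^sup>+y. ennreal (gauss (a + b) x) * ennreal (gauss ?c (- ?m + y)) \<partial>lborel)"
    by (intro nn_integral_cong) (simp add: gauss_product[OF a b] ennreal_mult)
  also have "\<dots> = ennreal (gauss (a + b) x) * (\<integral>\<^sup>+y. ennreal (gauss ?c (- ?m + y)) \<partial>lborel)"
    by (rule nn_integral_cmult) measurable
  also have "(\<integral>\<^sup>+y. ennreal (gauss ?c (- ?m + y)) \<partial>lborel) = (\<integral>\<^sup>+(y::'a). ennreal (gauss ?c y) \<partial>lborel)"
    by (rule nn_integral_lborel_translate) measurable
  also have "\<dots> = 1" by (rule gauss_mass[OF c])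
  finally show ?thesis by simp
qed

text \<open>With \<open>v = 1 / u\<close> this is \<open>Gamma(N/2 - \<sigma>) / pi^(N/2)\<close>.
  The exponent \<open>\<sigma> = s\<close> belongs to the Riesz kernel and
  \<open>\<sigma> = - s\<close> to the kernel of the fractional Laplacian.\<close>

definition subord_const :: "'a::euclidean_space itself \<Rightarrow> real \<Rightarrow> real" where
  "subord_const _ \<sigma> = enn2real (\<integral>\<^sup>+u. ennreal (u powr (\<sigma> - 1 - real DIM('a) / 2) * exp (- (1 / u)) / gauss_norm TYPE('a)) * indicator {0<..} u \<partial>lborel)"

lemma subord_const:
  assumes \<sigma>: "2 * \<sigma> < real DIM('a::euclidean_space)"
  shows "(\<integral>\<^sup>+u. ennreal (u powr (\<sigma> - 1 - real DIM('a) / 2) * exp (- (1 / u)) / gauss_norm TYPE('a)) * indicator {0<..} u \<partial>lborel) = ennreal (subord_const TYPE('a) \<sigma>)" (is "?I = _")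
    and "subord_const TYPE('a) \<sigma> > 0"
proof -
  define p where "p = \<sigma> - 1 - real DIM('a) / 2"
  define Z where "Z = gauss_norm TYPE('a)"
  have Z: "Z > 0" by (simp add: Z_def gauss_norm(2))
  have p: "p < -1" using \<sigma> by (simp add: p_def)
  \<comment> \<open>Near \<open>u = 0\<close> the bound \<open>exp (- 1 / u) \<le> k! u^k\<close>
    with \<open>k > - p\<close> makes \<open>u^(p + k)\<close> at most one; at infinity the power
    \<open>p < -1\<close> converges by itself.\<close>
  obtain k where k: "real k > - p" using reals_Archimedean2 by blast
  have "?I \<le> (\<integral>\<^sup>+u. ennreal (fact k / Z) * (ennreal (u powr 0) * indicator {0<..1} u) + ennreal (1 / Z) * (ennreal (u powr p) * indicator {1..} u) \<partial>lborel)"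
  proof (rule nn_integral_mono)
    fix u :: real
    have 1: "u powr p * exp (- (1 / u)) / Z \<le> fact k / Z" if "0 < u" "u \<le> 1"
    proof -
      have "exp (- (1 / u)) \<le> fact k / (1 / u) ^ k" using that by (intro exp_minus_le_power) auto
      also have "\<dots> = fact k * u powr real k" using that by (simp add: powr_realpow power_one_over)
      finally have "u powr p * exp (- (1 / u)) \<le> u powr p * (fact k * u powr real k)" by (intro mult_left_mono) auto
      also have "\<dots> = fact k * u powr (p + real k)" by (simp add: powr_add)
      also have "\<dots> \<le> fact k * 1" using that k by (intro mult_left_mono powr_le1) auto
      finally show ?thesis using Z by (simp add: divide_right_mono)
    qed
    have 2: "u powr p * exp (- (1 / u)) / Z \<le> 1 / Z * u powr p" if "u \<ge> 1"
      using that Z by (simp add: mult_left_le divide_right_mono)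
    have 2: "ennreal (u powr p * exp (- (1 / u)) / Z) \<le> ennreal (1 / Z) * ennreal (u powr p)" if "u \<ge> 1"
      using 2[OF that] Z by (subst ennreal_mult[symmetric]) (auto intro: ennreal_leI)
    consider "u \<le> 0" | "0 < u" "u < 1" | "u \<ge> 1" by linarith
    then show "ennreal (u powr (\<sigma> - 1 - real DIM('a) / 2) * exp (- (1 / u)) / gauss_norm TYPE('a)) * indicator {0<..} u
      \<le> ennreal (fact k / Z) * (ennreal (u powr 0) * indicator {0<..1} u) + ennreal (1 / Z) * (ennreal (u powr p) * indicator {1..} u)"
      unfolding p_def[symmetric] Z_def[symmetric]
    proof cases
      case 2 then show "ennreal (u powr p * exp (- (1 / u)) / Z) * indicator {0<..} u
      \<le> ennreal (fact k / Z) * (ennreal (u powr 0) * indicator {0<..1} u) + ennreal (1 / Z) * (ennreal (u powr p) * indicator {1..} u)"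
        using 1 by (auto intro!: ennreal_leI)
    next
      case 3 then show "ennreal (u powr p * exp (- (1 / u)) / Z) * indicator {0<..} u
      \<le> ennreal (fact k / Z) * (ennreal (u powr 0) * indicator {0<..1} u) + ennreal (1 / Z) * (ennreal (u powr p) * indicator {1..} u)"
        using 2 by (auto intro!: add_increasing)
    qed auto
  qed
  also have "\<dots> = ennreal (fact k / Z) * (\<integral>\<^sup>+u. ennreal (u powr 0) * indicator {0<..1} u \<partial>lborel) + ennreal (1 / Z) * (\<integral>\<^sup>+u. ennreal (u powr p) * indicator {1..} u \<partial>lborel)"
    by (subst nn_integral_add) (auto simp: nn_integral_cmult)
  also have "\<dots> < \<infinity>"
    using nn_integral_powr_near_0_finite[of 0 1] nn_integral_powr_at_top_finite[of p 1] p
    by (auto simp: ennreal_mult_less_top)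
  finally have fin: "?I < \<infinity>" .
  have "?I \<noteq> 0"
  proof
    assume "?I = 0"
    then have "AE u in lborel. ennreal (u powr p * exp (- (1 / u)) / Z) * indicator {0<..} u = 0"
      unfolding p_def[symmetric] Z_def[symmetric] by (subst (asm) nn_integral_0_iff_AE) auto
    then have "AE u in lborel. u \<notin> {0<..<1::real}"
      by eventually_elim (use Z in \<open>auto simp: indicator_def not_less split: if_splits\<close>)
    then have "emeasure lborel {0<..<1::real} = 0"
      by (subst (asm) AE_iff_measurable[of "{0<..<1}"]) auto
    then show False by simp
  qed
  then show "?I = ennreal (subord_const TYPE('a) \<sigma>)" "subord_const TYPE('a) \<sigma> > 0"
    using fin by (auto simp: subord_const_def enn2real_positive_iff zero_less_iff_neq_zero)
qed

text \<open>The substitution \<open>t = |x|^2 u\<close> extracts the power of \<open>|x|\<close> and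
  leaves an integral that no longer depends on \<open>x\<close>.\<close>

lemma gauss_subordination:
  fixes x :: "'a::euclidean_space"
  assumes \<sigma>: "2 * \<sigma> < real DIM('a)" and x: "x \<noteq> 0"
  shows "(\<integral>\<^sup>+t. ennreal (t powr (\<sigma> - 1) * gauss t x) * indicator {0<..} t \<partial>lborel)
    = ennreal (subord_const TYPE('a) \<sigma> * norm x powr (2 * \<sigma> - real DIM('a)))"
proof -
  define r where "r = (norm x)\<^sup>2"
  define Z where "Z = gauss_norm TYPE('a)"
  define p where "p = \<sigma> - 1 - real DIM('a) / 2"
  have r: "r > 0" using x by (simp add: r_def)
  have "(\<integral>\<^sup>+t. ennreal (t powr (\<sigma> - 1) * gauss t x) * indicator {0<..} t \<partial>lborel)
    = (\<integral>\<^sup>+t. ennreal (t powr p * exp (- r / t) / Z) * indicator {0<..} t \<partial>lborel)"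
  proof (rule nn_integral_cong)
    fix t :: real
    have "t powr p = t powr (\<sigma> - 1) * t powr (- real DIM('a) / 2)"
      unfolding p_def powr_add[symmetric] by simp
    then have "t powr (\<sigma> - 1) * gauss t x = t powr p * exp (- r / t) / Z"
      by (simp add: gauss_def r_def Z_def)
    then show "ennreal (t powr (\<sigma> - 1) * gauss t x) * indicator {0<..} t = ennreal (t powr p * exp (- r / t) / Z) * indicator {0<..} t"
      by simp
  qed
  also have "\<dots> = ennreal \<bar>r\<bar> * (\<integral>\<^sup>+u. ennreal ((0 + r * u) powr p * exp (- r / (0 + r * u)) / Z) * indicator {0<..} (0 + r * u) \<partial>lborel)"
    using r by (intro nn_integral_real_affine) auto
  also have "\<dots> = ennreal \<bar>r\<bar> * (\<integral>\<^sup>+u. ennreal (r powr p) * (ennreal (u powr p * exp (- (1 / u)) / Z) * indicator {0<..} u) \<partial>lborel)"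
  proof (rule arg_cong2[where f="(*)", OF refl], rule nn_integral_cong)
    fix u :: real
    show "ennreal ((0 + r * u) powr p * exp (- r / (0 + r * u)) / Z) * indicator {0<..} (0 + r * u) = ennreal (r powr p) * (ennreal (u powr p * exp (- (1 / u)) / Z) * indicator {0<..} u)"
    proof (cases "u > 0")
      case True
      have "(0 + r * u) powr p * exp (- r / (0 + r * u)) / Z = r powr p * (u powr p * exp (- (1 / u)) / Z)"
        using True r by (simp add: powr_mult)
      then show ?thesis using True r gauss_norm(2)[where 'a='a] by (simp add: ennreal_mult[symmetric] Z_def)
    qed (use r in \<open>auto simp: zero_less_mult_iff\<close>)
  qed
  also have "\<dots> = ennreal r * (ennreal (r powr p) * ennreal (subord_const TYPE('a) \<sigma>))"
    using r subord_const(1)[OF \<sigma>] by (subst nn_integral_cmult) (auto simp: p_def Z_def)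
  also have "\<dots> = ennreal (r * (r powr p) * subord_const TYPE('a) \<sigma>)"
    using r subord_const(2)[OF \<sigma>] by (simp add: ennreal_mult[symmetric])
  also have "r * r powr p = r powr (1 + p)" using r by (simp add: powr_add)
  also have "r powr (1 + p) = norm x powr (2 * (1 + p))"
    using x powr_powr[of "norm x" 2 "1 + p"] by (simp add: r_def)
  also have "2 * (1 + p) = 2 * \<sigma> - real DIM('a)" by (simp add: p_def)
  finally show ?thesis by (simp add: mult.commute)
qed

lemma riesz_subordination:
  fixes x :: "'a::euclidean_space"
  assumes "2 * s < real DIM('a)" "x \<noteq> 0"
  shows "(\<integral>\<^sup>+t. ennreal (t powr (s - 1) * gauss t x) * indicator {0<..} t \<partial>lborel)
    = ennreal (subord_const TYPE('a) s * riesz s x)"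
  unfolding riesz_def by (rule gauss_subordination[OF assms])

text \<open>Since \<open>ennreal\<close> truncates negative numbers to zero, \<open>?P\<close> and
  \<open>?Q\<close> have the positive and the negative part of \<open>f\<close> as densities. They
  agree and are finite on boxes, an intersection-stable generator, hence are equal; positive and
  negative part then agree almost everywhere, so both vanish.\<close>

lemma AE_zero_if_box_integrals_zero:
  fixes f :: "'a::euclidean_space \<Rightarrow> real"
  assumes f: "integrable lborel f"
    and zero: "\<And>a b. (\<integral>x. indicator (box a b) x * f x \<partial>lborel) = 0"
  shows "AE x in lborel. f x = 0"
proof -
  have [measurable]: "f \<in> borel_measurable borel" using f by (simp add: borel_measurable_integrable)
  let ?P = "density lborel (\<lambda>x. ennreal (f x))" and ?Q = "density lborel (\<lambda>x. ennreal (- f x))"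
  have box: "emeasure ?P (box a b) = emeasure ?Q (box a b)" "emeasure ?P (box a b) \<noteq> \<infinity>" for a b :: 'a
  proof -
    have int: "integrable lborel (\<lambda>x. indicator (box a b) x * f x)"
      using f by (intro integrable_real_mult_indicator[of "box a b" lborel f, unfolded mult.commute[of "f _"]]) auto
    have P: "emeasure ?P (box a b) = (\<integral>\<^sup>+x. ennreal (indicator (box a b) x * f x) \<partial>lborel)"
      by (subst emeasure_density) (auto intro!: nn_integral_cong simp: indicator_def)
    have Q: "emeasure ?Q (box a b) = (\<integral>\<^sup>+x. ennreal (- (indicator (box a b) x * f x)) \<partial>lborel)"
      by (subst emeasure_density) (auto intro!: nn_integral_cong simp: indicator_def)
    have fin: "emeasure ?P (box a b) \<noteq> \<infinity>" "emeasure ?Q (box a b) \<noteq> \<infinity>"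
      unfolding P Q using int by (auto simp: real_integrable_def)
    have "enn2real (emeasure ?P (box a b)) - enn2real (emeasure ?Q (box a b)) = 0"
      unfolding P Q real_lebesgue_integral_def[OF int, symmetric] by (rule zero)
    then show "emeasure ?P (box a b) = emeasure ?Q (box a b)"
      using fin by (metis enn2real_eq_0_iff ennreal_enn2real_if eq_iff_diff_eq_0 infinity_ennreal_def)
    show "emeasure ?P (box a b) \<noteq> \<infinity>" by fact
  qed
  have "?P = ?Q"
  proof (rule measure_eqI_generator_eq)
    let ?E = "range (\<lambda>(a, b). box a b :: 'a set)"
    let ?A = "\<lambda>n::nat. box (- (real n *\<^sub>R One)) (real n *\<^sub>R One) :: 'a set"
    show "Int_stable ?E" by (auto simp: Int_stable_def box_Int_box)
    show "?E \<subseteq> Pow UNIV" "sets ?P = sigma_sets UNIV ?E" "sets ?Q = sigma_sets UNIV ?E"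
      by (simp_all add: borel_eq_box)
    show "range ?A \<subseteq> ?E" "(\<Union>i. ?A i) = UNIV" unfolding UN_box_eq_UNIV by auto
    show "emeasure ?P (?A i) \<noteq> \<infinity>" for i by (rule box)
    show "emeasure ?P X = emeasure ?Q X" if "X \<in> ?E" for X using that box by auto
  qed
  then have "AE x in lborel. ennreal (f x) = ennreal (- f x)"
    by (intro sigma_finite_measure.density_unique[OF sigma_finite_lborel]) auto
  then show ?thesis by eventually_elim (metis ennreal_eq_0_iff linear neg_le_0_iff_le order_antisym)
qed

section \<open>Gaussian smoothing and positive definiteness\<close>

lemma integral_lborel_affine:
  fixes f :: "'a::euclidean_space \<Rightarrow> real"
  assumes c: "c \<noteq> 0" and f [measurable]: "f \<in> borel_measurable borel"
  shows "(\<integral>x. f x \<partial>lborel) = \<bar>c\<bar> ^ DIM('a) * (\<integral>x. f (t + c *\<^sub>R x) \<partial>lborel)"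
  by (subst lborel_affine[OF c, of t]) (simp add: integral_density integral_distr)

lemma integral_lborel_reflect:
  fixes f :: "'a::euclidean_space \<Rightarrow> real"
  assumes "f \<in> borel_measurable borel"
  shows "(\<integral>x. f (a - x) \<partial>lborel) = (\<integral>x. f x \<partial>lborel)"
  using integral_lborel_affine[of "-1" f a] assms by simp

lemma integral_gauss_scale:
  fixes h :: "'a::euclidean_space \<Rightarrow> real"
  assumes [measurable]: "h \<in> borel_measurable borel" and t: "t > 0"
  shows "(\<integral>y. gauss t y * h y \<partial>lborel) = (\<integral>y. gauss 1 y * h (sqrt t *\<^sub>R y) \<partial>lborel)"
proof -
  have "(\<integral>y. gauss t y * h y \<partial>lborel) = \<bar>sqrt t\<bar> ^ DIM('a) * (\<integral>y. gauss t (0 + sqrt t *\<^sub>R y) * h (0 + sqrt t *\<^sub>R y) \<partial>lborel)"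
    using t by (intro integral_lborel_affine) auto
  also have "\<dots> = (\<integral>y. \<bar>sqrt t\<bar> ^ DIM('a) * (gauss t (0 + sqrt t *\<^sub>R y) * h (0 + sqrt t *\<^sub>R y)) \<partial>lborel)"
    by simp
  also have "\<dots> = (\<integral>y. gauss 1 y * h (sqrt t *\<^sub>R y) \<partial>lborel)"
  proof (rule Bochner_Integration.integral_cong[OF refl])
    fix y :: 'a
    show "\<bar>sqrt t\<bar> ^ DIM('a) * (gauss t (0 + sqrt t *\<^sub>R y) * h (0 + sqrt t *\<^sub>R y)) = gauss 1 y * h (sqrt t *\<^sub>R y)"
    proof -
      have g: "gauss 1 y = sqrt t ^ DIM('a) * gauss t (sqrt t *\<^sub>R y)"
        using gauss_scale[OF t, of y] by (simp only: mult.commute)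
      show ?thesis unfolding g using t by simp
    qed
  qed
  finally show ?thesis .
qed

text \<open>Rescaling \<open>y\<close> by \<open>sqrt t\<close> moves the small parameter into the
  argument of \<open>\<eta>\<close>, where continuity at the single point \<open>x\<close> and
  domination by a fixed Gaussian suffice.\<close>

lemma gauss_smoothing_tendsto:
  fixes \<eta> :: "'a::euclidean_space \<Rightarrow> real"
  assumes [measurable]: "\<eta> \<in> borel_measurable borel" and B: "\<And>x. \<bar>\<eta> x\<bar> \<le> B" and cont: "isCont \<eta> x"
    and t: "\<And>n. t n > 0" "t \<longlonglongrightarrow> 0"
  shows "(\<lambda>n::nat. \<integral>y. gauss (t n) y * \<eta> (x - y) \<partial>lborel) \<longlonglongrightarrow> \<eta> x"
proof -
  have "(\<lambda>n. \<integral>y. gauss 1 y * \<eta> (x - sqrt (t n) *\<^sub>R y) \<partial>lborel) \<longlonglongrightarrow> (\<integral>(y::'a). gauss 1 y * \<eta> x \<partial>lborel)"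
  proof (rule Bochner_Integration.integral_dominated_convergence[where w="\<lambda>y::'a. B * gauss 1 y"])
    show "integrable lborel (\<lambda>y::'a. B * gauss 1 y)" using integrable_gauss[where 'a='a, of 1] by simp
    show "AE y in lborel. (\<lambda>n. gauss 1 y * \<eta> (x - sqrt (t n) *\<^sub>R y)) \<longlonglongrightarrow> gauss 1 y * \<eta> x"
    proof (rule AE_I2)
      fix y :: 'a
      have "(\<lambda>n. sqrt (t n)) \<longlonglongrightarrow> sqrt 0" by (intro tendsto_real_sqrt t)
      then have "(\<lambda>n. x - sqrt (t n) *\<^sub>R y) \<longlonglongrightarrow> x - 0 *\<^sub>R y" by (intro tendsto_intros) auto
      then have "(\<lambda>n. x - sqrt (t n) *\<^sub>R y) \<longlonglongrightarrow> x" by simp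
      then show "(\<lambda>n. gauss 1 y * \<eta> (x - sqrt (t n) *\<^sub>R y)) \<longlonglongrightarrow> gauss 1 y * \<eta> x"
        by (intro tendsto_mult tendsto_const isCont_tendsto_compose[OF cont])
    qed
    show "AE y in lborel. norm (gauss 1 y * \<eta> (x - sqrt (t n) *\<^sub>R y)) \<le> B * gauss 1 y" for n
      using B by (auto simp: abs_mult mult.commute[of B] intro!: mult_left_mono)
  qed auto
  also have "(\<integral>y. gauss 1 (y::'a) * \<eta> x \<partial>lborel) = \<eta> x" using integral_gauss[where 'a='a, of 1] by simp
  also have "(\<lambda>n. \<integral>y. gauss 1 y * \<eta> (x - sqrt (t n) *\<^sub>R y) \<partial>lborel) = (\<lambda>n. \<integral>y. gauss (t n) y * \<eta> (x - y) \<partial>lborel)"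
    using integral_gauss_scale[of "\<lambda>y. \<eta> (x - y)", OF _ t(1)] by auto
  finally show ?thesis .
qed

lemma integrable_lborel_pairI:
  fixes f :: "'a::euclidean_space \<times> 'b::euclidean_space \<Rightarrow> real"
  assumes [measurable]: "f \<in> borel_measurable borel"
    and "(\<integral>\<^sup>+x. \<integral>\<^sup>+y. ennreal \<bar>f (x, y)\<bar> \<partial>lborel \<partial>lborel) < \<infinity>"
  shows "integrable (lborel \<Otimes>\<^sub>M lborel) f"
proof (rule integrableI_bounded)
  show m: "f \<in> borel_measurable (lborel \<Otimes>\<^sub>M lborel)" by (simp add: lborel_prod)
  have "(\<integral>\<^sup>+z. ennreal (norm (f z)) \<partial>(lborel \<Otimes>\<^sub>M lborel)) = (\<integral>\<^sup>+x. \<integral>\<^sup>+y. ennreal (norm (f (x, y))) \<partial>lborel \<partial>lborel)"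
    by (subst lborel.nn_integral_fst[symmetric]) (use m in auto)
  then show "(\<integral>\<^sup>+z. ennreal (norm (f z)) \<partial>(lborel \<Otimes>\<^sub>M lborel)) < \<infinity>" using assms(2) by simp
qed

text \<open>The semigroup property \<open>gauss t = gauss (t/2) * gauss (t/2)\<close> makes the Gaussian form positive definite.\<close>

lemma gauss_form_eq_square:
  fixes E :: "'a::euclidean_space \<Rightarrow> real"
  assumes E: "integrable lborel E" and t: "t > 0"
  defines "g \<equiv> \<lambda>w. \<integral>y. gauss (t/2) (w - y) * E y \<partial>lborel"
  shows "integrable lborel (\<lambda>w. (g w)\<^sup>2)"
    and "(\<integral>p. gauss t (fst p - snd p) * (E (fst p) * E (snd p)) \<partial>lborel) = (\<integral>w. (g w)\<^sup>2 \<partial>lborel)"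
proof -
  have [measurable]: "E \<in> borel_measurable borel" using E by (simp add: borel_measurable_integrable)
  \<comment> \<open>A function of a pair \<open>(z, y)\<close> and of an intermediate point
    \<open>w\<close>. Integrating over \<open>w\<close> alone gives the Gaussian form at time
    \<open>t\<close>; integrating over the pair alone gives the square of
    \<open>g w\<close>.\<close>
  define K where "K q = (gauss (t/2) (fst (fst q) - snd q) * E (fst (fst q))) * (gauss (t/2) (snd q - snd (fst q)) * E (snd (fst q)))" for q :: "('a \<times> 'a) \<times> 'a"
  have Km [measurable]: "K \<in> borel_measurable borel"
    unfolding K_def borel_prod[symmetric] by measurable
  define C where "C = t powr (- real DIM('a) / 2) / gauss_norm TYPE('a)"
  have C: "C \<ge> 0" using gauss_norm(2)[where 'a='a] by (simp add: C_def)
  have inner: "(\<integral>\<^sup>+w. ennreal (gauss (t/2) (z - w) * gauss (t/2) (w - y)) \<partial>lborel) = ennreal (gauss t (z - y))" for z y :: 'a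
  proof -
    have "(\<integral>\<^sup>+w. ennreal (gauss (t/2) (z - w) * gauss (t/2) (w - y)) \<partial>lborel)
      = (\<integral>\<^sup>+w. ennreal (gauss (t/2) (z - (y + w)) * gauss (t/2) ((y + w) - y)) \<partial>lborel)"
      by (rule nn_integral_lborel_translate[symmetric]) measurable
    also have "\<dots> = ennreal (gauss (t/2 + t/2) (z - y))"
      using gauss_semigroup[of "t/2" "t/2" "z - y"] t by (simp add: algebra_simps)
    finally show ?thesis by simp
  qed
  have "(\<integral>\<^sup>+p. \<integral>\<^sup>+w. ennreal \<bar>K (p, w)\<bar> \<partial>lborel \<partial>lborel) = (\<integral>\<^sup>+p. ennreal (\<bar>E (fst p)\<bar> * \<bar>E (snd p)\<bar>) * ennreal (gauss t (fst p - snd p)) \<partial>lborel)"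
  proof (rule nn_integral_cong)
    fix p :: "'a \<times> 'a"
    have "(\<integral>\<^sup>+w. ennreal \<bar>K (p, w)\<bar> \<partial>lborel) = (\<integral>\<^sup>+w. ennreal (\<bar>E (fst p)\<bar> * \<bar>E (snd p)\<bar>) * ennreal (gauss (t/2) (fst p - w) * gauss (t/2) (w - snd p)) \<partial>lborel)"
      by (intro nn_integral_cong) (simp add: K_def abs_mult ennreal_mult[symmetric] mult_ac)
    also have "\<dots> = ennreal (\<bar>E (fst p)\<bar> * \<bar>E (snd p)\<bar>) * ennreal (gauss t (fst p - snd p))"
      by (subst nn_integral_cmult) (auto simp: inner)
    finally show "(\<integral>\<^sup>+w. ennreal \<bar>K (p, w)\<bar> \<partial>lborel) = ennreal (\<bar>E (fst p)\<bar> * \<bar>E (snd p)\<bar>) * ennreal (gauss t (fst p - snd p))" .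
  qed
  also have "\<dots> \<le> (\<integral>\<^sup>+p. ennreal (\<bar>E (fst p)\<bar> * \<bar>E (snd p)\<bar>) * ennreal C \<partial>(lborel \<Otimes>\<^sub>M lborel))"
    unfolding lborel_prod C_def using gauss_le[OF t] by (intro nn_integral_mono mult_left_mono ennreal_leI) auto
  also have "\<dots> = (\<integral>\<^sup>+p. ennreal C * (ennreal \<bar>E (fst p)\<bar> * ennreal \<bar>E (snd p)\<bar>) \<partial>(lborel \<Otimes>\<^sub>M lborel))"
    by (intro nn_integral_cong) (simp add: ennreal_mult mult_ac)
  also have "\<dots> = (\<integral>\<^sup>+x. \<integral>\<^sup>+y. ennreal C * (ennreal \<bar>E x\<bar> * ennreal \<bar>E y\<bar>) \<partial>lborel \<partial>lborel)"
    by (subst lborel.nn_integral_fst[symmetric]) auto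
  also have "\<dots> = ennreal C * ((\<integral>\<^sup>+x. ennreal \<bar>E x\<bar> \<partial>lborel) * (\<integral>\<^sup>+x. ennreal \<bar>E x\<bar> \<partial>lborel))"
    by (simp add: nn_integral_cmult nn_integral_multc)
  also have "\<dots> < \<infinity>"
    using E by (auto simp: integrable_iff_bounded ennreal_mult_less_top)
  finally have intK: "integrable (lborel \<Otimes>\<^sub>M lborel) K"
    by (intro integrable_lborel_pairI) auto
  have gm [measurable]: "g \<in> borel_measurable borel" unfolding g_def by measurable
  have "AE w in lborel. integrable lborel (\<lambda>p. K (p, w))"
    by (rule lborel_pair.AE_integrable_snd) (use intK in \<open>simp add: case_prod_unfold\<close>)
  then have AEeq: "AE w in lborel. (\<integral>p. K (p, w) \<partial>lborel) = (g w)\<^sup>2"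
  proof eventually_elim
    case (elim w)
    then have "integrable (lborel \<Otimes>\<^sub>M lborel) (\<lambda>p. K (p, w))" by (simp add: lborel_prod)
    from lborel_pair.integral_fst'[OF this]
    have "(\<integral>p. K (p, w) \<partial>lborel) = (\<integral>x. \<integral>y. (gauss (t/2) (x - w) * E x) * (gauss (t/2) (w - y) * E y) \<partial>lborel \<partial>lborel)"
      by (simp add: K_def lborel_prod)
    also have "\<dots> = (g w)\<^sup>2" by (simp add: g_def power2_eq_square gauss_minus[of _ _ w])
    finally show ?case .
  qed
  have intw: "integrable lborel (\<lambda>w. \<integral>p. K (p, w) \<partial>lborel)"
    by (rule lborel_pair.integrable_snd) (use intK in \<open>simp add: case_prod_unfold\<close>)
  show "integrable lborel (\<lambda>w. (g w)\<^sup>2)"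
    by (rule integrable_cong_AE_imp[OF intw]) (use AEeq in \<open>auto elim: eventually_mono\<close>)
  have "(\<integral>w. (g w)\<^sup>2 \<partial>lborel) = (\<integral>w. \<integral>p. K (p, w) \<partial>lborel \<partial>lborel)"
    by (rule integral_cong_AE) (use AEeq intw in \<open>auto elim: eventually_mono\<close>)
  also have "\<dots> = (\<integral>p. \<integral>w. K (p, w) \<partial>lborel \<partial>lborel)"
    by (rule lborel_pair.Fubini_integral) (use intK in \<open>simp add: case_prod_unfold\<close>)
  also have "\<dots> = (\<integral>p. gauss t (fst p - snd p) * (E (fst p) * E (snd p)) \<partial>lborel)"
  proof (rule Bochner_Integration.integral_cong[OF refl])
    fix p :: "'a \<times> 'a"
    have "(\<integral>w. K (p, w) \<partial>lborel) = (\<integral>w. (gauss (t/2) (fst p - w) * gauss (t/2) (w - snd p)) * (E (fst p) * E (snd p)) \<partial>lborel)"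
      by (intro Bochner_Integration.integral_cong) (auto simp: K_def)
    also have "\<dots> = (\<integral>w. gauss (t/2) (fst p - w) * gauss (t/2) (w - snd p) \<partial>lborel) * (E (fst p) * E (snd p))"
      by simp
    also have "(\<integral>w. gauss (t/2) (fst p - w) * gauss (t/2) (w - snd p) \<partial>lborel) = gauss t (fst p - snd p)"
      by (subst integral_eq_nn_integral) (auto simp: inner)
    finally show "(\<integral>w. K (p, w) \<partial>lborel) = gauss t (fst p - snd p) * (E (fst p) * E (snd p))" .
  qed
  finally show "(\<integral>p. gauss t (fst p - snd p) * (E (fst p) * E (snd p)) \<partial>lborel) = (\<integral>w. (g w)\<^sup>2 \<partial>lborel)" by simp
qed

text \<open>By Fubini's theorem the smoothing moves from \<open>E\<close> to the indicator of a box.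
  As \<open>t n -> 0\<close> the smoothed indicators converge off the frontier of the box, which is
  a null set, so every box integral of \<open>E\<close> vanishes.\<close>

lemma gauss_smoothing_zero_imp_zero:
  fixes E :: "'a::euclidean_space \<Rightarrow> real"
  assumes E: "integrable lborel E" and t: "\<And>n. t n > 0" "t \<longlonglongrightarrow> 0"
    and zero: "\<And>n::nat. AE w in lborel. (\<integral>y. gauss (t n) (w - y) * E y \<partial>lborel) = 0"
  shows "AE x in lborel. E x = 0"
proof (rule AE_zero_if_box_integrals_zero[OF E])
  fix a b :: 'a
  have [measurable]: "E \<in> borel_measurable borel" using E by (simp add: borel_measurable_integrable)
  define \<eta> :: "'a \<Rightarrow> real" where "\<eta> = indicator (box a b)"
  have \<eta>m [measurable]: "\<eta> \<in> borel_measurable borel" unfolding \<eta>_def by measurable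
  have \<eta>1: "\<bar>\<eta> x\<bar> \<le> 1" for x by (simp add: \<eta>_def indicator_def)
  define A where "A n y = (\<integral>v. gauss (t n) v * \<eta> (y - v) \<partial>lborel)" for n y
  have Am [measurable]: "A n \<in> borel_measurable borel" for n unfolding A_def by measurable
  have intv: "integrable lborel (\<lambda>v. gauss (t n) v * \<eta> (y - v))" for n y
    by (rule Bochner_Integration.integrable_bound[OF integrable_gauss[OF t(1)[of n]]])
       (use \<eta>1 in \<open>auto simp: abs_mult intro!: mult_left_le\<close>)
  have A1: "\<bar>A n y\<bar> \<le> 1" for n y
  proof -
    have "\<bar>A n y\<bar> \<le> (\<integral>v. norm (gauss (t n) v * \<eta> (y - v)) \<partial>lborel)"
      unfolding A_def real_norm_def[symmetric] by (rule integral_norm_bound)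
    also have "\<dots> \<le> (\<integral>v. gauss (t n) (v::'a) \<partial>lborel)"
      by (intro integral_mono integrable_norm intv integrable_gauss t(1)) (use \<eta>1 in \<open>auto simp: abs_mult intro!: mult_left_le\<close>)
    also have "\<dots> = 1" by (rule integral_gauss[OF t(1)])
    finally show ?thesis .
  qed
  have zero': "(\<integral>y. E y * A n y \<partial>lborel) = 0" for n
  proof -
    define H where "H p = \<eta> (snd p) * (gauss (t n) (snd p - fst p) * E (fst p))" for p :: "'a \<times> 'a"
    have Hm [measurable]: "H \<in> borel_measurable borel" unfolding H_def borel_prod[symmetric] by measurable
    have "(\<integral>\<^sup>+y. \<integral>\<^sup>+w. ennreal \<bar>H (y, w)\<bar> \<partial>lborel \<partial>lborel) \<le> (\<integral>\<^sup>+y. \<integral>\<^sup>+w. ennreal \<bar>E y\<bar> * ennreal (gauss (t n) (y - w)) \<partial>lborel \<partial>lborel)"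
    proof (intro nn_integral_mono)
      fix y w :: 'a
      have "\<bar>H (y, w)\<bar> = \<bar>\<eta> w\<bar> * (\<bar>E y\<bar> * gauss (t n) (y - w))"
        by (simp add: H_def abs_mult gauss_minus[of _ w])
      also have "\<dots> \<le> 1 * (\<bar>E y\<bar> * gauss (t n) (y - w))"
        using \<eta>1 by (intro mult_right_mono) auto
      finally have "\<bar>H (y, w)\<bar> \<le> 1 * (\<bar>E y\<bar> * gauss (t n) (y - w))" .
      then show "ennreal \<bar>H (y, w)\<bar> \<le> ennreal \<bar>E y\<bar> * ennreal (gauss (t n) (y - w))"
        by (simp add: ennreal_mult[symmetric] ennreal_leI)
    qed
    also have "\<dots> = (\<integral>\<^sup>+y. ennreal \<bar>E y\<bar> * (\<integral>\<^sup>+w. ennreal (gauss (t n) w) \<partial>(lborel :: 'a measure)) \<partial>lborel)"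
    proof (intro nn_integral_cong)
      fix y :: 'a
      have "(\<integral>\<^sup>+w. ennreal (gauss (t n) (y - w)) \<partial>lborel) = (\<integral>\<^sup>+w. ennreal (gauss (t n) (w :: 'a)) \<partial>lborel)"
        by (rule nn_integral_lborel_reflect) measurable
      then show "(\<integral>\<^sup>+w. ennreal \<bar>E y\<bar> * ennreal (gauss (t n) (y - w)) \<partial>lborel) = ennreal \<bar>E y\<bar> * (\<integral>\<^sup>+w. ennreal (gauss (t n) w) \<partial>(lborel :: 'a measure))"
        by (simp add: nn_integral_cmult)
    qed
    also have "\<dots> < \<infinity>" using E gauss_mass[OF t(1), where 'a='a] by (simp add: integrable_iff_bounded)
    finally have intH: "integrable (lborel \<Otimes>\<^sub>M lborel) H" by (intro integrable_lborel_pairI) auto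
    have "(\<integral>w. \<integral>y. H (y, w) \<partial>lborel \<partial>lborel) = (\<integral>y. \<integral>w. H (y, w) \<partial>lborel \<partial>lborel)"
      by (rule lborel_pair.Fubini_integral) (use intH in \<open>simp add: case_prod_unfold\<close>)
    moreover have "(\<integral>w. \<integral>y. H (y, w) \<partial>lborel \<partial>lborel) = (\<integral>w. 0 \<partial>(lborel :: 'a measure))"
    proof (rule integral_cong_AE)
      show "AE w in lborel. (\<integral>y. H (y, w) \<partial>lborel) = 0"
        using zero[of n] by eventually_elim (simp add: H_def)
    qed (unfold H_def, measurable)
    moreover have "(\<integral>w. H (y, w) \<partial>lborel) = E y * A n y" for y
    proof -
      have "(\<integral>w. H (y, w) \<partial>lborel) = (\<integral>w. H (y, y - w) \<partial>lborel)"
        by (rule integral_lborel_reflect[symmetric]) measurable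
      also have "\<dots> = (\<integral>w. E y * (gauss (t n) w * \<eta> (y - w)) \<partial>lborel)"
        by (intro Bochner_Integration.integral_cong) (auto simp: H_def gauss_def)
      finally show ?thesis by (simp add: A_def)
    qed
    ultimately show ?thesis by simp
  qed
  have "(\<lambda>n. \<integral>y. E y * A n y \<partial>lborel) \<longlonglongrightarrow> (\<integral>y. E y * \<eta> y \<partial>lborel)"
  proof (rule Bochner_Integration.integral_dominated_convergence[where w="\<lambda>y. \<bar>E y\<bar>"])
    have "frontier (box a b) \<in> null_sets lborel"
      using negligible_convex_frontier[of "box a b"] by (simp add: negligible_iff_null_sets null_sets_completion_iff)
    then have "AE y in lborel. y \<notin> frontier (box a b)" by (rule AE_not_in)
    then show "AE y in lborel. (\<lambda>n. E y * A n y) \<longlonglongrightarrow> E y * \<eta> y"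
    proof eventually_elim
      case (elim y)
      have "isCont \<eta> y" unfolding \<eta>_def using elim by (simp add: isCont_indicator)
      then show ?case unfolding A_def
        by (intro tendsto_mult tendsto_const gauss_smoothing_tendsto[OF \<eta>m \<eta>1 _ t])
    qed
    show "AE y in lborel. norm (E y * A n y) \<le> \<bar>E y\<bar>" for n
      using A1 by (auto simp: abs_mult intro!: mult_left_le)
  qed (use E in auto)
  then have "(\<integral>y. E y * \<eta> y \<partial>lborel) = 0" unfolding zero' by (simp add: LIMSEQ_const_iff)
  then show "(\<integral>x. indicator (box a b) x * E x \<partial>lborel) = 0" by (simp add: \<eta>_def mult.commute)
qed

text \<open>In the energy of \<open>E\<close> the potential is multiplied by \<open>E\<close>, so
  its vanishing on the carrier \<open>S\<close> alone makes the energy zero; this is the form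
  required for functions that live outside the ball. The bound \<open>M\<close> on \<open>S\<close>
  makes the integral over \<open>z\<close>, \<open>y\<close> and the time variable absolutely
  convergent, so that the energy may be written as an integral over time of nonnegative forms
  \<open>Q t\<close>.\<close>

lemma riesz_potential_injective:
  fixes E :: "'a::euclidean_space \<Rightarrow> real"
  assumes s: "2 * s < real DIM('a)"
    and E: "integrable lborel E" and supp: "\<And>y. y \<notin> S \<Longrightarrow> E y = 0"
    and M: "\<And>z. z \<in> S \<Longrightarrow> (\<integral>\<^sup>+y. ennreal (riesz s (z - y) * \<bar>E y\<bar>) \<partial>lborel) \<le> ennreal M"
    and zero: "\<And>z. z \<in> S \<Longrightarrow> (\<integral>y. riesz s (z - y) * E y \<partial>lborel) = 0"
  shows "AE x in lborel. E x = 0"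
proof -
  have [measurable]: "E \<in> borel_measurable borel" using E by (simp add: borel_measurable_integrable)
  define c where "c = subord_const TYPE('a) s"
  have c: "c > 0" using subord_const(2)[OF s] by (simp add: c_def)
  define H where "H q = indicator {0<..} (snd q) * (snd q powr (s - 1) * gauss (snd q) (fst (fst q) - snd (fst q))) * (E (fst (fst q)) * E (snd (fst q)))" for q :: "('a \<times> 'a) \<times> real"
  have Hm [measurable]: "H \<in> borel_measurable borel" unfolding H_def borel_prod[symmetric] by measurable
  have inner: "(\<integral>\<^sup>+t. ennreal (indicator {0<..} t * (t powr (s - 1) * gauss t (z - y))) \<partial>lborel) = ennreal (c * riesz s (z - y))"
    if "z \<noteq> y" for z y :: 'a
  proof -
    have "(\<integral>\<^sup>+t. ennreal (indicator {0<..} t * (t powr (s - 1) * gauss t (z - y))) \<partial>lborel) = (\<integral>\<^sup>+t. ennreal (t powr (s - 1) * gauss t (z - y)) * indicator {0<..} t \<partial>lborel)"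
      by (intro nn_integral_cong) (auto simp: indicator_def)
    then show ?thesis unfolding c_def using riesz_subordination[OF s, of "z - y"] that by simp
  qed
  have nnH: "(\<integral>\<^sup>+t. ennreal \<bar>H ((z, y), t)\<bar> \<partial>lborel) = ennreal (c * riesz s (z - y)) * ennreal (\<bar>E z\<bar> * \<bar>E y\<bar>)" if "z \<noteq> y" for z y
  proof -
    have "(\<integral>\<^sup>+t. ennreal \<bar>H ((z, y), t)\<bar> \<partial>lborel) = (\<integral>\<^sup>+t. ennreal (indicator {0<..} t * (t powr (s - 1) * gauss t (z - y))) * ennreal (\<bar>E z\<bar> * \<bar>E y\<bar>) \<partial>lborel)"
      by (intro nn_integral_cong) (simp add: H_def abs_mult ennreal_mult[symmetric])
    then show ?thesis using inner[OF that] by (simp add: nn_integral_multc)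
  qed
  have neq: "AE y in lborel. z \<noteq> y" for z :: 'a
    using AE_lborel_singleton[of z] by eventually_elim auto
  have "(\<integral>\<^sup>+p. \<integral>\<^sup>+t. ennreal \<bar>H (p, t)\<bar> \<partial>lborel \<partial>lborel) = (\<integral>\<^sup>+p. \<integral>\<^sup>+t. ennreal \<bar>H (p, t)\<bar> \<partial>lborel \<partial>(lborel \<Otimes>\<^sub>M lborel))"
    by (simp add: lborel_prod)
  also have "\<dots> = (\<integral>\<^sup>+z. \<integral>\<^sup>+y. \<integral>\<^sup>+t. ennreal \<bar>H ((z, y), t)\<bar> \<partial>lborel \<partial>lborel \<partial>lborel)"
    by (rule lborel.nn_integral_fst[symmetric]) (simp add: lborel_prod)
  also have "\<dots> = (\<integral>\<^sup>+z. \<integral>\<^sup>+y. ennreal (c * \<bar>E z\<bar>) * ennreal (riesz s (z - y) * \<bar>E y\<bar>) \<partial>lborel \<partial>lborel)"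
  proof (rule nn_integral_cong, rule nn_integral_cong_AE)
    fix z
    show "AE y in lborel. (\<integral>\<^sup>+t. ennreal \<bar>H ((z, y), t)\<bar> \<partial>lborel) = ennreal (c * \<bar>E z\<bar>) * ennreal (riesz s (z - y) * \<bar>E y\<bar>)"
      using neq[of z]
    proof eventually_elim
      case (elim y)
      show ?case unfolding nnH[OF elim] using c by (simp add: ennreal_mult[symmetric] mult_ac)
    qed
  qed
  also have "\<dots> = (\<integral>\<^sup>+z. ennreal (c * \<bar>E z\<bar>) * (\<integral>\<^sup>+y. ennreal (riesz s (z - y) * \<bar>E y\<bar>) \<partial>lborel) \<partial>lborel)"
    by (intro nn_integral_cong nn_integral_cmult) measurable
  also have "\<dots> \<le> (\<integral>\<^sup>+z. ennreal (c * \<bar>E z\<bar>) * ennreal M \<partial>lborel)"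
  proof (rule nn_integral_mono)
    fix z
    show "ennreal (c * \<bar>E z\<bar>) * (\<integral>\<^sup>+y. ennreal (riesz s (z - y) * \<bar>E y\<bar>) \<partial>lborel) \<le> ennreal (c * \<bar>E z\<bar>) * ennreal M"
      using M[of z] supp[of z] by (cases "z \<in> S") (auto intro: mult_left_mono)
  qed
  also have "\<dots> < \<infinity>"
    using E c by (simp add: nn_integral_multc ennreal_mult nn_integral_cmult integrable_iff_bounded ennreal_mult_less_top)
  finally have intH: "integrable (lborel \<Otimes>\<^sub>M lborel) H" by (intro integrable_lborel_pairI) auto
  define Q where "Q t = (\<integral>p. gauss t (fst p - snd p) * (E (fst p) * E (snd p)) \<partial>lborel)" for t
  have Qint: "(\<integral>p. H (p, t) \<partial>lborel) = indicator {0<..} t * (t powr (s - 1) * Q t)" for t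
    by (simp add: H_def Q_def mult.assoc)
  have Qnn: "Q t \<ge> 0" if "t > 0" for t
    unfolding Q_def gauss_form_eq_square(2)[OF E that] by simp
  have "integrable lborel (\<lambda>t. \<integral>p. H (p, t) \<partial>lborel)"
    by (rule lborel_pair.integrable_snd) (use intH in \<open>simp add: case_prod_unfold\<close>)
  then have intQ: "integrable lborel (\<lambda>t. indicator {0<..} t * (t powr (s - 1) * Q t))" by (simp only: Qint)
  have "(\<integral>t. indicator {0<..} t * (t powr (s - 1) * Q t) \<partial>lborel) = (\<integral>t. \<integral>p. H (p, t) \<partial>lborel \<partial>lborel)"
    by (simp only: Qint)
  also have "\<dots> = (\<integral>p. \<integral>t. H (p, t) \<partial>lborel \<partial>lborel)"
    by (rule lborel_pair.Fubini_integral) (use intH in \<open>simp add: case_prod_unfold\<close>)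
  also have "\<dots> = (\<integral>z. \<integral>y. \<integral>t. H ((z, y), t) \<partial>lborel \<partial>lborel \<partial>lborel)"
  proof -
    have "integrable lborel (\<lambda>p. \<integral>t. H (p, t) \<partial>lborel)"
      by (rule lborel_pair.integrable_fst) (use intH in \<open>simp add: case_prod_unfold\<close>)
    then have "integrable (lborel \<Otimes>\<^sub>M lborel) (\<lambda>p. \<integral>t. H (p, t) \<partial>lborel)" by (simp add: lborel_prod)
    from lborel_pair.integral_fst'[OF this] show ?thesis by (simp add: lborel_prod)
  qed
  also have "\<dots> = (\<integral>z. \<integral>y. (c * E z) * (riesz s (z - y) * E y) \<partial>lborel \<partial>lborel)"
  proof (rule Bochner_Integration.integral_cong[OF refl], rule integral_cong_AE)
    fix z :: 'a
    show "AE y in lborel. (\<integral>t. H ((z, y), t) \<partial>lborel) = (c * E z) * (riesz s (z - y) * E y)"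
      using neq[of z]
    proof eventually_elim
      case (elim y)
      have "(\<integral>t. H ((z, y), t) \<partial>lborel) = (\<integral>t. indicator {0<..} t * (t powr (s - 1) * gauss t (z - y)) \<partial>lborel) * (E z * E y)"
        by (simp add: H_def)
      also have "(\<integral>t. indicator {0<..} t * (t powr (s - 1) * gauss t (z - y)) \<partial>lborel) = c * riesz s (z - y)"
        using inner[OF elim] c by (subst integral_eq_nn_integral) auto
      finally show ?case by simp
    qed
    show "(\<lambda>y. \<integral>t. H ((z, y), t) \<partial>lborel) \<in> borel_measurable lborel"
      unfolding H_def fst_conv snd_conv by measurable
  qed measurable
  also have "\<dots> = (\<integral>z. 0 \<partial>(lborel :: 'a measure))"
  proof (rule Bochner_Integration.integral_cong[OF refl])
    fix z
    show "(\<integral>y. (c * E z) * (riesz s (z - y) * E y) \<partial>lborel) = 0"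
      using zero[of z] supp[of z] by (cases "z \<in> S") auto
  qed
  finally have "(\<integral>t. indicator {0<..} t * (t powr (s - 1) * Q t) \<partial>lborel) = 0" by simp
  then have "AE t in lborel. indicator {0<..} t * (t powr (s - 1) * Q t) = 0"
    using Qnn by (subst (asm) integral_nonneg_eq_0_iff_AE[OF intQ]) (auto simp: indicator_def)
  then have Q0: "AE t in lborel. t > 0 \<longrightarrow> Q t = 0"
    by eventually_elim (auto simp: indicator_def)
  \<comment> \<open>\<open>Q\<close> is known to vanish for almost every positive time only, but
    this provides zeros of \<open>Q\<close> below every \<open>1 / (n + 1)\<close> and hence a
    sequence of times tending to zero.\<close>
  have "\<exists>t. 0 < t \<and> t < 1 / real (Suc n) \<and> Q t = 0" for n
  proof (rule ccontr)
    assume "\<not> ?thesis"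
    with Q0 have "AE t in lborel. t \<notin> {0<..<1 / real (Suc n)}" by (auto elim: eventually_mono)
    then have "emeasure lborel {0<..<1 / real (Suc n)} = 0"
      by (subst (asm) AE_iff_measurable[of "{0<..<1 / real (Suc n)}"]) auto
    then show False by simp
  qed
  then obtain t where t: "\<And>n. 0 < t n" "\<And>n. t n < 1 / real (Suc n)" "\<And>n. Q (t n) = 0" by metis
  have "t \<longlonglongrightarrow> 0"
    by (rule tendsto_sandwich[OF _ _ tendsto_const LIMSEQ_Suc[OF lim_inverse_n']]) (use t in \<open>auto simp: less_imp_le intro!: always_eventually\<close>)
  then have lim: "(\<lambda>n. t n / 2) \<longlonglongrightarrow> 0" using tendsto_divide[of t 0 _ "\<lambda>_. 2" 2] by simp
  show ?thesis
  proof (rule gauss_smoothing_zero_imp_zero[OF E _ lim])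
    show "t n / 2 > 0" for n using t(1) by simp
    show "AE w in lborel. (\<integral>y. gauss (t n / 2) (w - y) * E y \<partial>lborel) = 0" for n
    proof -
      note sq = gauss_form_eq_square[OF E t(1)[of n]]
      have "(\<integral>w. (\<integral>y. gauss (t n / 2) (w - y) * E y \<partial>lborel)\<^sup>2 \<partial>lborel) = 0"
        using t(3)[of n] unfolding Q_def sq(2) .
      then have "AE w in lborel. (\<integral>y. gauss (t n / 2) (w - y) * E y \<partial>lborel)\<^sup>2 = 0"
        by (subst (asm) integral_nonneg_eq_0_iff_AE[OF sq(1)]) auto
      then show ?thesis by eventually_elim simp
    qed
  qed
qed

section \<open>The fractional Laplacian on test functions\<close>

lemma integrable_lborel_reflect:
  fixes f :: "'a::euclidean_space \<Rightarrow> real"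
  assumes "integrable lborel f" shows "integrable lborel (\<lambda>x. f (a - x))"
proof -
  have [measurable]: "f \<in> borel_measurable borel" using assms by (simp add: borel_measurable_integrable)
  show ?thesis using assms nn_integral_lborel_reflect[of "\<lambda>x. ennreal (norm (f x))" a]
    by (simp add: integrable_iff_bounded)
qed

section \<open>Calculus of smooth compactly supported functions\<close>

lemma smooth_fun_differentiable: "smooth_fun f \<Longrightarrow> f differentiable (at x)"
  by (erule smooth_fun.cases) (auto simp: differentiable_on_def)

lemma smooth_fun_has_derivative: "smooth_fun f \<Longrightarrow> (f has_derivative frechet_derivative f (at x)) (at x)"
  using smooth_fun_differentiable frechet_derivative_works by blast

lemma smooth_fun_partial: "smooth_fun f \<Longrightarrow> b \<in> Basis \<Longrightarrow> smooth_fun (\<lambda>x. frechet_derivative f (at x) b)"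
  by (erule smooth_fun.cases) auto

lemma smooth_fun_continuous: "smooth_fun f \<Longrightarrow> continuous_on UNIV f"
  by (meson smooth_fun_differentiable differentiable_imp_continuous_on differentiable_at_withinI differentiable_on_def)

lemma smooth_fun_measurable: "smooth_fun f \<Longrightarrow> f \<in> borel_measurable borel"
  by (intro borel_measurable_continuous_onI smooth_fun_continuous)

definition compact_supp :: "('a::euclidean_space \<Rightarrow> real) \<Rightarrow> bool" where
  "compact_supp f \<longleftrightarrow> compact (closure {x. f x \<noteq> 0})"

lemma compact_supp_obtain:
  assumes "compact_supp f"
  obtains R where "R > 0" "\<And>x. norm x > R \<Longrightarrow> f x = 0"
proof -
  have "bounded {x. f x \<noteq> 0}"
    using assms bounded_subset[OF compact_imp_bounded closure_subset] by (auto simp: compact_supp_def)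
  then obtain R where "R > 0" "\<And>x. f x \<noteq> 0 \<Longrightarrow> norm x \<le> R" by (auto simp: bounded_pos)
  then show ?thesis using that[of R] by force
qed

lemma compact_suppI:
  assumes "\<And>x. norm x > R \<Longrightarrow> f x = 0"
  shows "compact_supp f"
proof -
  have "{x. f x \<noteq> 0} \<subseteq> cball 0 R" using assms by (force simp: not_less[symmetric])
  then show ?thesis unfolding compact_supp_def
    using bounded_subset[OF bounded_cball] by (simp add: compact_closure)
qed

lemma frechet_derivative_eq_0_outside:
  assumes "\<And>x. norm x > R \<Longrightarrow> f x = (0::real)" "norm x > R"
  shows "frechet_derivative f (at x) = (\<lambda>h. 0)"
proof -
  have "((\<lambda>x. 0) has_derivative (\<lambda>h. 0)) (at x)" by (rule has_derivative_const)
  moreover have "open {x. norm x > R}" by (intro open_Collect_less continuous_intros)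
  ultimately have "(f has_derivative (\<lambda>h. 0)) (at x)"
    by (rule has_derivative_transform_within_open) (use assms in auto)
  then show ?thesis by (metis frechet_derivative_at)
qed

lemma compact_supp_partial:
  assumes "compact_supp f"
  shows "compact_supp (\<lambda>x. frechet_derivative f (at x) b)"
proof -
  obtain R where "R > 0" and R: "\<And>x. norm x > R \<Longrightarrow> f x = 0" using compact_supp_obtain[OF assms] by metis
  show ?thesis by (rule compact_suppI[of R]) (simp add: frechet_derivative_eq_0_outside[OF R])
qed

lemma smooth_compact_bounded:
  assumes "smooth_fun f" "compact_supp f"
  obtains B where "B \<ge> 0" "\<And>x. \<bar>f x\<bar> \<le> B"
proof -
  have "compact (f ` closure {x. f x \<noteq> 0})"
    using assms(2) continuous_on_subset[OF smooth_fun_continuous[OF assms(1)] subset_UNIV]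
    by (intro compact_continuous_image) (auto simp: compact_supp_def)
  then obtain B where "B > 0" and B: "\<And>y. y \<in> f ` closure {x. f x \<noteq> 0} \<Longrightarrow> norm y \<le> B"
    using compact_imp_bounded bounded_pos by metis
  have "\<bar>f x\<bar> \<le> B" for x
    using B[of "f x"] \<open>B > 0\<close> closure_subset[of "{x. f x \<noteq> 0}"] by (cases "f x = 0") auto
  then show ?thesis using that[of B] \<open>B > 0\<close> by simp
qed

lemma frechet_derivative_basis_sum:
  fixes f :: "'a::euclidean_space \<Rightarrow> real"
  assumes "f differentiable (at x)"
  shows "frechet_derivative f (at x) h = (\<Sum>b\<in>Basis. (h \<bullet> b) * frechet_derivative f (at x) b)"
proof -
  interpret linear "frechet_derivative f (at x)" using linear_frechet_derivative[OF assms] .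
  have "frechet_derivative f (at x) h = frechet_derivative f (at x) (\<Sum>b\<in>Basis. (h \<bullet> b) *\<^sub>R b)"
    by (simp add: euclidean_representation)
  also have "\<dots> = (\<Sum>b\<in>Basis. (h \<bullet> b) * frechet_derivative f (at x) b)"
    by (simp only: sum scale real_scaleR_def)
  finally show ?thesis .
qed

lemma smooth_compact_Lipschitz:
  fixes f :: "'a::euclidean_space \<Rightarrow> real"
  assumes f: "smooth_fun f" "compact_supp f"
  obtains L where "L \<ge> 0" "\<And>x y. \<bar>f x - f y\<bar> \<le> L * norm (x - y)"
proof -
  have "\<exists>B. B \<ge> 0 \<and> (\<forall>x. \<bar>frechet_derivative f (at x) b\<bar> \<le> B)" if "b \<in> Basis" for b
    using smooth_compact_bounded[OF smooth_fun_partial[OF f(1) that] compact_supp_partial[OF f(2)]] by metis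
  then obtain B where B: "\<And>b. b \<in> Basis \<Longrightarrow> B b \<ge> 0" "\<And>b x. b \<in> Basis \<Longrightarrow> \<bar>frechet_derivative f (at x) b\<bar> \<le> B b"
    by metis
  have "\<bar>f x - f y\<bar> \<le> (\<Sum>b\<in>Basis. B b) * norm (x - y)" for x y
    unfolding real_norm_def[symmetric]
  proof (rule differentiable_bound[where S=UNIV and f'="\<lambda>x. frechet_derivative f (at x)"])
    fix z
    show "(f has_derivative frechet_derivative f (at z)) (at z within UNIV)"
      using smooth_fun_has_derivative[OF f(1)] by simp
    show "onorm (frechet_derivative f (at z)) \<le> (\<Sum>b\<in>Basis. B b)"
    proof (rule onorm_le)
      fix h
      have "norm (frechet_derivative f (at z) h) \<le> (\<Sum>b\<in>Basis. norm ((h \<bullet> b) * frechet_derivative f (at z) b))"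
        unfolding frechet_derivative_basis_sum[OF smooth_fun_differentiable[OF f(1)], of z h] by (rule norm_sum)
      also have "\<dots> \<le> (\<Sum>b\<in>Basis. norm h * B b)"
        using B by (intro sum_mono) (auto simp: abs_mult Basis_le_norm intro!: mult_mono)
      also have "\<dots> = (\<Sum>b\<in>Basis. B b) * norm h" by (subst sum_distrib_right) (simp add: mult.commute)
      finally show "norm (frechet_derivative f (at z) h) \<le> (\<Sum>b\<in>Basis. B b) * norm h" .
    qed
  qed auto
  then show ?thesis using that[of "\<Sum>b\<in>Basis. B b"] B(1) by (auto intro: sum_nonneg)
qed

text \<open>The mean value inequality is applied to \<open>f\<close> minus its linearisation at
  \<open>x\<close> on the ball of radius \<open>|h|\<close>; the derivative of this difference is
  \<open>O(|h|)\<close> because the partial derivatives are Lipschitz. The constant is uniform in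
  \<open>x\<close>.\<close>

lemma smooth_compact_Taylor:
  fixes f :: "'a::euclidean_space \<Rightarrow> real"
  assumes f: "smooth_fun f" "compact_supp f"
  obtains L where "L \<ge> 0" "\<And>x h. \<bar>f (x + h) - f x - frechet_derivative f (at x) h\<bar> \<le> L * (norm h)\<^sup>2"
proof -
  have "\<exists>L. L \<ge> 0 \<and> (\<forall>x y. \<bar>frechet_derivative f (at x) b - frechet_derivative f (at y) b\<bar> \<le> L * norm (x - y))" if "b \<in> Basis" for b
    using smooth_compact_Lipschitz[OF smooth_fun_partial[OF f(1) that] compact_supp_partial[OF f(2)]] by metis
  then obtain B where B: "\<And>b. b \<in> Basis \<Longrightarrow> B b \<ge> 0"
    "\<And>b x y. b \<in> Basis \<Longrightarrow> \<bar>frechet_derivative f (at x) b - frechet_derivative f (at y) b\<bar> \<le> B b * norm (x - y)"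
    by metis
  define L where "L = (\<Sum>b\<in>Basis. B b)"
  have L: "L \<ge> 0" unfolding L_def using B(1) by (auto intro: sum_nonneg)
  have lin: "linear (frechet_derivative f (at x))" for x
    using linear_frechet_derivative[OF smooth_fun_differentiable[OF f(1)]] .
  have "\<bar>f (x + h) - f x - frechet_derivative f (at x) h\<bar> \<le> L * (norm h)\<^sup>2" for x h
  proof -
    define g where "g y = f y - frechet_derivative f (at x) y" for y
    have "norm (g (x + h) - g x) \<le> (L * norm h) * norm ((x + h) - x)"
    proof (rule differentiable_bound[where S="cball x (norm h)" and f'="\<lambda>y k. frechet_derivative f (at y) k - frechet_derivative f (at x) k"])
      fix y assume y: "y \<in> cball x (norm h)"
      show "(g has_derivative (\<lambda>k. frechet_derivative f (at y) k - frechet_derivative f (at x) k)) (at y within cball x (norm h))"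
        unfolding g_def
        by (intro has_derivative_diff has_derivative_at_withinI[OF smooth_fun_has_derivative[OF f(1)]]
              linear_imp_has_derivative lin)
      show "onorm (\<lambda>k. frechet_derivative f (at y) k - frechet_derivative f (at x) k) \<le> L * norm h"
      proof (rule onorm_le)
        fix k
        have "frechet_derivative f (at y) k - frechet_derivative f (at x) k = (\<Sum>b\<in>Basis. (k \<bullet> b) * (frechet_derivative f (at y) b - frechet_derivative f (at x) b))"
          unfolding frechet_derivative_basis_sum[OF smooth_fun_differentiable[OF f(1)], of _ k]
          by (simp add: sum_subtractf[symmetric] right_diff_distrib)
        then have "norm (frechet_derivative f (at y) k - frechet_derivative f (at x) k) \<le> (\<Sum>b\<in>Basis. norm ((k \<bullet> b) * (frechet_derivative f (at y) b - frechet_derivative f (at x) b)))"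
          by (simp only:) (rule norm_sum)
        also have "\<dots> \<le> (\<Sum>b\<in>Basis. norm k * (B b * norm h))"
        proof (rule sum_mono)
          fix b :: 'a assume b: "b \<in> Basis"
          have "\<bar>frechet_derivative f (at y) b - frechet_derivative f (at x) b\<bar> \<le> B b * norm (y - x)" using B(2)[OF b] .
          also have "\<dots> \<le> B b * norm h" using y B(1)[OF b] by (intro mult_left_mono) (auto simp: dist_norm norm_minus_commute)
          finally show "norm ((k \<bullet> b) * (frechet_derivative f (at y) b - frechet_derivative f (at x) b)) \<le> norm k * (B b * norm h)"
            using Basis_le_norm[OF b, of k] by (auto simp: abs_mult intro!: mult_mono)
        qed
        also have "\<dots> = L * norm h * norm k" by (simp add: L_def sum_distrib_left sum_distrib_right mult_ac)
        finally show "norm (frechet_derivative f (at y) k - frechet_derivative f (at x) k) \<le> L * norm h * norm k" .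
      qed
    qed (auto simp: dist_norm)
    then show ?thesis by (simp add: g_def linear_add[OF lin] power2_eq_square algebra_simps)
  qed
  then show ?thesis using that L by blast
qed

text \<open>The increment symmetrised in \<open>h\<close>. It is \<open>O(|h|^2)\<close> on test
  functions, so the integral against \<open>|h|^(-N-2s)\<close> converges absolutely for every
  \<open>s < 1\<close> and the principal value disappears.\<close>

definition second_diff :: "('a::euclidean_space \<Rightarrow> real) \<Rightarrow> 'a \<Rightarrow> 'a \<Rightarrow> real" where
  "second_diff \<phi> x h = 2 * \<phi> x - \<phi> (x + h) - \<phi> (x - h)"

lemma second_diff_bound:
  assumes f: "smooth_fun f" "compact_supp f"
  obtains C where "C \<ge> 0" "\<And>x h. \<bar>second_diff f x h\<bar> \<le> C * (norm h)\<^sup>2"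
proof -
  obtain L where L: "L \<ge> 0" "\<And>x h. \<bar>f (x + h) - f x - frechet_derivative f (at x) h\<bar> \<le> L * (norm h)\<^sup>2"
    using smooth_compact_Taylor[OF f] by metis
  have lin: "linear (frechet_derivative f (at x))" for x
    using linear_frechet_derivative[OF smooth_fun_differentiable[OF f(1)]] .
  have "\<bar>second_diff f x h\<bar> \<le> (2 * L) * (norm h)\<^sup>2" for x h
    using L(2)[of x h] L(2)[of x "-h"] linear_neg[OF lin, of x h] by (simp add: second_diff_def)
  then show ?thesis using that[of "2 * L"] L(1) by simp
qed

section \<open>Absolutely convergent form of the fractional Laplacian\<close>

definition frac_kernel :: "real \<Rightarrow> 'a::euclidean_space \<Rightarrow> real" where
  "frac_kernel s h = norm h powr (- real DIM('a) - 2 * s)"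

lemma frac_kernel_nonneg [simp]: "frac_kernel s h \<ge> 0"
  by (simp add: frac_kernel_def)

lemma frac_kernel_measurable [measurable]: "frac_kernel s \<in> borel_measurable borel"
  unfolding frac_kernel_def by measurable

definition nonlocal :: "real \<Rightarrow> ('a::euclidean_space \<Rightarrow> real) \<Rightarrow> 'a \<Rightarrow> real" where
  "nonlocal s \<phi> x = (\<integral>h. second_diff \<phi> x h * frac_kernel s h \<partial>lborel)"

text \<open>The standard integrability condition for a Levy measure. It serves as one majorant for
  all points \<open>x\<close>: the factor \<open>|h|^2\<close> comes from the second difference near
  the origin and the factor \<open>1\<close> from boundedness of the function.\<close>

definition levy_weight :: "real \<Rightarrow> 'a::euclidean_space \<Rightarrow> real" where
  "levy_weight s h = min 1 ((norm h)\<^sup>2) * frac_kernel s h"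

lemma levy_weight_measurable [measurable]: "levy_weight s \<in> borel_measurable borel"
  unfolding levy_weight_def by measurable

lemma levy_weight_nonneg [simp]: "levy_weight s h \<ge> 0"
  by (simp add: levy_weight_def)

lemma levy_weight_finite:
  assumes s: "0 < s" "s < 1"
  shows "(\<integral>\<^sup>+(h::'a::euclidean_space). ennreal (levy_weight s h) \<partial>lborel) < \<infinity>"
proof -
  have "(\<integral>\<^sup>+(h::'a). ennreal (levy_weight s h) \<partial>lborel) \<le> (\<integral>\<^sup>+(h::'a). ennreal (norm h powr (2 - 2 * s - real DIM('a))) * indicator {0<..1} (norm h) + ennreal (norm h powr (- real DIM('a) - 2 * s)) * indicator {1..} (norm h) \<partial>lborel)"
  proof (rule nn_integral_mono)
    fix h :: 'a
    have "levy_weight s h \<le> norm h powr (2 - 2 * s - real DIM('a))" if "norm h > 0"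
    proof -
      have "levy_weight s h \<le> (norm h)\<^sup>2 * frac_kernel s h" unfolding levy_weight_def by (intro mult_right_mono) auto
      also have "\<dots> = norm h powr 2 * norm h powr (- real DIM('a) - 2 * s)" by (simp add: frac_kernel_def)
      also have "\<dots> = norm h powr (2 + (- real DIM('a) - 2 * s))" by (rule powr_add[symmetric])
      finally show ?thesis by (simp add: algebra_simps)
    qed
    have "levy_weight s h \<le> norm h powr (- real DIM('a) - 2 * s)"
      unfolding levy_weight_def frac_kernel_def by (simp add: mult_left_le_one_le)
    have "levy_weight s h = 0" if "norm h = 0" using that by (simp add: levy_weight_def)
    show "ennreal (levy_weight s h) \<le> ennreal (norm h powr (2 - 2 * s - real DIM('a))) * indicator {0<..1} (norm h) + ennreal (norm h powr (- real DIM('a) - 2 * s)) * indicator {1..} (norm h)"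
    proof -
      consider "norm h = 0" | "0 < norm h" "norm h \<le> 1" | "norm h > 1" using norm_ge_zero[of h] by linarith
      then show ?thesis
      proof cases
        case 2
        then have "ennreal (levy_weight s h) \<le> ennreal (norm h powr (2 - 2 * s - real DIM('a))) * indicator {0<..1} (norm h)"
          using \<open>0 < norm h \<Longrightarrow> _\<close> by (auto intro: ennreal_leI)
        then show ?thesis by (rule add_increasing2[rotated]) simp
      next
        case 3
        then show ?thesis using \<open>levy_weight s h \<le> norm h powr (- real DIM('a) - 2 * s)\<close> by (auto intro: ennreal_leI)
      qed (use \<open>norm h = 0 \<Longrightarrow> _\<close> in auto)
    qed
  qed
  also have "\<dots> < \<infinity>"
    using nn_integral_norm_powr_ball_finite[where 'a='a, of "2 - 2 * s - real DIM('a)" 1]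
      nn_integral_norm_powr_at_top_finite[where 'a='a, of "- real DIM('a) - 2 * s" 1] s
    by (subst nn_integral_add) auto
  finally show ?thesis .
qed

lemma levy_weight_integrable: "0 < s \<Longrightarrow> s < 1 \<Longrightarrow> integrable lborel (levy_weight s :: 'a::euclidean_space \<Rightarrow> real)"
  using levy_weight_finite[where 'a='a] by (intro integrableI_nonneg) auto

lemma second_diff_levy_bound:
  assumes f: "smooth_fun f" "compact_supp f"
  obtains C where "C \<ge> 0" "\<And>x h. \<bar>second_diff f x h\<bar> * frac_kernel s h \<le> C * levy_weight s h"
proof -
  obtain C where C: "C \<ge> 0" "\<And>x h. \<bar>second_diff f x h\<bar> \<le> C * (norm h)\<^sup>2" using second_diff_bound[OF f] by metis
  obtain B where B: "B \<ge> 0" "\<And>x. \<bar>f x\<bar> \<le> B" using smooth_compact_bounded[OF f] by metis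
  have "\<bar>second_diff f x h\<bar> * frac_kernel s h \<le> (C + 4 * B) * levy_weight s h" for x h
  proof -
    have 1: "\<bar>second_diff f x h\<bar> \<le> 4 * B" using B(2)[of x] B(2)[of "x + h"] B(2)[of "x - h"] by (simp add: second_diff_def)
    have "\<bar>second_diff f x h\<bar> \<le> (C + 4 * B) * min 1 ((norm h)\<^sup>2)"
    proof (cases "(norm h)\<^sup>2 \<le> 1")
      case True
      have "C * (norm h)\<^sup>2 \<le> (C + 4 * B) * (norm h)\<^sup>2" using B(1) by (intro mult_right_mono) auto
      then show ?thesis using True C(2)[of x h] by (simp add: min_absorb2)
    next
      case False
      then show ?thesis using 1 C(1) by (simp add: min_absorb1)
    qed
    then have "\<bar>second_diff f x h\<bar> * frac_kernel s h \<le> (C + 4 * B) * min 1 ((norm h)\<^sup>2) * frac_kernel s h"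
      by (intro mult_right_mono) auto
    then show ?thesis by (simp add: levy_weight_def mult.assoc)
  qed
  then show ?thesis using that[of "C + 4 * B"] C(1) B(1) by simp
qed

text \<open>The region \<open>|h| > \<epsilon>\<close> is invariant under \<open>h -> - h\<close>,
  so the truncated integral is half the truncated integral of the second difference. The latter has
  an integrable majorant, and dominated convergence identifies the limit at
  \<open>\<epsilon> -> 0\<close>.\<close>

lemma frac_lap_eq_nonlocal:
  fixes \<phi> :: "'a::euclidean_space \<Rightarrow> real"
  assumes s: "0 < s" "s < 1" and \<phi>: "smooth_fun \<phi>" "compact_supp \<phi>"
  shows "frac_lap s \<phi> x = frac_const DIM('a) s / 2 * nonlocal s \<phi> x"
proof -
  have m [measurable]: "\<phi> \<in> borel_measurable borel" by (rule smooth_fun_measurable[OF \<phi>(1)])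
  obtain C where C: "C \<ge> 0" "\<And>x h. \<bar>second_diff \<phi> x h\<bar> * frac_kernel s h \<le> C * levy_weight s h"
    using second_diff_levy_bound[OF \<phi>] by metis
  obtain B where B: "B \<ge> 0" "\<And>x. \<bar>\<phi> x\<bar> \<le> B" using smooth_compact_bounded[OF \<phi>] by metis
  define J where "J e = (\<integral>h. indicator {e<..} (norm h) * (second_diff \<phi> x h * frac_kernel s h) \<partial>lborel)" for e
  have sd [measurable]: "second_diff \<phi> x \<in> borel_measurable borel" unfolding second_diff_def by measurable
  have cut: "(LINT y : {y. dist x y > e} | lebesgue. (\<phi> x - \<phi> y) / dist x y powr (real DIM('a) + 2 * s)) = J e / 2" if e: "e > 0" for e
  proof -
    define f where "f h = indicator {e<..} (norm h) * ((\<phi> x - \<phi> (x + h)) * frac_kernel s h)" for h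
    have [measurable]: "f \<in> borel_measurable borel" unfolding f_def by measurable
    have fin: "integrable lborel (\<lambda>h::'a. 2 * B * (norm h powr (- real DIM('a) - 2 * s) * indicator {e..} (norm h)))"
    proof (intro integrable_mult_right integrableI_nonneg)
      have "(\<integral>\<^sup>+(h::'a). ennreal (norm h powr (- real DIM('a) - 2 * s) * indicator {e..} (norm h)) \<partial>lborel)
        = (\<integral>\<^sup>+(h::'a). ennreal (norm h powr (- real DIM('a) - 2 * s)) * indicator {e..} (norm h) \<partial>lborel)"
        by (intro nn_integral_cong) (auto simp: indicator_def)
      then show "(\<integral>\<^sup>+(h::'a). ennreal (norm h powr (- real DIM('a) - 2 * s) * indicator {e..} (norm h)) \<partial>lborel) < \<infinity>"
        using nn_integral_norm_powr_at_top_finite[where 'a='a, of "- real DIM('a) - 2 * s" e] s e by simp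
    qed auto
    have fi: "integrable lborel f"
    proof (rule Bochner_Integration.integrable_bound[OF fin])
      show "AE h in lborel. norm (f h) \<le> norm (2 * B * (norm h powr (- real DIM('a) - 2 * s) * indicator {e..} (norm h)))"
      proof (rule AE_I2)
        fix h :: 'a
        have "\<bar>\<phi> x - \<phi> (x + h)\<bar> \<le> 2 * B" using B(2)[of x] B(2)[of "x + h"] by simp
        then show "norm (f h) \<le> norm (2 * B * (norm h powr (- real DIM('a) - 2 * s) * indicator {e..} (norm h)))"
          using B(1) by (auto simp: f_def abs_mult frac_kernel_def indicator_def intro!: mult_right_mono)
      qed
    qed simp
    have fi': "integrable lborel (\<lambda>h. f (- h))"
      using integrable_lborel_reflect[OF fi, of 0] by simp
    have "(LINT y : {y. dist x y > e} | lebesgue. (\<phi> x - \<phi> y) / dist x y powr (real DIM('a) + 2 * s))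
      = (\<integral>y. f (- x + y) \<partial>lebesgue)"
      unfolding set_lebesgue_integral_def
    proof (rule Bochner_Integration.integral_cong[OF refl])
      fix y
      have d: "dist x y = norm (y - x)" by (simp add: dist_norm norm_minus_commute)
      have "norm (y - x) powr (- real DIM('a) - 2 * s) = inverse (norm (y - x) powr (real DIM('a) + 2 * s))"
        by (subst powr_minus[symmetric]) simp
      then show "indicator {y. dist x y > e} y *\<^sub>R ((\<phi> x - \<phi> y) / dist x y powr (real DIM('a) + 2 * s)) = f (- x + y)"
        by (simp add: f_def frac_kernel_def d indicator_def divide_inverse)
    qed
    also have "\<dots> = (\<integral>y. f (- x + y) \<partial>lborel)" by (rule integral_completion) measurable
    also have "\<dots> = (\<integral>h. f h \<partial>lborel)" using integral_lborel_affine[of 1 f "- x"] by simp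
    finally have I: "(LINT y : {y. dist x y > e} | lebesgue. (\<phi> x - \<phi> y) / dist x y powr (real DIM('a) + 2 * s)) = (\<integral>h. f h \<partial>lborel)" .
    have "2 * (\<integral>h. f h \<partial>lborel) = (\<integral>h. f h \<partial>lborel) + (\<integral>h. f (- h) \<partial>lborel)"
      using integral_lborel_reflect[of f 0] by simp
    also have "\<dots> = (\<integral>h. f h + f (- h) \<partial>lborel)"
      using fi fi' by simp
    also have "\<dots> = J e"
      unfolding J_def by (intro Bochner_Integration.integral_cong) (auto simp: f_def second_diff_def frac_kernel_def algebra_simps)
    finally show ?thesis unfolding I by simp
  qed
  have lim: "(J \<longlongrightarrow> nonlocal s \<phi> x) (at_right 0)"
    unfolding tendsto_at_iff_sequentially
  proof (intro allI impI)
    fix X :: "nat \<Rightarrow> real" assume X: "\<forall>i. X i \<in> {0<..} - {0}" "X \<longlonglongrightarrow> 0"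
    have "(\<lambda>n. J (X n)) \<longlonglongrightarrow> nonlocal s \<phi> x"
      unfolding J_def nonlocal_def
    proof (rule Bochner_Integration.integral_dominated_convergence[where w="\<lambda>h. C * levy_weight s h"])
      show "integrable lborel (\<lambda>h::'a. C * levy_weight s h)" using levy_weight_integrable[OF s, where 'a='a] by simp
      show "AE h in lborel. (\<lambda>n. indicator {X n<..} (norm h) * (second_diff \<phi> x h * frac_kernel s h)) \<longlonglongrightarrow> second_diff \<phi> x h * frac_kernel s h"
      proof (rule AE_I2)
        fix h :: 'a
        show "(\<lambda>n. indicator {X n<..} (norm h) * (second_diff \<phi> x h * frac_kernel s h)) \<longlonglongrightarrow> second_diff \<phi> x h * frac_kernel s h"
        proof (cases "h = 0")
          case True then show ?thesis by (simp add: frac_kernel_def)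
        next
          case False
          then have ev: "eventually (\<lambda>n. X n < norm h) sequentially" using order_tendstoD(2)[OF X(2), of "norm h"] by simp
          show ?thesis by (rule tendsto_eventually, rule eventually_mono[OF ev]) simp
        qed
      qed
      show "AE h in lborel. norm (indicator {X n<..} (norm h) * (second_diff \<phi> x h * frac_kernel s h)) \<le> C * levy_weight s h" for n
        using C by (auto simp: abs_mult indicator_def intro!: mult_nonneg_nonneg)
    qed measurable
    then show "(J \<circ> X) \<longlonglongrightarrow> nonlocal s \<phi> x" by (simp add: o_def)
  qed
  have "Lim (at_right 0) (\<lambda>e. LINT y : {y. dist x y > e} | lebesgue. (\<phi> x - \<phi> y) / dist x y powr (real DIM('a) + 2 * s)) = nonlocal s \<phi> x / 2"
  proof (rule tendsto_Lim)
    have "eventually (\<lambda>e. J e / 2 = (LINT y : {y. dist x y > e} | lebesgue. (\<phi> x - \<phi> y) / dist x y powr (real DIM('a) + 2 * s))) (at_right 0)"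
      using eventually_at_right_less[of "0::real"] by eventually_elim (simp add: cut)
    then show "((\<lambda>e. LINT y : {y. dist x y > e} | lebesgue. (\<phi> x - \<phi> y) / dist x y powr (real DIM('a) + 2 * s)) \<longlongrightarrow> nonlocal s \<phi> x / 2) (at_right 0)"
      by (rule Lim_transform_eventually[rotated]) (intro tendsto_divide lim tendsto_const, simp)
  qed simp
  then show ?thesis by (simp add: frac_lap_def)
qed

lemma frac_const_pos:
  assumes "0 < s" "s < 1" shows "frac_const N s > 0"
proof -
  have "Gamma (real N / 2 + s) > 0" "Gamma (2 - s) > 0" using assms by (auto intro!: Gamma_real_pos)
  then show ?thesis using assms by (simp add: frac_const_def)
qed

section \<open>Boundedness and integrability of the fractional Laplacian of a test function\<close>

definition nonlocal_abs :: "real \<Rightarrow> ('a::euclidean_space \<Rightarrow> real) \<Rightarrow> 'a \<Rightarrow> real" where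
  "nonlocal_abs s \<phi> x = (\<integral>h. \<bar>second_diff \<phi> x h\<bar> * frac_kernel s h \<partial>lborel)"

lemma nonlocal_measurable:
  assumes [measurable]: "\<phi> \<in> borel_measurable borel"
  shows "nonlocal s \<phi> \<in> borel_measurable borel" "nonlocal_abs s \<phi> \<in> borel_measurable borel"
  unfolding nonlocal_def nonlocal_abs_def second_diff_def by measurable

context
  fixes \<phi> :: "'a::euclidean_space \<Rightarrow> real" and s :: real
  assumes s: "0 < s" "s < 1" and \<phi>: "smooth_fun \<phi>" "compact_supp \<phi>"
begin

lemma integrable_second_diff: "integrable lborel (\<lambda>h. \<bar>second_diff \<phi> x h\<bar> * frac_kernel s h)"
proof -
  note [measurable] = smooth_fun_measurable[OF \<phi>(1)]
  obtain C where C: "C \<ge> 0" "\<And>x h. \<bar>second_diff \<phi> x h\<bar> * frac_kernel s h \<le> C * levy_weight s h"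
    using second_diff_levy_bound[OF \<phi>] by metis
  have [measurable]: "second_diff \<phi> x \<in> borel_measurable borel" unfolding second_diff_def by measurable
  show ?thesis
    by (rule Bochner_Integration.integrable_bound[where f="\<lambda>h::'a. C * levy_weight s h"])
       (use C levy_weight_integrable[OF s] in \<open>auto simp: abs_mult\<close>)
qed

lemma nonlocal_abs_bounded:
  obtains M where "M \<ge> 0" "\<And>x. nonlocal_abs s \<phi> x \<le> M"
proof -
  obtain C where C: "C \<ge> 0" "\<And>x h. \<bar>second_diff \<phi> x h\<bar> * frac_kernel s h \<le> C * levy_weight s h"
    using second_diff_levy_bound[OF \<phi>] by metis
  have "nonlocal_abs s \<phi> x \<le> (\<integral>h. C * levy_weight s (h::'a) \<partial>lborel)" for x
    unfolding nonlocal_abs_def using C levy_weight_integrable[OF s]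
    by (intro integral_mono integrable_second_diff) auto
  moreover have "(\<integral>h. C * levy_weight s (h::'a) \<partial>lborel) \<ge> 0" using C by (intro Bochner_Integration.integral_nonneg) auto
  ultimately show ?thesis using that by blast
qed

lemma nonlocal_le_abs: "\<bar>nonlocal s \<phi> x\<bar> \<le> nonlocal_abs s \<phi> x"
proof -
  have "\<bar>nonlocal s \<phi> x\<bar> \<le> (\<integral>h. norm (second_diff \<phi> x h * frac_kernel s h) \<partial>lborel)"
    unfolding nonlocal_def real_norm_def[symmetric] by (rule integral_norm_bound)
  then show ?thesis by (simp add: nonlocal_abs_def abs_mult)
qed

lemma nn_integral_second_diff: "(\<integral>\<^sup>+h. ennreal (\<bar>second_diff \<phi> x h\<bar> * frac_kernel s h) \<partial>lborel) = ennreal (nonlocal_abs s \<phi> x)"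
  unfolding nonlocal_abs_def by (intro nn_integral_eq_integral integrable_second_diff) auto

lemma test_function_integrable: "integrable lborel \<phi>"
proof -
  note [measurable] = smooth_fun_measurable[OF \<phi>(1)]
  obtain R where R: "R > 0" "\<And>x. norm x > R \<Longrightarrow> \<phi> x = 0" using compact_supp_obtain[OF \<phi>(2)] by metis
  obtain B where B: "B \<ge> 0" "\<And>x. \<bar>\<phi> x\<bar> \<le> B" using smooth_compact_bounded[OF \<phi>] by metis
  have "integrable lborel (\<lambda>x::'a. B * indicator (cball 0 R) x)"
    using emeasure_lborel_cball_finite[of "0::'a" R] by (intro integrable_mult_right integrable_real_indicator) (auto simp: less_top)
  then show ?thesis
    by (rule Bochner_Integration.integrable_bound) (use B R in \<open>auto simp: indicator_def not_le\<close>)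
qed

text \<open>By Tonelli's theorem it is enough to bound the integral over \<open>x\<close> of the
  second difference by a multiple of \<open>min 1 (|h|^2)\<close>. For \<open>|h| \<le> 1\<close> it
  is \<open>O(|h|^2)\<close> and supported in the ball of radius \<open>R + 1\<close>; for larger
  \<open>h\<close> translation invariance gives four times the integral of
  \<open>|\<phi>|\<close>.\<close>

lemma nonlocal_abs_integrable: "integrable lborel (nonlocal_abs s \<phi>)"
proof (rule integrableI_nonneg)
  note [measurable] = smooth_fun_measurable[OF \<phi>(1)]
  show "nonlocal_abs s \<phi> \<in> borel_measurable lborel" using nonlocal_measurable(2)[OF smooth_fun_measurable[OF \<phi>(1)]] by simp
  show "AE x in lborel. 0 \<le> nonlocal_abs s \<phi> x"
    unfolding nonlocal_abs_def by (intro AE_I2 Bochner_Integration.integral_nonneg) auto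
  obtain R where R: "R > 0" "\<And>x. norm x > R \<Longrightarrow> \<phi> x = 0" using compact_supp_obtain[OF \<phi>(2)] by metis
  obtain C where C: "C \<ge> 0" "\<And>x h. \<bar>second_diff \<phi> x h\<bar> \<le> C * (norm h)\<^sup>2" using second_diff_bound[OF \<phi>] by metis
  define m where "m = emeasure lborel (cball (0::'a) (R + 1))"
  define I where "I = (\<integral>\<^sup>+x. ennreal \<bar>\<phi> x\<bar> \<partial>lborel)"
  have fin: "m < \<infinity>" "I < \<infinity>"
    using emeasure_lborel_cball_finite[of "0::'a" "R + 1"] test_function_integrable
    by (auto simp: m_def I_def less_top integrable_iff_bounded)
  have shift: "(\<integral>\<^sup>+x. ennreal \<bar>second_diff \<phi> x h\<bar> \<partial>lborel) \<le> 4 * I" for h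
  proof -
    have "(\<integral>\<^sup>+x. ennreal \<bar>second_diff \<phi> x h\<bar> \<partial>lborel) \<le> (\<integral>\<^sup>+x. 2 * ennreal \<bar>\<phi> x\<bar> + (ennreal \<bar>\<phi> (h + x)\<bar> + ennreal \<bar>\<phi> (- h + x)\<bar>) \<partial>lborel)"
    proof (rule nn_integral_mono)
      fix x
      have "\<bar>second_diff \<phi> x h\<bar> \<le> 2 * \<bar>\<phi> x\<bar> + (\<bar>\<phi> (h + x)\<bar> + \<bar>\<phi> (- h + x)\<bar>)"
        by (simp add: second_diff_def add.commute)
      then have "ennreal \<bar>second_diff \<phi> x h\<bar> \<le> ennreal (2 * \<bar>\<phi> x\<bar> + (\<bar>\<phi> (h + x)\<bar> + \<bar>\<phi> (- h + x)\<bar>))" by (rule ennreal_leI)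
      then show "ennreal \<bar>second_diff \<phi> x h\<bar> \<le> 2 * ennreal \<bar>\<phi> x\<bar> + (ennreal \<bar>\<phi> (h + x)\<bar> + ennreal \<bar>\<phi> (- h + x)\<bar>)"
        by (simp add: ennreal_mult)
    qed
    also have "\<dots> = 2 * I + ((\<integral>\<^sup>+x. ennreal \<bar>\<phi> (h + x)\<bar> \<partial>lborel) + (\<integral>\<^sup>+x. ennreal \<bar>\<phi> (- h + x)\<bar> \<partial>lborel))"
      unfolding I_def by (simp add: nn_integral_add nn_integral_cmult)
    also have "\<dots> = 2 * I + (I + I)"
      unfolding I_def using nn_integral_lborel_translate[of "\<lambda>x. ennreal \<bar>\<phi> x\<bar>" h] nn_integral_lborel_translate[of "\<lambda>x. ennreal \<bar>\<phi> x\<bar>" "- h"]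
      by simp
    also have "\<dots> = 4 * I" by (simp add: mult_2[symmetric] mult.assoc[symmetric])
    finally show ?thesis .
  qed
  have small: "(\<integral>\<^sup>+x. ennreal \<bar>second_diff \<phi> x h\<bar> \<partial>lborel) \<le> ennreal (C * (norm h)\<^sup>2) * m" if h: "norm h \<le> 1" for h
  proof -
    have "(\<integral>\<^sup>+x. ennreal \<bar>second_diff \<phi> x h\<bar> \<partial>lborel) \<le> (\<integral>\<^sup>+(x::'a). ennreal (C * (norm h)\<^sup>2) * indicator (cball 0 (R + 1)) x \<partial>lborel)"
    proof (rule nn_integral_mono)
      fix x
      show "ennreal \<bar>second_diff \<phi> x h\<bar> \<le> ennreal (C * (norm h)\<^sup>2) * indicator (cball 0 (R + 1)) x"
      proof (cases "norm x \<le> R + 1")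
        case True then show ?thesis using C(2)[of x h] by (auto intro: ennreal_leI)
      next
        case False
        have "norm x - norm h \<le> norm (x + h)" "norm x - norm h \<le> norm (x - h)"
          using norm_diff_ineq[of x h] norm_triangle_ineq2[of x h] by auto
        then have "\<phi> x = 0" "\<phi> (x + h) = 0" "\<phi> (x - h) = 0" using False h by (auto intro!: R(2))
        then show ?thesis by (simp add: second_diff_def)
      qed
    qed
    also have "\<dots> = ennreal (C * (norm h)\<^sup>2) * m" by (simp add: m_def nn_integral_cmult_indicator)
    finally show ?thesis .
  qed
  have "(\<integral>\<^sup>+x. ennreal (nonlocal_abs s \<phi> x) \<partial>lborel) = (\<integral>\<^sup>+x. \<integral>\<^sup>+h. ennreal (\<bar>second_diff \<phi> x h\<bar> * frac_kernel s h) \<partial>lborel \<partial>lborel)"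
    by (simp only: nn_integral_second_diff)
  also have "\<dots> = (\<integral>\<^sup>+h. \<integral>\<^sup>+x. ennreal (\<bar>second_diff \<phi> x h\<bar> * frac_kernel s h) \<partial>lborel \<partial>lborel)"
    unfolding second_diff_def by (rule lborel_pair.Fubini'[symmetric]) measurable
  also have "\<dots> \<le> (\<integral>\<^sup>+h. (ennreal C * m + 4 * I) * ennreal (levy_weight s (h::'a)) \<partial>lborel)"
  proof (rule nn_integral_mono)
    fix h :: 'a
    have [measurable]: "(\<lambda>x. second_diff \<phi> x h) \<in> borel_measurable borel" unfolding second_diff_def by measurable
    have "(\<integral>\<^sup>+x. ennreal (\<bar>second_diff \<phi> x h\<bar> * frac_kernel s h) \<partial>lborel) = (\<integral>\<^sup>+x. ennreal \<bar>second_diff \<phi> x h\<bar> \<partial>lborel) * ennreal (frac_kernel s h)"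
      by (simp add: ennreal_mult nn_integral_multc)
    also have "\<dots> \<le> (ennreal C * m + 4 * I) * ennreal (levy_weight s h)"
    proof (cases "norm h \<le> 1")
      case True
      then have "min 1 ((norm h)\<^sup>2) = (norm h)\<^sup>2" by (simp add: min_absorb2 abs_square_le_1)
      then have w: "ennreal (levy_weight s h) = ennreal ((norm h)\<^sup>2) * ennreal (frac_kernel s h)" by (simp add: levy_weight_def ennreal_mult)
      have "(\<integral>\<^sup>+x. ennreal \<bar>second_diff \<phi> x h\<bar> \<partial>lborel) * ennreal (frac_kernel s h) \<le> ennreal (C * (norm h)\<^sup>2) * m * ennreal (frac_kernel s h)"
        using small[OF True] by (rule mult_right_mono) simp
      also have "\<dots> = ennreal C * m * ennreal (levy_weight s h)"
        unfolding w using C(1) by (simp add: ennreal_mult mult_ac)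
      also have "\<dots> \<le> (ennreal C * m + 4 * I) * ennreal (levy_weight s h)" by (intro mult_right_mono) auto
      finally show ?thesis .
    next
      case False
      then have "min 1 ((norm h)\<^sup>2) = 1" by (simp add: min_absorb1 one_le_power)
      then have w: "levy_weight s h = frac_kernel s h" by (simp add: levy_weight_def)
      have "(\<integral>\<^sup>+x. ennreal \<bar>second_diff \<phi> x h\<bar> \<partial>lborel) * ennreal (frac_kernel s h) \<le> 4 * I * ennreal (frac_kernel s h)"
        using shift by (rule mult_right_mono) simp
      also have "\<dots> \<le> (ennreal C * m + 4 * I) * ennreal (levy_weight s h)" unfolding w by (intro mult_right_mono) auto
      finally show ?thesis .
    qed
    finally show "(\<integral>\<^sup>+x. ennreal (\<bar>second_diff \<phi> x h\<bar> * frac_kernel s h) \<partial>lborel) \<le> (ennreal C * m + 4 * I) * ennreal (levy_weight s h)" .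
  qed
  also have "\<dots> = (ennreal C * m + 4 * I) * (\<integral>\<^sup>+h. ennreal (levy_weight s (h::'a)) \<partial>lborel)"
    by (rule nn_integral_cmult) measurable
  also have "\<dots> < \<infinity>" using fin levy_weight_finite[OF s, where 'a='a]
    by (auto simp: ennreal_mult_less_top)
  finally show "(\<integral>\<^sup>+x. ennreal (nonlocal_abs s \<phi> x) \<partial>lborel) < \<infinity>" .
qed

lemma nonlocal_integrable: "integrable lborel (nonlocal s \<phi>)"
  by (rule Bochner_Integration.integrable_bound[OF nonlocal_abs_integrable])
     (use nonlocal_le_abs nonlocal_measurable(1)[OF smooth_fun_measurable[OF \<phi>(1)]] in \<open>auto intro: order_trans[OF _ abs_ge_self]\<close>)

end

section \<open>Riesz potentials invert the fractional Laplacian\<close>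

definition heat :: "real \<Rightarrow> ('a::euclidean_space \<Rightarrow> real) \<Rightarrow> 'a \<Rightarrow> real" where
  "heat t f x = (\<integral>y. gauss t (x - y) * f y \<partial>lborel)"

lemma heat_measurable [measurable]:
  assumes [measurable]: "f \<in> borel_measurable borel" "t \<in> borel_measurable M" "g \<in> borel_measurable M"
  shows "(\<lambda>x. heat (t x) f (g x)) \<in> borel_measurable M"
  unfolding heat_def by measurable

lemma heat_conv:
  assumes [measurable]: "f \<in> borel_measurable borel"
  shows "heat t f x = (\<integral>y. gauss t y * f (x - y) \<partial>lborel)"
  unfolding heat_def using integral_lborel_reflect[of "\<lambda>y. gauss t (x - y) * f y" x] by simp

lemma heat_nn_bound:
  fixes f :: "'a::euclidean_space \<Rightarrow> real"
  assumes f [measurable]: "f \<in> borel_measurable borel" and B: "\<And>x. \<bar>f x\<bar> \<le> B" and t: "t > 0"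
  shows "(\<integral>\<^sup>+y. ennreal (gauss t (x - y) * \<bar>f y\<bar>) \<partial>lborel) \<le> ennreal B"
proof -
  have "(\<integral>\<^sup>+y. ennreal (gauss t (x - y) * \<bar>f y\<bar>) \<partial>lborel) \<le> (\<integral>\<^sup>+y. ennreal (gauss t (x - y)) * ennreal B \<partial>lborel)"
    using B by (intro nn_integral_mono) (auto simp: ennreal_mult intro!: mult_left_mono ennreal_leI)
  also have "\<dots> = (\<integral>\<^sup>+y. ennreal (gauss t (x - y)) \<partial>lborel) * ennreal B"
    by (rule nn_integral_multc) measurable
  also have "(\<integral>\<^sup>+y. ennreal (gauss t (x - y)) \<partial>lborel) = (\<integral>\<^sup>+y. ennreal (gauss t (y::'a)) \<partial>lborel)"
    by (rule nn_integral_lborel_reflect) measurable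
  finally show ?thesis by (simp add: gauss_mass[OF t])
qed

lemma heat_integrand_integrable:
  assumes f [measurable]: "f \<in> borel_measurable borel" and B: "\<And>x. \<bar>f x\<bar> \<le> B" and t: "t > 0"
  shows "integrable lborel (\<lambda>y. gauss t (x - y) * f y)"
  using order.strict_trans1[OF heat_nn_bound[OF f B t], of "\<infinity>"]
  by (intro integrableI_bounded) (auto simp: abs_mult)

lemma heat_bound:
  assumes f [measurable]: "f \<in> borel_measurable borel" and B: "\<And>x. \<bar>f x\<bar> \<le> B" and t: "t > 0"
  shows "\<bar>heat t f x\<bar> \<le> B"
proof -
  have "B \<ge> 0" using B[of undefined] by (rule order_trans[OF abs_ge_zero])
  moreover have "ennreal \<bar>heat t f x\<bar> \<le> (\<integral>\<^sup>+y. ennreal (norm (gauss t (x - y) * f y)) \<partial>lborel)"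
    unfolding heat_def real_norm_def[symmetric]
    by (intro integral_norm_bound_ennreal heat_integrand_integrable[OF f B t])
  ultimately show ?thesis
    using order_trans[OF _ heat_nn_bound[OF f B t], of "ennreal \<bar>heat t f x\<bar>" x] by (simp add: abs_mult)
qed

lemma heat_pair_integrable:
  fixes f :: "'a::euclidean_space \<Rightarrow> real"
  assumes f: "integrable lborel f" and t: "t > 0"
    and g [measurable]: "g \<in> borel_measurable borel" and B: "\<And>x. \<bar>g x\<bar> \<le> B"
  shows "integrable (lborel \<Otimes>\<^sub>M lborel) (\<lambda>p. g (snd p) * (gauss t (snd p - fst p) * f (fst p)))"
proof (rule integrable_lborel_pairI)
  have m [measurable]: "f \<in> borel_measurable borel" using f by (simp add: borel_measurable_integrable)
  show "(\<lambda>p. g (snd p) * (gauss t (snd p - fst p) * f (fst p))) \<in> borel_measurable borel"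
    unfolding borel_prod[symmetric] by measurable
  have "(\<integral>\<^sup>+y. \<integral>\<^sup>+x. ennreal \<bar>g (snd (y, x)) * (gauss t (snd (y, x) - fst (y, x)) * f (fst (y, x)))\<bar> \<partial>lborel \<partial>lborel)
    = (\<integral>\<^sup>+y. ennreal \<bar>f y\<bar> * (\<integral>\<^sup>+x. ennreal (gauss t (y - x) * \<bar>g x\<bar>) \<partial>lborel) \<partial>lborel)"
  proof (rule nn_integral_cong)
    fix y
    have "(\<integral>\<^sup>+x. ennreal \<bar>g (snd (y, x)) * (gauss t (snd (y, x) - fst (y, x)) * f (fst (y, x)))\<bar> \<partial>lborel)
       = (\<integral>\<^sup>+x. ennreal \<bar>f y\<bar> * ennreal (gauss t (y - x) * \<bar>g x\<bar>) \<partial>lborel)"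
      by (intro nn_integral_cong) (simp add: abs_mult ennreal_mult[symmetric] gauss_minus[of t y] mult_ac)
    then show "(\<integral>\<^sup>+x. ennreal \<bar>g (snd (y, x)) * (gauss t (snd (y, x) - fst (y, x)) * f (fst (y, x)))\<bar> \<partial>lborel) = ennreal \<bar>f y\<bar> * (\<integral>\<^sup>+x. ennreal (gauss t (y - x) * \<bar>g x\<bar>) \<partial>lborel)"
      by (simp add: nn_integral_cmult)
  qed
  also have "\<dots> \<le> (\<integral>\<^sup>+y. ennreal \<bar>f y\<bar> * ennreal B \<partial>lborel)"
    by (intro nn_integral_mono mult_left_mono heat_nn_bound[OF g B t]) auto
  also have "\<dots> < \<infinity>" using f by (simp add: nn_integral_multc integrable_iff_bounded ennreal_mult_less_top)
  finally show "(\<integral>\<^sup>+y. \<integral>\<^sup>+x. ennreal \<bar>g (snd (y, x)) * (gauss t (snd (y, x) - fst (y, x)) * f (fst (y, x)))\<bar> \<partial>lborel \<partial>lborel) < \<infinity>" .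
qed

lemma heat_integrable:
  assumes f: "integrable lborel f" and t: "t > 0"
  shows "integrable lborel (heat t f)"
proof -
  have "integrable (lborel \<Otimes>\<^sub>M lborel) (\<lambda>p. 1 * (gauss t (snd p - fst p) * f (fst p)))"
    by (rule heat_pair_integrable[OF f t, of "\<lambda>_. 1" 1]) auto
  then have "integrable lborel (\<lambda>x. \<integral>y. gauss t (x - y) * f y \<partial>lborel)"
    by (intro lborel_pair.integrable_snd) (simp add: case_prod_unfold)
  then show ?thesis by (simp add: heat_def[abs_def])
qed

lemma heat_heat:
  fixes f :: "'a::euclidean_space \<Rightarrow> real"
  assumes f: "integrable lborel f" and a: "a > 0" and b: "b > 0"
  shows "heat a (heat b f) x = heat (a + b) f x"
proof -
  have m [measurable]: "f \<in> borel_measurable borel" using f by (simp add: borel_measurable_integrable)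
  define C where "C = a powr (- real DIM('a) / 2) / gauss_norm TYPE('a)"
  have "integrable (lborel \<Otimes>\<^sub>M lborel) (\<lambda>p. gauss a (x - snd p) * (gauss b (snd p - fst p) * f (fst p)))"
    by (rule heat_pair_integrable[OF f b, of _ C]) (use gauss_le[OF a] in \<open>auto simp: C_def\<close>)
  then have "(\<integral>z. \<integral>y. gauss a (x - z) * (gauss b (z - y) * f y) \<partial>lborel \<partial>lborel) = (\<integral>y. \<integral>z. gauss a (x - z) * (gauss b (z - y) * f y) \<partial>lborel \<partial>lborel)"
    by (intro lborel_pair.Fubini_integral) (simp add: case_prod_unfold)
  moreover have "(\<integral>z. gauss a (x - z) * (gauss b (z - y) * f y) \<partial>lborel) = gauss (a + b) (x - y) * f y" for y
  proof -
    have "(\<integral>z. gauss a (x - z) * gauss b (z - y) \<partial>lborel) = (\<integral>z. gauss a (x - (y + z)) * gauss b ((y + z) - y) \<partial>lborel)"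
      using integral_lborel_affine[of 1 "\<lambda>z. gauss a (x - z) * gauss b (z - y)" y] by simp
    also have "\<dots> = (\<integral>z. gauss a ((x - y) - z) * gauss b z \<partial>lborel)" by (simp add: algebra_simps)
    also have "\<dots> = gauss (a + b) (x - y)"
      using gauss_semigroup[OF a b, of "x - y"] by (subst integral_eq_nn_integral) auto
    finally have 1: "(\<integral>z. gauss a (x - z) * gauss b (z - y) \<partial>lborel) = gauss (a + b) (x - y)" .
    have "(\<integral>z. gauss a (x - z) * (gauss b (z - y) * f y) \<partial>lborel) = (\<integral>z. (gauss a (x - z) * gauss b (z - y)) * f y \<partial>lborel)"
      by (simp only: mult.assoc)
    then show ?thesis using 1 by simp
  qed
  ultimately show ?thesis by (simp add: heat_def)
qed

section \<open>Bounds and heat representation for Riesz potentials\<close>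

definition riesz_near :: "'a::euclidean_space itself \<Rightarrow> real \<Rightarrow> ennreal" where
  "riesz_near _ s = (\<integral>\<^sup>+(w::'a). ennreal (riesz s w) * indicator {0<..1} (norm w) \<partial>lborel)"

lemma riesz_near_finite:
  assumes "0 < s" shows "riesz_near TYPE('a::euclidean_space) s < \<infinity>"
  unfolding riesz_near_def riesz_def using nn_integral_norm_powr_ball_finite[where 'a='a, of "2 * s - real DIM('a)" 1] assms
  by simp

text \<open>The kernel is split at distance one: the near part is integrable and meets the bound
  \<open>B\<close>, whereas the far part is at most one because \<open>2 s < N\<close> and meets the
  integral of \<open>f\<close>. The result is uniform in \<open>x\<close>.\<close>

lemma riesz_nn_bound:
  fixes f :: "'a::euclidean_space \<Rightarrow> ennreal"
  assumes s: "2 * s < real DIM('a)" and f [measurable]: "f \<in> borel_measurable borel" and B: "\<And>x. f x \<le> B"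
  shows "(\<integral>\<^sup>+y. ennreal (riesz s (x - y)) * f y \<partial>lborel) \<le> riesz_near TYPE('a) s * B + (\<integral>\<^sup>+y. f y \<partial>lborel)"
proof -
  have "(\<integral>\<^sup>+y. ennreal (riesz s (x - y)) * f y \<partial>lborel) \<le> (\<integral>\<^sup>+y. (ennreal (riesz s (x - y)) * indicator {0<..1} (norm (x - y))) * B + f y \<partial>lborel)"
  proof (rule nn_integral_mono)
    fix y
    consider "norm (x - y) = 0" | "0 < norm (x - y)" "norm (x - y) \<le> 1" | "norm (x - y) > 1" using norm_ge_zero[of "x - y"] by linarith
    then show "ennreal (riesz s (x - y)) * f y \<le> (ennreal (riesz s (x - y)) * indicator {0<..1} (norm (x - y))) * B + f y"
    proof cases
      case 1 then show ?thesis by (simp add: riesz_def)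
    next
      case 2
      then have "ennreal (riesz s (x - y)) * f y \<le> (ennreal (riesz s (x - y)) * indicator {0<..1} (norm (x - y))) * B"
        using B by (auto intro: mult_left_mono)
      then show ?thesis by (rule add_increasing2[rotated]) simp
    next
      case 3
      then have "riesz s (x - y) \<le> norm (x - y) powr 0" unfolding riesz_def using s by (intro powr_mono) auto
      then have "ennreal (riesz s (x - y)) * f y \<le> 1 * f y" using 3 by (intro mult_right_mono) (auto simp: ennreal_le_1 split: if_splits)
      then show ?thesis by (auto intro: add_increasing)
    qed
  qed
  also have "\<dots> = (\<integral>\<^sup>+y. ennreal (riesz s (x - y)) * indicator {0<..1} (norm (x - y)) \<partial>lborel) * B + (\<integral>\<^sup>+y. f y \<partial>lborel)"
    by (simp add: nn_integral_add nn_integral_multc)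
  also have "(\<integral>\<^sup>+y. ennreal (riesz s (x - y)) * indicator {0<..1} (norm (x - y)) \<partial>lborel) = riesz_near TYPE('a) s"
    unfolding riesz_near_def by (rule nn_integral_lborel_reflect) measurable
  finally show ?thesis .
qed

lemma riesz_nn_bound_real:
  fixes f :: "'a::euclidean_space \<Rightarrow> real"
  assumes s: "0 < s" "2 * s < real DIM('a)" and f: "integrable lborel f" and B: "\<And>x. \<bar>f x\<bar> \<le> B"
  obtains M where "M \<ge> 0" "\<And>x. (\<integral>\<^sup>+y. ennreal (riesz s (x - y) * \<bar>f y\<bar>) \<partial>lborel) \<le> ennreal M"
proof -
  have m [measurable]: "f \<in> borel_measurable borel" using f by (simp add: borel_measurable_integrable)
  let ?M = "riesz_near TYPE('a) s * ennreal B + (\<integral>\<^sup>+y. ennreal \<bar>f y\<bar> \<partial>lborel)"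
  have fin: "?M < \<infinity>" using riesz_near_finite[OF s(1), where 'a='a] f
    by (auto simp: ennreal_mult_less_top integrable_iff_bounded)
  have "(\<integral>\<^sup>+y. ennreal (riesz s (x - y) * \<bar>f y\<bar>) \<partial>lborel) \<le> ?M" for x
    using riesz_nn_bound[OF s(2), of "\<lambda>y. ennreal \<bar>f y\<bar>" "ennreal B" x] B by (simp add: ennreal_mult ennreal_leI)
  then show ?thesis using that[of "enn2real ?M"] fin by simp
qed

lemma riesz_integrable:
  fixes f :: "'a::euclidean_space \<Rightarrow> real"
  assumes s: "0 < s" "2 * s < real DIM('a)" and f: "integrable lborel f" and B: "\<And>x. \<bar>f x\<bar> \<le> B"
  shows "integrable lborel (\<lambda>y. riesz s (x - y) * f y)"
proof -
  have m [measurable]: "f \<in> borel_measurable borel" using f by (simp add: borel_measurable_integrable)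
  obtain M where M: "\<And>x. (\<integral>\<^sup>+y. ennreal (riesz s (x - y) * \<bar>f y\<bar>) \<partial>lborel) \<le> ennreal M"
    using riesz_nn_bound_real[OF s f B] by metis
  have "(\<integral>\<^sup>+y. ennreal (riesz s (x - y) * \<bar>f y\<bar>) \<partial>lborel) < \<infinity>"
    by (rule order.strict_trans1[OF M]) simp
  then show ?thesis by (intro integrableI_bounded) (auto simp: abs_mult)
qed

text \<open>Subordination inside the convolution: the Riesz potential is the negative power of the
  Laplacian written as a Mellin transform of the heat semigroup.\<close>

lemma riesz_potential_heat:
  fixes f :: "'a::euclidean_space \<Rightarrow> real"
  assumes s: "0 < s" "2 * s < real DIM('a)" and f: "integrable lborel f" and B: "\<And>x. \<bar>f x\<bar> \<le> B"
  shows "integrable lborel (\<lambda>t. indicator {0<..} t * (t powr (s - 1) * heat t f x))"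
    and "subord_const TYPE('a) s * (\<integral>y. riesz s (x - y) * f y \<partial>lborel) = (\<integral>t. indicator {0<..} t * (t powr (s - 1) * heat t f x) \<partial>lborel)"
proof -
  have m [measurable]: "f \<in> borel_measurable borel" using f by (simp add: borel_measurable_integrable)
  define c where "c = subord_const TYPE('a) s"
  have c: "c > 0" using subord_const(2)[OF s(2)] by (simp add: c_def)
  define K where "K p = (indicator {0<..} (snd p) * (snd p powr (s - 1) * gauss (snd p) (x - fst p))) * f (fst p)" for p :: "'a \<times> real"
  have Km [measurable]: "K \<in> borel_measurable borel" unfolding K_def borel_prod[symmetric] by measurable
  have inner: "(\<integral>\<^sup>+t. ennreal (indicator {0<..} t * (t powr (s - 1) * gauss t (x - y))) \<partial>lborel) = ennreal (c * riesz s (x - y))"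
    if "x \<noteq> y" for y
  proof -
    have "(\<integral>\<^sup>+t. ennreal (indicator {0<..} t * (t powr (s - 1) * gauss t (x - y))) \<partial>lborel) = (\<integral>\<^sup>+t. ennreal (t powr (s - 1) * gauss t (x - y)) * indicator {0<..} t \<partial>lborel)"
      by (intro nn_integral_cong) (auto simp: indicator_def)
    then show ?thesis unfolding c_def using riesz_subordination[OF s(2), of "x - y"] that by simp
  qed
  have neq: "AE y in lborel. x \<noteq> y" using AE_lborel_singleton[of x] by eventually_elim auto
  have "(\<integral>\<^sup>+y. \<integral>\<^sup>+t. ennreal \<bar>K (y, t)\<bar> \<partial>lborel \<partial>lborel) = (\<integral>\<^sup>+y. ennreal c * ennreal (riesz s (x - y) * \<bar>f y\<bar>) \<partial>lborel)"
  proof (rule nn_integral_cong_AE)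
    show "AE y in lborel. (\<integral>\<^sup>+t. ennreal \<bar>K (y, t)\<bar> \<partial>lborel) = ennreal c * ennreal (riesz s (x - y) * \<bar>f y\<bar>)"
      using neq
    proof eventually_elim
      case (elim y)
      have "(\<integral>\<^sup>+t. ennreal \<bar>K (y, t)\<bar> \<partial>lborel) = (\<integral>\<^sup>+t. ennreal (indicator {0<..} t * (t powr (s - 1) * gauss t (x - y))) * ennreal \<bar>f y\<bar> \<partial>lborel)"
        by (intro nn_integral_cong) (simp add: K_def abs_mult ennreal_mult[symmetric])
      also have "\<dots> = ennreal (c * riesz s (x - y)) * ennreal \<bar>f y\<bar>"
        using inner[OF elim] by (simp add: nn_integral_multc)
      finally show ?case using c by (simp add: ennreal_mult mult_ac)
    qed
  qed
  also have "\<dots> < \<infinity>"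
    using riesz_integrable[OF s f B, of x] by (simp add: nn_integral_cmult ennreal_mult_less_top integrable_iff_bounded abs_mult)
  finally have intK: "integrable (lborel \<Otimes>\<^sub>M lborel) K" by (intro integrable_lborel_pairI) auto
  have Kt: "(\<integral>y. K (y, t) \<partial>lborel) = indicator {0<..} t * (t powr (s - 1) * heat t f x)" for t
    by (simp add: K_def heat_def mult.assoc)
  have "integrable lborel (\<lambda>t. \<integral>y. K (y, t) \<partial>lborel)"
    by (rule lborel_pair.integrable_snd) (use intK in \<open>simp add: case_prod_unfold\<close>)
  then show "integrable lborel (\<lambda>t. indicator {0<..} t * (t powr (s - 1) * heat t f x))" by (simp only: Kt)
  have "(\<integral>t. indicator {0<..} t * (t powr (s - 1) * heat t f x) \<partial>lborel) = (\<integral>t. \<integral>y. K (y, t) \<partial>lborel \<partial>lborel)"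
    by (simp only: Kt)
  also have "\<dots> = (\<integral>y. \<integral>t. K (y, t) \<partial>lborel \<partial>lborel)"
    by (rule lborel_pair.Fubini_integral) (use intK in \<open>simp add: case_prod_unfold\<close>)
  also have "\<dots> = (\<integral>y. c * (riesz s (x - y) * f y) \<partial>lborel)"
  proof (rule integral_cong_AE)
    show "AE y in lborel. (\<integral>t. K (y, t) \<partial>lborel) = c * (riesz s (x - y) * f y)"
      using neq
    proof eventually_elim
      case (elim y)
      have "(\<integral>t. indicator {0<..} t * (t powr (s - 1) * gauss t (x - y)) \<partial>lborel) = c * riesz s (x - y)"
        using inner[OF elim] c by (subst integral_eq_nn_integral) auto
      then show ?case by (simp add: K_def)
    qed
    show "(\<lambda>y. \<integral>t. K (y, t) \<partial>lborel) \<in> borel_measurable lborel" unfolding K_def fst_conv snd_conv by measurable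
  qed measurable
  finally show "subord_const TYPE('a) s * (\<integral>y. riesz s (x - y) * f y \<partial>lborel) = (\<integral>t. indicator {0<..} t * (t powr (s - 1) * heat t f x) \<partial>lborel)"
    by (simp add: c_def)
qed

text \<open>The kernel \<open>k\<^sub>1(\<sigma>) = \<sigma>\<^sup>s\<^sup>-\<^sup>1 - (\<sigma> - 1)\<^sub>+\<^sup>s / \<sigma>\<close> is what remains of the product of the two subordination
  measures when the singular one is cut off at \<open>1\<close>; its dilations form an approximate identity at \<open>0\<close>.\<close>

definition inv_kernel :: "real \<Rightarrow> real \<Rightarrow> real" where
  "inv_kernel s \<sigma> = indicator {0<..} \<sigma> * \<sigma> powr (s - 1) - indicator {1<..} \<sigma> * ((\<sigma> - 1) powr s / \<sigma>)"

lemma inv_kernel_measurable [measurable]: "inv_kernel s \<in> borel_measurable borel"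
  unfolding inv_kernel_def by measurable

text \<open>Each of the two terms decays only like \<open>\<sigma>^(s-1)\<close>, which is not
  integrable at infinity; their difference gains a factor \<open>1 / \<sigma>\<close>.\<close>

lemma inv_kernel_bounds:
  assumes s: "0 < s" "s < 1"
  shows "0 \<le> inv_kernel s \<sigma>" "\<sigma> > 1 \<Longrightarrow> inv_kernel s \<sigma> \<le> \<sigma> powr (s - 2)"
proof -
  have up: "(\<sigma> - 1) powr s \<le> \<sigma> powr s" if "\<sigma> > 1" using that s by (intro powr_mono2) auto
  have e: "\<sigma> powr (s - 1) = \<sigma> powr s / \<sigma>" "\<sigma> powr (s - 2) = \<sigma> powr s / \<sigma> / \<sigma>" if "\<sigma> > 1"
    using that by (auto simp: powr_diff power2_eq_square)
  show "0 \<le> inv_kernel s \<sigma>"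
  proof (cases "\<sigma> > 1")
    case True then show ?thesis using up by (simp add: inv_kernel_def e divide_right_mono)
  qed (auto simp: inv_kernel_def)
  show "inv_kernel s \<sigma> \<le> \<sigma> powr (s - 2)" if \<sigma>: "\<sigma> > 1"
  proof -
    \<comment> \<open>With \<open>\<sigma> - 1 = \<sigma> u\<close> the gain follows from
      \<open>u \<le> u^s\<close> on the unit interval.\<close>
    define u where "u = 1 - 1 / \<sigma>"
    have u: "0 \<le> u" "u \<le> 1" "\<sigma> - 1 = \<sigma> * u" using \<sigma> by (auto simp: u_def field_simps)
    have "u powr 1 \<le> u powr s" using u s by (intro powr_mono') auto
    then have "\<sigma> powr s * u \<le> \<sigma> powr s * u powr s" using u by (intro mult_left_mono) auto
    also have "\<dots> = (\<sigma> - 1) powr s" unfolding u(3) using \<sigma> u by (simp add: powr_mult)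
    finally have "\<sigma> powr s - (\<sigma> - 1) powr s \<le> \<sigma> powr s / \<sigma>" by (simp add: u_def algebra_simps)
    then have "(\<sigma> powr s - (\<sigma> - 1) powr s) / \<sigma> \<le> \<sigma> powr s / \<sigma> / \<sigma>" using \<sigma> by (intro divide_right_mono) auto
    then show ?thesis using \<sigma> by (simp add: inv_kernel_def e diff_divide_distrib)
  qed
qed

lemma inv_kernel_integrable:
  assumes s: "0 < s" "s < 1"
  shows "integrable lborel (inv_kernel s)" "(\<integral>\<sigma>. inv_kernel s \<sigma> \<partial>lborel) > 0"
proof -
  have "(\<integral>\<^sup>+\<sigma>. ennreal (inv_kernel s \<sigma>) \<partial>lborel) \<le> (\<integral>\<^sup>+\<sigma>. ennreal (\<sigma> powr (s - 1)) * indicator {0<..1} \<sigma> + ennreal (\<sigma> powr (s - 2)) * indicator {1..} \<sigma> \<partial>lborel)"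
  proof (rule nn_integral_mono)
    fix \<sigma> :: real
    consider "\<sigma> \<le> 0" | "0 < \<sigma>" "\<sigma> \<le> 1" | "\<sigma> > 1" by linarith
    then show "ennreal (inv_kernel s \<sigma>) \<le> ennreal (\<sigma> powr (s - 1)) * indicator {0<..1} \<sigma> + ennreal (\<sigma> powr (s - 2)) * indicator {1..} \<sigma>"
    proof cases
      case 3 then show ?thesis using inv_kernel_bounds(2)[OF s] by (auto intro!: ennreal_leI)
    qed (auto simp: inv_kernel_def)
  qed
  also have "\<dots> < \<infinity>"
    using nn_integral_powr_near_0_finite[of "s - 1" 1] nn_integral_powr_at_top_finite[of "s - 2" 1] s
    by (subst nn_integral_add) auto
  finally show int: "integrable lborel (inv_kernel s)"
    using inv_kernel_bounds(1)[OF s] by (intro integrableI_nonneg) auto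
  have "(\<integral>\<sigma>. inv_kernel s \<sigma> \<partial>lborel) \<noteq> 0"
  proof
    assume "(\<integral>\<sigma>. inv_kernel s \<sigma> \<partial>lborel) = 0"
    then have "AE \<sigma> in lborel. inv_kernel s \<sigma> = 0"
      using inv_kernel_bounds(1)[OF s] by (subst (asm) integral_nonneg_eq_0_iff_AE[OF int]) auto
    then have "AE \<sigma> in lborel. \<sigma> \<notin> {0<..<1::real}" by eventually_elim (auto simp: inv_kernel_def)
    then have "emeasure lborel {0<..<1::real} = 0"
      by (subst (asm) AE_iff_measurable[of "{0<..<1}"]) auto
    then show False by simp
  qed
  moreover have "(\<integral>\<sigma>. inv_kernel s \<sigma> \<partial>lborel) \<ge> 0" using inv_kernel_bounds(1)[OF s] by (intro Bochner_Integration.integral_nonneg) auto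
  ultimately show "(\<integral>\<sigma>. inv_kernel s \<sigma> \<partial>lborel) > 0" by simp
qed

text \<open>The exponents \<open>- s - 1\<close> and \<open>s - 1\<close> add up to
  \<open>- 2\<close>, so under \<open>t = \<tau> / (1 + v)\<close> all powers of
  \<open>\<tau> / (1 + v)\<close> cancel against the Jacobian except one factor
  \<open>1 / \<tau>\<close>. This incomplete Beta integral is therefore elementary, and
  \<open>v\<close> runs up to \<open>(\<tau> - \<eta>) / \<eta>\<close>.\<close>

lemma cut_beta_integral:
  fixes \<eta> \<tau> s :: real
  assumes \<eta>: "0 < \<eta>" "\<eta> < \<tau>" and s: "0 < s"
  shows "(\<integral>\<^sup>+t. ennreal (t powr (- s - 1) * (\<tau> - t) powr (s - 1)) * indicator {\<eta><..<\<tau>} t \<partial>lborel) = ennreal (((\<tau> - \<eta>) / \<eta>) powr s / (s * \<tau>))"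
proof -
  define R where "R = (\<tau> - \<eta>) / \<eta>"
  have R: "R > 0" "\<tau> = \<eta> * (1 + R)" using \<eta> by (auto simp: R_def field_simps)
  have \<tau>: "\<tau> > 0" using \<eta> by linarith
  have bij: "bij_betw (\<lambda>v. \<tau> / (1 + v)) {0<..<R} {\<eta><..<\<tau>}"
  proof (rule bij_betw_byWitness[where f'="\<lambda>t. \<tau> / t - 1"])
    show "\<forall>v\<in>{0<..<R}. \<tau> / (\<tau> / (1 + v)) - 1 = v" using \<tau> by auto
    show "\<forall>t\<in>{\<eta><..<\<tau>}. \<tau> / (1 + (\<tau> / t - 1)) = t" using \<tau> \<eta> by auto
    show "(\<lambda>v. \<tau> / (1 + v)) ` {0<..<R} \<subseteq> {\<eta><..<\<tau>}"
    proof clarify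
      fix v assume v: "v \<in> {0<..<R}"
      then have "\<eta> * (1 + v) < \<tau>" "\<tau> * 1 < \<tau> * (1 + v)"
        unfolding R(2) using \<eta> R(1) by (auto intro!: mult_strict_left_mono mult_pos_pos)
      then show "\<tau> / (1 + v) \<in> {\<eta><..<\<tau>}" using v by (simp add: pos_less_divide_eq pos_divide_less_eq)
    qed
    show "(\<lambda>t. \<tau> / t - 1) ` {\<eta><..<\<tau>} \<subseteq> {0<..<R}" using \<eta> by (auto simp: R_def field_simps)
  qed
  have "(\<integral>\<^sup>+t. ennreal (t powr (- s - 1) * (\<tau> - t) powr (s - 1)) * indicator {\<eta><..<\<tau>} t \<partial>lborel)
    = (\<integral>\<^sup>+v. ennreal (\<bar>- \<tau> / (1 + v)\<^sup>2\<bar> * ((\<tau> / (1 + v)) powr (- s - 1) * (\<tau> - \<tau> / (1 + v)) powr (s - 1))) * indicator {0<..<R} v \<partial>lborel)"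
  proof (rule nn_integral_substitution_open[OF _ _ _ _ _ _ _ bij])
    fix v assume "v \<in> {0<..<R}"
    then have v: "1 + v \<noteq> 0" by auto
    have d: "((\<lambda>v. 1 + v) has_field_derivative 1) (at v)" by (auto intro!: derivative_eq_intros)
    show "((\<lambda>v. \<tau> / (1 + v)) has_field_derivative - \<tau> / (1 + v)\<^sup>2) (at v)"
      by (rule DERIV_cong[OF DERIV_divide[OF DERIV_const d v]]) (simp add: power2_eq_square)
  qed auto
  also have "\<dots> = (\<integral>\<^sup>+v. ennreal (1 / \<tau>) * ennreal (indicator {0..R} v * v powr (s - 1)) \<partial>lborel)"
  proof (rule nn_integral_cong_AE)
    have "AE v in lborel. v \<noteq> 0" "AE v in lborel. v \<noteq> R" by (auto intro: AE_lborel_singleton)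
    then show "AE v in lborel. ennreal (\<bar>- \<tau> / (1 + v)\<^sup>2\<bar> * ((\<tau> / (1 + v)) powr (- s - 1) * (\<tau> - \<tau> / (1 + v)) powr (s - 1))) * indicator {0<..<R} v = ennreal (1 / \<tau>) * ennreal (indicator {0..R} v * v powr (s - 1))"
    proof eventually_elim
      case (elim v)
      show ?case
      proof (cases "0 < v \<and> v < R")
        case True
        define w where "w = 1 + v"
        have w: "w > 0" "\<tau> / w > 0" using True \<tau> by (auto simp: w_def)
        have "\<tau> - \<tau> / w = \<tau> / w * v" using w by (simp add: w_def field_simps)
        then have "(\<tau> - \<tau> / w) powr (s - 1) = (\<tau> / w) powr (s - 1) * v powr (s - 1)"
          using w True powr_mult[of "\<tau> / w" v "s - 1"] by simp
        then have "(\<tau> / w) powr (- s - 1) * (\<tau> - \<tau> / w) powr (s - 1) = ((\<tau> / w) powr (- s - 1) * (\<tau> / w) powr (s - 1)) * v powr (s - 1)" by simp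
        also have "(\<tau> / w) powr (- s - 1) * (\<tau> / w) powr (s - 1) = (\<tau> / w) powr (- 2)" unfolding powr_add[symmetric] by simp
        also have "\<dots> = 1 / (\<tau> / w)\<^sup>2" using w by (simp add: powr_minus_divide)
        finally have "\<bar>- \<tau> / w\<^sup>2\<bar> * ((\<tau> / w) powr (- s - 1) * (\<tau> - \<tau> / w) powr (s - 1)) = 1 / \<tau> * v powr (s - 1)"
          using w \<tau> by (simp add: power2_eq_square)
        then show ?thesis using True \<tau> by (simp add: ennreal_mult[symmetric] w_def)
      qed (use elim in auto)
    qed
  qed
  also have "\<dots> = ennreal (1 / \<tau>) * (\<integral>\<^sup>+v. ennreal (indicator {0..R} v * v powr (s - 1)) \<partial>lborel)"
    by (rule nn_integral_cmult) measurable
  also have "(\<integral>\<^sup>+v. ennreal (indicator {0..R} v * v powr (s - 1)) \<partial>lborel) = ennreal (R powr s / s)"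
  proof -
    have "((\<lambda>x. x powr (s - 1)) has_integral (R powr (s - 1 + 1) / (s - 1 + 1))) {0..R}"
      by (rule has_integral_powr_from_0) (use s R in auto)
    from nn_integral_has_integral_lebesgue[OF _ this] show ?thesis by (simp add: nn_integral_completion)
  qed
  finally show ?thesis using \<tau> s by (simp add: ennreal_mult[symmetric] R_def mult.commute)
qed

text \<open>Subordination with the negative exponent \<open>- s\<close>: the kernel
  \<open>|h|^(-N-2s)\<close> is a mixture of Gaussians, and the average of the second difference
  against the Gaussian of time \<open>t\<close> is twice \<open>\<phi> - heat t \<phi>\<close>, once
  for each of \<open>h\<close> and \<open>- h\<close>. The absolute bound is what the later exchange
  with the Riesz kernel requires.\<close>

lemma nonlocal_subordination:
  fixes \<phi> :: "'a::euclidean_space \<Rightarrow> real"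
  assumes s: "0 < s" "s < 1" and \<phi>: "smooth_fun \<phi>" "compact_supp \<phi>"
  defines "c \<equiv> subord_const TYPE('a) (- s)"
  defines "m \<equiv> \<lambda>y t. indicator {0<..} t * (t powr (- s - 1) * (2 * (\<phi> y - heat t \<phi> y)))"
  shows "(\<integral>\<^sup>+t. ennreal \<bar>m y t\<bar> \<partial>lborel) \<le> ennreal (c * nonlocal_abs s \<phi> y)"
    and "(\<integral>t. m y t \<partial>lborel) = c * nonlocal s \<phi> y"
proof -
  have N: "2 * (- s) < real DIM('a)"
  proof -
    have "real DIM('a) > 0" by simp
    then show ?thesis using s(1) by linarith
  qed
  have c: "c > 0" using subord_const(2)[OF N] by (simp add: c_def)
  note [measurable] = smooth_fun_measurable[OF \<phi>(1)]
  obtain B where B: "\<And>x. \<bar>\<phi> x\<bar> \<le> B" using smooth_compact_bounded[OF \<phi>] by metis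
  have [measurable]: "second_diff \<phi> y \<in> borel_measurable borel" unfolding second_diff_def by measurable
  define K where "K p = (indicator {0<..} (snd p) * (snd p powr (- s - 1) * gauss (snd p) (fst p))) * second_diff \<phi> y (fst p)" for p :: "'a \<times> real"
  have Km [measurable]: "K \<in> borel_measurable borel" unfolding K_def borel_prod[symmetric] by measurable
  have inner: "(\<integral>\<^sup>+t. ennreal (indicator {0<..} t * (t powr (- s - 1) * gauss t h)) \<partial>lborel) = ennreal (c * frac_kernel s h)"
    if "h \<noteq> 0" for h :: 'a
  proof -
    have "(\<integral>\<^sup>+t. ennreal (indicator {0<..} t * (t powr (- s - 1) * gauss t h)) \<partial>lborel) = (\<integral>\<^sup>+t. ennreal (t powr (- s - 1) * gauss t h) * indicator {0<..} t \<partial>lborel)"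
      by (intro nn_integral_cong) (auto simp: indicator_def)
    also have "\<dots> = ennreal (c * norm h powr (2 * (- s) - real DIM('a)))"
      unfolding c_def using gauss_subordination[OF N that] by simp
    also have "2 * (- s) - real DIM('a) = - real DIM('a) - 2 * s" by simp
    finally show ?thesis by (simp add: frac_kernel_def)
  qed
  have neq: "AE (h::'a) in lborel. h \<noteq> 0" by (rule AE_lborel_singleton)
  have nnK: "(\<integral>\<^sup>+h. \<integral>\<^sup>+t. ennreal \<bar>K (h, t)\<bar> \<partial>lborel \<partial>lborel) = ennreal (c * nonlocal_abs s \<phi> y)"
  proof -
    have "(\<integral>\<^sup>+h. \<integral>\<^sup>+t. ennreal \<bar>K (h, t)\<bar> \<partial>lborel \<partial>lborel) = (\<integral>\<^sup>+h. ennreal c * ennreal (\<bar>second_diff \<phi> y h\<bar> * frac_kernel s h) \<partial>lborel)"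
    proof (rule nn_integral_cong_AE)
      show "AE h in lborel. (\<integral>\<^sup>+t. ennreal \<bar>K (h, t)\<bar> \<partial>lborel) = ennreal c * ennreal (\<bar>second_diff \<phi> y h\<bar> * frac_kernel s h)"
        using neq
      proof eventually_elim
        case (elim h)
        have "(\<integral>\<^sup>+t. ennreal \<bar>K (h, t)\<bar> \<partial>lborel) = (\<integral>\<^sup>+t. ennreal (indicator {0<..} t * (t powr (- s - 1) * gauss t h)) * ennreal \<bar>second_diff \<phi> y h\<bar> \<partial>lborel)"
          by (intro nn_integral_cong) (simp add: K_def abs_mult ennreal_mult[symmetric])
        also have "\<dots> = ennreal (c * frac_kernel s h) * ennreal \<bar>second_diff \<phi> y h\<bar>"
          using inner[OF elim] by (simp add: nn_integral_multc)
        finally show ?case using c by (simp add: ennreal_mult mult_ac)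
      qed
    qed
    also have "\<dots> = ennreal c * ennreal (nonlocal_abs s \<phi> y)"
      using nn_integral_second_diff[OF s \<phi>, of y] by (simp add: nn_integral_cmult)
    finally show ?thesis using c by (simp add: ennreal_mult' less_imp_le)
  qed
  then have intK: "integrable (lborel \<Otimes>\<^sub>M lborel) K" by (intro integrable_lborel_pairI) auto
  have Kt: "(\<integral>h. K (h, t) \<partial>lborel) = m y t" for t
  proof (cases "t > 0")
    case True
    have i1: "integrable lborel (\<lambda>h. gauss t h * \<phi> (y - h))"
      using integrable_lborel_reflect[OF heat_integrand_integrable[of \<phi> B t y], of y] B True by (simp add: mult.commute)
    have i2: "integrable lborel (\<lambda>h. gauss t h * \<phi> (y + h))"
      using integrable_lborel_reflect[OF i1, of 0] by (simp add: gauss_def)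
    have e2: "(\<integral>h. gauss t h * \<phi> (y + h) \<partial>lborel) = heat t \<phi> y"
      using integral_lborel_reflect[of "\<lambda>h. gauss t h * \<phi> (y - h)" 0] by (simp add: heat_conv gauss_def)
    have e1: "(\<integral>h. gauss t h * \<phi> (y - h) \<partial>lborel) = heat t \<phi> y" by (simp add: heat_conv)
    have i0: "integrable lborel (\<lambda>h::'a. 2 * \<phi> y * gauss t h)" using integrable_gauss[OF True, where 'a='a] by simp
    have "(\<integral>h. gauss t h * second_diff \<phi> y h \<partial>lborel) = (\<integral>h. (2 * \<phi> y * gauss t h - gauss t h * \<phi> (y + h)) - gauss t h * \<phi> (y - h) \<partial>lborel)"
      by (intro Bochner_Integration.integral_cong) (auto simp: second_diff_def algebra_simps)
    also have "\<dots> = (2 * \<phi> y * (\<integral>(h::'a). gauss t h \<partial>lborel) - heat t \<phi> y) - heat t \<phi> y"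
      using i0 i1 i2 e1 e2 by (subst Bochner_Integration.integral_diff, simp, simp, subst Bochner_Integration.integral_diff) auto
    finally have "(\<integral>h. gauss t h * second_diff \<phi> y h \<partial>lborel) = 2 * (\<phi> y - heat t \<phi> y)"
      using integral_gauss[OF True, where 'a='a] by simp
    then show ?thesis using True by (simp add: K_def m_def mult.assoc)
  qed (simp add: K_def m_def)
  have "(\<integral>\<^sup>+t. ennreal \<bar>m y t\<bar> \<partial>lborel) \<le> (\<integral>\<^sup>+t. \<integral>\<^sup>+h. ennreal \<bar>K (h, t)\<bar> \<partial>lborel \<partial>lborel)"
  proof (rule nn_integral_mono)
    fix t
    show "ennreal \<bar>m y t\<bar> \<le> (\<integral>\<^sup>+h. ennreal \<bar>K (h, t)\<bar> \<partial>lborel)"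
    proof (cases "integrable lborel (\<lambda>h. K (h, t))")
      case True
      show ?thesis unfolding Kt[symmetric] using integral_norm_bound_ennreal[OF True] by simp
    next
      case False
      then show ?thesis unfolding Kt[symmetric] by (simp add: not_integrable_integral_eq)
    qed
  qed
  also have "\<dots> = (\<integral>\<^sup>+h. \<integral>\<^sup>+t. ennreal \<bar>K (h, t)\<bar> \<partial>lborel \<partial>lborel)"
    by (rule lborel_pair.Fubini') (simp add: lborel_prod case_prod_unfold)
  finally show "(\<integral>\<^sup>+t. ennreal \<bar>m y t\<bar> \<partial>lborel) \<le> ennreal (c * nonlocal_abs s \<phi> y)" unfolding nnK .
  have "(\<integral>t. m y t \<partial>lborel) = (\<integral>t. \<integral>h. K (h, t) \<partial>lborel \<partial>lborel)" by (simp only: Kt)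
  also have "\<dots> = (\<integral>h. \<integral>t. K (h, t) \<partial>lborel \<partial>lborel)"
    by (rule lborel_pair.Fubini_integral) (use intK in \<open>simp add: case_prod_unfold\<close>)
  also have "\<dots> = (\<integral>h. c * (second_diff \<phi> y h * frac_kernel s h) \<partial>lborel)"
  proof (rule integral_cong_AE)
    show "AE h in lborel. (\<integral>t. K (h, t) \<partial>lborel) = c * (second_diff \<phi> y h * frac_kernel s h)"
      using neq
    proof eventually_elim
      case (elim h)
      have "(\<integral>t. indicator {0<..} t * (t powr (- s - 1) * gauss t h) \<partial>lborel) = c * frac_kernel s h"
        using inner[OF elim] c by (subst integral_eq_nn_integral) auto
      then show ?case by (simp add: K_def)
    qed
    show "(\<lambda>h. \<integral>t. K (h, t) \<partial>lborel) \<in> borel_measurable lborel" unfolding K_def fst_conv snd_conv by measurable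
  qed measurable
  finally show "(\<integral>t. m y t \<partial>lborel) = c * nonlocal s \<phi> y" by (simp add: nonlocal_def)
qed

text \<open>In the application \<open>F\<close> is a heat extension at a fixed point. Away from
  \<open>t = 0\<close> the terms \<open>G 0\<close> and \<open>G t\<close> may be integrated
  separately, and each becomes an integral of \<open>F \<tau>\<close> against an explicit
  coefficient: \<open>\<eta>^(-s) \<tau>^(s-1) / s\<close> from the first and an incomplete Beta
  integral from the second. By scaling, their difference is a dilation of \<open>inv_kernel\<close>,
  which concentrates at \<open>\<tau> = 0\<close> as \<open>\<eta> -> 0\<close>.\<close>

lemma cut_potential_identity:
  fixes F :: "real \<Rightarrow> real"
  assumes s: "0 < s" "s < 1" and F [measurable]: "F \<in> borel_measurable borel" and \<eta>: "\<eta> > 0"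
    and int: "integrable lborel (\<lambda>t. indicator {0<..} t * (t powr (s - 1) * F t))"
  defines "G \<equiv> \<lambda>t. \<integral>\<tau>. indicator {0<..} \<tau> * (\<tau> powr (s - 1) * F (\<tau> + t)) \<partial>lborel"
  shows "(\<integral>t. indicator {\<eta>..} t * (t powr (- s - 1) * (G 0 - G t)) \<partial>lborel) = 1 / s * (\<integral>\<sigma>. F (\<eta> * \<sigma>) * inv_kernel s \<sigma> \<partial>lborel)"
proof -
  \<comment> \<open>The coefficient of \<open>F \<tau>\<close> in the integral of
    \<open>t^(-s-1) G t\<close> over \<open>t \<ge> \<eta>\<close>, once the order of integration is
    exchanged.\<close>
  define b where "b \<tau> = (if \<tau> > \<eta> then ((\<tau> - \<eta>) / \<eta>) powr s / (s * \<tau>) else 0)" for \<tau>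
  have bm [measurable]: "b \<in> borel_measurable borel" unfolding b_def by measurable
  have b0: "b \<tau> \<ge> 0" for \<tau> using \<eta> s by (simp add: b_def)
  have b_le: "b \<tau> \<le> \<eta> powr (- s) / s * (indicator {0<..} \<tau> * \<tau> powr (s - 1))" for \<tau>
  proof (cases "\<tau> > \<eta>")
    case True
    then have "((\<tau> - \<eta>) / \<eta>) powr s \<le> (\<tau> / \<eta>) powr s" using \<eta> s by (intro powr_mono2 divide_right_mono) auto
    also have "\<dots> = \<tau> powr s * \<eta> powr (- s)" using True \<eta> by (intro powr_divide_minus) auto
    finally have "((\<tau> - \<eta>) / \<eta>) powr s / (s * \<tau>) \<le> \<tau> powr s * \<eta> powr (- s) / (s * \<tau>)"
      using True \<eta> s by (intro divide_right_mono) auto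
    then show ?thesis using True \<eta> by (simp add: b_def powr_diff mult.commute)
  qed (use s in \<open>simp add: b_def\<close>)
  have nnw: "(\<integral>\<^sup>+t. ennreal (indicator {\<eta>..} t * t powr (- s - 1)) \<partial>lborel) = ennreal (\<eta> powr (- s) / s)"
  proof -
    have "((\<lambda>x. x powr (- s - 1)) has_integral (- (\<eta> powr (- s - 1 + 1)) / (- s - 1 + 1))) {\<eta>..}"
      by (rule has_integral_powr_to_inf) (use s \<eta> in auto)
    from nn_integral_has_integral_lebesgue[OF _ this] show ?thesis using s by (simp add: nn_integral_completion)
  qed
  have iw: "integrable lborel (\<lambda>t. indicator {\<eta>..} t * t powr (- s - 1))" using nnw by (intro integrableI_nonneg) auto
  have w: "(\<integral>t. indicator {\<eta>..} t * t powr (- s - 1) \<partial>lborel) = \<eta> powr (- s) / s"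
    using nnw s by (subst integral_eq_nn_integral) auto
  define K where "K p = (indicator {\<eta>..} (snd p) * (snd p powr (- s - 1) * (indicator {0<..} (fst p - snd p) * (fst p - snd p) powr (s - 1)))) * F (fst p)" for p :: "real \<times> real"
  have Km [measurable]: "K \<in> borel_measurable borel" unfolding K_def borel_prod[symmetric] by measurable
  have inner: "(\<integral>\<^sup>+t. ennreal (indicator {\<eta>..} t * (t powr (- s - 1) * (indicator {0<..} (\<tau> - t) * (\<tau> - t) powr (s - 1)))) \<partial>lborel) = ennreal (b \<tau>)" for \<tau>
  proof (cases "\<tau> > \<eta>")
    case True
    have "(\<integral>\<^sup>+t. ennreal (indicator {\<eta>..} t * (t powr (- s - 1) * (indicator {0<..} (\<tau> - t) * (\<tau> - t) powr (s - 1)))) \<partial>lborel)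
      = (\<integral>\<^sup>+t. ennreal (t powr (- s - 1) * (\<tau> - t) powr (s - 1)) * indicator {\<eta><..<\<tau>} t \<partial>lborel)"
    proof (rule nn_integral_cong_AE)
      have "AE t in lborel. t \<noteq> \<eta>" by (rule AE_lborel_singleton)
      then show "AE t in lborel. ennreal (indicator {\<eta>..} t * (t powr (- s - 1) * (indicator {0<..} (\<tau> - t) * (\<tau> - t) powr (s - 1)))) = ennreal (t powr (- s - 1) * (\<tau> - t) powr (s - 1)) * indicator {\<eta><..<\<tau>} t"
        by eventually_elim (auto simp: indicator_def algebra_simps)
    qed
    then show ?thesis using True cut_beta_integral[OF \<eta> True s(1)] by (simp add: b_def)
  next
    case False
    have "(\<integral>\<^sup>+t. ennreal (indicator {\<eta>..} t * (t powr (- s - 1) * (indicator {0<..} (\<tau> - t) * (\<tau> - t) powr (s - 1)))) \<partial>lborel) = (\<integral>\<^sup>+(t::real). 0 \<partial>lborel)"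
      using False by (intro nn_integral_cong) (auto simp: indicator_def)
    then show ?thesis using False by (simp add: b_def)
  qed
  have intbF: "integrable lborel (\<lambda>\<tau>. b \<tau> * F \<tau>)"
  proof (rule Bochner_Integration.integrable_bound[where f="\<lambda>\<tau>. \<eta> powr (- s) / s * (indicator {0<..} \<tau> * (\<tau> powr (s - 1) * F \<tau>))"])
    show "AE \<tau> in lborel. norm (b \<tau> * F \<tau>) \<le> norm (\<eta> powr (- s) / s * (indicator {0<..} \<tau> * (\<tau> powr (s - 1) * F \<tau>)))"
    proof (rule AE_I2)
      fix \<tau>
      have "norm (b \<tau> * F \<tau>) = b \<tau> * \<bar>F \<tau>\<bar>" using b0 by (simp add: abs_mult)
      also have "\<dots> \<le> \<eta> powr (- s) / s * (indicator {0<..} \<tau> * \<tau> powr (s - 1)) * \<bar>F \<tau>\<bar>" by (intro mult_right_mono b_le) simp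
      also have "\<dots> = norm (\<eta> powr (- s) / s * (indicator {0<..} \<tau> * (\<tau> powr (s - 1) * F \<tau>)))" using s by (simp add: abs_mult)
      finally show "norm (b \<tau> * F \<tau>) \<le> norm (\<eta> powr (- s) / s * (indicator {0<..} \<tau> * (\<tau> powr (s - 1) * F \<tau>)))" .
    qed
  qed (use int in auto)
  have "(\<integral>\<^sup>+\<tau>. \<integral>\<^sup>+t. ennreal \<bar>K (\<tau>, t)\<bar> \<partial>lborel \<partial>lborel) = (\<integral>\<^sup>+\<tau>. ennreal (norm (b \<tau> * F \<tau>)) \<partial>lborel)"
  proof (rule nn_integral_cong)
    fix \<tau>
    have "(\<integral>\<^sup>+t. ennreal \<bar>K (\<tau>, t)\<bar> \<partial>lborel) = (\<integral>\<^sup>+t. ennreal (indicator {\<eta>..} t * (t powr (- s - 1) * (indicator {0<..} (\<tau> - t) * (\<tau> - t) powr (s - 1)))) * ennreal \<bar>F \<tau>\<bar> \<partial>lborel)"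
      by (intro nn_integral_cong) (simp add: K_def abs_mult ennreal_mult[symmetric])
    also have "\<dots> = ennreal (b \<tau>) * ennreal \<bar>F \<tau>\<bar>" using inner[of \<tau>] by (simp add: nn_integral_multc)
    finally show "(\<integral>\<^sup>+t. ennreal \<bar>K (\<tau>, t)\<bar> \<partial>lborel) = ennreal (norm (b \<tau> * F \<tau>))" using b0 by (simp add: ennreal_mult abs_mult)
  qed
  also have "\<dots> < \<infinity>" using intbF by (simp add: integrable_iff_bounded)
  finally have intK: "integrable (lborel \<Otimes>\<^sub>M lborel) K" by (intro integrable_lborel_pairI) auto
  have Kt: "(\<integral>\<tau>. K (\<tau>, t) \<partial>lborel) = indicator {\<eta>..} t * t powr (- s - 1) * G t" for t
  proof -
    have "(\<integral>\<tau>. K (\<tau>, t) \<partial>lborel) = indicator {\<eta>..} t * t powr (- s - 1) * (\<integral>\<tau>. indicator {0<..} (\<tau> - t) * ((\<tau> - t) powr (s - 1) * F \<tau>) \<partial>lborel)"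
      by (simp add: K_def mult.assoc)
    also have "(\<integral>\<tau>. indicator {0<..} (\<tau> - t) * ((\<tau> - t) powr (s - 1) * F \<tau>) \<partial>lborel) = G t"
      unfolding G_def using lborel_integral_real_affine[of 1 "\<lambda>\<tau>. indicator {0<..} (\<tau> - t) * ((\<tau> - t) powr (s - 1) * F \<tau>)" t] by (simp add: add.commute)
    finally show ?thesis .
  qed
  have intG: "integrable lborel (\<lambda>t. indicator {\<eta>..} t * t powr (- s - 1) * G t)"
    unfolding Kt[symmetric] by (rule lborel_pair.integrable_snd) (use intK in \<open>simp add: case_prod_unfold\<close>)
  have "(\<integral>t. indicator {\<eta>..} t * t powr (- s - 1) * G t \<partial>lborel) = (\<integral>\<tau>. \<integral>t. K (\<tau>, t) \<partial>lborel \<partial>lborel)"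
    unfolding Kt[symmetric] by (rule lborel_pair.Fubini_integral) (use intK in \<open>simp add: case_prod_unfold\<close>)
  also have "\<dots> = (\<integral>\<tau>. b \<tau> * F \<tau> \<partial>lborel)"
  proof (rule Bochner_Integration.integral_cong[OF refl])
    fix \<tau>
    have "(\<integral>t. indicator {\<eta>..} t * (t powr (- s - 1) * (indicator {0<..} (\<tau> - t) * (\<tau> - t) powr (s - 1))) \<partial>lborel) = b \<tau>"
      using inner[of \<tau>] b0 by (subst integral_eq_nn_integral) auto
    then show "(\<integral>t. K (\<tau>, t) \<partial>lborel) = b \<tau> * F \<tau>" by (simp add: K_def)
  qed
  finally have B: "(\<integral>t. indicator {\<eta>..} t * t powr (- s - 1) * G t \<partial>lborel) = (\<integral>\<tau>. b \<tau> * F \<tau> \<partial>lborel)" .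
  have "(\<integral>t. indicator {\<eta>..} t * (t powr (- s - 1) * (G 0 - G t)) \<partial>lborel) = (\<integral>t. indicator {\<eta>..} t * t powr (- s - 1) * G 0 - indicator {\<eta>..} t * t powr (- s - 1) * G t \<partial>lborel)"
    by (intro Bochner_Integration.integral_cong) (auto simp: algebra_simps)
  also have "\<dots> = \<eta> powr (- s) / s * G 0 - (\<integral>\<tau>. b \<tau> * F \<tau> \<partial>lborel)"
    using iw intG by (subst Bochner_Integration.integral_diff) (auto simp: w B)
  also have "\<dots> = (\<integral>\<tau>. \<eta> powr (- s) / s * (indicator {0<..} \<tau> * (\<tau> powr (s - 1) * F \<tau>)) - b \<tau> * F \<tau> \<partial>lborel)"
    using int intbF by (subst Bochner_Integration.integral_diff) (auto simp: G_def)
  also have "\<dots> = \<bar>\<eta>\<bar> *\<^sub>R (\<integral>\<sigma>. \<eta> powr (- s) / s * (indicator {0<..} (0 + \<eta> * \<sigma>) * ((0 + \<eta> * \<sigma>) powr (s - 1) * F (0 + \<eta> * \<sigma>))) - b (0 + \<eta> * \<sigma>) * F (0 + \<eta> * \<sigma>) \<partial>lborel)"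
    using \<eta> by (intro lborel_integral_real_affine) auto
  also have "\<dots> = (\<integral>\<sigma>. 1 / s * (F (\<eta> * \<sigma>) * inv_kernel s \<sigma>) \<partial>lborel)"
    unfolding real_scaleR_def
  proof (subst integral_mult_right_zero[symmetric], rule Bochner_Integration.integral_cong[OF refl])
    fix \<sigma> :: real
    have "\<eta> * (\<eta> powr (- s) * (\<eta> * \<sigma>) powr (s - 1)) = \<sigma> powr (s - 1)" if "\<sigma> > 0"
    proof -
      have "\<eta> * (\<eta> powr (- s) * (\<eta> * \<sigma>) powr (s - 1)) = (\<eta> powr 1 * \<eta> powr (- s) * \<eta> powr (s - 1)) * \<sigma> powr (s - 1)"
        using \<eta> that by (simp add: powr_mult)
      also have "\<eta> powr 1 * \<eta> powr (- s) * \<eta> powr (s - 1) = \<eta> powr (1 + - s + (s - 1))" by (simp only: powr_add)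
        also have "1 + - s + (s - 1) = 0" by simp
        also have "\<eta> powr 0 = 1" using \<eta> by simp
      finally show ?thesis by simp
    qed
    then have 1: "\<eta> * (\<eta> powr (- s) / s * (indicator {0<..} (0 + \<eta> * \<sigma>) * (0 + \<eta> * \<sigma>) powr (s - 1))) = 1 / s * (indicator {0<..} \<sigma> * \<sigma> powr (s - 1))"
      using \<eta> by (cases "\<sigma> > 0") (auto simp: zero_less_mult_iff)
    have 2: "\<eta> * b (0 + \<eta> * \<sigma>) = 1 / s * (indicator {1<..} \<sigma> * ((\<sigma> - 1) powr s / \<sigma>))"
    proof -
      have "(\<eta> * \<sigma> - \<eta>) / \<eta> = \<sigma> - 1" using \<eta> by (simp add: field_simps)
      moreover have "\<eta> * \<sigma> > \<eta> \<longleftrightarrow> \<sigma> > 1" using \<eta> by simp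
      ultimately show ?thesis using \<eta> by (simp add: b_def)
    qed
    have "\<bar>\<eta>\<bar> * (\<eta> powr (- s) / s * (indicator {0<..} (0 + \<eta> * \<sigma>) * ((0 + \<eta> * \<sigma>) powr (s - 1) * F (0 + \<eta> * \<sigma>))) - b (0 + \<eta> * \<sigma>) * F (0 + \<eta> * \<sigma>))
      = (\<eta> * (\<eta> powr (- s) / s * (indicator {0<..} (0 + \<eta> * \<sigma>) * (0 + \<eta> * \<sigma>) powr (s - 1))) - \<eta> * b (0 + \<eta> * \<sigma>)) * F (\<eta> * \<sigma>)"
      using \<eta> by (simp add: algebra_simps)
    also have "\<dots> = 1 / s * (F (\<eta> * \<sigma>) * inv_kernel s \<sigma>)"
      unfolding 1 2 by (simp add: inv_kernel_def algebra_simps)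
    finally show "\<bar>\<eta>\<bar> * (\<eta> powr (- s) / s * (indicator {0<..} (0 + \<eta> * \<sigma>) * ((0 + \<eta> * \<sigma>) powr (s - 1) * F (0 + \<eta> * \<sigma>))) - b (0 + \<eta> * \<sigma>) * F (0 + \<eta> * \<sigma>)) = 1 / s * (F (\<eta> * \<sigma>) * inv_kernel s \<sigma>)" .
  qed
  finally show ?thesis by simp
qed

definition riesz_inv_const :: "'a::euclidean_space itself \<Rightarrow> real \<Rightarrow> real" where
  "riesz_inv_const T s = 2 * (\<integral>\<sigma>. inv_kernel s \<sigma> \<partial>lborel) / (s * subord_const T (- s) * subord_const T s)"

lemma riesz_inv_const_pos:
  assumes s: "0 < s" "s < 1" "2 * s < real DIM('a::euclidean_space)"
  shows "riesz_inv_const TYPE('a) s > 0"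
proof -
  have "2 * (- s) < real DIM('a)" using s by linarith
  then show ?thesis unfolding riesz_inv_const_def
    using subord_const(2)[where 'a='a] s inv_kernel_integrable(2)[OF s(1,2)] by (auto intro!: divide_pos_pos mult_pos_pos)
qed

text \<open>Both operators are written through the heat semigroup. With
  \<open>F \<tau> = heat \<tau> \<phi> x\<close>, the semigroup law makes \<open>G t\<close> a
  multiple of the Riesz potential of \<open>heat t \<phi>\<close> at \<open>x\<close>, so the
  left-hand side is a multiple of the integral of \<open>t^(-s-1) (G 0 - G t)\<close>. Since
  \<open>F\<close> tends to \<open>\<phi> x\<close> at time zero, the approximate identity evaluates
  it.\<close>

lemma riesz_potential_nonlocal:
  fixes \<phi> :: "'a::euclidean_space \<Rightarrow> real"
  assumes s: "0 < s" "s < 1" "2 * s < real DIM('a)" and \<phi>: "smooth_fun \<phi>" "compact_supp \<phi>"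
  shows "(\<integral>y. riesz s (x - y) * nonlocal s \<phi> y \<partial>lborel) = riesz_inv_const TYPE('a) s * \<phi> x"
proof -
  note m [measurable] = smooth_fun_measurable[OF \<phi>(1)]
  note int\<phi> = test_function_integrable[OF s(1,2) \<phi>]
  obtain B where B: "\<And>x. \<bar>\<phi> x\<bar> \<le> B" using smooth_compact_bounded[OF \<phi>] by metis
  define c1 where "c1 = subord_const TYPE('a) (- s)"
  define c2 where "c2 = subord_const TYPE('a) s"
  have N: "2 * (- s) < real DIM('a)" using s by linarith
  have c: "c1 > 0" "c2 > 0" using subord_const(2)[OF N] subord_const(2)[OF s(3)] by (auto simp: c1_def c2_def)
  define mm where "mm y t = indicator {0<..} t * (t powr (- s - 1) * (2 * (\<phi> y - heat t \<phi> y)))" for y t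
  note sub = nonlocal_subordination[OF s(1,2) \<phi>, folded c1_def mm_def]
  define F where "F \<tau> = heat \<tau> \<phi> x" for \<tau>
  have Fm [measurable]: "F \<in> borel_measurable borel" unfolding F_def by measurable
  define G where "G t = (\<integral>\<tau>. indicator {0<..} \<tau> * (\<tau> powr (s - 1) * F (\<tau> + t)) \<partial>lborel)" for t
  define K where "K p = riesz s (x - fst p) * mm (fst p) (snd p)" for p :: "'a \<times> real"
  have Km [measurable]: "K \<in> borel_measurable borel" unfolding K_def mm_def borel_prod[symmetric] by measurable
  have absm [measurable]: "nonlocal_abs s \<phi> \<in> borel_measurable borel" by (rule nonlocal_measurable(2)[OF m])
  obtain M where M: "\<And>x. nonlocal_abs s \<phi> x \<le> M" using nonlocal_abs_bounded[OF s(1,2) \<phi>] by metis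
  have abs0: "nonlocal_abs s \<phi> y \<ge> 0" for y using nonlocal_le_abs[OF s(1,2) \<phi>, of y] by linarith
  have mmm [measurable]: "(\<lambda>t. mm y t) \<in> borel_measurable borel" for y unfolding mm_def by measurable
  have "(\<integral>\<^sup>+y. \<integral>\<^sup>+t. ennreal \<bar>K (y, t)\<bar> \<partial>lborel \<partial>lborel) = (\<integral>\<^sup>+y. ennreal (riesz s (x - y)) * (\<integral>\<^sup>+t. ennreal \<bar>mm y t\<bar> \<partial>lborel) \<partial>lborel)"
    by (simp add: K_def abs_mult ennreal_mult nn_integral_cmult)
  also have "\<dots> \<le> (\<integral>\<^sup>+y. ennreal (riesz s (x - y)) * ennreal (c1 * nonlocal_abs s \<phi> y) \<partial>lborel)"
    by (intro nn_integral_mono mult_left_mono sub(1)) auto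
  also have "\<dots> = (\<integral>\<^sup>+y. ennreal c1 * ennreal (norm (riesz s (x - y) * nonlocal_abs s \<phi> y)) \<partial>lborel)"
    using c abs0 by (intro nn_integral_cong) (simp add: ennreal_mult[symmetric] mult_ac)
  also have "\<dots> < \<infinity>"
    using riesz_integrable[OF s(1,3) nonlocal_abs_integrable[OF s(1,2) \<phi>], of M x] M abs0
    by (simp add: nn_integral_cmult integrable_iff_bounded ennreal_mult_less_top)
  finally have intK: "integrable (lborel \<Otimes>\<^sub>M lborel) K" by (intro integrable_lborel_pairI) auto
  have V0: "c2 * (\<integral>y. riesz s (x - y) * \<phi> y \<partial>lborel) = G 0"
    unfolding c2_def G_def F_def using riesz_potential_heat(2)[OF s(1,3) int\<phi> B] by simp
  have Vt: "c2 * (\<integral>y. riesz s (x - y) * heat t \<phi> y \<partial>lborel) = G t" if "t > 0" for t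
  proof -
    have "c2 * (\<integral>y. riesz s (x - y) * heat t \<phi> y \<partial>lborel) = (\<integral>\<tau>. indicator {0<..} \<tau> * (\<tau> powr (s - 1) * heat \<tau> (heat t \<phi>) x) \<partial>lborel)"
      unfolding c2_def by (rule riesz_potential_heat(2)[OF s(1,3) heat_integrable[OF int\<phi> that] heat_bound[OF m B that]])
    also have "\<dots> = G t" unfolding G_def F_def
      by (intro Bochner_Integration.integral_cong) (auto simp: indicator_def heat_heat[OF int\<phi> _ that])
    finally show ?thesis .
  qed
  have Kt: "(\<integral>y. K (y, t) \<partial>lborel) = 2 / c2 * (indicator {0<..} t * (t powr (- s - 1) * (G 0 - G t)))" for t
  proof (cases "t > 0")
    case True
    have "(\<integral>y. K (y, t) \<partial>lborel) = t powr (- s - 1) * (2 * (\<integral>y. riesz s (x - y) * \<phi> y - riesz s (x - y) * heat t \<phi> y \<partial>lborel))"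
    proof -
      have "(\<integral>y. K (y, t) \<partial>lborel) = (\<integral>y. (t powr (- s - 1) * 2) * (riesz s (x - y) * \<phi> y - riesz s (x - y) * heat t \<phi> y) \<partial>lborel)"
        using True by (intro Bochner_Integration.integral_cong) (auto simp: K_def mm_def algebra_simps)
      then show ?thesis by simp
    qed
    also have "(\<integral>y. riesz s (x - y) * \<phi> y - riesz s (x - y) * heat t \<phi> y \<partial>lborel) = (\<integral>y. riesz s (x - y) * \<phi> y \<partial>lborel) - (\<integral>y. riesz s (x - y) * heat t \<phi> y \<partial>lborel)"
      by (intro Bochner_Integration.integral_diff riesz_integrable[OF s(1,3) int\<phi> B] riesz_integrable[OF s(1,3) heat_integrable[OF int\<phi> True] heat_bound[OF m B True]])
    also have "\<dots> = 1 / c2 * (G 0 - G t)" using V0 Vt[OF True] c by (simp add: field_simps)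
    finally show ?thesis using True by simp
  qed (simp add: K_def mm_def)
  have "integrable lborel (\<lambda>t. \<integral>y. K (y, t) \<partial>lborel)"
    by (rule lborel_pair.integrable_snd) (use intK in \<open>simp add: case_prod_unfold\<close>)
  then have "integrable lborel (\<lambda>t. c2 / 2 * (2 / c2 * (indicator {0<..} t * (t powr (- s - 1) * (G 0 - G t)))))"
    unfolding Kt by (rule integrable_mult_right)
  moreover have "c2 / 2 * (2 / c2 * r) = r" for r using c by simp
  ultimately have intG: "integrable lborel (\<lambda>t. indicator {0<..} t * (t powr (- s - 1) * (G 0 - G t)))"
    by (simp only:)
  have "c1 * (\<integral>y. riesz s (x - y) * nonlocal s \<phi> y \<partial>lborel) = (\<integral>y. \<integral>t. K (y, t) \<partial>lborel \<partial>lborel)"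
    by (simp add: K_def sub(2) mult.left_commute)
  also have "\<dots> = (\<integral>t. \<integral>y. K (y, t) \<partial>lborel \<partial>lborel)"
    by (rule lborel_pair.Fubini_integral[symmetric]) (use intK in \<open>simp add: case_prod_unfold\<close>)
  also have "\<dots> = 2 / c2 * (\<integral>t. indicator {0<..} t * (t powr (- s - 1) * (G 0 - G t)) \<partial>lborel)"
    unfolding Kt by simp
  finally have main: "c1 * (\<integral>y. riesz s (x - y) * nonlocal s \<phi> y \<partial>lborel) = 2 / c2 * (\<integral>t. indicator {0<..} t * (t powr (- s - 1) * (G 0 - G t)) \<partial>lborel)" .
  define \<eta> where "\<eta> n = 1 / real (Suc n)" for n
  have \<eta>: "\<eta> n > 0" for n by (simp add: \<eta>_def)
  have \<eta>0: "\<eta> \<longlonglongrightarrow> 0" unfolding \<eta>_def by (rule LIMSEQ_Suc[OF lim_inverse_n'])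
  have intF: "integrable lborel (\<lambda>t. indicator {0<..} t * (t powr (s - 1) * F t))"
    unfolding F_def by (rule riesz_potential_heat(1)[OF s(1,3) int\<phi> B])
  \<comment> \<open>The cut integrals have two limits to be compared: the uncut integral, by
    dominated convergence, and \<open>\<phi> x\<close> times the mass of \<open>inv_kernel\<close>,
    by the identity for the cut integrals.\<close>
  have "(\<lambda>n. \<integral>t. indicator {\<eta> n..} t * (t powr (- s - 1) * (G 0 - G t)) \<partial>lborel) \<longlonglongrightarrow> (\<integral>t. indicator {0<..} t * (t powr (- s - 1) * (G 0 - G t)) \<partial>lborel)"
  proof (rule Bochner_Integration.integral_dominated_convergence[where w="\<lambda>t. \<bar>indicator {0<..} t * (t powr (- s - 1) * (G 0 - G t))\<bar>"])
    show "AE t in lborel. (\<lambda>n. indicator {\<eta> n..} t * (t powr (- s - 1) * (G 0 - G t))) \<longlonglongrightarrow> indicator {0<..} t * (t powr (- s - 1) * (G 0 - G t))"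
    proof (rule AE_I2)
      fix t :: real
      have "eventually (\<lambda>n. indicator {\<eta> n..} t = (indicator {0<..} t :: real)) sequentially"
      proof (cases "t > 0")
        case True
        have "eventually (\<lambda>n. \<eta> n < t) sequentially" using order_tendstoD(2)[OF \<eta>0 True] .
        then show ?thesis by (rule eventually_mono) (use True in simp)
      next
        case False
        have "indicator {\<eta> n..} t = (indicator {0<..} t :: real)" for n using False \<eta>[of n] by (auto simp: indicator_def)
        then show ?thesis by simp
      qed
      then show "(\<lambda>n. indicator {\<eta> n..} t * (t powr (- s - 1) * (G 0 - G t))) \<longlonglongrightarrow> indicator {0<..} t * (t powr (- s - 1) * (G 0 - G t))"
        by (intro tendsto_eventually) (erule eventually_mono, simp)
    qed
    show "AE t in lborel. norm (indicator {\<eta> n..} t * (t powr (- s - 1) * (G 0 - G t))) \<le> \<bar>indicator {0<..} t * (t powr (- s - 1) * (G 0 - G t))\<bar>" for n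
      using \<eta>[of n] by (auto simp: indicator_def)
  qed (use intG in \<open>auto simp: G_def\<close>)
  moreover have "(\<lambda>n. \<integral>t. indicator {\<eta> n..} t * (t powr (- s - 1) * (G 0 - G t)) \<partial>lborel) \<longlonglongrightarrow> 1 / s * (\<integral>\<sigma>. \<phi> x * inv_kernel s \<sigma> \<partial>lborel)"
  proof -
    have "(\<lambda>n. \<integral>\<sigma>. F (\<eta> n * \<sigma>) * inv_kernel s \<sigma> \<partial>lborel) \<longlonglongrightarrow> (\<integral>\<sigma>. \<phi> x * inv_kernel s \<sigma> \<partial>lborel)"
    proof (rule Bochner_Integration.integral_dominated_convergence[where w="\<lambda>\<sigma>. B * inv_kernel s \<sigma>"])
      show "AE \<sigma> in lborel. (\<lambda>n. F (\<eta> n * \<sigma>) * inv_kernel s \<sigma>) \<longlonglongrightarrow> \<phi> x * inv_kernel s \<sigma>"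
      proof (rule AE_I2)
        fix \<sigma> :: real
        show "(\<lambda>n. F (\<eta> n * \<sigma>) * inv_kernel s \<sigma>) \<longlonglongrightarrow> \<phi> x * inv_kernel s \<sigma>"
        proof (cases "\<sigma> > 0")
          case True
          have "(\<lambda>n. \<integral>y. gauss (\<eta> n * \<sigma>) y * \<phi> (x - y) \<partial>lborel) \<longlonglongrightarrow> \<phi> x"
          proof (rule gauss_smoothing_tendsto[OF m B])
            show "isCont \<phi> x" using smooth_fun_continuous[OF \<phi>(1)] by (simp add: continuous_on_eq_continuous_at)
            show "\<eta> n * \<sigma> > 0" for n using \<eta> True by simp
            show "(\<lambda>n. \<eta> n * \<sigma>) \<longlonglongrightarrow> 0" using tendsto_mult[OF \<eta>0 tendsto_const[of \<sigma>]] by simp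
          qed
          then show ?thesis unfolding F_def heat_conv[OF m] by (intro tendsto_mult tendsto_const)
        qed (simp add: inv_kernel_def)
      qed
      show "AE \<sigma> in lborel. norm (F (\<eta> n * \<sigma>) * inv_kernel s \<sigma>) \<le> B * inv_kernel s \<sigma>" for n
      proof (rule AE_I2)
        fix \<sigma> :: real
        show "norm (F (\<eta> n * \<sigma>) * inv_kernel s \<sigma>) \<le> B * inv_kernel s \<sigma>"
        proof (cases "\<sigma> > 0")
          case True
          then have "\<bar>F (\<eta> n * \<sigma>)\<bar> \<le> B" unfolding F_def using \<eta>[of n] by (intro heat_bound[OF m B]) simp
          then show ?thesis using inv_kernel_bounds(1)[OF s(1,2)] by (simp add: abs_mult mult_right_mono)
        qed (simp add: inv_kernel_def)
      qed
    qed (use inv_kernel_integrable(1)[OF s(1,2)] in auto)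
    then show ?thesis
      unfolding G_def cut_potential_identity[OF s(1,2) Fm \<eta> intF] by (intro tendsto_mult tendsto_const)
  qed
  ultimately have "(\<integral>t. indicator {0<..} t * (t powr (- s - 1) * (G 0 - G t)) \<partial>lborel) = 1 / s * (\<integral>\<sigma>. \<phi> x * inv_kernel s \<sigma> \<partial>lborel)"
    by (rule LIMSEQ_unique)
  then show ?thesis using main c s by (simp add: riesz_inv_const_def c1_def c2_def field_simps)
qed

section \<open>Mollifiers\<close>

text \<open>The standard flat function in \<open>w = 1 / (e - t)\<close>. The polynomial factor
  makes the family closed under differentiation, so that all derivatives are treated at
  once.\<close>

definition bump :: "real \<Rightarrow> real poly \<Rightarrow> real \<Rightarrow> real" where
  "bump e p t = (if t < e then poly p (1 / (e - t)) * exp (- (1 / (e - t))) else 0)"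

text \<open>The exponential is compared with \<open>(i + 2)! / w^(i + 2)\<close> separately for each
  monomial \<open>w^i\<close>. The power \<open>w^(-2)\<close> that is left makes
  \<open>bump\<close> quadratically small at the end point.\<close>

lemma poly_exp_bound:
  fixes p :: "real poly"
  obtains C where "C \<ge> 0" "\<And>w. w > 0 \<Longrightarrow> \<bar>poly p w * exp (- w)\<bar> \<le> C / w\<^sup>2"
proof -
  define C where "C = (\<Sum>i\<le>degree p. \<bar>coeff p i\<bar> * fact (i + 2))"
  have "\<bar>poly p w * exp (- w)\<bar> \<le> C / w\<^sup>2" if w: "w > 0" for w
  proof -
    have "\<bar>poly p w * exp (- w)\<bar> \<le> (\<Sum>i\<le>degree p. \<bar>coeff p i\<bar> * w ^ i) * exp (- w)"
      unfolding poly_altdef abs_mult using w by (intro mult_mono order_trans[OF sum_abs] sum_mono) (auto simp: abs_mult intro!: sum_nonneg)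
    also have "\<dots> = (\<Sum>i\<le>degree p. \<bar>coeff p i\<bar> * w ^ i * exp (- w))" by (simp add: sum_distrib_right)
    also have "\<dots> \<le> (\<Sum>i\<le>degree p. \<bar>coeff p i\<bar> * fact (i + 2) / w\<^sup>2)"
    proof (rule sum_mono)
      fix i
      have "\<bar>coeff p i\<bar> * w ^ i * exp (- w) \<le> \<bar>coeff p i\<bar> * w ^ i * (fact (i + 2) / w ^ (i + 2))"
        using w by (intro mult_left_mono exp_minus_le_power) auto
      also have "\<dots> = \<bar>coeff p i\<bar> * fact (i + 2) / w\<^sup>2" using w by (simp add: power_add power2_eq_square)
      finally show "\<bar>coeff p i\<bar> * w ^ i * exp (- w) \<le> \<bar>coeff p i\<bar> * fact (i + 2) / w\<^sup>2" .
    qed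
    also have "\<dots> = C / w\<^sup>2" by (simp add: C_def sum_divide_distrib)
    finally show ?thesis .
  qed
  moreover have "C \<ge> 0" unfolding C_def by (intro sum_nonneg) auto
  ultimately show ?thesis using that by blast
qed

text \<open>Differentiating \<open>p(w) exp(- w)\<close> with \<open>w' = w^2\<close> gives the
  polynomial \<open>(p' - p) w^2\<close>, and \<open>[:0, 0, 1:]\<close> is \<open>w^2\<close>. At
  the junction \<open>t = e\<close> the quadratic bound makes the difference quotient
  \<open>O(h)\<close>.\<close>

lemma bump_has_derivative:
  "(bump e p has_field_derivative bump e ((pderiv p - p) * [:0, 0, 1:]) t) (at t)"
proof -
  consider "t < e" | "t = e" | "t > e" by linarith
  then show ?thesis
  proof cases
    case 1
    have ne: "e - t \<noteq> 0" using 1 by simp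
    have d0: "((\<lambda>t. e - t) has_field_derivative - 1) (at t)" by (auto intro!: derivative_eq_intros)
    have dw: "((\<lambda>t. 1 / (e - t)) has_field_derivative (1 / (e - t))\<^sup>2) (at t)"
      by (rule DERIV_cong[OF DERIV_divide[OF DERIV_const d0 ne]]) (simp add: power2_eq_square)
    have "((\<lambda>t. poly p (1 / (e - t)) * exp (- (1 / (e - t)))) has_field_derivative
       (poly (pderiv p) (1 / (e - t)) * (1 / (e - t))\<^sup>2) * exp (- (1 / (e - t))) +
       (exp (- (1 / (e - t))) * (- (1 / (e - t))\<^sup>2)) * poly p (1 / (e - t))) (at t)"
      by (intro DERIV_mult DERIV_chain2[OF poly_DERIV dw] DERIV_chain2[OF DERIV_exp] DERIV_minus dw)
    also have "(poly (pderiv p) (1 / (e - t)) * (1 / (e - t))\<^sup>2) * exp (- (1 / (e - t))) +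
       (exp (- (1 / (e - t))) * (- (1 / (e - t))\<^sup>2)) * poly p (1 / (e - t)) = bump e ((pderiv p - p) * [:0, 0, 1:]) t"
      using 1 by (simp add: bump_def power2_eq_square algebra_simps)
    finally show ?thesis
      by (rule DERIV_cong_ev[THEN iffD1, rotated -1])
         (use 1 eventually_nhds_in_open[of "{..<e}" t] in \<open>auto elim!: eventually_mono simp: bump_def\<close>)
  next
    case 3
    have "((\<lambda>t. 0) has_field_derivative 0) (at t)" by simp
    then show ?thesis
      by (rule DERIV_cong_ev[THEN iffD1, rotated -1])
         (use 3 eventually_nhds_in_open[of "{e<..}" t] in \<open>auto elim!: eventually_mono simp: bump_def\<close>)
  next
    case 2
    obtain C where C: "C \<ge> 0" "\<And>w. w > 0 \<Longrightarrow> \<bar>poly p w * exp (- w)\<bar> \<le> C / w\<^sup>2" using poly_exp_bound[of p] by metis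
    have bd: "\<bar>bump e p (e + h)\<bar> \<le> C * h\<^sup>2" for h
    proof (cases "h < 0")
      case True
      then have "1 / (- h) > 0" by simp
      from C(2)[OF this] True show ?thesis by (simp add: bump_def power_one_over)
    qed (use C in \<open>simp add: bump_def\<close>)
    have "(\<lambda>h. (bump e p (e + h) - bump e p e) / h) \<midarrow>0\<rightarrow> 0"
    proof (rule Lim_null_comparison)
      show "eventually (\<lambda>h. norm ((bump e p (e + h) - bump e p e) / h) \<le> C * \<bar>h\<bar>) (at 0)"
      proof (rule always_eventually, rule allI)
        fix h
        have "bump e p e = 0" by (simp add: bump_def)
        moreover have "\<bar>bump e p (e + h)\<bar> / \<bar>h\<bar> \<le> C * h\<^sup>2 / \<bar>h\<bar>" by (intro divide_right_mono bd) simp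
        moreover have "C * h\<^sup>2 / \<bar>h\<bar> = C * \<bar>h\<bar>" by (cases "h = 0") (auto simp: power2_eq_square abs_if)
        ultimately show "norm ((bump e p (e + h) - bump e p e) / h) \<le> C * \<bar>h\<bar>" by simp
      qed
      show "((\<lambda>h. C * \<bar>h\<bar>) \<longlongrightarrow> 0) (at 0)" by (rule tendsto_eq_intros refl | simp)+
    qed
    then show ?thesis unfolding DERIV_def 2 by (simp add: bump_def)
  qed
qed

text \<open>A class of functions that is closed under partial derivatives is a post-fixed point for
  the coinductive \<open>smooth_fun\<close>. The class contains inner products because they arise
  from differentiating \<open>x . x\<close>.\<close>

inductive bump_algebra :: "real \<Rightarrow> ('a::euclidean_space \<Rightarrow> real) \<Rightarrow> bool" for e where
  const: "bump_algebra e (\<lambda>x. c)"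
| inner: "bump_algebra e (\<lambda>x. x \<bullet> b)"
| bump: "bump_algebra e (\<lambda>x. bump e p (x \<bullet> x))"
| add: "bump_algebra e f \<Longrightarrow> bump_algebra e g \<Longrightarrow> bump_algebra e (\<lambda>x. f x + g x)"
| mult: "bump_algebra e f \<Longrightarrow> bump_algebra e g \<Longrightarrow> bump_algebra e (\<lambda>x. f x * g x)"

lemma bump_algebra_has_derivative:
  assumes "bump_algebra e f"
  shows "\<exists>f'. (\<forall>x. (f has_derivative f' x) (at x)) \<and> (\<forall>b. bump_algebra e (\<lambda>x. f' x b))"
  using assms
proof induction
  case (const c)
  then show ?case by (intro exI[of _ "\<lambda>x h. 0"]) (auto intro: bump_algebra.const)
next
  case (inner b)
  have "((\<lambda>x. x \<bullet> b) has_derivative (\<lambda>h. h \<bullet> b)) (at x)" for x :: 'a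
    by (rule bounded_linear_imp_has_derivative) (rule bounded_linear_inner_left)
  then show ?case by (intro exI[of _ "\<lambda>x h. h \<bullet> b"]) (auto intro: bump_algebra.const)
next
  case (bump p)
  let ?q = "(pderiv p - p) * [:0, 0, 1:]"
  have "((\<lambda>x. bump e p (x \<bullet> x)) has_derivative (\<lambda>h. bump e ?q (x \<bullet> x) * (2 * (x \<bullet> h)))) (at x)" for x :: 'a
  proof -
    have "((\<lambda>x. x \<bullet> x) has_derivative (\<lambda>h. x \<bullet> h + h \<bullet> x)) (at x)"
      by (intro has_derivative_inner has_derivative_ident)
    then have "((\<lambda>x. x \<bullet> x) has_derivative (\<lambda>h. 2 * (x \<bullet> h))) (at x)"
      by (rule has_derivative_eq_rhs) (auto simp: inner_commute[of _ x])
    from has_derivative_compose[OF this bump_has_derivative[of e p "x \<bullet> x", unfolded has_field_derivative_def]]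
    show ?thesis .
  qed
  moreover have "bump_algebra e (\<lambda>x. bump e ?q (x \<bullet> x) * (2 * (x \<bullet> b)))" for b
    by (intro bump_algebra.intros)
  ultimately show ?case by (intro exI[of _ "\<lambda>x h. bump e ?q (x \<bullet> x) * (2 * (x \<bullet> h))"]) auto
next
  case (add f g)
  then obtain f' g' where "\<And>x. (f has_derivative f' x) (at x)" "\<And>b. bump_algebra e (\<lambda>x. f' x b)"
    "\<And>x. (g has_derivative g' x) (at x)" "\<And>b. bump_algebra e (\<lambda>x. g' x b)" by blast
  then show ?case
    by (intro exI[of _ "\<lambda>x h. f' x h + g' x h"]) (auto intro: has_derivative_add bump_algebra.add)
next
  case (mult f g)
  then obtain f' g' where "\<And>x. (f has_derivative f' x) (at x)" "\<And>b. bump_algebra e (\<lambda>x. f' x b)"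
    "\<And>x. (g has_derivative g' x) (at x)" "\<And>b. bump_algebra e (\<lambda>x. g' x b)" by blast
  with mult.hyps show ?case
    by (intro exI[of _ "\<lambda>x h. f x * g' x h + f' x h * g x"]) (auto intro!: has_derivative_mult bump_algebra.add bump_algebra.mult)
qed

lemma bump_algebra_smooth: "bump_algebra e f \<Longrightarrow> smooth_fun f"
proof (coinduction arbitrary: f)
  case smooth_fun
  then obtain f' where f': "\<And>x. (f has_derivative f' x) (at x)" "\<And>b. bump_algebra e (\<lambda>x. f' x b)"
    using bump_algebra_has_derivative by blast
  have "frechet_derivative f (at x) = f' x" for x using f'(1)[of x] by (metis frechet_derivative_at)
  moreover have "f differentiable_on UNIV" using f'(1) by (auto simp: differentiable_on_def intro: differentiableI)
  ultimately show ?case using f'(2) by auto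
qed

lemma mollifier_exists:
  fixes e :: real
  assumes e: "e > 0"
  obtains \<rho> :: "'a::euclidean_space \<Rightarrow> real" where
    "smooth_fun \<rho>" "\<And>x. \<rho> x \<ge> 0" "\<And>x. norm x \<ge> e \<Longrightarrow> \<rho> x = 0" "(\<integral>x. \<rho> x \<partial>lborel) = 1" "\<And>x. \<rho> (- x) = \<rho> x"
proof -
  define \<beta> where "\<beta> x = bump (e\<^sup>2) 1 (x \<bullet> x)" for x :: 'a
  have ba: "bump_algebra (e\<^sup>2) \<beta>" unfolding \<beta>_def by (rule bump_algebra.bump)
  have sm: "smooth_fun \<beta>" by (rule bump_algebra_smooth[OF ba])
  have pos: "\<beta> x > 0" if "norm x < e" for x
  proof -
    have "x \<bullet> x < e\<^sup>2" unfolding power2_norm_eq_inner[symmetric] using that by (simp add: power_strict_mono)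
    then show ?thesis by (simp add: \<beta>_def bump_def)
  qed
  have zero: "\<beta> x = 0" if "norm x \<ge> e" for x
  proof -
    have "e\<^sup>2 \<le> x \<bullet> x" unfolding power2_norm_eq_inner[symmetric] using that e by (simp add: power_mono)
    then show ?thesis by (simp add: \<beta>_def bump_def)
  qed
  have nn: "\<beta> x \<ge> 0" for x using pos[of x] zero[of x] by (cases "norm x < e") auto
  have cs: "compact_supp \<beta>" by (rule compact_suppI[of e]) (use zero in auto)
  have int: "integrable lborel \<beta>" by (rule test_function_integrable[of "1/2"]) (use sm cs in auto)
  have "(\<integral>x. \<beta> x \<partial>lborel) \<noteq> 0"
  proof
    assume "(\<integral>x. \<beta> x \<partial>lborel) = 0"
    then have "AE x in lborel. \<beta> x = 0" using nn by (subst (asm) integral_nonneg_eq_0_iff_AE[OF int]) auto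
    then have "AE x in lborel. x \<notin> ball (0::'a) e" by eventually_elim (use pos in \<open>force simp: less_le\<close>)
    then have "ball (0::'a) e \<in> null_sets lborel" by (simp add: AE_iff_null_sets)
    then have "negligible (ball (0::'a) e)" by (auto simp: negligible_iff_null_sets intro: null_sets_completionI)
    then show False using e open_not_negligible[of "ball (0::'a) e"] by simp
  qed
  moreover have "(\<integral>x. \<beta> x \<partial>lborel) \<ge> 0" using nn by (intro Bochner_Integration.integral_nonneg)
  ultimately have Z: "(\<integral>x. \<beta> x \<partial>lborel) > 0" by simp
  define \<rho> where "\<rho> x = (1 / (\<integral>x. \<beta> x \<partial>lborel)) * \<beta> x" for x
  have "smooth_fun \<rho>" unfolding \<rho>_def by (intro bump_algebra_smooth[of "e\<^sup>2"] bump_algebra.mult bump_algebra.const ba)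
  then show ?thesis using Z nn zero by (intro that[of \<rho>]) (auto simp: \<rho>_def \<beta>_def)
qed

section \<open>Convolution of a test function with an integrable function\<close>

definition conv :: "('a::euclidean_space \<Rightarrow> real) \<Rightarrow> ('a \<Rightarrow> real) \<Rightarrow> 'a \<Rightarrow> real" where
  "conv f G x = (\<integral>z. f (x - z) * G z \<partial>lborel)"

lemma conv_integrand_integrable:
  fixes f G :: "'a::euclidean_space \<Rightarrow> real"
  assumes f [measurable]: "f \<in> borel_measurable borel" and B: "\<And>x. \<bar>f x\<bar> \<le> B" and G: "integrable lborel G"
  shows "integrable lborel (\<lambda>z. f (x - z) * G z)"
proof (rule Bochner_Integration.integrable_bound[where f="\<lambda>z. B * G z"])
  have [measurable]: "G \<in> borel_measurable borel" using G by (simp add: borel_measurable_integrable)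
  show "(\<lambda>z. f (x - z) * G z) \<in> borel_measurable lborel" by measurable
  have "\<bar>f y\<bar> \<le> \<bar>B\<bar>" for y using B[of y] by linarith
  then show "AE z in lborel. norm (f (x - z) * G z) \<le> norm (B * G z)" by (auto simp: abs_mult intro!: mult_right_mono)
qed (use G in simp)

text \<open>The Taylor estimate for \<open>f\<close> is uniform in the base point, so integrating it
  against \<open>G\<close> bounds the remainder by \<open>L\<close> times the integral of
  \<open>|G|\<close> times \<open>|h|^2\<close>. Regularity of \<open>G\<close> does not enter,
  which is what allows the singular Green function in that place.\<close>

lemma conv_has_derivative:
  fixes f G :: "'a::euclidean_space \<Rightarrow> real"
  assumes f: "smooth_fun f" "compact_supp f" and G: "integrable lborel G"
  shows "(conv f G has_derivative (\<lambda>h. \<Sum>b\<in>Basis. (h \<bullet> b) * conv (\<lambda>x. frechet_derivative f (at x) b) G x)) (at x)"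
proof -
  have m [measurable]: "f \<in> borel_measurable borel" by (rule smooth_fun_measurable[OF f(1)])
  have [measurable]: "G \<in> borel_measurable borel" using G by (simp add: borel_measurable_integrable)
  obtain B where B: "\<And>x. \<bar>f x\<bar> \<le> B" using smooth_compact_bounded[OF f] by metis
  obtain L where L: "L \<ge> 0" "\<And>x h. \<bar>f (x + h) - f x - frechet_derivative f (at x) h\<bar> \<le> L * (norm h)\<^sup>2"
    using smooth_compact_Taylor[OF f] by metis
  have int1: "integrable lborel (\<lambda>z. f (x - z) * G z)" for x by (rule conv_integrand_integrable[OF m B G])
  have int2: "integrable lborel (\<lambda>z. frechet_derivative f (at (x - z)) b * G z)" if b: "b \<in> Basis" for b
  proof -
    obtain B' where "\<And>x. \<bar>frechet_derivative f (at x) b\<bar> \<le> B'"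
      using smooth_compact_bounded[OF smooth_fun_partial[OF f(1) b] compact_supp_partial[OF f(2)]] by metis
    then show ?thesis
      by (intro conv_integrand_integrable[OF smooth_fun_measurable[OF smooth_fun_partial[OF f(1) b]] _ G])
  qed
  let ?D = "\<lambda>h. \<Sum>b\<in>Basis. (h \<bullet> b) * conv (\<lambda>x. frechet_derivative f (at x) b) G x"
  define I where "I = (\<integral>z. \<bar>G z\<bar> \<partial>lborel)"
  have bound: "norm (conv f G (x + h) - conv f G x - ?D h) \<le> (L * I) * (norm h)\<^sup>2" for h
  proof -
    have D: "?D h = (\<integral>z. frechet_derivative f (at (x - z)) h * G z \<partial>lborel)"
    proof -
      have "(\<integral>z. frechet_derivative f (at (x - z)) h * G z \<partial>lborel) = (\<integral>z. (\<Sum>b\<in>Basis. (h \<bullet> b) * (frechet_derivative f (at (x - z)) b * G z)) \<partial>lborel)"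
        by (intro Bochner_Integration.integral_cong[OF refl])
           (subst frechet_derivative_basis_sum[OF smooth_fun_differentiable[OF f(1)]], simp add: sum_distrib_right mult.assoc)
      also have "\<dots> = (\<Sum>b\<in>Basis. \<integral>z. (h \<bullet> b) * (frechet_derivative f (at (x - z)) b * G z) \<partial>lborel)"
        by (intro Bochner_Integration.integral_sum integrable_mult_right int2)
      finally show ?thesis by (simp add: conv_def)
    qed
    have int3: "integrable lborel (\<lambda>z. frechet_derivative f (at (x - z)) h * G z)"
    proof -
      have "integrable lborel (\<lambda>z. \<Sum>b\<in>Basis. (h \<bullet> b) * (frechet_derivative f (at (x - z)) b * G z))"
        by (intro Bochner_Integration.integrable_sum integrable_mult_right int2)
      moreover have "(\<Sum>b\<in>Basis. (h \<bullet> b) * (frechet_derivative f (at (x - z)) b * G z)) = frechet_derivative f (at (x - z)) h * G z" for z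
        by (subst (2) frechet_derivative_basis_sum[OF smooth_fun_differentiable[OF f(1)]]) (simp add: sum_distrib_right mult.assoc)
      ultimately show ?thesis by simp
    qed
    have eq: "conv f G (x + h) - conv f G x - ?D h = (\<integral>z. (f ((x - z) + h) - f (x - z) - frechet_derivative f (at (x - z)) h) * G z \<partial>lborel)"
    proof -
      have "conv f G (x + h) - conv f G x - ?D h = (\<integral>z. f (x + h - z) * G z - f (x - z) * G z - frechet_derivative f (at (x - z)) h * G z \<partial>lborel)"
        unfolding D unfolding conv_def using int1 int3 by (simp add: Bochner_Integration.integral_diff)
      also have "\<dots> = (\<integral>z. (f ((x - z) + h) - f (x - z) - frechet_derivative f (at (x - z)) h) * G z \<partial>lborel)"
        by (intro Bochner_Integration.integral_cong[OF refl]) (simp add: algebra_simps)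
      finally show ?thesis .
    qed
    have int4: "integrable lborel (\<lambda>z. (f ((x - z) + h) - f (x - z) - frechet_derivative f (at (x - z)) h) * G z)"
    proof -
      have "integrable lborel (\<lambda>z. f (x + h - z) * G z - f (x - z) * G z - frechet_derivative f (at (x - z)) h * G z)"
        using int1 int3 by (intro Bochner_Integration.integrable_diff)
      then show ?thesis by (simp add: algebra_simps)
    qed
    have "norm (conv f G (x + h) - conv f G x - ?D h) \<le> (\<integral>z. norm ((f ((x - z) + h) - f (x - z) - frechet_derivative f (at (x - z)) h) * G z) \<partial>lborel)"
      unfolding eq by (rule integral_norm_bound)
    also have "\<dots> \<le> (\<integral>z. L * (norm h)\<^sup>2 * \<bar>G z\<bar> \<partial>lborel)"
      using int4 G L by (intro integral_mono integrable_norm) (auto simp: abs_mult intro!: mult_right_mono)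
    also have "\<dots> = (L * I) * (norm h)\<^sup>2" by (simp add: I_def)
    finally show ?thesis .
  qed
  show ?thesis
    unfolding has_derivative_at
  proof
    show "bounded_linear ?D"
      by (intro bounded_linear_sum bounded_linear_compose[OF bounded_linear_mult_left bounded_linear_inner_left])
    show "(\<lambda>h. norm (conv f G (x + h) - conv f G x - ?D h) / norm h) \<midarrow>0\<rightarrow> 0"
    proof (rule Lim_null_comparison)
      show "eventually (\<lambda>h. norm (norm (conv f G (x + h) - conv f G x - ?D h) / norm h) \<le> (L * I) * norm h) (at 0)"
      proof (rule always_eventually, rule allI)
        fix h
        have "norm (conv f G (x + h) - conv f G x - ?D h) / norm h \<le> (L * I) * (norm h)\<^sup>2 / norm h"
          by (intro divide_right_mono bound) simp
        also have "\<dots> = (L * I) * norm h" by (simp add: power2_eq_square)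
        finally show "norm (norm (conv f G (x + h) - conv f G x - ?D h) / norm h) \<le> (L * I) * norm h" by simp
      qed
      show "((\<lambda>h::'a. (L * I) * norm h) \<longlongrightarrow> 0) (at 0)" by (rule tendsto_eq_intros refl | simp)+
    qed
  qed
qed

text \<open>The partial derivatives of \<open>conv f G\<close> are convolutions of \<open>G\<close>
  with the partial derivatives of \<open>f\<close>, which are again smooth with compact support;
  this closes the coinduction.\<close>

lemma conv_smooth:
  fixes f G :: "'a::euclidean_space \<Rightarrow> real"
  assumes G: "integrable lborel G"
  shows "smooth_fun f \<Longrightarrow> compact_supp f \<Longrightarrow> smooth_fun (conv f G)"
proof (coinduction arbitrary: f)
  case smooth_fun
  have "frechet_derivative (conv f G) (at x) b = conv (\<lambda>x. frechet_derivative f (at x) b) G x" if b: "b \<in> Basis" for x b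
  proof -
    have "frechet_derivative (conv f G) (at x) b = (\<Sum>c\<in>Basis. (b \<bullet> c) * conv (\<lambda>x. frechet_derivative f (at x) c) G x)"
      using fun_cong[OF frechet_derivative_at[OF conv_has_derivative[OF smooth_fun G, of x]], of b] by (rule sym)
    also have "\<dots> = (\<Sum>c\<in>Basis. if c = b then conv (\<lambda>x. frechet_derivative f (at x) c) G x else 0)"
      using b by (intro sum.cong) (auto simp: inner_Basis)
    finally show ?thesis using b by simp
  qed
  moreover have "conv f G differentiable_on UNIV"
    using conv_has_derivative[OF smooth_fun G] by (auto simp: differentiable_on_def intro: differentiableI)
  ultimately show ?case
    using smooth_fun_partial[OF smooth_fun(1)] compact_supp_partial[OF smooth_fun(2)] by auto
qed

section \<open>Existence: the Poisson extension\<close>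

lemma AE_norm_neq: "AE (x::'a::euclidean_space) in lborel. norm x \<noteq> r"
proof -
  have "sphere (0::'a) r \<in> null_sets lborel"
    using negligible_sphere[of "0::'a" r] by (simp add: negligible_iff_null_sets null_sets_completion_iff)
  then have "AE x in lborel. x \<notin> sphere (0::'a) r" by (rule AE_not_in)
  then show ?thesis by eventually_elim simp
qed

lemma poisson_mass_le:
  assumes "0 < s" "s < 1"
  shows "(\<integral>\<^sup>+y. ennreal (poisson s (x::'a::euclidean_space) y) \<partial>lborel) \<le> 1"
proof (cases "norm x < 1")
  case True then show ?thesis by (rule poisson_mass_le_1[OF assms])
qed (simp add: poisson_def)

lemma poisson_integrable:
  assumes "0 < s" "s < 1"
  shows "integrable lborel (poisson s (x::'a::euclidean_space))"
proof (rule integrableI_nonneg)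
  show "poisson s x \<in> borel_measurable lborel"
    by (rule poisson_measurable) simp_all
  show "AE y in lborel. 0 \<le> poisson s x y" by (simp add: poisson_nonneg)
  show "(\<integral>\<^sup>+y. ennreal (poisson s x y) \<partial>lborel) < \<infinity>"
    by (rule order.strict_trans1[OF poisson_mass_le[OF assms]]) simp
qed

lemma integrable_bounded_mult:
  fixes f g :: "'a::euclidean_space \<Rightarrow> real"
  assumes f: "integrable lborel f" and [measurable]: "g \<in> borel_measurable borel" and B: "\<And>x. \<bar>g x\<bar> \<le> B"
  shows "integrable lborel (\<lambda>x. g x * f x)"
proof (rule Bochner_Integration.integrable_bound[where f="\<lambda>x. B * f x"])
  have "\<bar>g y\<bar> \<le> \<bar>B\<bar>" for y using B[of y] by linarith
  then show "AE x in lborel. norm (g x * f x) \<le> norm (B * f x)" by (auto simp: abs_mult intro!: mult_right_mono)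
qed (use f in \<open>auto simp: borel_measurable_integrable\<close>)

lemma poisson_pair_integrable:
  fixes f g :: "'a::euclidean_space \<Rightarrow> real"
  assumes s: "0 < s" "s < 1" and f: "integrable lborel f"
    and g [measurable]: "g \<in> borel_measurable borel" and B: "\<And>x. \<bar>g x\<bar> \<le> B"
  shows "integrable (lborel \<Otimes>\<^sub>M lborel) (\<lambda>p. g (snd p) * (poisson s (fst p) (snd p) * f (fst p)))"
proof (rule integrable_lborel_pairI)
  have m [measurable]: "f \<in> borel_measurable borel" using f by (simp add: borel_measurable_integrable)
  show "(\<lambda>p. g (snd p) * (poisson s (fst p) (snd p) * f (fst p))) \<in> borel_measurable borel"
    unfolding borel_prod[symmetric] by measurable
  have "B \<ge> 0" using B[of undefined] by (rule order_trans[OF abs_ge_zero])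
  have "(\<integral>\<^sup>+x. \<integral>\<^sup>+y. ennreal \<bar>g (snd (x, y)) * (poisson s (fst (x, y)) (snd (x, y)) * f (fst (x, y)))\<bar> \<partial>lborel \<partial>lborel)
    \<le> (\<integral>\<^sup>+x. \<integral>\<^sup>+y. ennreal B * ennreal \<bar>f x\<bar> * ennreal (poisson s x y) \<partial>lborel \<partial>lborel)"
  proof (intro nn_integral_mono)
    fix x y :: 'a
    have "\<bar>g y * (poisson s x y * f x)\<bar> \<le> B * (poisson s x y * \<bar>f x\<bar>)"
      unfolding abs_mult using B[of y] by (intro mult_mono) (auto simp: poisson_nonneg)
    then show "ennreal \<bar>g (snd (x, y)) * (poisson s (fst (x, y)) (snd (x, y)) * f (fst (x, y)))\<bar> \<le> ennreal B * ennreal \<bar>f x\<bar> * ennreal (poisson s x y)"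
      using \<open>B \<ge> 0\<close> by (simp add: ennreal_mult[symmetric] poisson_nonneg ennreal_leI mult_ac)
  qed
  also have "\<dots> = (\<integral>\<^sup>+x. ennreal B * ennreal \<bar>f x\<bar> * (\<integral>\<^sup>+y. ennreal (poisson s x y) \<partial>lborel) \<partial>lborel)"
    by (intro nn_integral_cong nn_integral_cmult) measurable
  also have "\<dots> \<le> (\<integral>\<^sup>+x. ennreal B * ennreal \<bar>f x\<bar> * 1 \<partial>lborel)"
    by (intro nn_integral_mono mult_left_mono poisson_mass_le[OF s]) auto
  also have "\<dots> < \<infinity>" using f by (simp add: nn_integral_cmult integrable_iff_bounded ennreal_mult_less_top)
  finally show "(\<integral>\<^sup>+x. \<integral>\<^sup>+y. ennreal \<bar>g (snd (x, y)) * (poisson s (fst (x, y)) (snd (x, y)) * f (fst (x, y)))\<bar> \<partial>lborel \<partial>lborel) < \<infinity>" .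
qed

text \<open>Sweeping: outside the ball, \<open>(-\<Delta>)\<^sup>s \<phi>\<close> is minus the balayage of its restriction to the ball, since
  both have the same Riesz potential there.\<close>

lemma poisson_balayage:
  fixes \<phi> :: "'a::euclidean_space \<Rightarrow> real"
  assumes s: "0 < s" "s < 1" "2 * s < real DIM('a)" and \<phi>: "smooth_fun \<phi>" "compact_supp \<phi>"
    and supp: "\<And>x. norm x \<ge> 1 \<Longrightarrow> \<phi> x = 0"
  shows "AE y in lborel. norm y > 1 \<longrightarrow> nonlocal s \<phi> y + (\<integral>x. poisson s x y * nonlocal s \<phi> x \<partial>lborel) = 0"
proof -
  define f where "f = nonlocal s \<phi>"
  define S where "S = {y::'a. norm y > 1}"
  have fi: "integrable lborel f" unfolding f_def by (rule nonlocal_integrable[OF s(1,2) \<phi>])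
  have fm [measurable]: "f \<in> borel_measurable borel" using fi by (simp add: borel_measurable_integrable)
  obtain B where B1: "\<And>x. nonlocal_abs s \<phi> x \<le> B" using nonlocal_abs_bounded[OF s(1,2) \<phi>] by blast
  have B: "\<bar>f x\<bar> \<le> B" for x
    unfolding f_def by (rule order_trans[OF nonlocal_le_abs[OF s(1,2) \<phi>, of x] B1])
  obtain M where M: "M \<ge> 0" "\<And>x. (\<integral>\<^sup>+y. ennreal (riesz s (x - y) * \<bar>f y\<bar>) \<partial>lborel) \<le> ennreal M"
    using riesz_nn_bound_real[OF s(1,3) fi B] by metis
  define P where "P y = (\<integral>x. poisson s x y * f x \<partial>lborel)" for y
  have Pm [measurable]: "P \<in> borel_measurable borel" unfolding P_def by measurable
  have "integrable (lborel \<Otimes>\<^sub>M lborel) (\<lambda>p. 1 * (poisson s (fst p) (snd p) * f (fst p)))"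
    by (rule poisson_pair_integrable[OF s(1,2) fi, of "\<lambda>_. 1" 1]) auto
  then have Pi: "integrable lborel P"
    unfolding P_def by (intro lborel_pair.integrable_snd) (simp add: case_prod_unfold)
  have [measurable]: "S \<in> sets borel" unfolding S_def by measurable
  \<comment> \<open>The defect of the claim, carried by the exterior of the closed ball. Its
    potential has to vanish only on that exterior, exactly where the potential of the balayage is
    known.\<close>
  define E where "E y = indicator S y * (f y + P y)" for y
  have nnK: "(\<integral>\<^sup>+x. \<integral>\<^sup>+y. ennreal \<bar>riesz s (z - y) * (poisson s x y * f x)\<bar> \<partial>lborel \<partial>lborel) \<le> ennreal M" if z: "z \<in> S" for z
  proof -
    have "(\<integral>\<^sup>+x. \<integral>\<^sup>+y. ennreal \<bar>riesz s (z - y) * (poisson s x y * f x)\<bar> \<partial>lborel \<partial>lborel)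
      \<le> (\<integral>\<^sup>+x. ennreal (riesz s (z - x) * \<bar>f x\<bar>) \<partial>lborel)"
    proof (rule nn_integral_mono)
      fix x :: 'a
      have "(\<integral>\<^sup>+y. ennreal \<bar>riesz s (z - y) * (poisson s x y * f x)\<bar> \<partial>lborel) = (\<integral>\<^sup>+y. ennreal \<bar>f x\<bar> * ennreal (poisson s x y * riesz s (y - z)) \<partial>lborel)"
        by (intro nn_integral_cong) (simp add: abs_mult ennreal_mult[symmetric] poisson_nonneg riesz_minus[of s z] mult_ac)
      also have "\<dots> = ennreal \<bar>f x\<bar> * (\<integral>\<^sup>+y. ennreal (poisson s x y * riesz s (y - z)) \<partial>lborel)"
        by (rule nn_integral_cmult) measurable
      also have "\<dots> \<le> ennreal \<bar>f x\<bar> * ennreal (riesz s (x - z))"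
      proof (cases "norm x < 1")
        case True
        then show ?thesis using poisson_riesz[OF s(1,2) True] z by (simp add: S_def)
      qed (simp add: poisson_def)
      finally show "(\<integral>\<^sup>+y. ennreal \<bar>riesz s (z - y) * (poisson s x y * f x)\<bar> \<partial>lborel) \<le> ennreal (riesz s (z - x) * \<bar>f x\<bar>)"
        by (simp add: ennreal_mult[symmetric] riesz_minus[of s z] mult.commute)
    qed
    also have "\<dots> \<le> ennreal M" by (rule M(2))
    finally show ?thesis .
  qed
  have "AE y in lborel. E y = 0"
  proof (rule riesz_potential_injective[OF s(3), where S=S and M="M + M"])
    show "integrable lborel E"
      unfolding E_def by (rule integrable_bounded_mult[where B=1]) (use fi Pi in \<open>auto simp: indicator_def\<close>)
    show "E y = 0" if "y \<notin> S" for y using that by (simp add: E_def)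
    fix z assume z: "z \<in> S"
    have "(\<integral>\<^sup>+y. ennreal (riesz s (z - y) * \<bar>E y\<bar>) \<partial>lborel) \<le> (\<integral>\<^sup>+y. ennreal (riesz s (z - y) * \<bar>f y\<bar>) + (\<integral>\<^sup>+x. ennreal \<bar>riesz s (z - y) * (poisson s x y * f x)\<bar> \<partial>lborel) \<partial>lborel)"
    proof (rule nn_integral_mono)
      fix y
      have 1: "ennreal \<bar>P y\<bar> \<le> (\<integral>\<^sup>+x. ennreal \<bar>poisson s x y * f x\<bar> \<partial>lborel)"
      proof (cases "integrable lborel (\<lambda>x. poisson s x y * f x)")
        case True then show ?thesis unfolding P_def using integral_norm_bound_ennreal[OF True] by simp
      qed (simp add: P_def not_integrable_integral_eq)
      have "\<bar>E y\<bar> \<le> \<bar>f y\<bar> + \<bar>P y\<bar>" by (auto simp: E_def indicator_def)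
      then have "ennreal (riesz s (z - y) * \<bar>E y\<bar>) \<le> ennreal (riesz s (z - y) * (\<bar>f y\<bar> + \<bar>P y\<bar>))"
        by (intro ennreal_leI mult_left_mono) auto
      also have "\<dots> = ennreal (riesz s (z - y) * \<bar>f y\<bar>) + ennreal (riesz s (z - y)) * ennreal \<bar>P y\<bar>"
        by (simp add: distrib_left ennreal_mult)
      also have "\<dots> \<le> ennreal (riesz s (z - y) * \<bar>f y\<bar>) + ennreal (riesz s (z - y)) * (\<integral>\<^sup>+x. ennreal \<bar>poisson s x y * f x\<bar> \<partial>lborel)"
        using 1 by (intro add_left_mono mult_left_mono) auto
      also have "ennreal (riesz s (z - y)) * (\<integral>\<^sup>+x. ennreal \<bar>poisson s x y * f x\<bar> \<partial>lborel) = (\<integral>\<^sup>+x. ennreal \<bar>riesz s (z - y) * (poisson s x y * f x)\<bar> \<partial>lborel)"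
        by (subst nn_integral_cmult[symmetric]) (auto simp: abs_mult ennreal_mult)
      finally show "ennreal (riesz s (z - y) * \<bar>E y\<bar>) \<le> ennreal (riesz s (z - y) * \<bar>f y\<bar>) + (\<integral>\<^sup>+x. ennreal \<bar>riesz s (z - y) * (poisson s x y * f x)\<bar> \<partial>lborel)" .
    qed
    also have "\<dots> = (\<integral>\<^sup>+y. ennreal (riesz s (z - y) * \<bar>f y\<bar>) \<partial>lborel) + (\<integral>\<^sup>+y. \<integral>\<^sup>+x. ennreal \<bar>riesz s (z - y) * (poisson s x y * f x)\<bar> \<partial>lborel \<partial>lborel)"
      by (rule nn_integral_add) measurable
    also have "(\<integral>\<^sup>+y. \<integral>\<^sup>+x. ennreal \<bar>riesz s (z - y) * (poisson s x y * f x)\<bar> \<partial>lborel \<partial>lborel) = (\<integral>\<^sup>+x. \<integral>\<^sup>+y. ennreal \<bar>riesz s (z - y) * (poisson s x y * f x)\<bar> \<partial>lborel \<partial>lborel)"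
      by (rule lborel_pair.Fubini') measurable
    also have "(\<integral>\<^sup>+y. ennreal (riesz s (z - y) * \<bar>f y\<bar>) \<partial>lborel) + (\<integral>\<^sup>+x. \<integral>\<^sup>+y. ennreal \<bar>riesz s (z - y) * (poisson s x y * f x)\<bar> \<partial>lborel \<partial>lborel) \<le> ennreal M + ennreal M"
      by (intro add_mono M(2) nnK z)
    finally show "(\<integral>\<^sup>+y. ennreal (riesz s (z - y) * \<bar>E y\<bar>) \<partial>lborel) \<le> ennreal (M + M)"
      using M(1) by (subst ennreal_plus) auto
    define K where "K p = riesz s (z - snd p) * (poisson s (fst p) (snd p) * f (fst p))" for p
    have Km [measurable]: "K \<in> borel_measurable borel" unfolding K_def borel_prod[symmetric] by measurable
    have intK: "integrable (lborel \<Otimes>\<^sub>M lborel) K"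
      by (rule integrable_lborel_pairI) (use order.strict_trans1[OF nnK[OF z], of \<infinity>] in \<open>auto simp: K_def\<close>)
    have "integrable lborel (\<lambda>y. \<integral>x. K (x, y) \<partial>lborel)"
      by (rule lborel_pair.integrable_snd) (use intK in \<open>simp add: case_prod_unfold\<close>)
    then have rP: "integrable lborel (\<lambda>y. riesz s (z - y) * P y)" by (simp add: K_def P_def)
    have "(\<integral>y. riesz s (z - y) * P y \<partial>lborel) = (\<integral>y. \<integral>x. K (x, y) \<partial>lborel \<partial>lborel)" by (simp add: K_def P_def)
    also have "\<dots> = (\<integral>x. \<integral>y. K (x, y) \<partial>lborel \<partial>lborel)"
      by (rule lborel_pair.Fubini_integral) (use intK in \<open>simp add: case_prod_unfold\<close>)
    \<comment> \<open>For \<open>x\<close> in the ball the integral over \<open>y\<close> is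
      \<open>W(x - z)\<close> by the balayage identity: sweeping leaves the potential at exterior
      points \<open>z\<close> unchanged.\<close>
    also have "\<dots> = (\<integral>x. indicator (ball 0 1) x * (riesz s (z - x) * f x) \<partial>lborel)"
    proof (rule Bochner_Integration.integral_cong[OF refl])
      fix x :: 'a
      have "(\<integral>y. K (x, y) \<partial>lborel) = (\<integral>y. poisson s x y * riesz s (y - z) \<partial>lborel) * f x"
        by (simp add: K_def riesz_minus[of s z] mult_ac flip: integral_mult_left_zero)
      also have "\<dots> = indicator (ball 0 1) x * (riesz s (z - x) * f x)"
      proof (cases "norm x < 1")
        case True
        have "(\<integral>y. poisson s x y * riesz s (y - z) \<partial>lborel) = riesz s (x - z)"
          using poisson_riesz[OF s(1,2) True] z by (subst integral_eq_nn_integral) (auto simp: S_def poisson_nonneg)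
        then show ?thesis using True by (simp add: riesz_minus[of s z])
      qed (simp add: poisson_def)
      finally show "(\<integral>y. K (x, y) \<partial>lborel) = indicator (ball 0 1) x * (riesz s (z - x) * f x)" .
    qed
    finally have 1: "(\<integral>y. riesz s (z - y) * P y \<partial>lborel) = (\<integral>x. indicator (ball 0 1) x * (riesz s (z - x) * f x) \<partial>lborel)" .
    have ri: "integrable lborel (\<lambda>y. riesz s (z - y) * f y)" by (rule riesz_integrable[OF s(1,3) fi B])
    have ri1: "integrable lborel (\<lambda>y. indicator S y * (riesz s (z - y) * f y))"
      and ri2: "integrable lborel (\<lambda>y. indicator (ball 0 1) y * (riesz s (z - y) * f y))"
      by (rule integrable_bounded_mult[OF ri, of _ 1]; simp add: indicator_def)+
    have P0: "P y = 0" if "y \<notin> S" for y using that by (simp add: P_def poisson_def S_def)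
    have "(\<integral>y. riesz s (z - y) * E y \<partial>lborel) = (\<integral>y. indicator S y * (riesz s (z - y) * f y) + riesz s (z - y) * P y \<partial>lborel)"
      using P0 by (intro Bochner_Integration.integral_cong) (auto simp: E_def indicator_def algebra_simps)
    also have "\<dots> = (\<integral>y. indicator S y * (riesz s (z - y) * f y) \<partial>lborel) + (\<integral>y. indicator (ball 0 1) y * (riesz s (z - y) * f y) \<partial>lborel)"
      using ri1 rP by (simp add: 1)
    also have "\<dots> = (\<integral>y. indicator S y * (riesz s (z - y) * f y) + indicator (ball 0 1) y * (riesz s (z - y) * f y) \<partial>lborel)"
      using ri1 ri2 by simp
    also have "\<dots> = (\<integral>y. riesz s (z - y) * f y \<partial>lborel)"
    proof (rule integral_cong_AE)
      show "AE y in lborel. indicator S y * (riesz s (z - y) * f y) + indicator (ball 0 1) y * (riesz s (z - y) * f y) = riesz s (z - y) * f y"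
        using AE_norm_neq[where 'a='a, of 1] by eventually_elim (auto simp: S_def indicator_def)
    qed measurable
    \<comment> \<open>The exterior part of \<open>f\<close> and the swept interior part together
      have the potential of all of \<open>f\<close>, which is a multiple of \<open>\<phi> z\<close>,
      and \<open>\<phi>\<close> vanishes outside the ball.\<close>
    also have "\<dots> = riesz_inv_const TYPE('a) s * \<phi> z"
      unfolding f_def by (rule riesz_potential_nonlocal[OF s \<phi>])
    also have "\<dots> = 0" using supp[of z] z by (simp add: S_def)
    finally show "(\<integral>y. riesz s (z - y) * E y \<partial>lborel) = 0" .
  qed
  then show ?thesis by eventually_elim (auto simp: E_def S_def P_def f_def)
qed

lemma test_fun_ballD:
  fixes \<phi> :: "'a::euclidean_space \<Rightarrow> real"
  assumes "test_fun (ball 0 1) \<phi>"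
  shows "smooth_fun \<phi>" "compact_supp \<phi>" "\<And>x. norm x \<ge> 1 \<Longrightarrow> \<phi> x = 0"
proof -
  show "smooth_fun \<phi>" "compact_supp \<phi>" using assms by (auto simp: test_fun_def compact_supp_def)
  fix x :: 'a assume "norm x \<ge> 1"
  then have "x \<notin> closure {x. \<phi> x \<noteq> 0}" using assms by (auto simp: test_fun_def)
  then show "\<phi> x = 0" using closure_subset[of "{x. \<phi> x \<noteq> 0}"] by auto
qed

section \<open>The Poisson extension solves the exterior value problem\<close>

definition poisson_ext :: "real \<Rightarrow> ('a::euclidean_space \<Rightarrow> real) \<Rightarrow> 'a \<Rightarrow> real" where
  "poisson_ext s g x = (if norm x < 1 then (\<integral>y. poisson s x y * g y \<partial>lborel) else g x)"

lemma poisson_ext_measurable [measurable]: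
  assumes [measurable]: "g \<in> borel_measurable borel"
  shows "poisson_ext s g \<in> borel_measurable borel"
  unfolding poisson_ext_def by measurable

lemma poisson_ext_bound:
  fixes g :: "'a::euclidean_space \<Rightarrow> real"
  assumes s: "0 < s" "s < 1" and g [measurable]: "g \<in> borel_measurable borel" and B: "\<And>x. \<bar>g x\<bar> \<le> B"
  shows "\<bar>poisson_ext s g x\<bar> \<le> B"
proof (cases "norm x < 1")
  case True
  have B0: "B \<ge> 0" using B[of undefined] by (rule order_trans[OF abs_ge_zero])
  have i: "integrable lborel (\<lambda>y. g y * poisson s x y)"
    by (rule integrable_bounded_mult[OF poisson_integrable[OF s] g B])
  have "\<bar>\<integral>y. g y * poisson s x y \<partial>lborel\<bar> \<le> (\<integral>y. norm (g y * poisson s x y) \<partial>lborel)"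
    unfolding real_norm_def[symmetric] by (rule integral_norm_bound)
  also have "\<dots> \<le> (\<integral>y. B * poisson s x y \<partial>lborel)"
    using i B by (intro integral_mono integrable_norm integrable_mult_right poisson_integrable[OF s]) (auto simp: abs_mult poisson_nonneg mult_right_mono)
  also have "\<dots> = B * (\<integral>y. poisson s x y \<partial>lborel)" by simp
  also have "\<dots> \<le> B * 1"
  proof (rule mult_left_mono[OF _ B0])
    have "ennreal (\<integral>y. poisson s x y \<partial>lborel) \<le> 1"
      using poisson_mass_le[OF s, of x] by (subst nn_integral_eq_integral[symmetric]) (auto simp: poisson_nonneg poisson_integrable[OF s])
    then show "(\<integral>y. poisson s x y \<partial>lborel) \<le> 1" by simp
  qed
  finally show ?thesis using True by (simp add: poisson_ext_def mult.commute)
qed (use B in \<open>simp add: poisson_ext_def\<close>)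

text \<open>For \<open>|x| \<le> \<rho>\<close> and \<open>|y| > 1\<close> one has
  \<open>|y - x| \<ge> (1 - \<rho>) |y|\<close>, and the numerator is largest at the centre. This
  gives one integrable majorant for all kernels with \<open>x\<close> in a smaller ball, as needed
  for continuity of the extension.\<close>

lemma poisson_Harnack:
  fixes x :: "'a::euclidean_space"
  assumes s: "0 < s" "s < 1" and x: "norm x \<le> \<rho>" and \<rho>: "\<rho> < 1"
  shows "poisson s x y \<le> (1 / (1 - \<rho>)) ^ DIM('a) * poisson s 0 y"
proof (cases "norm y > 1")
  case True
  have K: "riesz_norm TYPE('a) s > 0" by (rule riesz_ball_const_eq[OF s])
  have x1: "norm x < 1" using x \<rho> by simp
  have y1: "(norm y)\<^sup>2 - 1 > 0" using True by (simp add: one_less_power)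
  have "(1 - (norm x)\<^sup>2) / ((norm y)\<^sup>2 - 1) \<le> (1 - (norm (0::'a))\<^sup>2) / ((norm y)\<^sup>2 - 1)"
    using y1 by (intro divide_right_mono) auto
  then have a: "((1 - (norm x)\<^sup>2) / ((norm y)\<^sup>2 - 1)) powr s \<le> ((1 - (norm (0::'a))\<^sup>2) / ((norm y)\<^sup>2 - 1)) powr s"
    using s y1 x1 by (intro powr_mono2) (auto simp: power_le_one)
  have "\<rho> \<ge> 0" using x norm_ge_zero order_trans by blast
  then have "\<rho> * 1 \<le> \<rho> * norm y" using True by (intro mult_left_mono) auto
  then have "(1 - \<rho>) * norm y \<le> norm y - norm x" using x by (simp add: algebra_simps)
  also have "\<dots> \<le> norm (y - x)" by (rule norm_triangle_ineq2)
  finally have le: "(1 - \<rho>) * norm y \<le> norm (y - x)" .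
  have p: "(1 - \<rho>) * norm y > 0" using \<rho> True by (intro mult_pos_pos) auto
  have b: "1 / norm (y - x) ^ DIM('a) \<le> 1 / ((1 - \<rho>) * norm y) ^ DIM('a)"
    by (intro divide_left_mono[OF power_mono[OF le less_imp_le[OF p]] zero_le_one
          mult_pos_pos[OF zero_less_power[OF less_le_trans[OF p le]] zero_less_power[OF p]]])
  have "((1 - (norm x)\<^sup>2) / ((norm y)\<^sup>2 - 1)) powr s * (1 / norm (y - x) ^ DIM('a)) \<le> ((1 - (norm (0::'a))\<^sup>2) / ((norm y)\<^sup>2 - 1)) powr s * (1 / ((1 - \<rho>) * norm y) ^ DIM('a))"
    by (intro mult_mono a b) auto
  then have "((1 - (norm x)\<^sup>2) / ((norm y)\<^sup>2 - 1)) powr s * (1 / norm (y - x) ^ DIM('a)) / riesz_norm TYPE('a) s \<le> ((1 - (norm (0::'a))\<^sup>2) / ((norm y)\<^sup>2 - 1)) powr s * (1 / ((1 - \<rho>) * norm y) ^ DIM('a)) / riesz_norm TYPE('a) s"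
    using K by (intro divide_right_mono) auto
  then show ?thesis using x1 True by (simp add: poisson_def power_mult_distrib power_one_over mult_ac)
qed (simp add: poisson_def)

lemma poisson_ext_continuous:
  fixes g :: "'a::euclidean_space \<Rightarrow> real"
  assumes s: "0 < s" "s < 1" and g [measurable]: "g \<in> borel_measurable borel" and B: "\<And>x. \<bar>g x\<bar> \<le> B"
  shows "continuous_on (ball 0 1) (poisson_ext s g)"
  unfolding continuous_on_sequentially
proof (intro allI ballI impI, elim conjE)
  fix x :: "nat \<Rightarrow> 'a" and a
  assume a: "a \<in> ball 0 1" and x: "\<forall>n. x n \<in> ball 0 1" and lim: "x \<longlonglongrightarrow> a"
  have B0: "B \<ge> 0" using B[of undefined] by (rule order_trans[OF abs_ge_zero])
  obtain \<rho> where \<rho>: "norm a < \<rho>" "\<rho> < 1" using a dense[of "norm a" 1] by auto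
  have "eventually (\<lambda>n. norm (x n) < \<rho>) sequentially"
    using order_tendstoD(2)[OF tendsto_norm[OF lim] \<rho>(1)] .
  then obtain k where k: "\<And>n. n \<ge> k \<Longrightarrow> norm (x n) < \<rho>" by (auto simp: eventually_sequentially)
  have "(\<lambda>n. \<integral>y. poisson s (x (n + k)) y * g y \<partial>lborel) \<longlonglongrightarrow> (\<integral>y. poisson s a y * g y \<partial>lborel)"
  proof (rule Bochner_Integration.integral_dominated_convergence[where w="\<lambda>y. (1 / (1 - \<rho>)) ^ DIM('a) * B * poisson s 0 y"])
    show "integrable lborel (\<lambda>y::'a. (1 / (1 - \<rho>)) ^ DIM('a) * B * poisson s 0 y)"
      by (intro integrable_mult_right poisson_integrable[OF s])
    show "AE y in lborel. (\<lambda>n. poisson s (x (n + k)) y * g y) \<longlonglongrightarrow> poisson s a y * g y"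
    proof (rule AE_I2)
      fix y :: 'a
      have lim': "(\<lambda>n. x (n + k)) \<longlonglongrightarrow> a" using LIMSEQ_ignore_initial_segment[OF lim] .
      have "(\<lambda>n. poisson s (x (n + k)) y) \<longlonglongrightarrow> poisson s a y"
      proof (cases "norm y > 1")
        case True
        have ne: "norm (y - a) ^ DIM('a) \<noteq> 0" using True a by auto
        have "(\<lambda>n. ((1 - (norm (x (n + k)))\<^sup>2) / ((norm y)\<^sup>2 - 1)) powr s / norm (y - x (n + k)) ^ DIM('a) / riesz_norm TYPE('a) s) \<longlonglongrightarrow>
          ((1 - (norm a)\<^sup>2) / ((norm y)\<^sup>2 - 1)) powr s / norm (y - a) ^ DIM('a) / riesz_norm TYPE('a) s"
        proof (intro tendsto_divide tendsto_powr' tendsto_intros lim' ne disjI2 conjI)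
          have "1 < (norm y)\<^sup>2" using True by (simp add: one_less_power)
          then show "(norm y)\<^sup>2 - 1 \<noteq> 0" by linarith
          show "riesz_norm TYPE('a) s \<noteq> 0" using riesz_ball_const_eq(2)[OF s, where 'a='a] by simp
          show "0 < s" by (rule s)
          show "eventually (\<lambda>n. 0 \<le> (1 - (norm (x (n + k)))\<^sup>2) / ((norm y)\<^sup>2 - 1)) sequentially"
            using x True by (intro always_eventually allI divide_nonneg_nonneg) (auto simp: power_le_one less_imp_le one_le_power)
        qed
        then show ?thesis using True a x by (simp add: poisson_def)
      qed (simp add: poisson_def)
      then show "(\<lambda>n. poisson s (x (n + k)) y * g y) \<longlonglongrightarrow> poisson s a y * g y" by (intro tendsto_mult tendsto_const)
    qed
    show "AE y in lborel. norm (poisson s (x (n + k)) y * g y) \<le> (1 / (1 - \<rho>)) ^ DIM('a) * B * poisson s 0 y" for n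
    proof (rule AE_I2)
      fix y :: 'a
      have "norm (poisson s (x (n + k)) y * g y) = poisson s (x (n + k)) y * \<bar>g y\<bar>" by (simp add: abs_mult poisson_nonneg)
      also have "\<dots> \<le> ((1 / (1 - \<rho>)) ^ DIM('a) * poisson s 0 y) * B"
        using poisson_Harnack[OF s less_imp_le[OF k] \<rho>(2), of "n + k" y] B[of y] \<rho>(2)
        by (intro mult_mono) (auto intro!: mult_nonneg_nonneg poisson_nonneg)
      finally show "norm (poisson s (x (n + k)) y * g y) \<le> (1 / (1 - \<rho>)) ^ DIM('a) * B * poisson s 0 y" by (simp add: mult_ac)
    qed
  qed measurable
  then have "(\<lambda>n. poisson_ext s g (x (n + k))) \<longlonglongrightarrow> poisson_ext s g a" using a x by (simp add: poisson_ext_def)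
  then show "(poisson_ext s g \<circ> x) \<longlonglongrightarrow> poisson_ext s g a" unfolding o_def by (rule LIMSEQ_offset)
qed

text \<open>By Fubini's theorem the integral over the ball of the extension against
  \<open>(-Delta)^s \<phi>\<close> becomes the integral of \<open>g\<close> against the swept
  function \<open>P\<close>. Outside the ball \<open>P\<close> is the negative of
  \<open>(-Delta)^s \<phi>\<close>, so this cancels the exterior contribution.\<close>

lemma poisson_ext_solution:
  fixes g :: "'a::euclidean_space \<Rightarrow> real"
  assumes s: "0 < s" "s < 1" "2 * s < real DIM('a)" and g [measurable]: "g \<in> borel_measurable borel" and B: "\<And>x. \<bar>g x\<bar> \<le> B"
  shows "frac_poisson_sol s (ball 0 1) g (poisson_ext s g)"
  unfolding frac_poisson_sol_def
proof (intro conjI allI impI)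
  let ?u = "poisson_ext s g"
  show "?u \<in> borel_measurable lebesgue" by (rule measurable_completion) measurable
  show "\<exists>C. AE x in lebesgue. \<bar>?u x\<bar> \<le> C" using poisson_ext_bound[OF s(1,2) g B] by (intro exI[of _ B] AE_I2)
  show "AE x in lebesgue. x \<notin> ball 0 1 \<longrightarrow> ?u x = g x" by (rule AE_I2) (simp add: poisson_ext_def)
  show "continuous_on (ball 0 1) ?u" by (rule poisson_ext_continuous[OF s(1,2) g B])
  fix \<phi> :: "'a \<Rightarrow> real" assume "test_fun (ball 0 1) \<phi>"
  note \<phi> = test_fun_ballD[OF this]
  define f where "f = nonlocal s \<phi>"
  have fi: "integrable lborel f" unfolding f_def by (rule nonlocal_integrable[OF s(1,2) \<phi>(1,2)])
  have fm [measurable]: "f \<in> borel_measurable borel" using fi by (simp add: borel_measurable_integrable)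
  define P where "P y = (\<integral>x. poisson s x y * f x \<partial>lborel)" for y
  have Pm [measurable]: "P \<in> borel_measurable borel" unfolding P_def by measurable
  have bal: "AE y in lborel. norm y > 1 \<longrightarrow> f y + P y = 0"
    using poisson_balayage[OF s \<phi>] by (simp add: f_def P_def)
  define K where "K p = g (snd p) * (poisson s (fst p) (snd p) * f (fst p))" for p
  have intK: "integrable (lborel \<Otimes>\<^sub>M lborel) K" unfolding K_def by (rule poisson_pair_integrable[OF s(1,2) fi g B])
  have Kx: "(\<integral>y. K (x, y) \<partial>lborel) = indicator (ball 0 1) x * (?u x * f x)" for x
  proof (cases "norm x < 1")
    case True
    have "(\<integral>y. K (x, y) \<partial>lborel) = (\<integral>y. (poisson s x y * g y) * f x \<partial>lborel)"
      by (intro Bochner_Integration.integral_cong) (auto simp: K_def)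
    then show ?thesis using True by (simp add: poisson_ext_def)
  qed (simp add: K_def poisson_def)
  have Ky: "(\<integral>x. K (x, y) \<partial>lborel) = g y * P y" for y by (simp add: K_def P_def)
  have iP: "integrable lborel (\<lambda>y. g y * P y)"
    unfolding Ky[symmetric] by (rule lborel_pair.integrable_snd) (use intK in \<open>simp add: case_prod_unfold\<close>)
  have F: "(\<integral>x. indicator (ball 0 1) x * (?u x * f x) \<partial>lborel) = (\<integral>y. g y * P y \<partial>lborel)"
    unfolding Kx[symmetric] Ky[symmetric]
    by (rule lborel_pair.Fubini_integral[symmetric]) (use intK in \<open>simp add: case_prod_unfold\<close>)
  have iu: "integrable lborel (\<lambda>x. ?u x * f x)"
    by (rule integrable_bounded_mult[OF fi _ poisson_ext_bound[OF s(1,2) g B]]) measurable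
  have iu1: "integrable lborel (\<lambda>x. indicator (ball 0 1) x * (?u x * f x))"
    and iu2: "integrable lborel (\<lambda>x. indicator (- ball 0 1) x * (?u x * f x))"
    by (rule integrable_bounded_mult[OF iu, of _ 1]; simp add: indicator_def)+
  have "(\<integral>x. ?u x * f x \<partial>lborel) = (\<integral>x. indicator (ball 0 1) x * (?u x * f x) + indicator (- ball 0 1) x * (?u x * f x) \<partial>lborel)"
    by (intro Bochner_Integration.integral_cong) (auto simp: indicator_def)
  also have "\<dots> = (\<integral>y. g y * P y + indicator (- ball 0 1) y * (?u y * f y) \<partial>lborel)"
    using iu1 iu2 iP by (simp add: F)
  also have "\<dots> = (\<integral>(y::'a). 0 \<partial>lborel)"
  proof (rule integral_cong_AE)
    show "AE y in lborel. g y * P y + indicator (- ball 0 1) y * (?u y * f y) = 0"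
      using bal AE_norm_neq[where 'a='a, of 1]
    proof eventually_elim
      case (elim y)
      show ?case
      proof (cases "norm y > 1")
        case True
        then have "f y = - P y" using elim by simp
        then show ?thesis using True by (simp add: poisson_ext_def)
      next
        case False
        then have "P y = 0" by (simp add: P_def poisson_def)
        then show ?thesis using False elim by simp
      qed
    qed
  qed measurable
  finally have 0: "(\<integral>x. ?u x * f x \<partial>lborel) = 0" by simp
  have "(\<integral>x. ?u x * frac_lap s \<phi> x \<partial>lebesgue) = (\<integral>x. frac_const DIM('a) s / 2 * (?u x * f x) \<partial>lebesgue)"
    by (intro Bochner_Integration.integral_cong) (auto simp: frac_lap_eq_nonlocal[OF s(1,2) \<phi>(1,2)] f_def)
  also have "\<dots> = (\<integral>x. frac_const DIM('a) s / 2 * (?u x * f x) \<partial>lborel)"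
    by (rule integral_completion) measurable
  finally show "(\<integral>x. ?u x * frac_lap s \<phi> x \<partial>lebesgue) = 0" using 0 by simp
qed

section \<open>Uniqueness: representation at the centre\<close>

text \<open>The exit density from the centre of the ball of radius \<open>r\<close>. With
  \<open>r < 1\<close> it leaves a margin in which the Green function can be mollified without
  leaving the unit ball.\<close>

definition poisson_scaled :: "real \<Rightarrow> real \<Rightarrow> 'a::euclidean_space \<Rightarrow> real" where
  "poisson_scaled s r y = poisson s 0 (y /\<^sub>R r) / r ^ DIM('a)"

lemma poisson_scaled_measurable [measurable]: "poisson_scaled s r \<in> borel_measurable borel"
  unfolding poisson_scaled_def by measurable

lemma poisson_scaled_nonneg: "r > 0 \<Longrightarrow> poisson_scaled s r y \<ge> 0"
  by (simp add: poisson_scaled_def poisson_nonneg)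

lemma nn_integral_poisson_scaled:
  fixes F :: "'a::euclidean_space \<Rightarrow> real"
  assumes r: "r > 0" and F [measurable]: "F \<in> borel_measurable borel" and F0: "\<And>x. F x \<ge> 0"
  shows "(\<integral>\<^sup>+y. ennreal (poisson_scaled s r y * F y) \<partial>lborel) = (\<integral>\<^sup>+y. ennreal (poisson s 0 y * F (r *\<^sub>R y)) \<partial>lborel)"
proof -
  have "(\<integral>\<^sup>+y. ennreal (poisson_scaled s r y * F y) \<partial>lborel) = ennreal (\<bar>r\<bar> ^ DIM('a)) * (\<integral>\<^sup>+y. ennreal (poisson_scaled s r (0 + r *\<^sub>R y) * F (0 + r *\<^sub>R y)) \<partial>lborel)"
    using r by (intro nn_integral_lborel_affine) auto
  also have "\<dots> = (\<integral>\<^sup>+y. ennreal (\<bar>r\<bar> ^ DIM('a)) * ennreal (poisson_scaled s r (0 + r *\<^sub>R y) * F (0 + r *\<^sub>R y)) \<partial>lborel)"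
    by (rule nn_integral_cmult[symmetric]) measurable
  also have "\<dots> = (\<integral>\<^sup>+y. ennreal (poisson s 0 y * F (r *\<^sub>R y)) \<partial>lborel)"
    using r F0 by (intro nn_integral_cong) (simp add: ennreal_mult[symmetric] poisson_scaled_def poisson_nonneg)
  finally show ?thesis .
qed

lemma integral_poisson_scaled:
  fixes F :: "'a::euclidean_space \<Rightarrow> real"
  assumes r: "r > 0" and F [measurable]: "F \<in> borel_measurable borel"
  shows "(\<integral>y. poisson_scaled s r y * F y \<partial>lborel) = (\<integral>y. poisson s 0 y * F (r *\<^sub>R y) \<partial>lborel)"
proof -
  have "(\<integral>y. poisson_scaled s r y * F y \<partial>lborel) = \<bar>r\<bar> ^ DIM('a) * (\<integral>y. poisson_scaled s r (0 + r *\<^sub>R y) * F (0 + r *\<^sub>R y) \<partial>lborel)"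
    using r by (intro integral_lborel_affine) auto
  also have "\<dots> = (\<integral>y. \<bar>r\<bar> ^ DIM('a) * (poisson_scaled s r (0 + r *\<^sub>R y) * F (0 + r *\<^sub>R y)) \<partial>lborel)"
    by simp
  also have "\<dots> = (\<integral>y. poisson s 0 y * F (r *\<^sub>R y) \<partial>lborel)"
    using r by (intro Bochner_Integration.integral_cong) (auto simp: poisson_scaled_def)
  finally show ?thesis .
qed

lemma poisson_scaled_mass:
  assumes "0 < s" "s < 1" "r > 0"
  shows "(\<integral>\<^sup>+(y::'a::euclidean_space). ennreal (poisson_scaled s r y) \<partial>lborel) = 1"
  using nn_integral_poisson_scaled[of r "\<lambda>_::'a. 1" s] poisson_center_mass[OF assms(1,2), where 'a='a] assms(3) by simp

lemma poisson_scaled_integrable: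
  assumes "0 < s" "s < 1" "r > 0"
  shows "integrable lborel (poisson_scaled s r :: 'a::euclidean_space \<Rightarrow> real)"
  by (rule integrableI_nonneg) (use poisson_scaled_mass[OF assms, where 'a='a] poisson_scaled_nonneg[OF assms(3)] in auto)

lemma poisson_scaled_riesz:
  fixes z :: "'a::euclidean_space"
  assumes s: "0 < s" "s < 1" and r: "r > 0" and z: "norm z > r"
  shows "(\<integral>\<^sup>+y. ennreal (poisson_scaled s r y * riesz s (z - y)) \<partial>lborel) = ennreal (riesz s z)"
proof -
  have sc: "riesz s (r *\<^sub>R w) = r powr (2 * s - real DIM('a)) * riesz s w" for w :: 'a
    using r by (simp add: riesz_def powr_mult)
  have zr: "norm (z /\<^sub>R r) > 1" using z r by (simp add: field_simps)
  have "(\<integral>\<^sup>+y. ennreal (poisson_scaled s r y * riesz s (z - y)) \<partial>lborel) = (\<integral>\<^sup>+y. ennreal (poisson s 0 y * riesz s (z - r *\<^sub>R y)) \<partial>lborel)"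
    by (rule nn_integral_poisson_scaled[OF r]) auto
  also have "\<dots> = (\<integral>\<^sup>+y. ennreal (r powr (2 * s - real DIM('a))) * ennreal (poisson s 0 y * riesz s (y - z /\<^sub>R r)) \<partial>lborel)"
  proof (rule nn_integral_cong)
    fix y :: 'a
    have "z - r *\<^sub>R y = r *\<^sub>R (z /\<^sub>R r - y)" using r by (simp add: scaleR_diff_right)
    then have "riesz s (z - r *\<^sub>R y) = r powr (2 * s - real DIM('a)) * riesz s (y - z /\<^sub>R r)"
      by (simp only: sc riesz_minus[of s "z /\<^sub>R r"])
    then show "ennreal (poisson s 0 y * riesz s (z - r *\<^sub>R y)) = ennreal (r powr (2 * s - real DIM('a))) * ennreal (poisson s 0 y * riesz s (y - z /\<^sub>R r))"
      by (simp add: ennreal_mult[symmetric] poisson_nonneg mult.left_commute)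
  qed
  also have "\<dots> = ennreal (r powr (2 * s - real DIM('a))) * (\<integral>\<^sup>+y. ennreal (poisson s 0 y * riesz s (y - z /\<^sub>R r)) \<partial>lborel)"
    by (rule nn_integral_cmult) measurable
  also have "\<dots> = ennreal (r powr (2 * s - real DIM('a))) * ennreal (riesz s (0 - z /\<^sub>R r))"
    using poisson_riesz[OF s _ zr, of 0] by simp
  also have "\<dots> = ennreal (riesz s (r *\<^sub>R (0 - z /\<^sub>R r)))" unfolding sc by (rule ennreal_mult[symmetric]) auto
  also have "r *\<^sub>R (0 - z /\<^sub>R r) = - z" using r by simp
  finally show ?thesis by (simp add: riesz_def)
qed

text \<open>Mollifications of the Green function of the ball of radius \<open>r\<close> with pole at the centre are test
  functions; by injectivity of Riesz potentials their fractional Laplacian is a multiple of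
  \<open>\<rho> - \<rho> * P\<^sub>r\<close>.\<close>

lemma mollified_Green_function:
  fixes \<rho> :: "'a::euclidean_space \<Rightarrow> real"
  assumes s: "0 < s" "s < 1" "2 * s < real DIM('a)" and r: "r > 0" and e: "e > 0"
    and \<rho>: "smooth_fun \<rho>" and supp: "\<And>x. norm x \<ge> e \<Longrightarrow> \<rho> x = 0"
  obtains \<phi> where "smooth_fun \<phi>" "\<And>x. norm x \<ge> r + e \<Longrightarrow> \<phi> x = 0"
    "AE x in lborel. nonlocal s \<phi> x = riesz_inv_const TYPE('a) s * (\<rho> x - conv \<rho> (poisson_scaled s r) x)"
proof -
  define Pr where "Pr = (poisson_scaled s r :: 'a \<Rightarrow> real)"
  define \<kappa> where "\<kappa> = riesz_inv_const TYPE('a) s"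
  note m [measurable] = smooth_fun_measurable[OF \<rho>]
  have Prm [measurable]: "Pr \<in> borel_measurable borel" unfolding Pr_def by measurable
  have Pr0: "Pr y \<ge> 0" for y unfolding Pr_def by (rule poisson_scaled_nonneg[OF r])
  have Pri: "integrable lborel Pr" unfolding Pr_def by (rule poisson_scaled_integrable[OF s(1,2) r])
  have Pr1: "(\<integral>\<^sup>+y. ennreal (Pr y) \<partial>lborel) = 1" unfolding Pr_def by (rule poisson_scaled_mass[OF s(1,2) r])
  have cs: "compact_supp \<rho>" by (rule compact_suppI[of e]) (use supp in auto)
  obtain B where B: "\<And>x. \<bar>\<rho> x\<bar> \<le> B" using smooth_compact_bounded[OF \<rho> cs] by blast
  have \<rho>i: "integrable lborel \<rho>" by (rule test_function_integrable[OF s(1,2) \<rho> cs])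
  define T where "T z = (\<integral>y. riesz s (z - y) * Pr y \<partial>lborel)" for z
  have Tm [measurable]: "T \<in> borel_measurable borel" unfolding T_def by measurable
  have Tout: "T z = riesz s z" if "norm z > r" for z
    unfolding T_def using poisson_scaled_riesz[OF s(1,2) r that]
    by (subst integral_eq_nn_integral) (auto simp: Pr0 Pr_def[symmetric] mult.commute)
  \<comment> \<open>The Green function with pole at the centre, up to a constant factor. The
    potential \<open>T\<close> of the exit density equals the Riesz kernel for
    \<open>|z| > r\<close>, so the truncation changes the difference only on a sphere.\<close>
  define G where "G z = indicator (ball 0 r) z * (riesz s z - T z)" for z
  have iR: "integrable lborel (\<lambda>z::'a. indicator (ball 0 r) z * riesz s z)"
  proof (rule integrableI_nonneg)
    have "(\<integral>\<^sup>+(z::'a). ennreal (indicator (ball 0 r) z * riesz s z) \<partial>lborel) \<le> (\<integral>\<^sup>+(z::'a). ennreal (norm z powr (2 * s - real DIM('a))) * indicator {0<..r} (norm z) \<partial>lborel)"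
      by (intro nn_integral_mono) (auto simp: riesz_def indicator_def)
    also have "\<dots> < \<infinity>" using r s by (intro nn_integral_norm_powr_ball_finite) auto
    finally show "(\<integral>\<^sup>+(z::'a). ennreal (indicator (ball 0 r) z * riesz s z) \<partial>lborel) < \<infinity>" .
  qed auto
  have iT: "integrable lborel (\<lambda>z. indicator (ball 0 r) z * T z)"
  proof -
    have "integrable (lborel \<Otimes>\<^sub>M lborel) (\<lambda>p. indicator (ball 0 r) (snd p) * (riesz s (snd p - fst p) * Pr (fst p)))"
    proof (rule integrable_lborel_pairI)
      show "(\<lambda>p. indicator (ball 0 r) (snd p) * (riesz s (snd p - fst p) * Pr (fst p))) \<in> borel_measurable borel"
        unfolding borel_prod[symmetric] by measurable
      define b :: "'a \<Rightarrow> ennreal" where "b = indicator (ball 0 r)"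
      have [measurable]: "b \<in> borel_measurable borel" unfolding b_def by measurable
      have "(\<integral>\<^sup>+y. \<integral>\<^sup>+z. ennreal \<bar>indicator (ball 0 r) (snd (y, z)) * (riesz s (snd (y, z) - fst (y, z)) * Pr (fst (y, z)))\<bar> \<partial>lborel \<partial>lborel)
        = (\<integral>\<^sup>+y. ennreal (Pr y) * (\<integral>\<^sup>+z. ennreal (riesz s (y - z)) * b z \<partial>lborel) \<partial>lborel)"
      proof (rule nn_integral_cong)
        fix y
        have "(\<integral>\<^sup>+z. ennreal \<bar>indicator (ball 0 r) (snd (y, z)) * (riesz s (snd (y, z) - fst (y, z)) * Pr (fst (y, z)))\<bar> \<partial>lborel) = (\<integral>\<^sup>+z. ennreal (Pr y) * (ennreal (riesz s (y - z)) * b z) \<partial>lborel)"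
          by (intro nn_integral_cong) (auto simp: b_def indicator_def abs_mult Pr0 ennreal_mult[symmetric] riesz_minus[of s y] mult.commute)
        then show "(\<integral>\<^sup>+z. ennreal \<bar>indicator (ball 0 r) (snd (y, z)) * (riesz s (snd (y, z) - fst (y, z)) * Pr (fst (y, z)))\<bar> \<partial>lborel) = ennreal (Pr y) * (\<integral>\<^sup>+z. ennreal (riesz s (y - z)) * b z \<partial>lborel)"
          by (simp add: nn_integral_cmult)
      qed
      also have "\<dots> \<le> (\<integral>\<^sup>+y. ennreal (Pr y) * (riesz_near TYPE('a) s * 1 + (\<integral>\<^sup>+z. b z \<partial>lborel)) \<partial>lborel)"
        by (intro nn_integral_mono mult_left_mono riesz_nn_bound[OF s(3)]) (auto simp: b_def indicator_def)
      also have "\<dots> = riesz_near TYPE('a) s * 1 + (\<integral>\<^sup>+z. b z \<partial>lborel)"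
        using Pr1 by (simp add: nn_integral_multc)
      also have "\<dots> < \<infinity>"
        using riesz_near_finite[OF s(1), where 'a='a] emeasure_lborel_ball_finite[of "0::'a" r] by (simp add: b_def less_top)
      finally show "(\<integral>\<^sup>+y. \<integral>\<^sup>+z. ennreal \<bar>indicator (ball 0 r) (snd (y, z)) * (riesz s (snd (y, z) - fst (y, z)) * Pr (fst (y, z)))\<bar> \<partial>lborel \<partial>lborel) < \<infinity>" .
    qed
    then have "integrable lborel (\<lambda>z. \<integral>y. indicator (ball 0 r) z * (riesz s (z - y) * Pr y) \<partial>lborel)"
      by (intro lborel_pair.integrable_snd) (simp add: case_prod_unfold)
    then show ?thesis by (simp add: T_def)
  qed
  have Gi: "integrable lborel G"
    using Bochner_Integration.integrable_diff[OF iR iT] by (simp add: G_def[abs_def] right_diff_distrib)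
  define \<phi> where "\<phi> = conv \<rho> G"
  have \<phi>s: "smooth_fun \<phi>" unfolding \<phi>_def by (rule conv_smooth[OF Gi \<rho> cs])
  have \<phi>0: "\<phi> x = 0" if "norm x \<ge> r + e" for x
  proof -
    have "\<rho> (x - z) * G z = 0" for z
    proof (cases "norm z < r")
      case True
      then have "norm (x - z) \<ge> e" using that norm_triangle_ineq2[of x z] by linarith
      then show ?thesis by (simp add: supp)
    qed (simp add: G_def)
    then have "(\<lambda>z. \<rho> (x - z) * G z) = (\<lambda>z. 0)" by (simp only:)
    then show ?thesis unfolding \<phi>_def conv_def by (simp only: Bochner_Integration.integral_zero)
  qed
  have \<phi>c: "compact_supp \<phi>" by (rule compact_suppI[of "r + e"]) (use \<phi>0 in auto)
  define c where "c = conv \<rho> Pr"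
  have cm [measurable]: "c \<in> borel_measurable borel" unfolding c_def conv_def by measurable
  have cB: "\<bar>c x\<bar> \<le> B" for x
  proof -
    have i: "integrable lborel (\<lambda>z. \<rho> (x - z) * Pr z)" by (rule conv_integrand_integrable[OF m B Pri])
    have "\<bar>c x\<bar> \<le> (\<integral>z. norm (\<rho> (x - z) * Pr z) \<partial>lborel)"
      unfolding c_def conv_def real_norm_def[symmetric] by (rule integral_norm_bound)
    also have "\<dots> \<le> (\<integral>z. B * Pr z \<partial>lborel)"
      using B Pr0 by (intro integral_mono integrable_norm i integrable_mult_right Pri) (auto simp: abs_mult mult_right_mono)
    also have "\<dots> = B * 1" using Pr1 Pr0 by (simp add: integral_eq_nn_integral)
    finally show ?thesis by simp
  qed
  have shift: "(\<integral>\<^sup>+y. ennreal \<bar>\<rho> (y - w)\<bar> \<partial>lborel) = (\<integral>\<^sup>+y. ennreal \<bar>\<rho> y\<bar> \<partial>lborel)" for w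
    using nn_integral_lborel_translate[of "\<lambda>y. ennreal \<bar>\<rho> y\<bar>" "- w"] by simp
  have ci: "integrable lborel c"
  proof -
    have "integrable (lborel \<Otimes>\<^sub>M lborel) (\<lambda>p. \<rho> (snd p - fst p) * Pr (fst p))"
    proof (rule integrable_lborel_pairI)
      show "(\<lambda>p. \<rho> (snd p - fst p) * Pr (fst p)) \<in> borel_measurable borel" unfolding borel_prod[symmetric] by measurable
      have "(\<integral>\<^sup>+w. \<integral>\<^sup>+y. ennreal \<bar>\<rho> (snd (w, y) - fst (w, y)) * Pr (fst (w, y))\<bar> \<partial>lborel \<partial>lborel) = (\<integral>\<^sup>+w. (\<integral>\<^sup>+y. ennreal \<bar>\<rho> y\<bar> \<partial>lborel) * ennreal (Pr w) \<partial>lborel)"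
        by (simp add: abs_mult ennreal_mult Pr0 nn_integral_multc shift)
      also have "\<dots> < \<infinity>" using \<rho>i Pr1 by (simp add: nn_integral_cmult integrable_iff_bounded)
      finally show "(\<integral>\<^sup>+w. \<integral>\<^sup>+y. ennreal \<bar>\<rho> (snd (w, y) - fst (w, y)) * Pr (fst (w, y))\<bar> \<partial>lborel \<partial>lborel) < \<infinity>" .
    qed
    then have "integrable lborel (\<lambda>y. \<integral>w. \<rho> (y - w) * Pr w \<partial>lborel)"
      by (intro lborel_pair.integrable_snd) (simp add: case_prod_unfold)
    then show ?thesis by (simp add: c_def conv_def[abs_def])
  qed
  define f where "f x = \<rho> x - c x" for x
  have fi: "integrable lborel f" unfolding f_def using \<rho>i ci by simp
  \<comment> \<open>The potential of \<open>\<rho> - \<rho> * P_r\<close> is \<open>\<rho>\<close>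
    convolved with \<open>W - W * P_r\<close>, that is with the Green function; this links
    \<open>\<phi>\<close> to the claimed right-hand side.\<close>
  have pot: "(\<integral>y. riesz s (x - y) * f y \<partial>lborel) = \<phi> x" for x
  proof -
    let ?M = "riesz_near TYPE('a) s * ennreal B + (\<integral>\<^sup>+y. ennreal \<bar>\<rho> y\<bar> \<partial>lborel)"
    have Mfin: "?M < \<infinity>" using riesz_near_finite[OF s(1), where 'a='a] \<rho>i
      by (auto simp: ennreal_mult_less_top integrable_iff_bounded)
    have bnd: "(\<integral>\<^sup>+y. ennreal (riesz s (x - y)) * ennreal \<bar>\<rho> (y - w)\<bar> \<partial>lborel) \<le> ?M" for w
      using riesz_nn_bound[OF s(3), of "\<lambda>y. ennreal \<bar>\<rho> (y - w)\<bar>" "ennreal B" x] B by (simp add: shift ennreal_leI)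
    define Q where "Q p = riesz s (x - snd p) * \<rho> (snd p - fst p) * Pr (fst p)" for p
    have Qm [measurable]: "Q \<in> borel_measurable borel" unfolding Q_def borel_prod[symmetric] by measurable
    have nnQ: "(\<integral>\<^sup>+w. \<integral>\<^sup>+y. ennreal \<bar>Q (w, y)\<bar> \<partial>lborel \<partial>lborel) < \<infinity>"
    proof -
      have "(\<integral>\<^sup>+w. \<integral>\<^sup>+y. ennreal \<bar>Q (w, y)\<bar> \<partial>lborel \<partial>lborel) = (\<integral>\<^sup>+w. (\<integral>\<^sup>+y. ennreal (riesz s (x - y)) * ennreal \<bar>\<rho> (y - w)\<bar> \<partial>lborel) * ennreal (Pr w) \<partial>lborel)"
        by (simp add: Q_def abs_mult ennreal_mult Pr0 nn_integral_multc)
      also have "\<dots> \<le> (\<integral>\<^sup>+w. ?M * ennreal (Pr w) \<partial>lborel)" by (intro nn_integral_mono mult_right_mono bnd) auto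
      also have "\<dots> = ?M" using Pr1 by (simp add: nn_integral_cmult)
      finally show ?thesis using Mfin by (rule order.strict_trans1)
    qed
    then have intQ: "integrable (lborel \<Otimes>\<^sub>M lborel) Q" by (intro integrable_lborel_pairI) auto
    \<comment> \<open>For fixed \<open>w\<close> the reflection \<open>y -> x + w - y\<close>
      exchanges the arguments of the Riesz kernel and of the mollifier. This moves the convolution
      with the exit density from \<open>\<rho>\<close> to the kernel.\<close>
    define Q2 where "Q2 p = \<rho> (x - snd p) * (riesz s (snd p - fst p) * Pr (fst p))" for p
    have Q2m [measurable]: "Q2 \<in> borel_measurable borel" unfolding Q2_def borel_prod[symmetric] by measurable
    have Q2Q: "Q2 (w, x + w - y) = Q (w, y)" for w y by (simp add: Q_def Q2_def)
    have nnQ2: "(\<integral>\<^sup>+z. ennreal \<bar>Q2 (w, z)\<bar> \<partial>lborel) = (\<integral>\<^sup>+y. ennreal \<bar>Q (w, y)\<bar> \<partial>lborel)" for w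
    proof -
      have "(\<integral>\<^sup>+y. ennreal \<bar>Q2 (w, (x + w) - y)\<bar> \<partial>lborel) = (\<integral>\<^sup>+z. ennreal \<bar>Q2 (w, z)\<bar> \<partial>lborel)"
        by (rule nn_integral_lborel_reflect) measurable
      then show ?thesis unfolding Q2Q by simp
    qed
    have intQ2: "integrable (lborel \<Otimes>\<^sub>M lborel) Q2" by (rule integrable_lborel_pairI) (use nnQ in \<open>simp_all add: nnQ2\<close>)
    have eqQ2: "(\<integral>z. Q2 (w, z) \<partial>lborel) = (\<integral>y. Q (w, y) \<partial>lborel)" for w
    proof -
      have "(\<integral>y. Q2 (w, (x + w) - y) \<partial>lborel) = (\<integral>z. Q2 (w, z) \<partial>lborel)"
        by (rule integral_lborel_reflect) measurable
      then show ?thesis unfolding Q2Q by simp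
    qed
    have "(\<integral>y. riesz s (x - y) * c y \<partial>lborel) = (\<integral>y. \<integral>w. Q (w, y) \<partial>lborel \<partial>lborel)"
      by (simp add: Q_def c_def conv_def mult.assoc)
    also have "\<dots> = (\<integral>w. \<integral>y. Q (w, y) \<partial>lborel \<partial>lborel)"
      by (rule lborel_pair.Fubini_integral) (use intQ in \<open>simp add: case_prod_unfold\<close>)
    also have "\<dots> = (\<integral>w. \<integral>z. Q2 (w, z) \<partial>lborel \<partial>lborel)" by (simp only: eqQ2)
    also have "\<dots> = (\<integral>z. \<integral>w. Q2 (w, z) \<partial>lborel \<partial>lborel)"
      by (rule lborel_pair.Fubini_integral[symmetric]) (use intQ2 in \<open>simp add: case_prod_unfold\<close>)
    also have "\<dots> = (\<integral>z. \<rho> (x - z) * T z \<partial>lborel)" by (simp add: Q2_def T_def)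
    finally have 1: "(\<integral>y. riesz s (x - y) * c y \<partial>lborel) = (\<integral>z. \<rho> (x - z) * T z \<partial>lborel)" .
    have "integrable lborel (\<lambda>z. \<integral>w. Q2 (w, z) \<partial>lborel)"
      by (rule lborel_pair.integrable_snd) (use intQ2 in \<open>simp add: case_prod_unfold\<close>)
    then have i1: "integrable lborel (\<lambda>z. \<rho> (x - z) * T z)" by (simp add: Q2_def T_def)
    have r\<rho>: "integrable lborel (\<lambda>y. riesz s (x - y) * \<rho> y)" by (rule riesz_integrable[OF s(1,3) \<rho>i B])
    have rc: "integrable lborel (\<lambda>y. riesz s (x - y) * c y)" by (rule riesz_integrable[OF s(1,3) ci cB])
    have 2: "(\<integral>y. riesz s (x - y) * \<rho> y \<partial>lborel) = (\<integral>z. \<rho> (x - z) * riesz s z \<partial>lborel)"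
      using integral_lborel_reflect[of "\<lambda>y. riesz s (x - y) * \<rho> y" x] by (simp add: mult.commute)
    have i2: "integrable lborel (\<lambda>z. \<rho> (x - z) * riesz s z)"
      using integrable_lborel_reflect[OF r\<rho>, of x] by (simp add: mult.commute)
    have "(\<integral>y. riesz s (x - y) * f y \<partial>lborel) = (\<integral>y. riesz s (x - y) * \<rho> y - riesz s (x - y) * c y \<partial>lborel)"
      by (simp add: f_def right_diff_distrib)
    also have "\<dots> = (\<integral>z. \<rho> (x - z) * riesz s z - \<rho> (x - z) * T z \<partial>lborel)"
      using r\<rho> rc i1 i2 by (simp add: 1 2)
    also have "\<dots> = (\<integral>z. \<rho> (x - z) * G z \<partial>lborel)"
    proof (rule integral_cong_AE)
      show "AE z in lborel. \<rho> (x - z) * riesz s z - \<rho> (x - z) * T z = \<rho> (x - z) * G z"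
        using AE_norm_neq[where 'a='a, of r]
      proof eventually_elim
        case (elim z)
        show ?case
        proof (cases "norm z < r")
          case True then show ?thesis by (simp add: G_def right_diff_distrib)
        next
          case False then show ?thesis using Tout[of z] elim by (simp add: G_def)
        qed
      qed
      show "(\<lambda>z. \<rho> (x - z) * G z) \<in> borel_measurable lborel" unfolding G_def by measurable
    qed measurable
    finally show ?thesis by (simp add: \<phi>_def conv_def)
  qed
  \<comment> \<open>Both terms have the same Riesz potential at every point, namely a multiple of
    \<open>\<phi>\<close>, so injectivity applies with the whole space as carrier.\<close>
  define E where "E x = nonlocal s \<phi> x - \<kappa> * f x" for x
  have ni: "integrable lborel (nonlocal s \<phi>)" by (rule nonlocal_integrable[OF s(1,2) \<phi>s \<phi>c])
  have Ei: "integrable lborel E" unfolding E_def using ni fi by simp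
  obtain B2 where B2: "\<And>x. nonlocal_abs s \<phi> x \<le> B2" using nonlocal_abs_bounded[OF s(1,2) \<phi>s \<phi>c] by blast
  have nB: "\<bar>nonlocal s \<phi> x\<bar> \<le> B2" for x by (rule order_trans[OF nonlocal_le_abs[OF s(1,2) \<phi>s \<phi>c] B2])
  have fB: "\<bar>f x\<bar> \<le> B + B" for x using B[of x] cB[of x] unfolding f_def by linarith
  have EB: "\<bar>E x\<bar> \<le> B2 + \<bar>\<kappa>\<bar> * (B + B)" for x
  proof -
    have "\<bar>E x\<bar> \<le> \<bar>nonlocal s \<phi> x\<bar> + \<bar>\<kappa>\<bar> * \<bar>f x\<bar>" unfolding E_def abs_mult[symmetric] by (rule abs_triangle_ineq4)
    also have "\<dots> \<le> B2 + \<bar>\<kappa>\<bar> * (B + B)" by (intro add_mono nB mult_left_mono fB) simp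
    finally show ?thesis .
  qed
  obtain M where M: "\<And>x. (\<integral>\<^sup>+y. ennreal (riesz s (x - y) * \<bar>E y\<bar>) \<partial>lborel) \<le> ennreal M"
    using riesz_nn_bound_real[OF s(1,3) Ei EB] by blast
  have "AE x in lborel. E x = 0"
  proof (rule riesz_potential_injective[OF s(3) Ei, where S=UNIV and M=M])
    fix x
    have "(\<integral>y. riesz s (x - y) * E y \<partial>lborel) = (\<integral>y. riesz s (x - y) * nonlocal s \<phi> y - \<kappa> * (riesz s (x - y) * f y) \<partial>lborel)"
      by (intro Bochner_Integration.integral_cong) (auto simp: E_def algebra_simps)
    also have "\<dots> = (\<integral>y. riesz s (x - y) * nonlocal s \<phi> y \<partial>lborel) - \<kappa> * (\<integral>y. riesz s (x - y) * f y \<partial>lborel)"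
      using riesz_integrable[OF s(1,3) ni nB, of x] riesz_integrable[OF s(1,3) fi fB, of x] by simp
    also have "\<dots> = 0" unfolding pot riesz_potential_nonlocal[OF s \<phi>s \<phi>c] \<kappa>_def by simp
    finally show "(\<integral>y. riesz s (x - y) * E y \<partial>lborel) = 0" .
  qed (use M in auto)
  then have "AE x in lborel. nonlocal s \<phi> x = \<kappa> * (\<rho> x - conv \<rho> Pr x)"
    by eventually_elim (simp add: E_def f_def c_def)
  then show ?thesis using that[OF \<phi>s \<phi>0] by (simp add: \<kappa>_def Pr_def)
qed

section \<open>Mollified averages of a solution\<close>

lemma integral_one_imp_integrable:
  fixes \<rho> :: "'a::euclidean_space \<Rightarrow> real"
  shows "(\<integral>x. \<rho> x \<partial>lborel) = 1 \<Longrightarrow> integrable lborel \<rho>"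
  using not_integrable_integral_eq[of lborel \<rho>] by (cases "integrable lborel \<rho>") auto

lemma mollified_average_bound:
  fixes \<rho> u :: "'a::euclidean_space \<Rightarrow> real"
  assumes \<rho>0: "\<And>x. \<rho> x \<ge> 0" and \<rho>1: "(\<integral>x. \<rho> x \<partial>lborel) = 1" and supp: "\<And>x. norm x \<ge> e \<Longrightarrow> \<rho> x = 0"
    and u [measurable]: "u \<in> borel_measurable borel" and C: "\<And>x. \<bar>u x\<bar> \<le> C"
    and close: "AE y in lborel. dist q y < e \<longrightarrow> \<bar>u y - c\<bar> \<le> d"
  shows "\<bar>(\<integral>y. \<rho> (y - q) * u y \<partial>lborel) - c\<bar> \<le> d"
proof -
  have \<rho>i: "integrable lborel \<rho>" by (rule integral_one_imp_integrable[OF \<rho>1])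
  have \<rho>m [measurable]: "\<rho> \<in> borel_measurable borel" using \<rho>i by (simp add: borel_measurable_integrable)
  have si: "integrable lborel (\<lambda>y. \<rho> (y - q))"
    using integrable_lborel_reflect[OF integrable_lborel_reflect[OF \<rho>i, of 0], of q] by simp
  have s1: "(\<integral>y. \<rho> (y - q) \<partial>lborel) = 1"
    using integral_lborel_affine[of 1 "\<lambda>y. \<rho> (y - q)" q] \<rho>1 by simp
  have i1: "integrable lborel (\<lambda>y. u y * \<rho> (y - q))" by (rule integrable_bounded_mult[OF si u C])
  have i2: "integrable lborel (\<lambda>y. \<rho> (y - q) * (u y - c))"
    using Bochner_Integration.integrable_diff[OF i1 integrable_mult_right[OF si, of c]] by (simp add: algebra_simps)
  have "(\<integral>y. \<rho> (y - q) * (u y - c) \<partial>lborel) = (\<integral>y. u y * \<rho> (y - q) - c * \<rho> (y - q) \<partial>lborel)"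
    by (simp add: algebra_simps)
  also have "\<dots> = (\<integral>y. \<rho> (y - q) * u y \<partial>lborel) - c"
    using i1 si by (subst Bochner_Integration.integral_diff) (auto simp: s1 mult.commute)
  finally have eq: "(\<integral>y. \<rho> (y - q) * u y \<partial>lborel) - c = (\<integral>y. \<rho> (y - q) * (u y - c) \<partial>lborel)" by simp
  have "\<bar>\<integral>y. \<rho> (y - q) * (u y - c) \<partial>lborel\<bar> \<le> (\<integral>y. norm (\<rho> (y - q) * (u y - c)) \<partial>lborel)"
    unfolding real_norm_def[symmetric] by (rule integral_norm_bound)
  also have "\<dots> \<le> (\<integral>y. d * \<rho> (y - q) \<partial>lborel)"
  proof (rule integral_mono_AE)
    show "integrable lborel (\<lambda>y. norm (\<rho> (y - q) * (u y - c)))" using i2 by (rule integrable_norm)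
    show "integrable lborel (\<lambda>y. d * \<rho> (y - q))" using si by simp
    show "AE y in lborel. norm (\<rho> (y - q) * (u y - c)) \<le> d * \<rho> (y - q)"
      using close
    proof eventually_elim
      case (elim y)
      show ?case
      proof (cases "dist q y < e")
        case True
        then have "\<bar>u y - c\<bar> * \<rho> (y - q) \<le> d * \<rho> (y - q)" using elim by (intro mult_right_mono \<rho>0) simp
        then show ?thesis using \<rho>0[of "y - q"] by (simp add: abs_mult mult.commute)
      next
        case False
        then have "\<rho> (y - q) = 0" by (intro supp) (simp add: dist_norm norm_minus_commute)
        then show ?thesis by simp
      qed
    qed
  qed
  also have "\<dots> = d" using s1 by simp
  finally show ?thesis unfolding eq .
qed

text \<open>The centres \<open>q n\<close> are allowed to move because the averages are taken at
  \<open>r n w\<close> with \<open>r n -> 1\<close>. Closeness to \<open>c\<close> is asked for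
  almost everywhere near \<open>p\<close>, so that a function known only up to null sets is
  admissible.\<close>

lemma mollified_average_tendsto:
  fixes \<rho> :: "nat \<Rightarrow> 'a::euclidean_space \<Rightarrow> real"
  assumes \<rho>: "\<And>n x. \<rho> n x \<ge> 0" "\<And>n. (\<integral>x. \<rho> n x \<partial>lborel) = 1" "\<And>n x. norm x \<ge> e n \<Longrightarrow> \<rho> n x = 0"
    and e: "e \<longlonglongrightarrow> 0" and p: "q \<longlonglongrightarrow> p"
    and u: "u \<in> borel_measurable borel" and C: "\<And>x. \<bar>u x\<bar> \<le> C"
    and close: "\<And>d. d > 0 \<Longrightarrow> \<exists>\<delta>>0. AE y in lborel. dist p y < \<delta> \<longrightarrow> \<bar>u y - c\<bar> \<le> d"
  shows "(\<lambda>n. \<integral>y. \<rho> n (y - q n) * u y \<partial>lborel) \<longlonglongrightarrow> c"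
proof (rule LIMSEQ_I)
  fix d :: real assume d: "d > 0"
  obtain \<delta> where \<delta>: "\<delta> > 0" "AE y in lborel. dist p y < \<delta> \<longrightarrow> \<bar>u y - c\<bar> \<le> d / 2" using close[of "d / 2"] d by auto
  have "eventually (\<lambda>n. dist (q n) p < \<delta> / 2) sequentially" using p \<delta>(1) by (intro tendstoD) auto
  moreover have "eventually (\<lambda>n. e n < \<delta> / 2) sequentially" using order_tendstoD(2)[OF e, of "\<delta> / 2"] \<delta>(1) by simp
  ultimately have "eventually (\<lambda>n. norm ((\<integral>y. \<rho> n (y - q n) * u y \<partial>lborel) - c) < d) sequentially"
  proof eventually_elim
    case (elim n)
    have "AE y in lborel. dist (q n) y < e n \<longrightarrow> \<bar>u y - c\<bar> \<le> d / 2"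
      using \<delta>(2)
    proof eventually_elim
      case (elim y)
      show ?case
      proof
        assume "dist (q n) y < e n"
        then have "dist p y < \<delta>"
          using \<open>dist (q n) p < \<delta> / 2\<close> \<open>e n < \<delta> / 2\<close> dist_triangle[of p y "q n"] by (simp add: dist_commute)
        then show "\<bar>u y - c\<bar> \<le> d / 2" using elim by simp
      qed
    qed
    from mollified_average_bound[where \<rho>="\<rho> n" and e="e n", OF \<rho>(1) \<rho>(2) \<rho>(3) u C this] show ?case using d by simp
  qed
  then show "\<exists>k. \<forall>n\<ge>k. norm ((\<integral>y. \<rho> n (y - q n) * u y \<partial>lborel) - c) < d" by (simp add: eventually_sequentially)
qed

text \<open>Testing the equation with the mollified Green function says that \<open>u\<close> has
  the same integral against \<open>\<rho>\<close> and against \<open>\<rho> * P_r\<close>, as the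
  constants in front are positive. Exchanging the order of integration displays this as a mean value
  property of the mollified averages of \<open>u\<close>. The condition \<open>r + e < 1\<close>
  makes the Green function a test function of the open ball.\<close>

lemma center_mean_value:
  fixes u \<rho> :: "'a::euclidean_space \<Rightarrow> real"
  assumes s: "0 < s" "s < 1" "2 * s < real DIM('a)" and sol: "frac_poisson_sol s (ball 0 1) g u"
    and u' [measurable]: "u' \<in> borel_measurable borel" and C: "\<And>x. \<bar>u' x\<bar> \<le> C" and uu': "AE x in lborel. u x = u' x"
    and r: "r > 0" and e: "e > 0" and re: "r + e < 1"
    and \<rho>: "smooth_fun \<rho>" "\<And>x. norm x \<ge> e \<Longrightarrow> \<rho> x = 0"
  shows "(\<integral>y. \<rho> y * u' y \<partial>lborel) = (\<integral>w. poisson s 0 w * (\<integral>y. \<rho> (y - r *\<^sub>R w) * u' y \<partial>lborel) \<partial>lborel)"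
proof -
  define Pr where "Pr = (poisson_scaled s r :: 'a \<Rightarrow> real)"
  define \<kappa> where "\<kappa> = riesz_inv_const TYPE('a) s"
  have \<kappa>: "\<kappa> > 0" unfolding \<kappa>_def by (rule riesz_inv_const_pos[OF s])
  obtain \<phi> where \<phi>: "smooth_fun \<phi>" "\<And>x. norm x \<ge> r + e \<Longrightarrow> \<phi> x = 0"
    "AE x in lborel. nonlocal s \<phi> x = \<kappa> * (\<rho> x - conv \<rho> Pr x)"
    using mollified_Green_function[OF s r e \<rho>] unfolding \<kappa>_def Pr_def by blast
  note m\<rho> [measurable] = smooth_fun_measurable[OF \<rho>(1)]
  note m\<phi> [measurable] = smooth_fun_measurable[OF \<phi>(1)]
  have nm [measurable]: "nonlocal s \<phi> \<in> borel_measurable borel" by (rule nonlocal_measurable(1)[OF m\<phi>])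
  have [measurable]: "Pr \<in> borel_measurable borel" unfolding Pr_def by measurable
  have cm [measurable]: "conv \<rho> Pr \<in> borel_measurable borel" unfolding conv_def[abs_def] by measurable
  have cs: "compact_supp \<rho>" by (rule compact_suppI[of e]) (use \<rho>(2) in auto)
  obtain B where B: "\<And>x. \<bar>\<rho> x\<bar> \<le> B" using smooth_compact_bounded[OF \<rho>(1) cs] by blast
  have \<rho>i: "integrable lborel \<rho>" by (rule test_function_integrable[OF s(1,2) \<rho>(1) cs])
  have c\<phi>: "compact_supp \<phi>" by (rule compact_suppI[of "r + e"]) (use \<phi>(2) in auto)
  have "closure {x. \<phi> x \<noteq> 0} \<subseteq> cball 0 (r + e)"
  proof (rule closure_minimal)
    show "{x. \<phi> x \<noteq> 0} \<subseteq> cball 0 (r + e)" using \<phi>(2) by (force simp: not_le[symmetric])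
  qed simp
  also have "\<dots> \<subseteq> ball 0 1" using re by auto
  finally have test: "test_fun (ball 0 1) \<phi>" using \<phi>(1) c\<phi> by (simp add: test_fun_def compact_supp_def)
  have um: "u \<in> borel_measurable lebesgue" using sol by (simp add: frac_poisson_sol_def)
  have fl: "frac_lap s \<phi> = (\<lambda>x. frac_const DIM('a) s / 2 * nonlocal s \<phi> x)"
    using frac_lap_eq_nonlocal[OF s(1,2) \<phi>(1) c\<phi>] by (simp add: fun_eq_iff)
  have nleb: "nonlocal s \<phi> \<in> borel_measurable lebesgue" using nm by (intro measurable_completion) simp
  have "0 = (\<integral>x. u x * frac_lap s \<phi> x \<partial>lebesgue)" using sol test by (simp add: frac_poisson_sol_def)
  also have "\<dots> = (\<integral>x. frac_const DIM('a) s / 2 * (u' x * nonlocal s \<phi> x) \<partial>lebesgue)"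
  proof (rule integral_cong_AE)
    show "(\<lambda>x. u x * frac_lap s \<phi> x) \<in> borel_measurable lebesgue"
      unfolding fl using um nleb by (intro borel_measurable_times borel_measurable_const)
    show "(\<lambda>x. frac_const DIM('a) s / 2 * (u' x * nonlocal s \<phi> x)) \<in> borel_measurable lebesgue"
      by (rule measurable_completion) measurable
    show "AE x in lebesgue. u x * frac_lap s \<phi> x = frac_const DIM('a) s / 2 * (u' x * nonlocal s \<phi> x)"
      by (rule AE_completion) (use uu' in \<open>eventually_elim, simp add: fl\<close>)
  qed
  also have "\<dots> = (\<integral>x. frac_const DIM('a) s / 2 * (u' x * nonlocal s \<phi> x) \<partial>lborel)"
    by (rule integral_completion) measurable
  also have "\<dots> = frac_const DIM('a) s / 2 * (\<integral>x. u' x * nonlocal s \<phi> x \<partial>lborel)" by simp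
  also have "(\<integral>x. u' x * nonlocal s \<phi> x \<partial>lborel) = (\<integral>x. \<kappa> * (u' x * \<rho> x - u' x * conv \<rho> Pr x) \<partial>lborel)"
  proof (rule integral_cong_AE)
    show "AE x in lborel. u' x * nonlocal s \<phi> x = \<kappa> * (u' x * \<rho> x - u' x * conv \<rho> Pr x)"
      using \<phi>(3)
    proof eventually_elim
      case (elim x)
      show ?case unfolding elim by (simp add: algebra_simps)
    qed
  qed measurable
  finally have zero: "(\<integral>x. u' x * \<rho> x - u' x * conv \<rho> Pr x \<partial>lborel) = 0"
    using \<kappa> frac_const_pos[OF s(1,2), of "DIM('a)"] by simp
  define Q where "Q p = u' (snd p) * \<rho> (snd p - fst p) * Pr (fst p)" for p
  have Qm [measurable]: "Q \<in> borel_measurable borel" unfolding Q_def borel_prod[symmetric] by measurable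
  have C0: "C \<ge> 0" using C[of undefined] by (rule order_trans[OF abs_ge_zero])
  have Pr0: "Pr y \<ge> 0" for y unfolding Pr_def by (rule poisson_scaled_nonneg[OF r])
  have "(\<integral>\<^sup>+w. \<integral>\<^sup>+y. ennreal \<bar>Q (w, y)\<bar> \<partial>lborel \<partial>lborel) \<le> (\<integral>\<^sup>+w. \<integral>\<^sup>+y. ennreal \<bar>\<rho> (y - w)\<bar> * ennreal (C * Pr w) \<partial>lborel \<partial>lborel)"
  proof (intro nn_integral_mono)
    fix w y
    have "\<bar>Q (w, y)\<bar> = \<bar>u' y\<bar> * (\<bar>\<rho> (y - w)\<bar> * Pr w)" by (simp add: Q_def abs_mult Pr0)
    also have "\<dots> \<le> C * (\<bar>\<rho> (y - w)\<bar> * Pr w)" by (intro mult_right_mono C mult_nonneg_nonneg Pr0) simp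
    finally show "ennreal \<bar>Q (w, y)\<bar> \<le> ennreal \<bar>\<rho> (y - w)\<bar> * ennreal (C * Pr w)"
      using C0 Pr0 by (simp add: ennreal_mult[symmetric] ennreal_leI mult_ac)
  qed
  also have "\<dots> = (\<integral>\<^sup>+w. (\<integral>\<^sup>+y. ennreal \<bar>\<rho> y\<bar> \<partial>lborel) * (ennreal C * ennreal (Pr w)) \<partial>lborel)"
  proof (rule nn_integral_cong)
    fix w
    show "(\<integral>\<^sup>+y. ennreal \<bar>\<rho> (y - w)\<bar> * ennreal (C * Pr w) \<partial>lborel) = (\<integral>\<^sup>+y. ennreal \<bar>\<rho> y\<bar> \<partial>lborel) * (ennreal C * ennreal (Pr w))"
      using nn_integral_lborel_translate[of "\<lambda>y. ennreal \<bar>\<rho> y\<bar>" "- w"] C0 Pr0 by (simp add: nn_integral_multc ennreal_mult)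
  qed
  also have "\<dots> < \<infinity>"
    using \<rho>i poisson_scaled_mass[OF s(1,2) r, where 'a='a]
    by (simp add: nn_integral_cmult Pr_def integrable_iff_bounded ennreal_mult_less_top)
  finally have intQ: "integrable (lborel \<Otimes>\<^sub>M lborel) Q" by (intro integrable_lborel_pairI) auto
  have Qy: "(\<integral>w. Q (w, y) \<partial>lborel) = u' y * conv \<rho> Pr y" for y by (simp add: Q_def conv_def mult.assoc)
  have i2: "integrable lborel (\<lambda>y. u' y * conv \<rho> Pr y)"
    unfolding Qy[symmetric] by (rule lborel_pair.integrable_snd) (use intQ in \<open>simp add: case_prod_unfold\<close>)
  have i1: "integrable lborel (\<lambda>y. u' y * \<rho> y)" by (rule integrable_bounded_mult[OF \<rho>i u' C])
  have "(\<integral>y. \<rho> y * u' y \<partial>lborel) = (\<integral>y. u' y * conv \<rho> Pr y \<partial>lborel)"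
    using zero i1 i2 by (simp add: mult.commute)
  also have "\<dots> = (\<integral>w. \<integral>y. Q (w, y) \<partial>lborel \<partial>lborel)"
    unfolding Qy[symmetric] by (rule lborel_pair.Fubini_integral) (use intQ in \<open>simp add: case_prod_unfold\<close>)
  also have "\<dots> = (\<integral>w. Pr w * (\<integral>y. \<rho> (y - w) * u' y \<partial>lborel) \<partial>lborel)"
    by (intro Bochner_Integration.integral_cong) (auto simp: Q_def mult.commute)
  also have "\<dots> = (\<integral>w. poisson s 0 w * (\<integral>y. \<rho> (y - r *\<^sub>R w) * u' y \<partial>lborel) \<partial>lborel)"
    unfolding Pr_def by (rule integral_poisson_scaled[OF r]) measurable
  finally show ?thesis .
qed

text \<open>Let \<open>r -> 1\<close> and the mollification shrink in the mean value property. At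
  the centre the averages converge by continuity of \<open>u\<close> in the ball; at
  \<open>w\<close> with \<open>|w| > 1\<close> they eventually see only exterior points, where
  \<open>u\<close> agrees with \<open>g\<close>, and \<open>g\<close> is locally constant. All
  averages are bounded by the bound for \<open>u\<close>, so \<open>P(0, .)\<close> supplies the
  majorant.\<close>

lemma center_representation:
  fixes u g :: "'a::euclidean_space \<Rightarrow> real"
  assumes s: "0 < s" "s < 1" "2 * s < real DIM('a)" and sol: "frac_poisson_sol s (ball 0 1) g u"
    and g [measurable]: "g \<in> borel_measurable borel"
    and loc: "AE w in lborel. norm w > 1 \<longrightarrow> (\<exists>\<delta>>0. \<forall>y. dist w y < \<delta> \<longrightarrow> g y = g w)"
  shows "u 0 = (\<integral>w. poisson s 0 w * g w \<partial>lborel)"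
proof -
  have um: "u \<in> borel_measurable (completion lborel)" using sol by (simp add: frac_poisson_sol_def)
  obtain v where v [measurable]: "v \<in> borel_measurable lborel" and uv: "AE x in lborel. u x = v x"
    using completion_ex_borel_measurable_real[OF um] by blast
  obtain C0 where C0: "AE x in lebesgue. \<bar>u x\<bar> \<le> C0" using sol by (auto simp: frac_poisson_sol_def)
  define C where "C = max C0 0"
  \<comment> \<open>A Borel representative that is bounded everywhere, obtained by cutting off the
    null set where the essential bound fails.\<close>
  define u' where "u' x = (if \<bar>v x\<bar> \<le> C then v x else 0)" for x
  have u'm [measurable]: "u' \<in> borel_measurable borel" unfolding u'_def using v by measurable
  have C: "\<bar>u' x\<bar> \<le> C" for x by (simp add: u'_def C_def)
  have C0': "AE x in lborel. \<bar>u x\<bar> \<le> C0" using C0 by (simp add: AE_completion_iff)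
  have uu': "AE x in lborel. u x = u' x"
    using uv C0' by eventually_elim (auto simp: u'_def C_def)
  have ug: "AE x in lborel. norm x \<ge> 1 \<longrightarrow> u x = g x"
  proof -
    have "AE x in lebesgue. x \<notin> ball 0 1 \<longrightarrow> u x = g x" using sol by (simp add: frac_poisson_sol_def)
    then have "AE x in lborel. x \<notin> ball 0 1 \<longrightarrow> u x = g x" by (simp add: AE_completion_iff)
    then show ?thesis by eventually_elim simp
  qed
  have cont: "continuous_on (ball 0 1) u" using sol by (simp add: frac_poisson_sol_def)
  \<comment> \<open>With these choices \<open>r n + e n = 1 - 1 / (n + 3)\<close>, so the supports
    stay strictly inside the unit ball for every \<open>n\<close>, and \<open>r n\<close> is
    positive already for \<open>n = 0\<close>.\<close>
  define e where "e n = 1 / (real n + 3)" for n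
  define r where "r n = 1 - 2 / (real n + 3)" for n
  have e: "e n > 0" and r: "r n > 0" and re: "r n + e n < 1" for n
    by (auto simp: e_def r_def field_simps)
  have elim: "e \<longlonglongrightarrow> 0" unfolding e_def by real_asymp
  have rlim: "r \<longlonglongrightarrow> 1" unfolding r_def by real_asymp
  have "\<exists>\<rho>::'a \<Rightarrow> real. smooth_fun \<rho> \<and> (\<forall>x. \<rho> x \<ge> 0) \<and> (\<forall>x. norm x \<ge> e n \<longrightarrow> \<rho> x = 0) \<and> (\<integral>x. \<rho> x \<partial>lborel) = 1" for n
    using mollifier_exists[OF e[of n]] by metis
  then obtain \<rho> :: "nat \<Rightarrow> 'a \<Rightarrow> real" where \<rho>: "\<And>n. smooth_fun (\<rho> n)" "\<And>n x. \<rho> n x \<ge> 0" "\<And>n x. norm x \<ge> e n \<Longrightarrow> \<rho> n x = 0" "\<And>n. (\<integral>x. \<rho> n x \<partial>lborel) = 1"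
    by metis
  have [measurable]: "\<rho> n \<in> borel_measurable borel" for n by (rule smooth_fun_measurable[OF \<rho>(1)])
  define A where "A n q = (\<integral>y. \<rho> n (y - q) * u' y \<partial>lborel)" for n q
  have Am [measurable]: "A n \<in> borel_measurable borel" for n unfolding A_def by measurable
  have AC: "\<bar>A n q\<bar> \<le> C" for n q
    using mollified_average_bound[where \<rho>="\<rho> n" and e="e n" and q=q and c=0 and d=C, OF \<rho>(2) \<rho>(4) \<rho>(3) u'm C] C
    by (simp add: A_def)
  have mean: "A n 0 = (\<integral>w. poisson s 0 w * A n (r n *\<^sub>R w) \<partial>lborel)" for n
    unfolding A_def using center_mean_value[OF s sol u'm C uu' r e re \<rho>(1) \<rho>(3), of n] by simp
  have lim0: "(\<lambda>n. A n 0) \<longlonglongrightarrow> u 0"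
    unfolding A_def
  proof (rule mollified_average_tendsto[OF \<rho>(2) \<rho>(4) \<rho>(3) elim tendsto_const u'm C])
    fix d :: real assume d: "d > 0"
    have "isCont u 0" using cont by (simp add: continuous_on_eq_continuous_at)
    then obtain \<delta> where \<delta>: "\<delta> > 0" "\<And>y. dist y 0 < \<delta> \<Longrightarrow> dist (u y) (u 0) < d"
      unfolding continuous_at_eps_delta using d by metis
    have "AE y in lborel. dist 0 y < \<delta> \<longrightarrow> \<bar>u' y - u 0\<bar> \<le> d"
      using uu'
    proof eventually_elim
      case (elim y)
      then show ?case using \<delta>(2)[of y] by (auto simp: dist_commute dist_real_def)
    qed
    then show "\<exists>\<delta>>0. AE y in lborel. dist 0 y < \<delta> \<longrightarrow> \<bar>u' y - u 0\<bar> \<le> d" using \<delta>(1) by blast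
  qed
  have "(\<lambda>n. \<integral>w. poisson s 0 w * A n (r n *\<^sub>R w) \<partial>lborel) \<longlonglongrightarrow> (\<integral>w. poisson s 0 w * g w \<partial>lborel)"
  proof (rule Bochner_Integration.integral_dominated_convergence[where w="\<lambda>w. C * poisson s 0 w"])
    show "integrable lborel (\<lambda>w::'a. C * poisson s 0 w)" by (intro integrable_mult_right poisson_integrable[OF s(1,2)])
    show "AE w in lborel. (\<lambda>n. poisson s 0 w * A n (r n *\<^sub>R w)) \<longlonglongrightarrow> poisson s 0 w * g w"
      using loc
    proof eventually_elim
      case (elim w)
      show ?case
      proof (cases "norm w > 1")
        case True
        then obtain \<delta> where \<delta>: "\<delta> > 0" "\<And>y. dist w y < \<delta> \<Longrightarrow> g y = g w" using elim by blast
        have "(\<lambda>n. A n (r n *\<^sub>R w)) \<longlonglongrightarrow> g w"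
          unfolding A_def
        proof (rule mollified_average_tendsto[OF \<rho>(2) \<rho>(4) \<rho>(3) \<open>e \<longlonglongrightarrow> 0\<close> _ u'm C])
          show "(\<lambda>n. r n *\<^sub>R w) \<longlonglongrightarrow> w" using tendsto_scaleR[OF rlim tendsto_const[of w]] by simp
          fix d :: real assume d: "d > 0"
          \<comment> \<open>The radius \<open>|w| - 1\<close> keeps \<open>y\<close> outside the
            unit ball, where \<open>u\<close> equals the datum.\<close>
          have "AE y in lborel. dist w y < min \<delta> (norm w - 1) \<longrightarrow> \<bar>u' y - g w\<bar> \<le> d"
            using uu' ug
          proof eventually_elim
            case (elim y)
            show ?case
            proof
              assume a: "dist w y < min \<delta> (norm w - 1)"
              have "norm w \<le> norm y + dist w y" using norm_triangle_ineq[of y "w - y"] by (simp add: dist_norm)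
              then have "norm y \<ge> 1" using a by simp
              then have "u' y = g w" using elim \<delta>(2)[of y] a by simp
              then show "\<bar>u' y - g w\<bar> \<le> d" using d by simp
            qed
          qed
          moreover have "min \<delta> (norm w - 1) > 0" using \<delta>(1) True by simp
          ultimately show "\<exists>\<delta>>0. AE y in lborel. dist w y < \<delta> \<longrightarrow> \<bar>u' y - g w\<bar> \<le> d" by blast
        qed
        then show ?thesis by (intro tendsto_mult tendsto_const)
      qed (simp add: poisson_def)
    qed
    show "AE w in lborel. norm (poisson s 0 w * A n (r n *\<^sub>R w)) \<le> C * poisson s 0 w" for n
      using mult_left_mono[OF AC poisson_nonneg] by (intro AE_I2) (simp add: abs_mult poisson_nonneg mult.commute[of C])
  qed measurable
  then show ?thesis using lim0 unfolding mean by (rule LIMSEQ_unique[rotated])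
qed

section \<open>The oscillating exterior datum\<close>

definition poisson_cmf :: "'a::euclidean_space itself \<Rightarrow> real \<Rightarrow> real \<Rightarrow> real" where
  "poisson_cmf _ s M = (\<integral>(y::'a). indicator (cball 0 M) y * poisson s 0 y \<partial>lborel)"

lemma poisson_cmf_integrable:
  assumes "0 < s" "s < 1" and [measurable]: "A \<in> sets borel"
  shows "integrable lborel (\<lambda>y::'a::euclidean_space. indicator A y * poisson s 0 y)"
  by (rule integrable_bounded_mult[OF poisson_integrable[OF assms(1,2)], of _ 1]) (auto simp: indicator_def)

lemma poisson_center_integral:
  assumes "0 < s" "s < 1"
  shows "(\<integral>(y::'a::euclidean_space). poisson s 0 y \<partial>lborel) = 1"
  using poisson_center_mass[OF assms, where 'a='a] by (subst integral_eq_nn_integral) (auto simp: poisson_nonneg borel_measurable_integrable[OF poisson_integrable[OF assms]])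

text \<open>\<open>riesz_norm\<close> is half of \<open>sphere_weight\<close> times the Beta
  integral, and the latter is at least \<open>1 / (2 s)\<close>; this gives a quarter of the surface
  area as the constant.\<close>

lemma riesz_norm_lower:
  obtains W where "W > 0" "\<And>s. 0 < s \<Longrightarrow> s < 1 \<Longrightarrow> riesz_norm TYPE('a::euclidean_space) s \<ge> W / s"
proof -
  define w where "w = enn2real (sphere_weight TYPE('a))"
  have w: "sphere_weight TYPE('a) = ennreal w" "w > 0"
    using sphere_weight_finite[where 'a='a] sphere_weight_pos[where 'a='a] by (auto simp: w_def enn2real_positive_iff)
  have "riesz_norm TYPE('a) s \<ge> (w / 4) / s" if s: "0 < s" "s < 1" for s
  proof -
    have "ennreal (w / 4 / s) = ennreal w * ennreal (1 / (2 * s)) * ennreal (1 / 2)"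
    proof -
      have "w / 4 / s = w * (1 / (2 * s)) * (1 / 2)" by simp
      moreover have "0 \<le> w" "0 \<le> 1 / (2 * s)" "0 \<le> (1 / 2 :: real)" "0 \<le> w * (1 / (2 * s))" using w s by auto
      ultimately show ?thesis by (simp only: ennreal_mult)
    qed
    also have "\<dots> \<le> sphere_weight TYPE('a) * beta_const s * ennreal (1 / 2)"
      unfolding w(1) by (intro mult_right_mono mult_left_mono beta_const_lower s) auto
    also have "\<dots> = riesz_ball_const TYPE('a) s" by (simp add: riesz_ball_const_def divide_ennreal_def)
    also have "\<dots> = ennreal (riesz_norm TYPE('a) s)" by (rule riesz_ball_const_eq[OF s])
    finally show ?thesis using riesz_ball_const_eq(2)[OF s, where 'a='a] by simp
  qed
  then show ?thesis using that[of "w / 4"] w by simp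
qed

text \<open>As \<open>s \<rightarrow> 0\<close> the exit distribution of the unit ball escapes to infinity, because the normalising
  constant blows up like \<open>1 / s\<close>.\<close>

lemma poisson_cmf_small:
  assumes M: "M \<ge> 1" and d: "d > 0"
  shows "\<exists>s0>0. \<forall>s. 0 < s \<and> s < s0 \<longrightarrow> poisson_cmf TYPE('a::euclidean_space) s M < d"
proof -
  obtain W where W: "W > 0" "\<And>s. 0 < s \<Longrightarrow> s < 1 \<Longrightarrow> riesz_norm TYPE('a) s \<ge> W / s"
    using riesz_norm_lower[where 'a='a] by blast
  define K where "K = riesz_norm TYPE('a) (1/2)"
  have K: "K > 0" unfolding K_def by (rule riesz_ball_const_eq) auto
  define D where "D = M\<^sup>2 * K / W"
  have D: "D > 0" using M K W by (simp add: D_def)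
  have bound: "poisson_cmf TYPE('a) s M \<le> D * s" if s: "0 < s" "s < 1/2" for s
  proof -
    have s1: "s < 1" using s by simp
    have Ks: "riesz_norm TYPE('a) s \<ge> W / s" by (rule W(2)[OF s(1) s1])
    \<comment> \<open>Comparison with the exponent \<open>1/2\<close>: with
      \<open>a = |y|^2 - 1 \<le> M^2\<close> one has \<open>a^(-s) \<le> M^2 a^(-1/2)\<close> for
      all \<open>s < 1/2\<close>. The kernel for \<open>1/2\<close> has mass one and absorbs the
      singularity at the unit sphere, and the quotient of the normalising constants supplies the
      factor \<open>s\<close>.\<close>
    have "indicator (cball 0 M) y * poisson s 0 y \<le> D * s * poisson (1/2) 0 y" for y :: 'a
    proof (cases "norm y \<le> M \<and> 1 < norm y")
      case True
      define a where "a = (norm y)\<^sup>2 - 1"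
      have a: "a > 0" using True by (simp add: a_def one_less_power)
      have "(norm y)\<^sup>2 \<le> M\<^sup>2" using True by (intro power_mono) auto
      then have aM: "a \<le> M\<^sup>2" by (simp add: a_def)
      have M2: "1 \<le> M\<^sup>2" using M by (simp add: one_le_power)
      have "a powr (1/2 - s) \<le> (M\<^sup>2) powr (1/2 - s)" using a aM s by (intro powr_mono2) auto
      also have "\<dots> \<le> (M\<^sup>2) powr 1" using M2 s by (intro powr_mono) auto
      finally have le: "a powr (1/2 - s) \<le> M\<^sup>2" using M2 by simp
      have e: "(1 / a) powr s = a powr (1/2 - s) * (1 / a) powr (1/2)"
      proof -
        have "(1 / a) powr s = a powr (- s)" "(1 / a) powr (1/2) = a powr (- (1/2))"
          using powr_divide_minus[of 1 a s] powr_divide_minus[of 1 a "1/2"] a by simp_all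
        moreover have "a powr (1/2 - s) * a powr (- (1/2)) = a powr (1/2 - s + - (1/2))" by (rule powr_add[symmetric])
        ultimately show ?thesis by simp
      qed
      define n where "n = norm y ^ DIM('a)"
      have n: "n > 0" unfolding n_def by (rule zero_less_power) (use True in linarith)
      have "poisson s 0 y = (1 / a) powr s / n / riesz_norm TYPE('a) s" using True by (simp add: poisson_def a_def n_def)
      also have "\<dots> \<le> (1 / a) powr s / n / (W / s)"
        using Ks W(1) s n by (intro divide_left_mono mult_pos_pos) (auto intro: less_le_trans[OF _ Ks])
      also have "\<dots> \<le> (M\<^sup>2 * (1 / a) powr (1/2)) / n / (W / s)"
        unfolding e using le n W(1) s by (intro divide_right_mono mult_right_mono) auto
      also have "\<dots> = D * s * ((1 / a) powr (1/2) / n / K)" using K W(1) s by (simp add: D_def mult_ac)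
      also have "(1 / a) powr (1/2) / n / K = poisson (1/2) 0 y" using True by (simp add: poisson_def a_def n_def K_def)
      finally show ?thesis using True by simp
    next
      case False
      then have z: "indicator (cball 0 M) y * poisson s 0 y = 0" by (auto simp: poisson_def indicator_def)
      show ?thesis unfolding z using D s by (intro mult_nonneg_nonneg poisson_nonneg) auto
    qed
    then have "poisson_cmf TYPE('a) s M \<le> (\<integral>(y::'a). D * s * poisson (1/2) 0 y \<partial>lborel)"
      unfolding poisson_cmf_def using s s1
      by (intro integral_mono poisson_cmf_integrable integrable_mult_right poisson_integrable) auto
    then show ?thesis using poisson_center_integral[where 'a='a, of "1/2"] by simp
  qed
  show ?thesis
  proof (intro exI[of _ "min (1/2) (d / D)"] conjI allI impI)
    show "min (1/2) (d / D) > 0" using d D by simp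
    fix s assume s: "0 < s \<and> s < min (1/2) (d / D)"
    then have "D * s < d" using D by (simp add: pos_less_divide_eq mult.commute)
    then show "poisson_cmf TYPE('a) s M < d" using bound[of s] s by simp
  qed
qed

lemma poisson_cmf_large:
  assumes s: "0 < s" "s < 1" and d: "d > 0"
  shows "\<exists>M0. \<forall>M\<ge>M0. poisson_cmf TYPE('a::euclidean_space) s M > 1 - d"
proof -
  have "(\<lambda>n. poisson_cmf TYPE('a) s (real n)) \<longlonglongrightarrow> (\<integral>(y::'a). poisson s 0 y \<partial>lborel)"
    unfolding poisson_cmf_def
  proof (rule Bochner_Integration.integral_dominated_convergence[where w="poisson s 0"])
    show "integrable lborel (poisson s (0::'a))" by (rule poisson_integrable[OF s])
    then show "poisson s (0::'a) \<in> borel_measurable lborel" by (rule borel_measurable_integrable)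
    show "(\<lambda>y::'a. indicator (cball 0 (real n)) y * poisson s 0 y) \<in> borel_measurable lborel" for n
      by (rule borel_measurable_integrable[OF poisson_cmf_integrable[OF s]]) simp
    show "AE (y::'a) in lborel. (\<lambda>n. indicator (cball 0 (real n)) y * poisson s 0 y) \<longlonglongrightarrow> poisson s 0 y"
    proof (rule AE_I2)
      fix y :: 'a
      have ev: "eventually (\<lambda>n. norm y \<le> real n) sequentially"
        using filterlim_real_sequentially unfolding filterlim_at_top by blast
      show "(\<lambda>n. indicator (cball 0 (real n)) y * poisson s 0 y) \<longlonglongrightarrow> poisson s 0 y"
        by (rule tendsto_eventually, rule eventually_mono[OF ev]) simp
    qed
    show "AE (y::'a) in lborel. norm (indicator (cball 0 (real n)) y * poisson s 0 y) \<le> poisson s 0 y" for n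
      by (intro AE_I2) (simp add: poisson_nonneg abs_mult indicator_def)
  qed
  then have "(\<lambda>n. poisson_cmf TYPE('a) s (real n)) \<longlonglongrightarrow> 1" by (simp only: poisson_center_integral[OF s])
  then have "eventually (\<lambda>n. poisson_cmf TYPE('a) s (real n) > 1 - d) sequentially"
    using d by (intro order_tendstoD(1)) auto
  then obtain n where n: "poisson_cmf TYPE('a) s (real n) > 1 - d" by (auto simp: eventually_sequentially)
  have "poisson_cmf TYPE('a) s M > 1 - d" if "M \<ge> real n" for M
  proof -
    have "poisson_cmf TYPE('a) s (real n) \<le> poisson_cmf TYPE('a) s M"
      unfolding poisson_cmf_def
      by (intro integral_mono poisson_cmf_integrable[OF s]) (use that in \<open>auto simp: indicator_def poisson_nonneg\<close>)
    then show ?thesis using n by simp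
  qed
  then show ?thesis by blast
qed

text \<open>Given the radius \<open>M k\<close>, the exponent \<open>\<sigma> k\<close> is taken so
  small that little mass lies within \<open>M k\<close>; for this exponent the next radius is taken
  so large that almost all mass lies within it. The errors \<open>1 / (k + 2)\<close> are below one
  already for \<open>k = 0\<close>, which also forces \<open>\<sigma> k < 1\<close>.\<close>

lemma oscillating_scales:
  obtains M \<sigma> :: "nat \<Rightarrow> real" where
    "\<And>k. M k \<ge> 1" "\<And>k. M (Suc k) \<ge> M k + 1" "\<And>k. 0 < \<sigma> k" "\<And>k. \<sigma> k < 1 / real (k + 2)"
    "\<And>k. poisson_cmf TYPE('a::euclidean_space) (\<sigma> k) (M k) < 1 / real (k + 2)"
    "\<And>k. poisson_cmf TYPE('a) (\<sigma> k) (M (Suc k)) > 1 - 1 / real (k + 2)"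
proof -
  define R where "R k m s m' \<longleftrightarrow> 0 < s \<and> s < 1 / real (k + 2) \<and> m' \<ge> m + 1 \<and>
    poisson_cmf TYPE('a) s m < 1 / real (k + 2) \<and> poisson_cmf TYPE('a) s m' > 1 - 1 / real (k + 2)" for k m s m'
  have "\<exists>s m'. m \<ge> 1 \<longrightarrow> R k m s m'" for k m
  proof (cases "m \<ge> 1")
    case True
    have d: "1 / real (k + 2) > 0" "1 / real (k + 2) < 1" by auto
    obtain s0 where s0: "s0 > 0" "\<And>s. 0 < s \<Longrightarrow> s < s0 \<Longrightarrow> poisson_cmf TYPE('a) s m < 1 / real (k + 2)"
      using poisson_cmf_small[OF True d(1), where 'a='a] by blast
    define q where "q = 1 / real (k + 2)"
    define s where "s = min s0 q / 2"
    have q: "q > 0" using d(1) by (simp only: q_def)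
    then have "0 < s" "s < s0" "s < q" using s0(1) by (auto simp: s_def min_def)
    then have s: "0 < s" "s < s0" "s < 1 / real (k + 2)" by (simp_all only: q_def)
    have s1: "s < 1" using s(3) d(2) by linarith
    obtain M0 where "\<forall>M\<ge>M0. poisson_cmf TYPE('a) s M > 1 - 1 / real (k + 2)"
      using poisson_cmf_large[OF s(1) s1 d(1), where 'a='a] by blast
    then have "poisson_cmf TYPE('a) s (max M0 (m + 1)) > 1 - 1 / real (k + 2)" by simp
    then show ?thesis using s s0(2)[OF s(1,2)] by (intro exI[of _ s] exI[of _ "max M0 (m + 1)"]) (auto simp: R_def)
  qed simp
  \<comment> \<open>Exponent and next radius are packed into one pair because the radius depends on
    the chosen exponent. The guard \<open>m \<ge> 1\<close> makes the choice total, so it can be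
    iterated by plain recursion from \<open>M 0 = 1\<close>.\<close>
  then have ex: "\<exists>p. m \<ge> 1 \<longrightarrow> R k m (fst p) (snd p)" for k m by (metis fst_conv snd_conv)
  define S where "S k m = fst (SOME p. m \<ge> 1 \<longrightarrow> R k m (fst p) (snd p))" for k m
  define T where "T k m = snd (SOME p. m \<ge> 1 \<longrightarrow> R k m (fst p) (snd p))" for k m
  have "m \<ge> 1 \<Longrightarrow> R k m (S k m) (T k m)" for k m
    using someI_ex[OF ex[of m k]] unfolding S_def T_def by blast
  then have ST: "m \<ge> 1 \<Longrightarrow> 0 < S k m \<and> S k m < 1 / real (k + 2) \<and> T k m \<ge> m + 1 \<and>
    poisson_cmf TYPE('a) (S k m) m < 1 / real (k + 2) \<and> poisson_cmf TYPE('a) (S k m) (T k m) > 1 - 1 / real (k + 2)" for k m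
    unfolding R_def by blast
  define M where "M = rec_nat 1 T"
  have Ms: "M (Suc k) = T k (M k)" for k by (simp add: M_def)
  have M1: "M k \<ge> 1" for k
  proof (induction k)
    case 0 then show ?case by (simp add: M_def)
  next
    case (Suc k)
    have "T k (M k) \<ge> M k + 1" using ST[OF Suc, of k] by blast
    then show ?case using Suc by (simp add: Ms)
  qed
  show ?thesis
    by (rule that[of M "\<lambda>k. S k (M k)"]) (use ST[OF M1] M1 Ms in auto)
qed

section \<open>The datum and its two limits\<close>

theorem theorem1p4:
  assumes "DIM('a::euclidean_space) \<ge> 2"
  shows "\<exists>g :: 'a \<Rightarrow> real. g \<in> borel_measurable lebesgue \<and> bounded (range g)
     \<and> (\<forall>s\<in>{0<..<1}. \<exists>u. frac_poisson_sol s (ball 0 1) g u)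
     \<and> (\<exists>x\<in>ball 0 1. \<forall>u :: real \<Rightarrow> 'a \<Rightarrow> real.
          (\<forall>s\<in>{0<..<1}. frac_poisson_sol s (ball 0 1) g (u s)) \<longrightarrow>
          Limsup (at_right 0) (\<lambda>s. ereal (u s x)) = 1 \<and>
          Liminf (at_right 0) (\<lambda>s. ereal (u s x)) = 0)"
proof -
  \<comment> \<open>Dimension at least two enters here: it makes the exponent \<open>2 s - N\<close>
    of the Riesz kernel negative for all \<open>s\<close> in \<open>(0,1)\<close>.\<close>
  have dim: "2 * s < real DIM('a)" if "s < 1" for s using assms that by linarith
  obtain M \<sigma> :: "nat \<Rightarrow> real" where M1: "\<And>k. M k \<ge> 1" and Mstep: "\<And>k. M (Suc k) \<ge> M k + 1"
    and \<sigma>: "\<And>k. 0 < \<sigma> k" "\<And>k. \<sigma> k < 1 / real (k + 2)"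
    and small: "\<And>k. poisson_cmf TYPE('a) (\<sigma> k) (M k) < 1 / real (k + 2)"
    and large: "\<And>k. poisson_cmf TYPE('a) (\<sigma> k) (M (Suc k)) > 1 - 1 / real (k + 2)"
    using oscillating_scales[where 'a='a] by metis
  have Mmono: "strict_mono M"
    unfolding strict_mono_Suc_iff
  proof
    show "M n < M (Suc n)" for n using Mstep[of n] by linarith
  qed
  have Mk: "M k \<ge> real k" for k
  proof (induction k)
    case 0 show ?case using M1[of 0] by simp
  next
    case (Suc k) then show ?case using Mstep[of k] by simp
  qed
  \<comment> \<open>Half-open shells, which tile the region \<open>|y| > M 0\<close>. Below
    \<open>M 0\<close> the datum is zero.\<close>
  define shell_set where "shell_set k = {y::'a. M k < norm y \<and> norm y \<le> M (Suc k)}" for k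
  have disj: "k = j" if "y \<in> shell_set k" "y \<in> shell_set j" for k j y
  proof (rule ccontr)
    assume "k \<noteq> j"
    then consider "Suc k \<le> j" | "Suc j \<le> k" by linarith
    then show False
    proof cases
      case 1
      then have "M (Suc k) \<le> M j" using Mmono by (simp add: strict_mono_less_eq)
      then show False using that by (auto simp: shell_set_def)
    next
      case 2
      then have "M (Suc j) \<le> M k" using Mmono by (simp add: strict_mono_less_eq)
      then show False using that by (auto simp: shell_set_def)
    qed
  qed
  define S where "S = (\<Union>k. shell_set (2 * k))"
  define g :: "'a \<Rightarrow> real" where "g = indicator S"
  have shm [measurable]: "shell_set k \<in> sets borel" for k unfolding shell_set_def by measurable
  have Sm [measurable]: "S \<in> sets borel" unfolding S_def by measurable
  have gm [measurable]: "g \<in> borel_measurable borel" unfolding g_def by measurable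
  have g01: "0 \<le> g y" "g y \<le> 1" for y by (auto simp: g_def indicator_def)
  have gB: "\<bar>g y\<bar> \<le> 1" for y using g01[of y] by simp
  have g_shell: "g y = (if even k then 1 else 0)" if "y \<in> shell_set k" for y k
  proof (cases "even k")
    case True
    then obtain j where "k = 2 * j" by (elim evenE)
    then have "y \<in> S" using that unfolding S_def by blast
    then show ?thesis using True by (simp add: g_def)
  next
    case False
    have "y \<notin> S"
    proof
      assume "y \<in> S"
      then obtain j where "y \<in> shell_set (2 * j)" unfolding S_def by blast
      from disj[OF that this] False show False by simp
    qed
    then show ?thesis using False by (simp add: g_def)
  qed
  \<comment> \<open>Exceptional points lie on the countably many spheres \<open>|w| = M k\<close>, a
    null set; everywhere else \<open>w\<close> is interior either to the ball of radius
    \<open>M 0\<close> or to a single shell.\<close>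
  have loc: "AE (w::'a) in lborel. norm w > 1 \<longrightarrow> (\<exists>\<delta>>0. \<forall>y. dist w y < \<delta> \<longrightarrow> g y = g w)"
  proof -
    have "AE (w::'a) in lborel. \<forall>k. norm w \<noteq> M k" unfolding AE_all_countable by (intro allI AE_norm_neq)
    then show ?thesis
    proof eventually_elim
      case (elim w)
      obtain n where n: "norm w \<le> M n" using Mk real_arch_simple[of "norm w"] order_trans by metis
      show ?case
      proof (intro impI, cases "norm w < M 0")
        case True
        have "g y = 0" if "norm y < M 0" for y
        proof -
          have "y \<notin> shell_set k" for k using that strict_mono_less_eq[OF Mmono, of 0 k] by (auto simp: shell_set_def)
          then show ?thesis by (simp add: g_def S_def)
        qed
        moreover have "norm y < M 0" if "dist w y < M 0 - norm w" for y
          using that norm_triangle_ineq[of w "y - w"] by (simp add: dist_norm norm_minus_commute)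
        ultimately show "\<exists>\<delta>>0. \<forall>y. dist w y < \<delta> \<longrightarrow> g y = g w"
          using True by (intro exI[of _ "M 0 - norm w"]) auto
      next
        case False
        \<comment> \<open>The first radius reaching \<open>|w|\<close>. It is not
          \<open>M 0\<close>, so its predecessor bounds the shell from inside.\<close>
        define m where "m = (LEAST m. norm w \<le> M m)"
        have m: "norm w \<le> M m" unfolding m_def by (rule LeastI[of "\<lambda>m. norm w \<le> M m", OF n])
        have "m \<noteq> 0"
        proof
          assume "m = 0"
          then have "norm w \<le> M 0" using m by simp
          then show False using False elim[rule_format, of 0] by linarith
        qed
        then obtain k where k: "m = Suc k" by (cases m) auto
        have "\<not> norm w \<le> M k" using not_less_Least[of k "\<lambda>m. norm w \<le> M m"] k by (simp add: m_def)
        then have wk: "M k < norm w" "norm w < M (Suc k)" using m k elim[rule_format, of "Suc k"] by auto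
        have near: "y \<in> shell_set k" if "dist w y < min (norm w - M k) (M (Suc k) - norm w)" for y
        proof -
          have "\<bar>norm w - norm y\<bar> \<le> dist w y" unfolding dist_norm by (rule norm_triangle_ineq3)
          then show ?thesis using that by (auto simp: shell_set_def)
        qed
        have w: "w \<in> shell_set k" using wk by (simp add: shell_set_def)
        show "\<exists>\<delta>>0. \<forall>y. dist w y < \<delta> \<longrightarrow> g y = g w"
        proof (intro exI conjI allI impI)
          show "min (norm w - M k) (M (Suc k) - norm w) > 0" using wk by simp
          fix y assume "dist w y < min (norm w - M k) (M (Suc k) - norm w)"
          then show "g y = g w" using g_shell[OF near] g_shell[OF w] by presburger
        qed
      qed
    qed
  qed
  define v where "v s = (\<integral>(y::'a). poisson s 0 y * g y \<partial>lborel)" for s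
  have gi: "integrable lborel (\<lambda>y. poisson s 0 y * g y)" if "0 < s" "s < 1" for s
    using integrable_bounded_mult[OF poisson_integrable[OF that, of 0] gm gB] by (simp add: mult.commute)
  have v01: "0 \<le> v s" "v s \<le> 1" if s: "0 < s" "s < 1" for s
  proof -
    show "0 \<le> v s" unfolding v_def using g01 by (intro Bochner_Integration.integral_nonneg mult_nonneg_nonneg poisson_nonneg)
    have "v s \<le> (\<integral>(y::'a). poisson s 0 y \<partial>lborel)"
      unfolding v_def using g01 by (intro integral_mono gi poisson_integrable s) (simp add: poisson_nonneg mult_left_le)
    then show "v s \<le> 1" by (simp only: poisson_center_integral[OF s])
  qed
  have \<sigma>1: "\<sigma> k < 1" for k using \<sigma>(2)[of k] by (rule less_le_trans) simp
  have si: "integrable lborel (\<lambda>y::'a. indicator (shell_set k) y * poisson (\<sigma> k) 0 y)" for k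
    by (rule poisson_cmf_integrable[OF \<sigma>(1) \<sigma>1 shm])
  have mass: "(\<integral>y. indicator (shell_set k) y * poisson (\<sigma> k) 0 y \<partial>lborel) > 1 - 2 / real (k + 2)" for k
  proof -
    have "(\<integral>y. indicator (shell_set k) y * poisson (\<sigma> k) 0 y \<partial>lborel) = (\<integral>(y::'a). indicator (cball 0 (M (Suc k))) y * poisson (\<sigma> k) 0 y - indicator (cball 0 (M k)) y * poisson (\<sigma> k) 0 y \<partial>lborel)"
      using strict_mono_less[OF Mmono, of k "Suc k"] by (intro Bochner_Integration.integral_cong) (auto simp: shell_set_def indicator_def)
    also have "\<dots> = poisson_cmf TYPE('a) (\<sigma> k) (M (Suc k)) - poisson_cmf TYPE('a) (\<sigma> k) (M k)"
      unfolding poisson_cmf_def by (intro Bochner_Integration.integral_diff poisson_cmf_integrable \<sigma>(1) \<sigma>1) auto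
    also have "\<dots> > (1 - 1 / real (k + 2)) - 1 / real (k + 2)" using small[of k] large[of k] by linarith
    finally show ?thesis by simp
  qed
  \<comment> \<open>For even \<open>k\<close> the datum is one on the shell that carries nearly all
    mass. For odd \<open>k\<close> it is zero there, and the bound comes from the complementary
    mass, which uses that the total is exactly one.\<close>
  have v_even: "v (\<sigma> k) > 1 - 2 / real (k + 2)" if "even k" for k
  proof -
    have "(\<integral>y. indicator (shell_set k) y * poisson (\<sigma> k) 0 y \<partial>lborel) \<le> v (\<sigma> k)"
      unfolding v_def
    proof (intro integral_mono si gi \<sigma>(1) \<sigma>1)
      fix y :: 'a
      show "indicator (shell_set k) y * poisson (\<sigma> k) 0 y \<le> poisson (\<sigma> k) 0 y * g y"
        using g_shell[of y k] that g01[of y] poisson_nonneg[of "\<sigma> k" 0 y] by (cases "y \<in> shell_set k") auto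
    qed
    then show ?thesis using mass[of k] by linarith
  qed
  have v_odd: "v (\<sigma> k) < 2 / real (k + 2)" if "odd k" for k
  proof -
    have "v (\<sigma> k) \<le> (\<integral>(y::'a). poisson (\<sigma> k) 0 y - indicator (shell_set k) y * poisson (\<sigma> k) 0 y \<partial>lborel)"
      unfolding v_def
    proof (intro integral_mono Bochner_Integration.integrable_diff poisson_integrable si gi \<sigma>(1) \<sigma>1)
      fix y :: 'a
      show "poisson (\<sigma> k) 0 y * g y \<le> poisson (\<sigma> k) 0 y - indicator (shell_set k) y * poisson (\<sigma> k) 0 y"
        using g_shell[of y k] that g01[of y] poisson_nonneg[of "\<sigma> k" 0 y] by (cases "y \<in> shell_set k") (auto simp: mult_left_le)
    qed
    also have "\<dots> = (\<integral>(y::'a). poisson (\<sigma> k) 0 y \<partial>lborel) - (\<integral>y. indicator (shell_set k) y * poisson (\<sigma> k) 0 y \<partial>lborel)"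
      by (intro Bochner_Integration.integral_diff poisson_integrable si \<sigma>(1) \<sigma>1)
    also have "\<dots> < 2 / real (k + 2)" using mass[of k] poisson_center_integral[OF \<sigma>(1) \<sigma>1, where 'a='a, of k] by linarith
    finally show ?thesis .
  qed
  \<comment> \<open>The offset \<open>i\<close> is 0 or 1 and selects the parity, so that
    arbitrarily small exponents with small error occur in both subsequences.\<close>
  have freq: "\<exists>k. \<sigma> (2 * k + i) < b \<and> 2 / real (2 * k + i + 2) < d" if "b > 0" "d > 0" for b d i
  proof -
    obtain k where k: "real k > max (1 / b) (2 / d)" using reals_Archimedean2 by blast
    then have kp: "real k > 0" using that by (meson divide_pos_pos less_trans max_less_iff_conj zero_less_one)
    have "1 / real (2 * k + i + 2) < b" "2 / real (2 * k + i + 2) < d"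
    proof -
      have "1 / b < real (2 * k + i + 2)" "2 / d < real (2 * k + i + 2)" using k by auto
      then show "1 / real (2 * k + i + 2) < b" "2 / real (2 * k + i + 2) < d"
        using that by (auto simp: field_simps)
    qed
    then show ?thesis using \<sigma>(2)[of "2 * k + i"] by (intro exI[of _ k]) linarith
  qed
  have lims: "Limsup (at_right 0) (\<lambda>s. ereal (u s 0)) = 1 \<and> Liminf (at_right 0) (\<lambda>s. ereal (u s 0)) = 0"
    if u: "\<forall>s\<in>{0<..<1}. frac_poisson_sol s (ball 0 1) g (u s)" for u :: "real \<Rightarrow> 'a \<Rightarrow> real"
  proof -
    \<comment> \<open>Here an arbitrary family of solutions is replaced by the explicit integrals
      \<open>v s\<close>; all remaining estimates concern \<open>v\<close> alone.\<close>
    have uv: "u s 0 = v s" if s: "0 < s" "s < 1" for s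
      unfolding v_def using u s by (intro center_representation[OF s dim[OF s(2)] _ gm loc]) auto
    have ev: "eventually (\<lambda>s. 0 < s \<and> s < 1) (at_right (0::real))"
      using eventually_at_right_real[of 0 1] by simp
    have notev: False if P: "eventually P (at_right (0::real))" and not: "\<And>b. b > 0 \<Longrightarrow> \<exists>s. 0 < s \<and> s < b \<and> \<not> P s" for P
      using P not unfolding eventually_at_right_field by blast
    have "Limsup (at_right 0) (\<lambda>s. ereal (u s 0)) \<le> 1"
      by (rule Limsup_bounded) (use ev in \<open>eventually_elim, simp add: uv v01\<close>)
    moreover have "\<not> Limsup (at_right 0) (\<lambda>s. ereal (u s 0)) < 1"
    proof
      assume "Limsup (at_right 0) (\<lambda>s. ereal (u s 0)) < 1"
      then obtain c where c: "Limsup (at_right 0) (\<lambda>s. ereal (u s 0)) < ereal c" "ereal c < 1"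
        using ereal_dense2 by blast
      have "eventually (\<lambda>s. ereal (u s 0) < ereal c) (at_right 0)" by (rule Limsup_lessD[OF c(1)])
      then show False
      proof (rule notev)
        fix b :: real assume "b > 0"
        then obtain k where k: "\<sigma> (2 * k + 0) < b" "2 / real (2 * k + 0 + 2) < 1 - c" using freq[of b "1 - c" 0] c(2) by auto
        have "v (\<sigma> (2 * k)) > c" using v_even[of "2 * k"] k(2) by simp
        then show "\<exists>s. 0 < s \<and> s < b \<and> \<not> ereal (u s 0) < ereal c"
          using k(1) \<sigma>(1) \<sigma>1 uv by (intro exI[of _ "\<sigma> (2 * k)"]) auto
      qed
    qed
    moreover have "Liminf (at_right 0) (\<lambda>s. ereal (u s 0)) \<ge> 0"
      by (rule Liminf_bounded) (use ev in \<open>eventually_elim, simp add: uv v01\<close>)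
    moreover have "\<not> Liminf (at_right 0) (\<lambda>s. ereal (u s 0)) > 0"
    proof
      assume "Liminf (at_right 0) (\<lambda>s. ereal (u s 0)) > 0"
      then obtain c where c: "0 < ereal c" "ereal c < Liminf (at_right 0) (\<lambda>s. ereal (u s 0))"
        using ereal_dense2 by blast
      have "eventually (\<lambda>s. ereal c < ereal (u s 0)) (at_right 0)" by (rule less_LiminfD[OF c(2)])
      then show False
      proof (rule notev)
        fix b :: real assume "b > 0"
        then obtain k where k: "\<sigma> (2 * k + 1) < b" "2 / real (2 * k + 1 + 2) < c" using freq[of b c 1] c(1) by auto
        have "v (\<sigma> (2 * k + 1)) < c" using v_odd[of "2 * k + 1"] k(2) by simp
        then show "\<exists>s. 0 < s \<and> s < b \<and> \<not> ereal c < ereal (u s 0)"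
          using k(1) \<sigma>(1)[of "2 * k + 1"] \<sigma>1[of "2 * k + 1"] uv[of "\<sigma> (2 * k + 1)"] by (intro exI[of _ "\<sigma> (2 * k + 1)"]) auto
      qed
    qed
    ultimately show ?thesis by (auto intro!: antisym simp: not_less)
  qed
  have "\<forall>s\<in>{0<..<1}. \<exists>u. frac_poisson_sol s (ball 0 1) g u"
  proof
    fix s :: real assume "s \<in> {0<..<1}"
    then have s: "0 < s" "s < 1" by auto
    show "\<exists>u. frac_poisson_sol s (ball 0 1) g u"
      by (rule exI, rule poisson_ext_solution[OF s dim[OF s(2)] gm gB])
  qed
  moreover have "\<exists>x\<in>ball 0 1. \<forall>u :: real \<Rightarrow> 'a \<Rightarrow> real.
      (\<forall>s\<in>{0<..<1}. frac_poisson_sol s (ball 0 1) g (u s)) \<longrightarrow>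
      Limsup (at_right 0) (\<lambda>s. ereal (u s x)) = 1 \<and> Liminf (at_right 0) (\<lambda>s. ereal (u s x)) = 0"
  proof (rule bexI, rule allI, rule impI)
    fix u :: "real \<Rightarrow> 'a \<Rightarrow> real"
    assume "\<forall>s\<in>{0<..<1}. frac_poisson_sol s (ball 0 1) g (u s)"
    then show "Limsup (at_right 0) (\<lambda>s. ereal (u s 0)) = 1 \<and> Liminf (at_right 0) (\<lambda>s. ereal (u s 0)) = 0"
      by (rule lims)
  qed simp
  moreover have "g \<in> borel_measurable lebesgue" by (rule measurable_completion) measurable
  moreover have "bounded (range g)"
  proof (rule boundedI)
    fix x assume "x \<in> range g"
    then show "norm x \<le> 1" using gB by auto
  qed
  ultimately show ?thesis by (intro exI[of _ g] conjI)
qed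

end
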